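(* Let $k\in\mathbb N$ and let $\mu$ be a Borel probability measure on $[0,1]^k$. If \[ \dim_{\ell^1}(\mu) > k - \frac{k-1}{k+1}, \] then $\mu$ is Khinchin. If moreover $\mu=\mu_1\times\cdots\times\mu_k$ is split and \[ \dim_{\ell^1}(\mu_j) > 1-\frac{1}{k+1}\qquad (1\leqslant j\leqslant k), \] then $\mu$ is Gallagher.
   Context: For $x\in\mathbb R$, $\|x\|$ denotes the distance from $x$ to the nearest integer, and $e(x)=e^{2\pi i x}$. For a Borel probability measure $\nu$ on $[0,1]^k$ and ${\boldsymbol{\xi}}\in\mathbb Z^k$, $\hat\nu({\boldsymbol{\xi}})=\int e(-{\boldsymbol{\xi}}\cdot\mathbf x)\,d\nu(\mathbf x)$. The Fourier $\ell^1$ dimension is \[ \dim_{\ell^1}(\nu)=\sup\Big\{s\geqslant 0:\ \sum_{{\boldsymbol{\xi}}\in\mathbb Z^k,\ \|{\boldsymbol{\xi}}\|_\infty\leqslant Q}|\hat\nu({\boldsymbol{\xi}})|\ll Q^{k-s}\ \text{for all } Q\geqslant 1\Big\} \] (for a measure on $[0,1]$ this is taken with $k=1$). A measure on $\mathbb R^k$ is split if it is a Cartesian product $\mu_1\times\cdots\times\mu_k$ of Borel probability measures on $\mathbb R$ (here on $[0,1]$). For $\psi:\mathbb N\to[0,1)$, $W_k(\psi)$ is the set of $\mathbf x\in[0,1)^k$ such that $\max\{\|nx_1\|,\dots,\|nx_k\|\}<\psi(n)$ for infinitely many $n\in\mathbb N$, and $W_k^\times(\psi)$ is the set of $\mathbf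 x\in[0,1)^k$ such that $\|nx_1\|\cdots\|nx_k\|<\psi(n)$ for infinitely many $n\in\mathbb N$. A probability measure $\mu$ on $[0,1]^k$ is Khinchin if for every non-increasing $\psi:\mathbb N\to[0,1)$, $\mu(W_k(\psi))=0$ when $\sum_n\psi(n)^k<\infty$ and $\mu(W_k(\psi))=1$ when $\sum_n\psi(n)^k=\infty$. It is Gallagher if for every non-increasing $\psi:\mathbb N\to[0,1)$, $\mu(W_k^\times(\psi))=0$ when $\sum_n\psi(n)(\log n)^{k-1}<\infty$ and $\mu(W_k^\times(\psi))=1$ when $\sum_n\psi(n)(\log n)^{k-1}=\infty$. *)

theory Defs
  imports "HOL-Probability.Probability"
begin

text \<open>Points of R^k are functions nat => real, extensional on {..<k};
  the Borel sigma-algebra on R^k is that of the product measure PiM {..<k} (\<lambda>_. borel).\<close>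

definition borel_k :: "nat \<Rightarrow> (nat \<Rightarrow> real) measure" where
  "borel_k k = PiM {..<k} (\<lambda>_. borel)"

definition nint_dist :: "real \<Rightarrow> real" where
  "nint_dist x = min (frac x) (1 - frac x)"

definition fourier_coeff :: "nat \<Rightarrow> (nat \<Rightarrow> real) measure \<Rightarrow> (nat \<Rightarrow> int) \<Rightarrow> complex" where
  "fourier_coeff k \<nu> \<xi> =
     (\<integral>x. cis (- 2 * pi * (\<Sum>i<k. of_int (\<xi> i) * x i)) \<partial>\<nu>)"

definition freq_box :: "nat \<Rightarrow> real \<Rightarrow> (nat \<Rightarrow> int) set" where
  "freq_box k Q = {\<xi>. (\<forall>i<k. \<bar>real_of_int (\<xi> i)\<bar> \<le> Q) \<and> (\<forall>i. k \<le> i \<longrightarrow> \<xi> i = 0)}"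

definition fourier_l1_dim :: "nat \<Rightarrow> (nat \<Rightarrow> real) measure \<Rightarrow> real" where
  "fourier_l1_dim k \<nu> = Sup {s. 0 \<le> s \<and> (\<exists>C. \<forall>Q\<ge>1.
      (\<Sum>\<xi>\<in>freq_box k Q. cmod (fourier_coeff k \<nu> \<xi>)) \<le> C * Q powr (real k - s))}"

definition fourier_coeff1 :: "real measure \<Rightarrow> int \<Rightarrow> complex" where
  "fourier_coeff1 \<nu> \<xi> = (\<integral>x. cis (- 2 * pi * (of_int \<xi> * x)) \<partial>\<nu>)"

definition fourier_l1_dim1 :: "real measure \<Rightarrow> real" where
  "fourier_l1_dim1 \<nu> = Sup {s. 0 \<le> s \<and> (\<exists>C. \<forall>Q\<ge>1.
      (\<Sum>\<xi>\<in>{\<xi>::int. \<bar>real_of_int \<xi>\<bar> \<le> Q}. cmod (fourier_coeff1 \<nu> \<xi>)) \<le> C * Q powr (1 - s))}"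

definition admissible_psi :: "(nat \<Rightarrow> real) \<Rightarrow> bool" where
  "admissible_psi \<psi> \<longleftrightarrow> (\<forall>n\<ge>1. 0 \<le> \<psi> n \<and> \<psi> n < 1) \<and> (\<forall>m n. 1 \<le> m \<longrightarrow> m \<le> n \<longrightarrow> \<psi> n \<le> \<psi> m)"

definition W_set :: "nat \<Rightarrow> (nat \<Rightarrow> real) \<Rightarrow> (nat \<Rightarrow> real) set" where
  "W_set k \<psi> = {x \<in> PiE {..<k} (\<lambda>_. {0..<1}).
     infinite {n::nat. 1 \<le> n \<and> Max ((\<lambda>i. nint_dist (real n * x i)) ` {..<k}) < \<psi> n}}"

definition W_mult_set :: "nat \<Rightarrow> (nat \<Rightarrow> real) \<Rightarrow> (nat \<Rightarrow> real) set" where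
  "W_mult_set k \<psi> = {x \<in> PiE {..<k} (\<lambda>_. {0..<1}).
     infinite {n::nat. 1 \<le> n \<and> (\<Prod>i<k. nint_dist (real n * x i)) < \<psi> n}}"

definition khinchin :: "nat \<Rightarrow> (nat \<Rightarrow> real) measure \<Rightarrow> bool" where
  "khinchin k \<mu> \<longleftrightarrow> (\<forall>\<psi>. admissible_psi \<psi> \<longrightarrow>
      (summable (\<lambda>n. \<psi> (Suc n) ^ k) \<longrightarrow> W_set k \<psi> \<in> null_sets \<mu>) \<and>
      (\<not> summable (\<lambda>n. \<psi> (Suc n) ^ k) \<longrightarrow> W_set k \<psi> \<in> sets \<mu> \<and> measure \<mu> (W_set k \<psi>) = 1))"

definition gallagher :: "nat \<Rightarrow> (nat \<Rightarrow> real) measure \<Rightarrow> bool" where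
  "gallagher k \<mu> \<longleftrightarrow> (\<forall>\<psi>. admissible_psi \<psi> \<longrightarrow>
      (summable (\<lambda>n. \<psi> (Suc n) * ln (real (Suc n)) ^ (k - 1)) \<longrightarrow> W_mult_set k \<psi> \<in> null_sets \<mu>) \<and>
      (\<not> summable (\<lambda>n. \<psi> (Suc n) * ln (real (Suc n)) ^ (k - 1)) \<longrightarrow>
         W_mult_set k \<psi> \<in> sets \<mu> \<and> measure \<mu> (W_mult_set k \<psi>) = 1))"

end

theory Submission
  imports Defs "HOL-Real_Asymp.Real_Asymp"
begin

text \<open>For boxes of volume about \<open>1 / n\<close>, the number of \<open>n\<close> with \<open>n x\<close> in the box modulo 1 is
  expanded into a Fourier series. Integrating it, or its square, against \<open>\<mu>\<close> gives the value for
  Lebesgue measure, from frequency 0, plus an error \<open>\<Sum>\<xi>. r \<xi> * \<bar>\<mu>^ \<xi>\<bar>\<close>, where \<open>r \<xi>\<close>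
  counts the solutions of \<open>n m = \<xi>\<close> or of \<open>n m + n' m' = \<xi>\<close>. Divisor bounds make \<open>r \<xi>\<close> small
  uniformly in \<open>\<xi>\<close>, and the \<open>\<ell>\<^sup>1\<close> hypothesis bounds the remaining sum.

  In the convergence case the first moments and the Borel-Cantelli lemma suffice. In the divergence case
  the Lebesgue variance, which comes from \<open>n m + n' m' = 0\<close>, is bounded by a constant times the
  expectation as soon as \<open>k \<ge> 2\<close>; hence the smoothed count has variance \<open>O(E + 1)\<close> with
  \<open>E \<longrightarrow> \<infinity>\<close>, and Chebyshev's inequality shows that it is almost surely unbounded. No zero-one law is
  needed. The smoothing kernels are trigonometric polynomials that are tiny, but not zero, off the box,
  and those tails are summable.

  For Gallagher's theorem the region \<open>\<Prod>i. \<bar>y i\<bar> < \<psi> n\<close> is covered by, or in the divergence case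
  filled with, dyadic boxes of equal volume.\<close>

section \<open>Trigonometric kernels\<close>

text \<open>The thresholds come from counting exponents. For \<open>n\<close> near
  \<open>N = 2 ^ j\<close> the balanced boxes have sides about \<open>N powr (- 1 / k)\<close>, so
  kernels of degree about \<open>Y = N powr (1 / k)\<close> suffice, and the frequencies that occur
  are at most a constant times \<open>N Y\<close>. If the coefficients up to \<open>X\<close> sum to
  \<open>O(X powr \<kappa>)\<close>, the second moment loses
  \<open>Y * (N Y) powr \<kappa> / N\<close>, up to divisor factors; this is a negative power of
  \<open>N\<close> exactly when \<open>\<kappa> < (k - 1) / (k + 1)\<close>. The first moment has no
  factor \<open>Y\<close> and tolerates a larger \<open>\<kappa>\<close> for balanced boxes. In
  Gallagher's convergence part the boxes can be very elongated. For a product measure their l1 sums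
  factor, and with one exponent \<open>\<kappa>1\<close> in every coordinate the total depends only
  on the volume: it is about \<open>N powr (\<kappa>1 * (k + 1))\<close>, whence the condition on
  the factors.

  The obstacle in the second moment is that dilates \<open>n, n'\<close> with a large gcd are
  strongly correlated. The loss has to be bounded by the expectation itself, not by a power of
  \<open>log N\<close> times it, because the divergence may be arbitrarily slow.\<close>

definition ee :: "real \<Rightarrow> complex" where
  "ee x = cis (2 * pi * x)"

lemma ee_0 [simp]: "ee 0 = 1"
  by (simp add: ee_def)

lemma ee_add: "ee (x + y) = ee x * ee y"
  by (simp add: ee_def cis_mult distrib_left)

lemma norm_ee [simp]: "cmod (ee x) = 1"
  by (simp add: ee_def)

lemma cnj_ee: "cnj (ee x) = ee (- x)"
  by (simp add: ee_def cis_cnj)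

lemma ee_of_int [simp]: "ee (of_int z) = 1"
  by (simp add: ee_def cis_multiple_2pi)

lemma ee_sum: "ee (\<Sum>i\<in>A. f i) = (\<Prod>i\<in>A. ee (f i))"
  by (induction A rule: infinite_finite_induct) (auto simp: ee_add)

lemma ee_nat_mult: "ee (real n * x) = ee x ^ n"
  using Complex.DeMoivre[of "2 * pi * x" n] by (simp add: ee_def mult.left_commute)

section \<open>Distance to the nearest integer and geometric sums\<close>

lemma nint_dist_le: "nint_dist y \<le> \<bar>y - of_int z\<bar>"
proof (cases "z \<le> \<lfloor>y\<rfloor>")
  case True
  then have "real_of_int z \<le> of_int \<lfloor>y\<rfloor>" by simp
  then show ?thesis unfolding nint_dist_def frac_def by linarith
next
  case False
  then have "real_of_int z \<ge> of_int \<lfloor>y\<rfloor> + 1" by linarith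
  then show ?thesis unfolding nint_dist_def frac_def by linarith
qed

lemma nint_dist_witness: obtains z :: int where "nint_dist y = \<bar>y - of_int z\<bar>"
proof (cases "frac y \<le> 1 - frac y")
  case True
  then have "nint_dist y = \<bar>y - of_int \<lfloor>y\<rfloor>\<bar>"
    unfolding nint_dist_def frac_def by linarith
  then show ?thesis by (rule that)
next
  case False
  then have "nint_dist y = \<bar>y - of_int (\<lfloor>y\<rfloor> + 1)\<bar>"
    unfolding nint_dist_def frac_def of_int_add of_int_1 by linarith
  then show ?thesis by (rule that)
qed

lemma nint_dist_nonneg: "0 \<le> nint_dist y"
  by (rule nint_dist_witness[of y]) simp

lemma nint_dist_le_half: "nint_dist y \<le> 1 / 2"
  unfolding nint_dist_def by linarith

lemma nint_dist_diff: "nint_dist y - \<bar>w\<bar> \<le> nint_dist (y - w)"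
proof -
  obtain z where z: "nint_dist (y - w) = \<bar>y - w - of_int z\<bar>" by (rule nint_dist_witness)
  then show ?thesis using nint_dist_le[of y z] by linarith
qed

text \<open>Jordan's inequality: the sine is concave on \<open>[0, pi]\<close>, so on
  \<open>[0, pi / 2]\<close> it lies above the chord through its endpoints; \<open>2 * t\<close> is
  the interpolation parameter.\<close>

lemma sin_pi_ge:
  assumes "0 \<le> t" "t \<le> 1 / 2"
  shows "2 * t \<le> sin (pi * t)"
proof -
  have "convex_on {0..pi} (\<lambda>x. - sin x)"
  proof (rule f''_ge0_imp_convex)
    show "((\<lambda>x. - sin x) has_real_derivative - cos x) (at x)" for x
      by (auto intro!: derivative_eq_intros)
    show "((\<lambda>x. - cos x) has_real_derivative sin x) (at x)" for x
      by (auto intro!: derivative_eq_intros)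
  qed (auto intro: sin_ge_zero)
  from convex_onD[OF this, of "2 * t" 0 "pi / 2"] assms show ?thesis
    by (simp add: field_simps)
qed

lemma abs_sin_pi_ge: "2 * nint_dist y \<le> \<bar>sin (pi * y)\<bar>"
proof -
  obtain z where z: "nint_dist y = \<bar>y - of_int z\<bar>" by (rule nint_dist_witness)
  have "2 * \<bar>y - of_int z\<bar> \<le> sin (pi * \<bar>y - of_int z\<bar>)"
    using nint_dist_le_half[of y] z by (intro sin_pi_ge) auto
  also have "\<dots> \<le> \<bar>sin (pi * (y - of_int z))\<bar>"
  proof (cases "y - of_int z \<ge> 0")
    case False
    then have "pi * \<bar>y - of_int z\<bar> = - (pi * (y - of_int z))" by (simp add: algebra_simps)
    then show ?thesis by (simp only: sin_minus abs_ge_minus_self)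
  qed simp
  also have "\<bar>sin (pi * (y - of_int z))\<bar> = \<bar>sin (pi * y)\<bar>"
  proof -
    have s0: "sin (pi * real_of_int z) = 0" by (rule sin_npi_int)
    have "sin (pi * (y - of_int z)) = sin (pi * y) * cos (pi * of_int z)"
      by (simp add: right_diff_distrib sin_diff s0)
    moreover have "\<bar>cos (pi * real_of_int z)\<bar> = 1"
      using sin_cos_squared_add[of "pi * real_of_int z"] unfolding s0 by (simp add: abs_square_eq_1)
    ultimately show ?thesis by (simp add: abs_mult)
  qed
  finally show ?thesis using z by simp
qed

lemma norm_one_minus_ee: "cmod (1 - ee y) = 2 * \<bar>sin (pi * y)\<bar>"
proof -
  have "(cmod (1 - ee y))\<^sup>2 = (1 - cos (2 * (pi * y)))\<^sup>2 + (sin (2 * (pi * y)))\<^sup>2"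
    by (simp add: cmod_power2 ee_def mult.assoc)
  also have "\<dots> = 2 - 2 * cos (2 * (pi * y))"
    using sin_cos_squared_add[of "2 * (pi * y)"] by (simp add: power2_eq_square algebra_simps)
  also have "\<dots> = (2 * \<bar>sin (pi * y)\<bar>)\<^sup>2"
    by (simp add: cos_double_sin power_mult_distrib)
  finally show ?thesis by (rule power2_eq_imp_eq) auto
qed

text \<open>The geometric series has a numerator of modulus at most 2 for every \<open>H\<close>, so
  only the distance of \<open>ee y\<close> from 1 matters. This uniformity in the length controls
  both the tent weights and the kernel off the arc.\<close>

lemma norm_geometric_ee_le:
  assumes "0 < nint_dist y"
  shows "cmod (\<Sum>u<H. ee (real u * y)) \<le> 1 / (2 * nint_dist y)"
proof -
  have pos: "4 * nint_dist y \<le> cmod (1 - ee y)"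
    using abs_sin_pi_ge[of y] by (simp add: norm_one_minus_ee)
  then have ne: "ee y \<noteq> 1" using assms by auto
  have "cmod (\<Sum>u<H. ee (real u * y)) = cmod ((1 - ee y ^ H) / (1 - ee y))"
    using ne by (simp add: ee_nat_mult sum_gp_strict)
  also have "\<dots> \<le> 2 / cmod (1 - ee y)"
    using norm_triangle_ineq4[of 1 "ee y ^ H"]
    by (auto simp: norm_divide norm_power intro!: divide_right_mono)
  also have "\<dots> \<le> 2 / (4 * nint_dist y)"
    using pos assms by (intro divide_left_mono) (auto intro!: mult_pos_pos)
  finally show ?thesis by simp
qed

text \<open>The \<open>m\<close>-th Fourier coefficient of the squared modulus of the trigonometric
  polynomial with coefficients \<open>a 0, ..., a (D - 1)\<close>.\<close>

definition autocorr :: "(nat \<Rightarrow> real) \<Rightarrow> nat \<Rightarrow> int \<Rightarrow> real" where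
  "autocorr a D m = (\<Sum>i<D. \<Sum>j<D. if int i - int j = m then a i * a j else 0)"

lemma autocorr_expand:
  "complex_of_real ((cmod (\<Sum>i<D. a i *\<^sub>R ee (real i * y)))\<^sup>2)
     = (\<Sum>m\<in>{- int D..int D}. autocorr a D m *\<^sub>R ee (of_int m * y))"
proof -
  have "complex_of_real ((cmod (\<Sum>i<D. a i *\<^sub>R ee (real i * y)))\<^sup>2)
      = (\<Sum>i<D. a i *\<^sub>R ee (real i * y)) * cnj (\<Sum>i<D. a i *\<^sub>R ee (real i * y))"
    by (simp only: complex_norm_square)
  also have "\<dots> = (\<Sum>i<D. \<Sum>j<D. (a i * a j) *\<^sub>R ee (of_int (int i - int j) * y))"
    unfolding cnj_sum sum_product
    by (intro sum.cong refl)
      (simp add: cnj_ee ee_add[symmetric] scaleR_conv_of_real left_diff_distrib)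
  also have "\<dots> = (\<Sum>i<D. \<Sum>j<D. \<Sum>m\<in>{- int D..int D}.
      if int i - int j = m then (a i * a j) *\<^sub>R ee (of_int m * y) else 0)"
    by (intro sum.cong refl) (auto simp: sum.delta')
  also have "\<dots> = (\<Sum>i<D. \<Sum>m\<in>{- int D..int D}. \<Sum>j<D.
      if int i - int j = m then (a i * a j) *\<^sub>R ee (of_int m * y) else 0)"
    by (intro sum.cong refl sum.swap)
  also have "\<dots> = (\<Sum>m\<in>{- int D..int D}. \<Sum>i<D. \<Sum>j<D.
      if int i - int j = m then (a i * a j) *\<^sub>R ee (of_int m * y) else 0)"
    by (rule sum.swap)
  also have "\<dots> = (\<Sum>m\<in>{- int D..int D}. autocorr a D m *\<^sub>R ee (of_int m * y))"
    unfolding autocorr_def scaleR_sum_left by (intro sum.cong refl) auto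
  finally show ?thesis .
qed

lemma autocorr_nonneg: "(\<And>i. 0 \<le> a i) \<Longrightarrow> 0 \<le> autocorr a D m"
  unfolding autocorr_def by (intro sum_nonneg) auto

lemma autocorr_0: "autocorr a D 0 = (\<Sum>i<D. (a i)\<^sup>2)"
  unfolding autocorr_def by (intro sum.cong refl) (auto simp: power2_eq_square)

text \<open>\<open>a i * a j\<close> is at most the mean of the two squares, and for fixed
  \<open>m\<close> every index occurs at most once as \<open>i\<close> and at most once as
  \<open>j\<close>.\<close>

lemma autocorr_le: "autocorr a D m \<le> autocorr a D 0"
proof -
  have one: "(\<Sum>i<D. \<Sum>j<D. if int i - int j = m then (a i)\<^sup>2 else 0) \<le> (\<Sum>i<D. (a i)\<^sup>2)" for m
  proof (rule sum_mono)
    fix i assume "i \<in> {..<D}"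
    have "(\<Sum>j<D. if int i - int j = m then (a i)\<^sup>2 else 0)
        = (\<Sum>j\<in>{j. j < D \<and> int i - int j = m}. (a i)\<^sup>2)"
      by (rule sum.mono_neutral_cong_right) auto
    also have "\<dots> = card {j. j < D \<and> int i - int j = m} * (a i)\<^sup>2" by simp
    also have "\<dots> \<le> 1 * (a i)\<^sup>2"
    proof (rule mult_right_mono)
      have "{j. j < D \<and> int i - int j = m} \<subseteq> {nat (int i - m)}" by auto
      then have "card {j. j < D \<and> int i - int j = m} \<le> card {nat (int i - m)}"
        by (intro card_mono) auto
      then show "real (card {j. j < D \<and> int i - int j = m}) \<le> 1" by simp
    qed simp
    finally show "(\<Sum>j<D. if int i - int j = m then (a i)\<^sup>2 else 0) \<le> (a i)\<^sup>2" by simp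
  qed
  have two: "(\<Sum>i<D. \<Sum>j<D. if int i - int j = m then (a j)\<^sup>2 else 0) \<le> (\<Sum>i<D. (a i)\<^sup>2)"
  proof -
    have "(\<Sum>i<D. \<Sum>j<D. if int i - int j = m then (a j)\<^sup>2 else 0)
        = (\<Sum>j<D. \<Sum>i<D. if int i - int j = m then (a j)\<^sup>2 else 0)" by (rule sum.swap)
    also have "\<dots> = (\<Sum>j<D. \<Sum>i<D. if int j - int i = - m then (a j)\<^sup>2 else 0)"
      by (intro sum.cong refl) auto
    also have "\<dots> \<le> (\<Sum>i<D. (a i)\<^sup>2)" by (rule one)
    finally show ?thesis .
  qed
  have "autocorr a D m \<le> (\<Sum>i<D. \<Sum>j<D. ((if int i - int j = m then (a i)\<^sup>2 else 0)
      + (if int i - int j = m then (a j)\<^sup>2 else 0)) / 2)"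
    unfolding autocorr_def
    by (intro sum_mono) (use sum_squares_bound in \<open>auto simp: field_simps\<close>)
  also have "\<dots> = ((\<Sum>i<D. \<Sum>j<D. if int i - int j = m then (a i)\<^sup>2 else 0)
      + (\<Sum>i<D. \<Sum>j<D. if int i - int j = m then (a j)\<^sup>2 else 0)) / 2"
    by (simp only: sum_divide_distrib[symmetric] sum.distrib)
  also have "\<dots> \<le> autocorr a D 0"
    using one[of m] two by (simp add: autocorr_0)
  finally show ?thesis .
qed

lemma autocorr_eq_0: "int D \<le> \<bar>m\<bar> \<Longrightarrow> autocorr a D m = 0"
  unfolding autocorr_def by (intro sum.neutral ballI) auto

text \<open>Cauchy-Schwarz. Applied to a power of a geometric sum, it bounds from below the
  coefficient by which the concentrated kernel is normalised.\<close>

lemma sum_square_le_autocorr_0: "(\<Sum>i<D. a i)\<^sup>2 \<le> real D * autocorr a D 0"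
  unfolding autocorr_0 using sum_squared_le_sum_of_squares[of a "{..<D}"] by (simp add: mult.commute)

text \<open>Four times \<open>p\<close> majorises the indicator of the arc of radius
  \<open>1 / 2 ^ l\<close>. The coefficients \<open>h\<close> have the size and range natural for
  such an arc; they are nonnegative so that expansions can be estimated term by term.\<close>

definition quarter_majorant :: "nat \<Rightarrow> (int \<Rightarrow> real) \<Rightarrow> (real \<Rightarrow> real) \<Rightarrow> bool" where
  "quarter_majorant l h p \<longleftrightarrow> (\<forall>m. 0 \<le> h m \<and> h m \<le> 8 / 2 ^ l) \<and>
    (\<forall>y. complex_of_real (p y) = (\<Sum>m\<in>{- (2 ^ l) .. 2 ^ l}. h m *\<^sub>R ee (- of_int m * y))) \<and>
    (\<forall>y. 0 \<le> p y) \<and> (\<forall>y. nint_dist y \<le> 1 / 2 ^ l \<longrightarrow> 1 / 4 \<le> p y)"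

lemma fejer_majorant: "\<exists>h p. quarter_majorant l h p"
proof -
  \<comment> \<open>For \<open>l \<ge> 3\<close> and \<open>y\<close> in the arc, every
    \<open>u * y\<close> with \<open>u < H\<close> is within 1/8 of an integer, so
    \<open>ee (u * y)\<close> has real part at least 1/2 and the kernel is at least 1/4. For
    \<open>l < 3\<close> the truncated difference gives \<open>H = 1\<close>, and \<open>p\<close>
    is constantly 1.\<close>
  define H :: nat where "H = 2 ^ (l - 3)"
  have H0: "H > 0" by (simp add: H_def)
  have Hle: "H \<le> 2 ^ l" unfolding H_def by (intro power_increasing) auto
  have H8: "2 ^ l \<le> 8 * H"
  proof -
    have "(2::nat) ^ l \<le> 2 ^ (3 + (l - 3))" by (intro power_increasing) auto
    then show ?thesis by (simp add: H_def power_add)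
  qed
  have H8r: "2 ^ l \<le> 8 * real H" using H8 by (metis of_nat_le_iff of_nat_mult of_nat_numeral of_nat_power)
  define h where "h m = autocorr (\<lambda>_. 1) H m / (real H)\<^sup>2" for m
  define p where "p y = (cmod (\<Sum>u<H. ee (real u * - y)))\<^sup>2 / (real H)\<^sup>2" for y
  have "quarter_majorant l h p"
    unfolding quarter_majorant_def
  proof (intro conjI allI impI)
    show "0 \<le> h m" for m unfolding h_def by (simp add: autocorr_nonneg)
    show "h m \<le> 8 / 2 ^ l" for m
    proof -
      have "h m \<le> autocorr (\<lambda>_. 1) H 0 / (real H)\<^sup>2"
        unfolding h_def by (intro divide_right_mono autocorr_le) auto
      also have "\<dots> = 1 / real H" using H0 by (simp add: autocorr_0 power2_eq_square)
      also have "\<dots> \<le> 8 / 2 ^ l" using H8r H0 by (simp add: field_simps)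
      finally show ?thesis .
    qed
    show "complex_of_real (p y) = (\<Sum>m\<in>{- (2 ^ l) .. 2 ^ l}. h m *\<^sub>R ee (- of_int m * y))" for y
    proof -
      have "complex_of_real (p y) = complex_of_real ((cmod (\<Sum>u<H. (1::real) *\<^sub>R ee (real u * - y)))\<^sup>2) / (real H)\<^sup>2"
        unfolding p_def by simp
      also have "\<dots> = (\<Sum>m\<in>{- int H..int H}. autocorr (\<lambda>_. 1) H m *\<^sub>R ee (of_int m * - y)) / (real H)\<^sup>2"
        by (subst autocorr_expand) simp
      also have "\<dots> = (\<Sum>m\<in>{- int H..int H}. h m *\<^sub>R ee (- of_int m * y))"
        unfolding h_def sum_divide_distrib by (intro sum.cong refl) (simp add: scaleR_conv_of_real)
      also have "\<dots> = (\<Sum>m\<in>{- (2 ^ l) .. 2 ^ l}. h m *\<^sub>R ee (- of_int m * y))"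
      proof (rule sum.mono_neutral_left)
        have "int H \<le> 2 ^ l" using Hle by (metis of_nat_le_iff of_nat_numeral of_nat_power)
        then show "{- int H..int H} \<subseteq> {- (2 ^ l) .. 2 ^ l}" by auto
        show "\<forall>m\<in>{- (2 ^ l) .. 2 ^ l} - {- int H..int H}. h m *\<^sub>R ee (- of_int m * y) = 0"
          by (auto simp: h_def autocorr_eq_0)
      qed simp
      finally show ?thesis .
    qed
    show "0 \<le> p y" for y unfolding p_def by simp
    show "1 / 4 \<le> p y" if y: "nint_dist y \<le> 1 / 2 ^ l" for y
    proof -
      obtain z where z: "nint_dist y = \<bar>y - of_int z\<bar>" by (rule nint_dist_witness)
      have "real H / 2 \<le> Re (\<Sum>u<H. ee (real u * - y))"
      proof -
        have half: "1 / 2 \<le> Re (ee (real u * - y))" if u: "u < H" for u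
        proof (cases "l < 3")
          case True
          then have "u = 0" using u by (simp add: H_def)
          then show ?thesis by simp
        next
          case False
          then have "(2::nat) ^ l = 2 ^ (3 + (l - 3))" by simp
          then have "(2::nat) ^ l = 8 * H" by (simp only: power_add H_def) simp
          then have Hl: "(2::real) ^ l = 8 * real H"
            by (metis of_nat_mult of_nat_numeral of_nat_power)
          have "ee (real u * - y) = ee (real u * - (y - of_int z)) * ee (of_int (- int u * z))"
            unfolding ee_add[symmetric] by (simp add: algebra_simps)
          then have eq: "ee (real u * - y) = ee (real u * - (y - of_int z))"
            by (metis ee_of_int mult.right_neutral)
          have "real u * \<bar>y - of_int z\<bar> \<le> real H * (1 / (8 * real H))"
            using u y z Hl by (intro mult_mono) auto
          then have ab: "\<bar>real u * - (y - of_int z)\<bar> \<le> 1 / 8" using H0 by (simp add: abs_mult abs_minus_commute)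
          have "cos (pi / 3) \<le> cos \<bar>2 * pi * (real u * - (y - of_int z))\<bar>"
          proof (rule cos_monotone_0_pi_le)
            have "\<bar>2 * pi * (real u * - (y - of_int z))\<bar> = 2 * pi * \<bar>real u * - (y - of_int z)\<bar>"
              by (simp add: abs_mult)
            also have "\<dots> \<le> 2 * pi * (1/8)" using ab by (intro mult_left_mono) auto
            also have "\<dots> \<le> pi / 3" by simp
            finally show "\<bar>2 * pi * (real u * - (y - of_int z))\<bar> \<le> pi / 3" .
          qed auto
          then show ?thesis unfolding eq by (simp add: ee_def cos_60)
        qed
        have "real H / 2 = (\<Sum>u<H. 1 / 2)" by simp
        also have "\<dots> \<le> (\<Sum>u<H. Re (ee (real u * - y)))" using half by (intro sum_mono) auto
        finally show ?thesis by simp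
      qed
      also have "\<dots> \<le> cmod (\<Sum>u<H. ee (real u * - y))" by (rule complex_Re_le_cmod)
      finally have "(real H / 2)\<^sup>2 \<le> (cmod (\<Sum>u<H. ee (real u * - y)))\<^sup>2" by (intro power_mono) auto
      then show ?thesis unfolding p_def using H0 by (simp add: field_simps)
    qed
  qed
  then show ?thesis by blast
qed

text \<open>About \<open>P\<close> terms are 1, and beyond them the tail of
  \<open>P\<^sup>2 / t\<^sup>2\<close> is again of order \<open>P\<close>.\<close>

lemma sum_min_inverse_square_le:
  fixes P :: real
  assumes "0 \<le> P"
  shows "(\<Sum>t=1..T. min 1 ((P / real t)\<^sup>2)) \<le> 3 * P"
proof (cases "P = 0")
  case False
  then have P: "P > 0" using assms by simp
  let ?S = "\<lambda>T. \<Sum>t=1..T. min 1 ((P / real t)\<^sup>2)"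
  have S_le: "?S T \<le> real T" for T
  proof -
    have "?S T \<le> (\<Sum>t=1..T. 1)" by (intro sum_mono) simp
    then show ?thesis by simp
  qed
  \<comment> \<open>The subtracted \<open>P\<^sup>2 / real T\<close> makes the induction telescope
    through \<open>1 / (T + 1)\<^sup>2 \<le> 1 / T - 1 / (T + 1)\<close>.\<close>
  have "P \<le> real T \<Longrightarrow> ?S T \<le> 3 * P - P\<^sup>2 / real T" for T
  proof (induction T)
    case 0
    then show ?case using P by simp
  next
    case (Suc T)
    have step: "?S (Suc T) \<le> ?S T + P\<^sup>2 / (real (Suc T))\<^sup>2" by (simp add: power_divide)
    show ?case
    proof (cases "P \<le> real T")
      case True
      then have T: "real T > 0" using P by simp
      have "1 / (real (Suc T))\<^sup>2 \<le> 1 / (real T * real (Suc T))"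
        unfolding power2_eq_square using T by (intro divide_left_mono mult_right_mono mult_pos_pos) auto
      also have "\<dots> = 1 / real T - 1 / real (Suc T)" using T by (simp add: field_simps)
      finally have "P\<^sup>2 * (1 / (real (Suc T))\<^sup>2) \<le> P\<^sup>2 * (1 / real T - 1 / real (Suc T))"
        by (intro mult_left_mono) auto
      then show ?thesis using Suc.IH[OF True] step by (simp add: right_diff_distrib)
    next
      case False
      have q: "P / real (Suc T) \<le> 1" using Suc.prems P by (simp add: field_simps)
      have "P\<^sup>2 / (real (Suc T))\<^sup>2 = (P / real (Suc T)) * (P / real (Suc T))"
        by (simp add: power2_eq_square)
      also have "\<dots> \<le> 1 * (P / real (Suc T))" using q P by (intro mult_right_mono) auto
      also have "\<dots> \<le> P" using P by (simp add: field_simps)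
      finally have a: "P\<^sup>2 / (real (Suc T))\<^sup>2 \<le> P" .
      have "P\<^sup>2 / real (Suc T) = (P / real (Suc T)) * P" by (simp add: power2_eq_square)
      also have "\<dots> \<le> 1 * P" using q P by (intro mult_right_mono) auto
      finally show ?thesis using a step S_le[of T] False by linarith
    qed
  qed
  from this[of T] show ?thesis
  proof (cases "P \<le> real T")
    case False
    then show ?thesis using S_le[of T] P by linarith
  next
    case True
    have "0 \<le> P\<^sup>2 / real T" by simp
    then show ?thesis using \<open>P \<le> real T \<Longrightarrow> _\<close>[OF True] by linarith
  qed
qed simp

text \<open>Multiplication by \<open>1 + z + ... + z ^ (H - 1)\<close> preserves nonnegative
  coefficients and adds at most \<open>H\<close> to the length. The exponent is written
  \<open>Suc r\<close> because the power with exponent 0, the constant 1, does not fit into an empty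
  index range.\<close>

lemma power_geometric_expand:
  fixes H r :: nat
  obtains a :: "nat \<Rightarrow> real" where "\<And>i. 0 \<le> a i"
    "\<And>z :: complex. (\<Sum>u<H. z ^ u) ^ Suc r = (\<Sum>i<Suc r * H. a i *\<^sub>R z ^ i)"
proof -
  have "\<exists>a. (\<forall>i. 0 \<le> a i) \<and>
      (\<forall>z :: complex. (\<Sum>u<H. z ^ u) ^ Suc r = (\<Sum>i<Suc r * H. a i *\<^sub>R z ^ i))"
  proof (induction r)
    case 0
    show ?case by (intro exI[of _ "\<lambda>_. 1"]) simp
  next
    case (Suc r)
    define N where "N = Suc r * H"
    obtain a where a: "\<And>i. 0 \<le> a i"
      "\<And>z :: complex. (\<Sum>u<H. z ^ u) ^ Suc r = (\<Sum>i<N. a i *\<^sub>R z ^ i)"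
      using Suc unfolding N_def by metis
    define b where "b s = (\<Sum>u<H. \<Sum>i<N. if u + i = s then a i else 0)" for s
    have "(\<Sum>u<H. z ^ u) ^ Suc (Suc r) = (\<Sum>i<Suc (Suc r) * H. b i *\<^sub>R z ^ i)" for z :: complex
    proof -
      have "(\<Sum>u<H. z ^ u) ^ Suc (Suc r) = (\<Sum>u<H. z ^ u) * (\<Sum>i<N. a i *\<^sub>R z ^ i)"
        by (simp only: power_Suc[of _ "Suc r"] a(2))
      also have "\<dots> = (\<Sum>u<H. \<Sum>i<N. a i *\<^sub>R z ^ (u + i))"
        by (simp add: sum_product power_add)
      also have "\<dots> = (\<Sum>u<H. \<Sum>i<N. \<Sum>s<H + N. if u + i = s then a i *\<^sub>R z ^ s else 0)"
        by (intro sum.cong refl) (auto simp: sum.delta')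
      also have "\<dots> = (\<Sum>u<H. \<Sum>s<H + N. \<Sum>i<N. if u + i = s then a i *\<^sub>R z ^ s else 0)"
        by (intro sum.cong refl sum.swap)
      also have "\<dots> = (\<Sum>s<H + N. \<Sum>u<H. \<Sum>i<N. if u + i = s then a i *\<^sub>R z ^ s else 0)"
        by (rule sum.swap)
      also have "\<dots> = (\<Sum>s<H + N. b s *\<^sub>R z ^ s)"
        unfolding b_def scaleR_sum_left by (intro sum.cong refl) auto
      finally show ?thesis by (simp add: N_def algebra_simps)
    qed
    moreover have "0 \<le> b s" for s unfolding b_def using a(1) by (auto intro!: sum_nonneg)
    ultimately show ?case by blast
  qed
  then show thesis using that by blast
qed

text \<open>Here \<open>c\<close> is the coefficient function of \<open>p\<close>. Its value at 0,
  the mean of \<open>p\<close>, is prescribed exactly, so that the expected number of hits is known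
  and not only bounded. The bounds on \<open>c m\<close> feed the correlation estimate; the last
  clause makes the contribution of non-hits negligible once \<open>R\<close> grows and
  \<open>r\<close> is a large constant.\<close>

definition concentrated :: "nat \<Rightarrow> nat \<Rightarrow> nat \<Rightarrow> (int \<Rightarrow> real) \<Rightarrow> (real \<Rightarrow> real) \<Rightarrow> bool" where
  "concentrated l R r c p \<longleftrightarrow> (\<forall>m. 0 \<le> c m) \<and> c 0 = 1 / (2 * 2 ^ l) \<and> (\<forall>m. c m \<le> 1 / 2 ^ l) \<and>
    (\<forall>m. m \<noteq> 0 \<longrightarrow> c m \<le> 2 ^ l / (real_of_int m)\<^sup>2) \<and> (\<forall>m. int (r * 2 ^ l * R) < \<bar>m\<bar> \<longrightarrow> c m = 0) \<and>
    (\<forall>y. complex_of_real (p y)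
      = (\<Sum>m\<in>{- int (r * 2 ^ l * R)..int (r * 2 ^ l * R)}. c m *\<^sub>R ee (- of_int m * y))) \<and>
    (\<forall>y. 0 \<le> p y \<and> p y \<le> 4) \<and>
    (\<forall>y. 1 / 2 ^ l \<le> nint_dist y \<longrightarrow> p y \<le> real r * real R / real R ^ (2 * r))"

text \<open>A Fejer-smoothed tent function: the kernel \<open>\<bar>\<Sum>\<^bsub>u < H\<^esub> z\<^sup>u\<bar>\<close> to the power \<open>2 r\<close>, averaged over
  translates by \<open>v / q\<close> with tent weights. The parameter \<open>R\<close> measures by how much its degree exceeds
  the natural bandwidth \<open>2 ^ l\<close>; in exchange the kernel is tiny off the arc of radius \<open>2 powr - l\<close>.\<close>

lemma concentrated_kernel:
  fixes l R r :: nat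
  assumes R: "R \<ge> 1" and r: "r \<ge> 1"
  shows "\<exists>c p. concentrated l R r c p"
proof -
  define M :: nat where "M = 2 ^ l"
  define H where "H = M * R"
  \<comment> \<open>The translates \<open>v / q\<close> with \<open>\<bar>v\<bar> \<le> U\<close>
    move a point by at most \<open>U / q = 1 / (2 * 2 ^ l)\<close>, half the radius of the arc.
    Since \<open>q = 4 * D\<close>, each frequency of the kernel satisfies
    \<open>\<bar>m\<bar> / q \<le> 1 / 4\<close>, where the distance of \<open>m / q\<close> to the
    nearest integer is \<open>\<bar>m\<bar> / q\<close> itself.\<close>
  define q where "q = 4 * r * M * R"
  define U where "U = 2 * r * R"
  define D where "D = r * H"
  have M0: "M > 0" by (simp add: M_def)
  have pos: "H > 0" "q > 0" "U > 0" "D > 0" using M0 R r by (auto simp: H_def q_def U_def D_def)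
  have UqM: "real U / real q = 1 / (2 * real M)"
    using pos M0 R r by (simp add: U_def q_def field_simps)
  have Dq: "4 * D = q" by (simp add: D_def H_def q_def algebra_simps)
  obtain a where a0: "\<And>i. 0 \<le> a i"
    and a: "\<And>z :: complex. (\<Sum>u<H. z ^ u) ^ r = (\<Sum>i<D. a i *\<^sub>R z ^ i)"
    using power_geometric_expand[of H "r - 1"] r unfolding D_def by (metis Suc_pred' less_eq_Suc_le One_nat_def)
  have suma: "(\<Sum>i<D. a i) = real H ^ r"
  proof -
    have "complex_of_real (\<Sum>i<D. a i) = (\<Sum>i<D. a i *\<^sub>R 1 ^ i)" by (simp add: scaleR_conv_of_real)
    also have "\<dots> = of_real (real H ^ r)" by (subst a[symmetric]) simp
    finally show ?thesis by (simp only: of_real_eq_iff)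
  qed
  define \<kappa> where "\<kappa> = autocorr a D"
  define \<tau> where "\<tau> = autocorr (\<lambda>_. 1) U"
  have k0: "real H ^ (2 * r) \<le> real D * \<kappa> 0"
    using sum_square_le_autocorr_0[of a D] unfolding suma \<kappa>_def by (simp add: power_mult mult.commute)
  have "0 < real D * \<kappa> 0" using k0 pos(1) by (intro less_le_trans[OF _ k0]) auto
  then have k0pos: "\<kappa> 0 > 0" using pos by (simp add: zero_less_mult_iff)
  define G where "G y = (cmod (\<Sum>u<H. ee (real u * y))) ^ (2 * r)" for y
  have G: "complex_of_real (G y) = (\<Sum>m\<in>{- int D..int D}. \<kappa> m *\<^sub>R ee (of_int m * y))" for y
  proof -
    have "cmod (\<Sum>i<D. a i *\<^sub>R ee (real i * y)) = cmod ((\<Sum>u<H. ee (real u * y)) ^ r)"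
      by (simp add: ee_nat_mult a)
    then have "G y = (cmod (\<Sum>i<D. a i *\<^sub>R ee (real i * y)))\<^sup>2"
      by (simp add: G_def norm_power power_mult[symmetric] mult.commute)
    then show ?thesis unfolding \<kappa>_def by (simp only: autocorr_expand)
  qed
  define F where "F y = (cmod (\<Sum>u<U. ee (real u * y)))\<^sup>2" for y
  have F: "complex_of_real (F y) = (\<Sum>v\<in>{- int U..int U}. \<tau> v *\<^sub>R ee (of_int v * y))" for y
    using autocorr_expand[where a = "\<lambda>_. 1" and D = U and y = y] by (simp add: F_def \<tau>_def)
  have F0: "F 0 = (real U)\<^sup>2" by (simp add: F_def)
  have sumtau: "(\<Sum>v\<in>{- int U..int U}. \<tau> v) = (real U)\<^sup>2"
  proof -
    have "complex_of_real (\<Sum>v\<in>{- int U..int U}. \<tau> v) = of_real (F 0)"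
      by (subst F) (simp add: scaleR_conv_of_real)
    then show ?thesis by (simp only: of_real_eq_iff F0)
  qed
  have tau0: "0 \<le> \<tau> v" for v by (simp add: \<tau>_def autocorr_nonneg)
  have kap0: "0 \<le> \<kappa> m" for m using a0 by (simp add: \<kappa>_def autocorr_nonneg)
  define C where "C = 1 / (real q * real U * \<kappa> 0)"
  have C0: "C > 0" using pos k0pos by (simp add: C_def)
  define c where "c m = C * \<kappa> m * F (of_int m / real q)" for m
  define p where "p y = C * (\<Sum>v\<in>{- int U..int U}. \<tau> v * G (of_int v / real q - y))" for y
  have Mr: "real M = 2 ^ l" by (simp add: M_def)
  have kle: "\<kappa> m \<le> \<kappa> 0" for m unfolding \<kappa>_def by (rule autocorr_le)
  have Fle: "F y \<le> (real U)\<^sup>2" for y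
  proof -
    have "cmod (\<Sum>u<U. ee (real u * y)) \<le> (\<Sum>u<U. 1)" by (rule sum_norm_le) simp
    then show ?thesis unfolding F_def by (intro power_mono) auto
  qed
  have F_nonneg: "0 \<le> F y" for y by (simp add: F_def)
  have C2: "C * \<kappa> 0 = 1 / (real q * real U)" using k0pos by (simp add: C_def)
  have cle: "c m \<le> F (of_int m / real q) / (real q * real U)" for m
  proof -
    have "c m \<le> C * \<kappa> 0 * F (of_int m / real q)"
      unfolding c_def using C0 F_nonneg kle by (intro mult_right_mono mult_left_mono) auto
    then show ?thesis unfolding C2 by simp
  qed
  have UU: "(real U)\<^sup>2 / (real q * real U) = 1 / (2 * 2 ^ l)"
    using UqM pos by (simp add: power2_eq_square Mr field_simps)
  have c_half: "c m \<le> 1 / (2 * 2 ^ l)" for m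
  proof -
    have "c m \<le> F (of_int m / real q) / (real q * real U)" by (rule cle)
    also have "\<dots> \<le> (real U)\<^sup>2 / (real q * real U)" by (intro divide_right_mono Fle) auto
    finally show ?thesis unfolding UU .
  qed
  have c_nonneg: "0 \<le> c m" for m using C0 kap0 F_nonneg by (simp add: c_def)
  have c_supp: "c m = 0" if "int D \<le> \<bar>m\<bar>" for m
    using that by (simp add: c_def \<kappa>_def autocorr_eq_0)
  have c_decay: "c m \<le> 2 ^ l / (2 * (real_of_int m)\<^sup>2)" if "m \<noteq> 0" for m
  proof (cases "int D \<le> \<bar>m\<bar>")
    case True
    then show ?thesis using c_supp by simp
  next
    case False
    then have mq: "4 * \<bar>real_of_int m\<bar> \<le> real q" using Dq by linarith
    have "\<bar>real_of_int m\<bar> / real q \<le> nint_dist (of_int m / real q)"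
    proof -
      obtain z where z: "nint_dist (of_int m / real q) = \<bar>of_int m / real q - of_int z\<bar>"
        by (rule nint_dist_witness)
      have ab: "\<bar>of_int m / real q\<bar> \<le> 1 / 4" using mq pos by (simp add: abs_divide field_simps)
      show ?thesis
      proof (cases "z = 0")
        case False
        then have "1 \<le> \<bar>real_of_int z\<bar>" by linarith
        then have "\<bar>of_int m / real q\<bar> \<le> \<bar>of_int m / real q - of_int z\<bar>" using ab by linarith
        then show ?thesis using z by (simp add: abs_divide)
      qed (use z in \<open>simp add: abs_divide\<close>)
    qed
    moreover have "0 < \<bar>real_of_int m\<bar> / real q" using that pos by simp
    ultimately have d: "1 / (2 * nint_dist (of_int m / real q)) \<le> 1 / (2 * (\<bar>real_of_int m\<bar> / real q))"
      and npos: "0 < nint_dist (of_int m / real q)"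
      by (intro divide_left_mono mult_pos_pos mult_left_mono, auto)
    have "cmod (\<Sum>u<U. ee (real u * (of_int m / real q))) \<le> real q / (2 * \<bar>real_of_int m\<bar>)"
      using norm_geometric_ee_le[OF npos, of U] d by simp
    then have "F (of_int m / real q) \<le> (real q / (2 * \<bar>real_of_int m\<bar>))\<^sup>2"
      unfolding F_def by (intro power_mono) auto
    then have "c m \<le> (real q / (2 * \<bar>real_of_int m\<bar>))\<^sup>2 / (real q * real U)"
      using cle[of m] by (meson divide_right_mono order_trans of_nat_0_le_iff mult_nonneg_nonneg)
    also have "\<dots> = (real q / real U) / (4 * (real_of_int m)\<^sup>2)"
      using pos that by (simp add: power_divide power_mult_distrib power2_eq_square field_simps)
    also have "real q / real U = 2 * real M"
      using pos M0 R r by (simp add: U_def q_def field_simps)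
    finally show ?thesis by (simp add: Mr)
  qed
  have Deq: "r * 2 ^ l * R = D" by (simp add: D_def H_def M_def)
  have p_expand: "complex_of_real (p y) = (\<Sum>m\<in>{- int D..int D}. c m *\<^sub>R ee (- of_int m * y))" for y
  proof -
    have "complex_of_real (p y) = C * (\<Sum>v\<in>{- int U..int U}. \<tau> v *\<^sub>R
        (\<Sum>m\<in>{- int D..int D}. \<kappa> m *\<^sub>R ee (of_int m * (of_int v / real q - y))))"
      unfolding p_def by (simp add: G scaleR_conv_of_real)
    also have "\<dots> = C * (\<Sum>v\<in>{- int U..int U}. \<Sum>m\<in>{- int D..int D}.
        (\<tau> v * \<kappa> m) *\<^sub>R (ee (of_int v * (of_int m / real q)) * ee (- of_int m * y)))"
      by (simp add: scaleR_sum_right ee_add[symmetric] right_diff_distrib mult.commute)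
    also have "\<dots> = C * (\<Sum>m\<in>{- int D..int D}. \<Sum>v\<in>{- int U..int U}.
        (\<tau> v * \<kappa> m) *\<^sub>R (ee (of_int v * (of_int m / real q)) * ee (- of_int m * y)))"
      by (subst sum.swap) simp
    also have "\<dots> = (\<Sum>m\<in>{- int D..int D}. (C * \<kappa> m) *\<^sub>R ((\<Sum>v\<in>{- int U..int U}.
        \<tau> v *\<^sub>R ee (of_int v * (of_int m / real q))) * ee (- of_int m * y)))"
      by (simp add: sum_distrib_left sum_distrib_right scaleR_conv_of_real mult_ac)
    also have "\<dots> = (\<Sum>m\<in>{- int D..int D}. c m *\<^sub>R ee (- of_int m * y))"
      unfolding c_def F[symmetric] by (simp add: scaleR_conv_of_real mult_ac)
    finally show ?thesis .
  qed
  have p_nonneg: "0 \<le> p y" for y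
    using C0 tau0 by (auto simp: p_def G_def intro!: mult_nonneg_nonneg sum_nonneg)
  \<comment> \<open>At most the sum of the coefficients: \<open>c 0\<close> and two copies of
    \<open>3 * 2 ^ l\<close> times the common bound \<open>1 / (2 * 2 ^ l)\<close>, in total at most
    7/2.\<close>
  have p_le: "p y \<le> 4" for y
  proof -
    have "p y = cmod (complex_of_real (p y))"
      using p_nonneg by (simp only: norm_of_real abs_of_nonneg)
    also have "\<dots> \<le> (\<Sum>m\<in>{- int D..int D}. c m)"
      unfolding p_expand using c_nonneg by (intro sum_norm_le) auto
    also have "{- int D..int D} = insert 0 (int ` {1..D} \<union> (\<lambda>t. - int t) ` {1..D})"
    proof (intro set_eqI iffI)
      fix m assume m: "m \<in> {- int D..int D}"
      show "m \<in> insert 0 (int ` {1..D} \<union> (\<lambda>t. - int t) ` {1..D})"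
      proof (cases "m > 0")
        case True
        then have "m = int (nat m)" "nat m \<in> {1..D}" using m by auto
        then show ?thesis by blast
      next
        case False
        show ?thesis
        proof (cases "m = 0")
          case False
          then have "m = - int (nat (- m))" "nat (- m) \<in> {1..D}" using m \<open>\<not> m > 0\<close> by auto
          then show ?thesis by blast
        qed simp
      qed
    qed auto
    also have "(\<Sum>m\<in>insert 0 (int ` {1..D} \<union> (\<lambda>t. - int t) ` {1..D}). c m)
        = c 0 + ((\<Sum>t=1..D. c (int t)) + (\<Sum>t=1..D. c (- int t)))"
      by (subst sum.insert, force, force, subst sum.union_disjoint)
        (auto simp: sum.reindex inj_on_def)
    also have "\<dots> \<le> 1 / (2 * 2 ^ l) + ((\<Sum>t=1..D. 1 / (2 * 2 ^ l) * min 1 ((2 ^ l / real t)\<^sup>2))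
        + (\<Sum>t=1..D. 1 / (2 * 2 ^ l) * min 1 ((2 ^ l / real t)\<^sup>2)))"
    proof (intro add_mono sum_mono c_half)
      have *: "c m \<le> 1 / (2 * 2 ^ l) * min 1 ((2 ^ l / real t)\<^sup>2)" if "t \<in> {1..D}" "\<bar>m\<bar> = int t" for m t
      proof -
        have "(real_of_int m)\<^sup>2 = (real t)\<^sup>2" using that by (metis of_int_of_nat_eq power2_abs of_int_abs)
        then have "c m \<le> 1 / (2 * 2 ^ l) * (2 ^ l / real t)\<^sup>2"
          using c_decay[of m] that by (auto simp: power_divide power2_eq_square)
        moreover have "c m \<le> 1 / (2 * 2 ^ l) * 1" using c_half[of m] by simp
        ultimately show ?thesis by (cases "1 \<le> (2 ^ l / real t)\<^sup>2") (auto simp: min_def)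
      qed
      show "c (int t) \<le> 1 / (2 * 2 ^ l) * min 1 ((2 ^ l / real t)\<^sup>2)" if "t \<in> {1..D}" for t
        using * that by simp
      show "c (- int t) \<le> 1 / (2 * 2 ^ l) * min 1 ((2 ^ l / real t)\<^sup>2)" if "t \<in> {1..D}" for t
        using * that by simp
    qed
    also have "\<dots> \<le> 1 / (2 * 2 ^ l) + (1 / (2 * 2 ^ l) * (3 * 2 ^ l) + 1 / (2 * 2 ^ l) * (3 * 2 ^ l))"
      unfolding sum_distrib_left[symmetric]
      by (intro add_mono mult_left_mono sum_min_inverse_square_le order_refl) auto
    also have "\<dots> \<le> 4"
    proof -
      have "(1::real) \<le> 2 ^ l" by simp
      then have "(1::real) \<le> 2 * 2 ^ l" by linarith
      then show ?thesis by (simp add: field_simps)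
    qed
    finally show ?thesis .
  qed
  have "concentrated l R r c p"
    unfolding concentrated_def Deq
  proof (intro conjI allI impI)
    show "0 \<le> c m" for m by (rule c_nonneg)
    show "c 0 = 1 / (2 * 2 ^ l)"
      unfolding c_def C2 using UU by (simp add: F0)
    show "c m \<le> 1 / 2 ^ l" for m using c_half[of m] by (rule order_trans) (simp add: field_simps)
    show "c m \<le> 2 ^ l / (real_of_int m)\<^sup>2" if "m \<noteq> 0" for m
      using c_decay[OF that] by (rule order_trans) (use that in \<open>simp add: field_simps\<close>)
    show "c m = 0" if "int D < \<bar>m\<bar>" for m using that by (intro c_supp) simp
    show "complex_of_real (p y) = (\<Sum>m\<in>{- int D..int D}. c m *\<^sub>R ee (- of_int m * y))" for y
      by (rule p_expand)
    show "0 \<le> p y" for y by (rule p_nonneg)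
    show "p y \<le> 4" for y by (rule p_le)
    show "p y \<le> real r * real R / real R ^ (2 * r)" if y: "1 / 2 ^ l \<le> nint_dist y" for y
    proof -
      \<comment> \<open>For \<open>y\<close> outside the arc the shifted argument stays at distance
        at least half the radius from the integers, so the geometric sum is at most
        \<open>M\<close>, smaller by a factor \<open>R\<close> than its value \<open>H\<close> at 0.
        The power \<open>2 * r\<close> turns this into the gain \<open>R ^ (2 * r)\<close>.\<close>
      have Gle: "\<tau> v * G (of_int v / real q - y) \<le> \<tau> v * real M ^ (2 * r)" for v
      proof (cases "int U \<le> \<bar>v\<bar>")
        case True
        then show ?thesis by (simp add: \<tau>_def autocorr_eq_0)
      next
        case False
        then have "\<bar>of_int v / real q\<bar> \<le> real U / real q"
          unfolding abs_divide using pos by (intro divide_mono) auto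
        then have "1 / (2 * real M) \<le> nint_dist (y - of_int v / real q)"
        proof -
          have "1 / 2 ^ l = 1 / (2 * real M) + 1 / (2 * real M)" using M0 unfolding Mr by simp
          then show ?thesis
            using nint_dist_diff[of y "of_int v / real q"] y UqM \<open>\<bar>of_int v / real q\<bar> \<le> _\<close> by linarith
        qed
        then have nd: "1 / (2 * real M) \<le> nint_dist (y - of_int v / real q)" .
        have "0 < 1 / (2 * real M)" using M0 by simp
        then have npos: "0 < nint_dist (y - of_int v / real q)" using nd by linarith
        have n2: "1 / (2 * nint_dist (y - of_int v / real q)) \<le> real M"
          using nd npos M0 by (simp add: field_simps)
        have "cmod (\<Sum>u<H. ee (real u * (of_int v / real q - y)))
            = cmod (cnj (\<Sum>u<H. ee (real u * (y - of_int v / real q))))"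
          unfolding cnj_sum cnj_ee by (simp add: algebra_simps)
        also have "\<dots> \<le> real M"
          unfolding complex_mod_cnj using norm_geometric_ee_le[OF npos, of H] n2 by linarith
        finally have "G (of_int v / real q - y) \<le> real M ^ (2 * r)"
          unfolding G_def by (intro power_mono) auto
        then show ?thesis by (intro mult_left_mono tau0)
      qed
      have "p y \<le> C * (\<Sum>v\<in>{- int U..int U}. \<tau> v * real M ^ (2 * r))"
        unfolding p_def using C0 by (intro mult_left_mono sum_mono Gle) auto
      also have "\<dots> = C * (real U)\<^sup>2 * real M ^ (2 * r)"
        by (simp add: sum_distrib_right[symmetric] sumtau)
      also have "\<dots> = (real U / real q) * (real M ^ (2 * r) / \<kappa> 0)"
        using pos by (simp add: C_def power2_eq_square)
      also have "\<dots> \<le> (real U / real q) * (real D / real R ^ (2 * r))"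
      proof (intro mult_left_mono)
        have "real M ^ (2 * r) * real R ^ (2 * r) \<le> real D * \<kappa> 0"
          using k0 by (simp add: H_def power_mult_distrib)
        then show "real M ^ (2 * r) / \<kappa> 0 \<le> real D / real R ^ (2 * r)"
          using k0pos R by (simp add: field_simps)
      qed auto
      also have "\<dots> \<le> real r * real R / real R ^ (2 * r)"
        unfolding UqM D_def H_def using M0 R by (simp add: field_simps)
      finally show ?thesis .
    qed
  qed
  then show ?thesis by blast
qed

section \<open>Divisors and linear equations\<close>

lemma divisors_prime_power_mult:
  fixes p q a :: nat
  assumes "prime p" "q > 0"
  shows "card {d. d dvd p ^ a * q} \<le> (a + 1) * card {d. d dvd q}"
proof -
  have "{d. d dvd p ^ a * q} \<subseteq> (\<lambda>(i, d). p ^ i * d) ` ({..a} \<times> {d. d dvd q})"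
  proof
    fix d assume "d \<in> {d. d dvd p ^ a * q}"
    then obtain b c where bc: "d = b * c" "b dvd p ^ a" "c dvd q"
      using division_decomp[of d "p ^ a" q] by auto
    then obtain i where "i \<le> a" "b = p ^ i"
      using divides_primepow_nat[OF assms(1)] by auto
    then show "d \<in> (\<lambda>(i, d). p ^ i * d) ` ({..a} \<times> {d. d dvd q})" using bc by force
  qed
  then have "card {d. d dvd p ^ a * q} \<le> card ((\<lambda>(i, d). p ^ i * d) ` ({..a} \<times> {d. d dvd q}))"
    using assms by (intro card_mono) auto
  also have "\<dots> \<le> card ({..a} \<times> {d. d dvd q})" using assms by (intro card_image_le) auto
  finally show ?thesis by (simp add: card_cartesian_product)
qed

text \<open>Prime powers are peeled off one at a time: \<open>p ^ a\<close> multiplies the count by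
  at most \<open>a + 1\<close>. For \<open>p \<ge> P\<close> this is at most
  \<open>2 ^ a \<le> p powr (a * \<epsilon>)\<close>; each of the at most \<open>P\<close> smaller
  primes costs a constant factor \<open>K\<close>.\<close>

lemma divisor_bound:
  fixes \<epsilon> :: real
  assumes "\<epsilon> > 0"
  obtains C where "C \<ge> 1" "\<And>n :: nat. n > 0 \<Longrightarrow> real (card {d. d dvd n}) \<le> C * real n powr \<epsilon>"
proof -
  define P where "P = nat \<lceil>2 powr (1 / \<epsilon>)\<rceil>"
  \<comment> \<open>Chosen so that \<open>a + 1 \<le> K * (1 + \<epsilon> * ln 2 * a)\<close>, where
    the second factor is at most \<open>2 powr (\<epsilon> * a)\<close>.\<close>
  define K where "K = 1 + 1 / (\<epsilon> * ln 2)"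
  have K1: "K \<ge> 1" using assms by (simp add: K_def)
  have large: "2 \<le> real p powr \<epsilon>" if "p \<ge> P" for p
  proof -
    have "2 powr (1 / \<epsilon>) \<le> real p" using that unfolding P_def by linarith
    then have "(2 powr (1 / \<epsilon>)) powr \<epsilon> \<le> real p powr \<epsilon>" using assms by (intro powr_mono2) auto
    then show ?thesis using assms by (simp add: powr_powr)
  qed
  have key: "real (a + 1) \<le> (if p < P then K else 1) * (real p ^ a) powr \<epsilon>" if p: "prime p" for a p :: nat
  proof -
    have p2: "real p \<ge> 2" using prime_ge_2_nat[OF p] by simp
    have eq: "(real p ^ a) powr \<epsilon> = (real p powr \<epsilon>) ^ a"
      using p2 by (simp add: powr_realpow[symmetric] powr_powr mult.commute powr_power)
    show ?thesis
    proof (cases "p < P")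
      case False
      have "real (a + 1) \<le> 2 ^ a"
        by (induction a) auto
      also have "\<dots> \<le> (real p powr \<epsilon>) ^ a" using large[of p] False by (intro power_mono) auto
      finally show ?thesis using False eq by simp
    next
      case True
      have "1 + \<epsilon> * ln 2 * real a \<le> exp (\<epsilon> * ln 2 * real a)" by (rule exp_ge_add_one_self)
      also have "\<dots> = (2 powr \<epsilon>) ^ a" by (simp add: powr_def exp_of_nat_mult[symmetric] mult_ac)
      also have "\<dots> \<le> (real p powr \<epsilon>) ^ a" using p2 assms by (intro power_mono powr_mono2) auto
      finally have le: "1 + \<epsilon> * ln 2 * real a \<le> (real p powr \<epsilon>) ^ a" .
      have "real (a + 1) \<le> K * (1 + \<epsilon> * ln 2 * real a)"
        using assms by (simp add: K_def field_simps)
      also have "\<dots> \<le> K * (real p powr \<epsilon>) ^ a" using le K1 by (intro mult_left_mono) auto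
      finally show ?thesis using True eq by simp
    qed
  qed
  have main: "real (card {d. d dvd n}) \<le> K ^ card {p \<in> prime_factors n. p < P} * real n powr \<epsilon>"
    if "n > 0" for n :: nat
    using that
  proof (induction n rule: less_induct)
    case (less n)
    show ?case
    proof (cases "n = 1")
      case False
      then obtain p where p: "prime p" "p dvd n" using prime_factor_nat by blast
      define a where "a = multiplicity p n"
      obtain q where q: "n = p ^ a * q" "\<not> p dvd q"
        using multiplicity_decompose'[of n p] less.prems p unfolding a_def
        by (metis not_prime_unit not_gr_zero)
      have a0: "a > 0" using p less.prems unfolding a_def by (simp add: prime_multiplicity_gt_zero_iff)
      have q0: "q > 0" using q less.prems by (cases q) auto
      have "p ^ a > 1" using prime_gt_1_nat[OF p(1)] a0 by (rule one_less_power)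
      then have qn: "q < n" using q0 unfolding q(1) by simp
      have "prime_factors n = insert p (prime_factors q)"
      proof -
        have "prime_factors n = prime_factors (p ^ a) \<union> prime_factors q"
          unfolding q(1) using q0 prime_gt_0_nat[OF p(1)] by (intro prime_factors_product) auto
        also have "prime_factors (p ^ a) = {p}"
          using a0 p(1) by (simp add: prime_factorization_prime_power)
        finally show ?thesis by simp
      qed
      then have "{r \<in> prime_factors n. r < P}
          = (if p < P then insert p {r \<in> prime_factors q. r < P} else {r \<in> prime_factors q. r < P})"
        by auto
      moreover have "p \<notin> prime_factors q" using q(2) by (auto dest: in_prime_factors_imp_dvd)
      ultimately have cd: "K ^ card {r \<in> prime_factors n. r < P}
          = (if p < P then K else 1) * K ^ card {r \<in> prime_factors q. r < P}"
        by auto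
      have "real (card {d. d dvd n}) \<le> real (a + 1) * real (card {d. d dvd q})"
        unfolding q(1) using divisors_prime_power_mult[OF p(1) q0, of a]
        by (metis of_nat_le_iff of_nat_mult)
      also have "\<dots> \<le> ((if p < P then K else 1) * (real p ^ a) powr \<epsilon>)
          * (K ^ card {r \<in> prime_factors q. r < P} * real q powr \<epsilon>)"
        using K1 by (intro mult_mono key p less.IH qn q0) auto
      also have "\<dots> = K ^ card {r \<in> prime_factors n. r < P} * real n powr \<epsilon>"
        unfolding cd by (simp add: q(1) powr_mult)
      finally show ?thesis .
    qed simp
  qed
  show thesis
  proof (rule that[of "K ^ P"])
    show "K ^ P \<ge> 1" using K1 by simp
    show "real (card {d. d dvd n}) \<le> K ^ P * real n powr \<epsilon>" if "n > 0" for n :: nat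
    proof -
      have "card {p \<in> prime_factors n. p < P} \<le> card {..<P}" by (intro card_mono) auto
      then have "K ^ card {p \<in> prime_factors n. p < P} \<le> K ^ P"
        using K1 by (intro power_increasing) auto
      then show ?thesis using main[OF that] by (meson mult_right_mono order_trans powr_ge_zero)
    qed
  qed
qed

section \<open>Linear equations in integers and in integer vectors\<close>

lemma card_residue_class_le:
  fixes Y q :: nat and u0 :: int
  assumes q: "q > 0"
  shows "real (card {u \<in> {- int Y..int Y}. int q dvd u - u0}) \<le> 1 + 2 * real Y / real q"
proof (cases "{u \<in> {- int Y..int Y}. int q dvd u - u0} = {}")
  case False
  let ?A = "{u \<in> {- int Y..int Y}. int q dvd u - u0}"
  have fin: "finite ?A" by (rule finite_subset[of _ "{- int Y..int Y}"]) auto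
  define w where "w = Min ?A"
  have w: "w \<in> ?A" "\<And>u. u \<in> ?A \<Longrightarrow> w \<le> u" using Min_in[OF fin False] fin unfolding w_def by auto
  have dv: "int q dvd u - w" if "u \<in> ?A" for u
    using that w(1) dvd_diff[of "int q" "u - u0" "w - u0"] by auto
  have inj: "inj_on (\<lambda>u. (u - w) div int q) ?A"
  proof (rule inj_onI)
    fix u v assume uv: "u \<in> ?A" "v \<in> ?A" "(u - w) div int q = (v - w) div int q"
    then show "u = v" using dv[OF uv(1)] dv[OF uv(2)] by (metis dvd_div_mult_self diff_add_cancel)
  qed
  have "(\<lambda>u. (u - w) div int q) ` ?A \<subseteq> {0..int (2 * Y div q)}"
  proof
    fix t assume "t \<in> (\<lambda>u. (u - w) div int q) ` ?A"
    then obtain u where u: "u \<in> ?A" "t = (u - w) div int q" by auto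
    have "0 \<le> u - w" using w(2)[OF u(1)] by simp
    moreover have "u - w \<le> int (2 * Y)" using u w(1) by auto
    then have "(u - w) div int q \<le> int (2 * Y) div int q" using q by (intro zdiv_mono1) auto
    ultimately show "t \<in> {0..int (2 * Y div q)}" using u q by (auto simp: zdiv_int pos_imp_zdiv_nonneg_iff)
  qed
  then have "card ?A \<le> card {0..int (2 * Y div q)}"
    unfolding card_image[OF inj, symmetric] by (intro card_mono) auto
  also have "\<dots> = 1 + 2 * Y div q" by simp
  finally have "real (card ?A) \<le> 1 + real (2 * Y div q)" by linarith
  also have "\<dots> \<le> 1 + 2 * real Y / real q" using of_nat_div_le_of_nat[of "2 * Y" q, where ?'a = real] by simp
  finally show ?thesis .
next
  case True
  show ?thesis unfolding True by simp
qed

definition linsol :: "nat \<Rightarrow> nat \<Rightarrow> nat \<Rightarrow> int \<Rightarrow> (int \<times> int) set" where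
  "linsol Y n n' x = {(u, v). u \<in> {- int Y..int Y} \<and> v \<in> {- int Y..int Y} \<and> int n * u + int n' * v = x}"

lemma finite_linsol [simp]: "finite (linsol Y n n' x)"
  by (rule finite_subset[of _ "{- int Y..int Y} \<times> {- int Y..int Y}"]) (auto simp: linsol_def)

text \<open>Division by \<open>g = gcd n n'\<close> shows that \<open>u\<close> is fixed modulo
  \<open>n' / g\<close>, and \<open>u\<close> determines \<open>v\<close>.\<close>

lemma card_linsol_le:
  assumes "n' > 0"
  shows "real (card (linsol Y n n' x)) \<le> 1 + 2 * real Y * real (gcd n n') / real n'"
proof (cases "linsol Y n n' x = {}")
  case False
  then obtain u0 v0 where uv0: "(u0, v0) \<in> linsol Y n n' x" by auto
  define g where "g = gcd n n'"
  have g0: "g > 0" using assms by (simp add: g_def)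
  obtain a b where ab: "n = g * a" "n' = g * b" "coprime a b"
    using gcd_coprime_exists[of n n'] g0 unfolding g_def by (metis mult.commute not_gr_zero)
  have b0: "b > 0" using ab assms by (cases b) auto
  have inj: "inj_on fst (linsol Y n n' x)"
    using assms by (auto simp: inj_on_def linsol_def)
  have "fst ` linsol Y n n' x \<subseteq> {u \<in> {- int Y..int Y}. int b dvd u - u0}"
  proof
    fix u assume "u \<in> fst ` linsol Y n n' x"
    then obtain v where uv: "(u, v) \<in> linsol Y n n' x" by auto
    have "int n * u + int n' * v = int n * u0 + int n' * v0" using uv uv0 by (auto simp: linsol_def)
    then have "int g * (int a * (u - u0)) = int g * (int b * (v0 - v))"
      by (simp add: ab algebra_simps)
    then have "int a * (u - u0) = int b * (v0 - v)" using g0 by simp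
    then have "int b dvd int a * (u - u0)" by simp
    moreover have "coprime (int b) (int a)" using ab(3) by (simp add: coprime_commute)
    ultimately have "int b dvd u - u0" by (simp add: coprime_dvd_mult_right_iff)
    then show "u \<in> {u \<in> {- int Y..int Y}. int b dvd u - u0}" using uv by (auto simp: linsol_def)
  qed
  then have "card (linsol Y n n' x) \<le> card {u \<in> {- int Y..int Y}. int b dvd u - u0}"
    unfolding card_image[OF inj, symmetric] by (intro card_mono) (auto intro: finite_subset[of _ "{- int Y..int Y}"])
  then have "real (card (linsol Y n n' x)) \<le> 1 + 2 * real Y / real b"
    using card_residue_class_le[OF b0, of Y u0] by linarith
  also have "2 * real Y / real b = 2 * real Y * real (gcd n n') / real n'"
  proof -
    have "real n' = real g * real b" by (simp add: ab(2))
    then show ?thesis unfolding g_def[symmetric] using g0 by simp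
  qed
  finally show ?thesis by simp
qed simp

text \<open>Integer vectors are functions that vanish outside \<open>{..<k}\<close>, as in
  \<open>freq_box\<close>, whereas points of space are extensional. With the default 0 the vectors
  can be added and dilated as functions.\<close>

abbreviation ivec :: "nat \<Rightarrow> (nat \<Rightarrow> int set) \<Rightarrow> (nat \<Rightarrow> int) set" where
  "ivec k A \<equiv> PiE_dflt {..<k} 0 A"

abbreviation ibox :: "nat \<Rightarrow> nat \<Rightarrow> (nat \<Rightarrow> int) set" where
  "ibox k Y \<equiv> PiE_dflt {..<k} 0 (\<lambda>_. {- int Y..int Y})"

text \<open>The condition is put on \<open>m'\<close> because the divisor bound is applied in a
  coordinate \<open>c\<close> with \<open>m' c \<noteq> 0\<close>, to the equation
  \<open>n' * m' c = \<xi> c - n * m c\<close>.\<close>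

definition vecsol :: "nat \<Rightarrow> nat \<Rightarrow> nat \<Rightarrow> nat \<Rightarrow> (nat \<Rightarrow> int) \<Rightarrow> ((nat \<Rightarrow> int) \<times> (nat \<Rightarrow> int)) set" where
  "vecsol k Y n n' \<xi> = {(m, m'). m \<in> ibox k Y \<and> m' \<in> ibox k Y \<and> m' \<noteq> (\<lambda>_. 0)
     \<and> (\<lambda>i. int n * m i + int n' * m' i) = \<xi>}"

text \<open>In one coordinate with \<open>m' c \<noteq> 0\<close> the solutions are kept as they
  are, to be counted later on average over \<open>n'\<close>; each of the remaining
  \<open>k - 1\<close> coordinates is estimated by its residue class.\<close>

lemma card_vecsol_le:
  assumes n': "n' > 0"
  shows "real (card (vecsol k Y n n' \<xi>))
    \<le> (\<Sum>c<k. real (card {(u, v) \<in> linsol Y n n' (\<xi> c). v \<noteq> 0})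
          * (1 + 2 * real Y * real (gcd n n') / real n') ^ (k - 1))"
proof -
  define S where "S c = {(m, m'). (m, m') \<in> vecsol k Y n n' \<xi> \<and> m' c \<noteq> 0}" for c
  define T where "T c i = (if i = c then {(u, v) \<in> linsol Y n n' (\<xi> c). v \<noteq> 0} else linsol Y n n' (\<xi> i))" for c i :: nat
  have finT: "finite (T c i)" for c i
    unfolding T_def by (auto intro: finite_subset[OF _ finite_linsol[of Y n n' "\<xi> c"]])
  let ?f = "\<lambda>(m, m'). restrict (\<lambda>i. (m i :: int, m' i :: int)) {..<k}"
  have injS: "inj_on ?f (S c)" for c
  proof (rule inj_onI, clarify)
    fix m m' r r'
    assume a: "(m, m') \<in> S c" "(r, r') \<in> S c"
      and e: "restrict (\<lambda>i. (m i, m' i)) {..<k} = restrict (\<lambda>i. (r i, r' i)) {..<k}"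
    have "m i = r i \<and> m' i = r' i" for i
    proof (cases "i < k")
      case True
      then show ?thesis using fun_cong[OF e, of i] by simp
    next
      case False
      then show ?thesis using a by (simp add: S_def vecsol_def PiE_dflt_def)
    qed
    then show "m = r \<and> m' = r'" by auto
  qed
  have imS: "?f ` S c \<subseteq> PiE {..<k} (T c)" for c
  proof (rule image_subsetI, clarify)
    fix m m' assume a: "(m, m') \<in> S c"
    have "(m i, m' i) \<in> T c i" if "i < k" for i
    proof -
      have "m i \<in> {- int Y..int Y}" "m' i \<in> {- int Y..int Y}" "int n * m i + int n' * m' i = \<xi> i"
        using a that by (auto simp: S_def vecsol_def PiE_dflt_def)
      moreover have "m' c \<noteq> 0" using a by (simp add: S_def)
      ultimately show ?thesis by (auto simp: T_def linsol_def)
    qed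
    then show "restrict (\<lambda>i. (m i, m' i)) {..<k} \<in> PiE {..<k} (T c)" by auto
  qed
  have finP: "finite (PiE {..<k} (T c))" for c by (intro finite_PiE) (auto simp: finT)
  have finS: "finite (S c)" for c
    by (rule finite_imageD[OF finite_subset[OF imS finP] injS])
  have cardS: "card (S c) \<le> (\<Prod>i<k. card (T c i))" for c
    using card_mono[OF finP imS] card_image[OF injS] by (simp add: card_PiE)
  have "vecsol k Y n n' \<xi> \<subseteq> (\<Union>c<k. S c)"
  proof (clarify)
    fix m m' assume mm: "(m, m') \<in> vecsol k Y n n' \<xi>"
    then obtain c where "m' c \<noteq> 0" by (auto simp: vecsol_def)
    moreover have "c < k" using mm \<open>m' c \<noteq> 0\<close> by (force simp: vecsol_def PiE_dflt_def)
    ultimately show "(m, m') \<in> (\<Union>c<k. S c)" using mm by (auto simp: S_def)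
  qed
  then have "card (vecsol k Y n n' \<xi>) \<le> card (\<Union>c<k. S c)"
    by (intro card_mono finite_UN_I finS) auto
  also have "\<dots> \<le> (\<Sum>c<k. card (S c))" by (rule card_UN_le) simp
  also have "\<dots> \<le> (\<Sum>c<k. \<Prod>i<k. card (T c i))" by (intro sum_mono cardS)
  finally have "real (card (vecsol k Y n n' \<xi>)) \<le> real (\<Sum>c<k. \<Prod>i<k. card (T c i))"
    by (rule of_nat_mono)
  also have "\<dots> = (\<Sum>c<k. \<Prod>i<k. real (card (T c i)))" by simp
  also have "\<dots> \<le> (\<Sum>c<k. real (card {(u, v) \<in> linsol Y n n' (\<xi> c). v \<noteq> 0})
          * (1 + 2 * real Y * real (gcd n n') / real n') ^ (k - 1))"
  proof (rule sum_mono)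
    fix c assume c: "c \<in> {..<k}"
    have "(\<Prod>i<k. real (card (T c i))) = real (card (T c c)) * (\<Prod>i\<in>{..<k} - {c}. real (card (T c i)))"
      using c by (subst prod.remove[of _ c]) auto
    also have "\<dots> \<le> real (card (T c c)) * (\<Prod>i\<in>{..<k} - {c}. 1 + 2 * real Y * real (gcd n n') / real n')"
      by (intro mult_left_mono prod_mono) (auto simp: T_def card_linsol_le n')
    finally show "(\<Prod>i<k. real (card (T c i))) \<le> real (card {(u, v) \<in> linsol Y n n' (\<xi> c). v \<noteq> 0})
          * (1 + 2 * real Y * real (gcd n n') / real n') ^ (k - 1)"
      using c by (simp add: T_def)
  qed
  finally show ?thesis .
qed

lemma card_multiples_block_le:
  assumes "g > 0"
  shows "real (card {n \<in> {N..<2 * N}. g dvd n}) \<le> 2 * real N / real g"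
proof -
  have "{n \<in> {N..<2 * N}. g dvd n} \<subseteq> (\<lambda>t. g * t) ` {1..2 * N div g}"
  proof
    fix n assume n: "n \<in> {n \<in> {N..<2 * N}. g dvd n}"
    then obtain t where t: "n = g * t" by auto
    have "t > 0" using n t by (cases t) auto
    moreover have "t \<le> 2 * N div g" using n t assms by (simp add: less_eq_div_iff_mult_less_eq mult.commute)
    ultimately show "n \<in> (\<lambda>t. g * t) ` {1..2 * N div g}" using t by auto
  qed
  then have "card {n \<in> {N..<2 * N}. g dvd n} \<le> card ((\<lambda>t. g * t) ` {1..2 * N div g})"
    by (intro card_mono) auto
  also have "\<dots> \<le> 2 * N div g" using card_image_le[of "{1..2 * N div g}" "\<lambda>t. g * t"] by simp
  finally have "real (card {n \<in> {N..<2 * N}. g dvd n}) \<le> real (2 * N div g)" by simp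
  also have "\<dots> \<le> real (2 * N) / real g" by (rule of_nat_div_le_of_nat)
  finally show ?thesis by simp
qed

lemma card_int_divisor_pairs_le:
  fixes h :: int
  assumes "\<And>h::int. h \<noteq> 0 \<Longrightarrow> \<bar>h\<bar> \<le> X \<Longrightarrow> real (card {d. d dvd nat \<bar>h\<bar>}) \<le> V" "\<bar>h\<bar> \<le> X" "0 \<le> V"
  shows "real (card {(n', v) \<in> A \<times> {- int Y..int Y}. v \<noteq> 0 \<and> n' > 0 \<and> int n' * v = h}) \<le> V"
proof (cases "h = 0")
  case True
  then have "{(n', v) \<in> A \<times> {- int Y..int Y}. v \<noteq> 0 \<and> n' > 0 \<and> int n' * v = h} = {}" by auto
  then show ?thesis using assms by (metis card.empty of_nat_0)
next
  case False
  let ?S = "{(n', v) \<in> A \<times> {- int Y..int Y}. v \<noteq> 0 \<and> n' > 0 \<and> int n' * v = h}"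
  have "inj_on fst ?S" by (auto simp: inj_on_def)
  moreover have "fst ` ?S \<subseteq> {d. d dvd nat \<bar>h\<bar>}"
    by (auto simp: abs_mult nat_mult_distrib)
  moreover have "finite {d. d dvd nat \<bar>h\<bar>}" using False by (intro finite_divisors_nat) auto
  ultimately have "card ?S \<le> card {d. d dvd nat \<bar>h\<bar>}" by (rule card_inj_on_le)
  then show ?thesis using assms(1)[OF False assms(2)] by linarith
qed


text \<open>In a coordinate \<open>c\<close> with \<open>m' c \<noteq> 0\<close>, the pair \<open>(n, m c)\<close> determines \<open>(n', m' c)\<close> up to a divisor
  of \<open>\<xi> c - n * m c\<close>. In the other coordinates \<open>m i\<close> is confined to a residue class modulo
  \<open>n' / gcd n n'\<close>, and large values of \<open>gcd n n'\<close> are rare because it divides \<open>\<xi> i0 \<noteq> 0\<close>.\<close>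

lemma card_vecsol_sum_le:
  fixes k N N' Y :: nat and V Q :: real and \<xi> :: "nat \<Rightarrow> int"
  assumes k: "k \<ge> 2" and N: "0 < N" "N \<le> N'" and Y: "1 \<le> Y"
    and V: "\<And>h::int. h \<noteq> 0 \<Longrightarrow> \<bar>h\<bar> \<le> 4 * int N' * int Y \<Longrightarrow> real (card {d. d dvd nat \<bar>h\<bar>}) \<le> V"
    and V0: "0 \<le> V" and Q: "1 \<le> Q" "real Y ^ (k - 1) \<le> Q * real N'"
    and \<xi>: "\<And>i. i < k \<Longrightarrow> \<bar>\<xi> i\<bar> \<le> 4 * int N' * int Y" "i0 < k" "\<xi> i0 \<noteq> 0"
  shows "(\<Sum>n\<in>{N..<2*N}. \<Sum>n'\<in>{N'..<2*N'}. real (card (vecsol k Y n n' \<xi>)))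
    \<le> 6 * real k * 8 ^ k * Q * real N * real Y * V\<^sup>2"
proof -
  define w where "w g = (1 + 2 * real Y * real g / real N') ^ (k - 1)" for g :: nat
  define G where "G = {d. d dvd nat \<bar>\<xi> i0\<bar>} \<inter> {1..2 * N}"
  define L where "L n n' c = {(u, v) \<in> linsol Y n n' (\<xi> c). v \<noteq> 0}" for n n' c
  have N'0: "N' > 0" using N by simp
  have w0: "0 \<le> w g" for g by (simp add: w_def)
  have finG: "finite G" by (simp add: G_def)
  have finL: "finite (L n n' c)" for n n' c
    unfolding L_def by (rule finite_subset[OF _ finite_linsol[of Y n n' "\<xi> c"]]) auto
  \<comment> \<open>The gcd of the pair is replaced by a sum over all \<open>g\<close> in
    \<open>G\<close> that divide \<open>n\<close>, among which it occurs. This overcounts, but the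
    weight \<open>w g\<close> no longer depends on \<open>n'\<close>.\<close>
  have one: "real (card (vecsol k Y n n' \<xi>)) \<le> (\<Sum>c<k. \<Sum>g\<in>G. if g dvd n then w g * real (card (L n n' c)) else 0)"
    if n: "n \<in> {N..<2*N}" and n': "n' \<in> {N'..<2*N'}" for n n'
  proof (cases "vecsol k Y n n' \<xi> = {}")
    case True
    then show ?thesis using w0 by (auto intro!: sum_nonneg)
  next
    case False
    then obtain m m' where "(m, m') \<in> vecsol k Y n n' \<xi>" by auto
    then have mm: "int n * m i0 + int n' * m' i0 = \<xi> i0" by (auto simp: vecsol_def)
    define g where "g = gcd n n'"
    have gdn: "g dvd n" by (simp add: g_def)
    have "int g dvd \<xi> i0" unfolding mm[symmetric] g_def by (simp flip: gcd_int_int_eq)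
    then have "g dvd nat \<bar>\<xi> i0\<bar>" by (simp add: dvd_nat_abs_iff)
    moreover have "g \<le> n" using gdn n N by (intro dvd_imp_le) auto
    moreover have "g \<ge> 1" using n' N'0 by (simp add: g_def Suc_le_eq)
    ultimately have gG: "g \<in> G" using n by (simp add: G_def)
    have "real (card (vecsol k Y n n' \<xi>))
      \<le> (\<Sum>c<k. real (card (L n n' c)) * (1 + 2 * real Y * real (gcd n n') / real n') ^ (k - 1))"
      unfolding L_def using n' N'0 by (intro card_vecsol_le) auto
    also have "\<dots> \<le> (\<Sum>c<k. w g * real (card (L n n' c)))"
    proof (rule sum_mono)
      fix c
      have "2 * real Y * real (gcd n n') / real n' \<le> 2 * real Y * real g / real N'"
        using n' N'0 unfolding g_def by (intro divide_left_mono) auto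
      then have "(1 + 2 * real Y * real (gcd n n') / real n') ^ (k - 1) \<le> w g"
        unfolding w_def by (intro power_mono) auto
      then show "real (card (L n n' c)) * (1 + 2 * real Y * real (gcd n n') / real n') ^ (k - 1)
          \<le> w g * real (card (L n n' c))"
        by (subst mult.commute) (intro mult_right_mono, auto)
    qed
    also have "\<dots> \<le> (\<Sum>c<k. \<Sum>g\<in>G. if g dvd n then w g * real (card (L n n' c)) else 0)"
    proof (rule sum_mono)
      fix c
      have "w g * real (card (L n n' c)) = (if g dvd n then w g * real (card (L n n' c)) else 0)"
        using gdn by simp
      also have "\<dots> \<le> (\<Sum>g\<in>G. if g dvd n then w g * real (card (L n n' c)) else 0)"
        using w0 by (intro member_le_sum[OF gG] finG) auto
      finally show "w g * real (card (L n n' c)) \<le> \<dots>" .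
    qed
    finally show ?thesis .
  qed
  have pairs: "(\<Sum>n'\<in>{N'..<2*N'}. real (card (L n n' c))) \<le> (2 * real Y + 1) * V"
    if c: "c < k" and n: "n \<in> {N..<2*N}" for n c
  proof -
    let ?D = "\<lambda>u. {(n', v) \<in> {N'..<2*N'} \<times> {- int Y..int Y}. v \<noteq> 0 \<and> n' > 0 \<and> int n' * v = \<xi> c - int n * u}"
    have Dfin: "finite (?D u)" for u
      by (rule finite_subset[of _ "{N'..<2*N'} \<times> {- int Y..int Y}"]) auto
    have "(\<Sum>n'\<in>{N'..<2*N'}. real (card (L n n' c))) = real (card (SIGMA n':{N'..<2*N'}. L n n' c))"
      using finL by (subst card_SigmaI) auto
    also have "\<dots> = real (card ((\<lambda>(n', u, v). (u, n', v)) ` (SIGMA n':{N'..<2*N'}. L n n' c)))"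
      by (subst card_image) (auto simp: inj_on_def)
    also have "\<dots> \<le> real (card (SIGMA u:{- int Y..int Y}. ?D u))"
    proof -
      have "(\<lambda>(n', u, v). (u, n', v)) ` (SIGMA n':{N'..<2*N'}. L n n' c) \<subseteq> (SIGMA u:{- int Y..int Y}. ?D u)"
        using N'0 by (auto simp: L_def linsol_def)
      then show ?thesis using Dfin by (intro of_nat_mono card_mono finite_SigmaI) auto
    qed
    also have "\<dots> = (\<Sum>u\<in>{- int Y..int Y}. real (card (?D u)))"
      using Dfin by (subst card_SigmaI) auto
    also have "\<dots> \<le> (\<Sum>u\<in>{- int Y..int Y}. V)"
    proof (rule sum_mono)
      fix u
      show "real (card (?D u)) \<le> V"
      proof (cases "\<bar>\<xi> c - int n * u\<bar> \<le> 4 * int N' * int Y")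
        case True
        then show ?thesis by (intro card_int_divisor_pairs_le[OF V]) (auto simp: V0)
      next
        case False
        have "?D u = {}"
        proof (rule ccontr)
          assume "?D u \<noteq> {}"
          then obtain n' v where "(n', v) \<in> ?D u" by fast
          then have nv: "n' < 2 * N'" "\<bar>v\<bar> \<le> int Y" "int n' * v = \<xi> c - int n * u" by auto
          have "\<bar>int n' * v\<bar> \<le> (2 * int N') * int Y"
            unfolding abs_mult using nv by (intro mult_mono) auto
          also have "\<dots> \<le> 4 * int N' * int Y" by simp
          finally show False using nv(3) False by simp
        qed
        then show ?thesis using V0 by (simp only: card.empty of_nat_0)
      qed
    qed
    also have "\<dots> = (2 * real Y + 1) * V" by simp
    finally show ?thesis .
  qed
  \<comment> \<open>Multiples of \<open>g\<close> have density about \<open>1 / g\<close> in the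
    block, which pays for the weight. When \<open>2 * Y * g\<close> exceeds \<open>N'\<close>, one
    of the \<open>k - 1 \<ge> 1\<close> factors \<open>g / N'\<close> is kept for this purpose and
    the others are at most 2; \<open>Y ^ (k - 1)\<close> is absorbed by
    \<open>Q * N'\<close>.\<close>
  have wg: "w g / real g \<le> 8 ^ k * Q" if "g \<in> G" for g
  proof -
    have g: "1 \<le> g" "g \<le> 2 * N" using that by (auto simp: G_def)
    show ?thesis
    proof (cases "2 * real Y * real g \<le> real N'")
      case True
      then have "w g \<le> 2 ^ (k - 1)"
        unfolding w_def using N'0 by (intro power_mono) (auto simp: field_simps)
      also have "\<dots> \<le> (8::real) ^ (k - 1)" by (intro power_mono) auto
      also have "\<dots> \<le> 8 ^ k * 1" by (simp add: power_increasing)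
      also have "\<dots> \<le> 8 ^ k * Q" using Q by (intro mult_left_mono) auto
      finally have "w g / real g \<le> 8 ^ k * Q / real g" by (intro divide_right_mono) auto
      also have "\<dots> \<le> 8 ^ k * Q / 1" using g Q by (intro divide_left_mono) auto
      finally show ?thesis by simp
    next
      case False
      have gN: "real g / real N' \<le> 2" using g N N'0 by (simp add: field_simps)
      have "w g \<le> (4 * real Y * (real g / real N')) ^ (k - 1)"
        unfolding w_def using False N'0 by (intro power_mono) (auto simp: field_simps)
      also have "\<dots> = 4 ^ (k - 1) * real Y ^ (k - 1) * (real g / real N') ^ (k - 1)"
        by (simp add: power_mult_distrib power_divide)
      also have "(real g / real N') ^ (k - 1) = (real g / real N') ^ (k - 2) * (real g / real N')"
      proof -
        have "k - 1 = Suc (k - 2)" using k by simp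
        then show ?thesis by (simp only: power_Suc2)
      qed
      also have "4 ^ (k - 1) * real Y ^ (k - 1) * ((real g / real N') ^ (k - 2) * (real g / real N'))
          \<le> 4 ^ (k - 1) * (Q * real N') * (2 ^ (k - 2) * (real g / real N'))"
        using Q gN by (intro mult_mono power_mono) auto
      also have "\<dots> = 4 ^ (k - 1) * 2 ^ (k - 2) * Q * real g" using N'0 by simp
      also have "\<dots> \<le> 8 ^ k * Q * real g"
      proof (intro mult_right_mono)
        have "(4::real) ^ (k - 1) * 2 ^ (k - 2) \<le> 4 ^ k * 2 ^ k"
          by (intro mult_mono power_increasing) auto
        then show "(4::real) ^ (k - 1) * 2 ^ (k - 2) \<le> 8 ^ k" by (simp flip: power_mult_distrib)
      qed (use Q in auto)
      finally show ?thesis using g by (simp add: field_simps)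
    qed
  qed
  have "(\<Sum>n\<in>{N..<2*N}. \<Sum>n'\<in>{N'..<2*N'}. real (card (vecsol k Y n n' \<xi>)))
     \<le> (\<Sum>n\<in>{N..<2*N}. \<Sum>n'\<in>{N'..<2*N'}. \<Sum>c<k. \<Sum>g\<in>G. if g dvd n then w g * real (card (L n n' c)) else 0)"
    by (intro sum_mono one)
  also have "\<dots> = (\<Sum>n\<in>{N..<2*N}. \<Sum>c<k. \<Sum>n'\<in>{N'..<2*N'}. \<Sum>g\<in>G. if g dvd n then w g * real (card (L n n' c)) else 0)"
    by (intro sum.cong refl sum.swap)
  also have "\<dots> = (\<Sum>n\<in>{N..<2*N}. \<Sum>c<k. \<Sum>g\<in>G. \<Sum>n'\<in>{N'..<2*N'}. if g dvd n then w g * real (card (L n n' c)) else 0)"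
    by (intro sum.cong refl sum.swap)
  also have "\<dots> = (\<Sum>n\<in>{N..<2*N}. \<Sum>c<k. \<Sum>g\<in>G. if g dvd n then w g * (\<Sum>n'\<in>{N'..<2*N'}. real (card (L n n' c))) else 0)"
    by (intro sum.cong refl) (auto simp: sum_distrib_left)
  also have "\<dots> \<le> (\<Sum>n\<in>{N..<2*N}. \<Sum>c<k. \<Sum>g\<in>G. if g dvd n then w g * ((2 * real Y + 1) * V) else 0)"
  proof (intro sum_mono)
    fix n c g assume "n \<in> {N..<2*N}" "c \<in> {..<k}"
    then have "w g * (\<Sum>n'\<in>{N'..<2*N'}. real (card (L n n' c))) \<le> w g * ((2 * real Y + 1) * V)"
      by (intro mult_left_mono pairs w0) auto
    then show "(if g dvd n then w g * (\<Sum>n'\<in>{N'..<2*N'}. real (card (L n n' c))) else 0)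
        \<le> (if g dvd n then w g * ((2 * real Y + 1) * V) else 0)" by simp
  qed
  also have "\<dots> = real k * (\<Sum>n\<in>{N..<2*N}. \<Sum>g\<in>G. if g dvd n then w g * ((2 * real Y + 1) * V) else 0)"
    by (simp add: sum_distrib_left)
  also have "\<dots> = real k * (\<Sum>g\<in>G. \<Sum>n\<in>{N..<2*N}. if g dvd n then w g * ((2 * real Y + 1) * V) else 0)"
    by (subst sum.swap) simp
  also have "\<dots> = real k * (\<Sum>g\<in>G. real (card {n \<in> {N..<2*N}. g dvd n}) * (w g * ((2 * real Y + 1) * V)))"
    by (simp add: sum.If_cases Int_def)
  also have "\<dots> \<le> real k * (\<Sum>g\<in>G. (2 * real N * (2 * real Y + 1) * V) * (8 ^ k * Q))"
  proof (intro mult_left_mono sum_mono)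
    fix g assume g: "g \<in> G"
    have "real (card {n \<in> {N..<2*N}. g dvd n}) * (w g * ((2 * real Y + 1) * V))
        \<le> (2 * real N / real g) * (w g * ((2 * real Y + 1) * V))"
      using g w0 V0 by (intro mult_right_mono card_multiples_block_le) (auto simp: G_def)
    also have "\<dots> = (2 * real N * (2 * real Y + 1) * V) * (w g / real g)" by simp
    also have "\<dots> \<le> (2 * real N * (2 * real Y + 1) * V) * (8 ^ k * Q)"
      using V0 by (intro mult_left_mono wg g) auto
    finally show "real (card {n \<in> {N..<2*N}. g dvd n}) * (w g * ((2 * real Y + 1) * V)) \<le> \<dots>" .
  qed auto
  also have "\<dots> = real k * (real (card G) * ((2 * real N * (2 * real Y + 1) * V) * (8 ^ k * Q)))" by simp
  also have "\<dots> \<le> real k * (V * ((2 * real N * (3 * real Y) * V) * (8 ^ k * Q)))"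
  proof (intro mult_left_mono mult_mono)
    have "card G \<le> card {d. d dvd nat \<bar>\<xi> i0\<bar>}"
      unfolding G_def using \<xi>(3) by (intro card_mono finite_divisors_nat) auto
    then show "real (card G) \<le> V" using V[OF \<xi>(3) \<xi>(1)[OF \<xi>(2)]] by linarith
    show "2 * real Y + 1 \<le> 3 * real Y" using Y by simp
  qed (use V0 Q in auto)
  also have "\<dots> = 6 * real k * 8 ^ k * Q * real N * real Y * V\<^sup>2"
    by (simp add: power2_eq_square)
  finally show ?thesis .
qed

section \<open>Fourier coefficients and first moments\<close>

lemma prod_sum_PiE_dflt:
  fixes f :: "'a \<Rightarrow> 'b \<Rightarrow> 'c :: comm_semiring_1"
  assumes "finite I" "\<And>i. i \<in> I \<Longrightarrow> finite (A i)"
  shows "(\<Prod>i\<in>I. \<Sum>y\<in>A i. f i y) = (\<Sum>g\<in>PiE_dflt I d A. \<Prod>i\<in>I. f i (g i))"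
proof -
  have inj: "inj_on (\<lambda>h. restrict h I) (PiE_dflt I d A)"
  proof (rule inj_onI)
    fix g h assume gh: "g \<in> PiE_dflt I d A" "h \<in> PiE_dflt I d A" "restrict g I = restrict h I"
    show "g = h"
    proof
      fix x
      show "g x = h x"
      proof (cases "x \<in> I")
        case True
        have "restrict g I x = restrict h I x" using gh(3) by simp
        then show ?thesis using True by simp
      qed (use gh in \<open>simp add: PiE_dflt_def\<close>)
    qed
  qed
  have "(\<Prod>i\<in>I. \<Sum>y\<in>A i. f i y) = (\<Sum>g\<in>PiE I A. \<Prod>i\<in>I. f i (g i))"
    using assms by (intro prod_sum_PiE) auto
  also have "\<dots> = (\<Sum>g\<in>(\<lambda>h. restrict h I) ` PiE_dflt I d A. \<Prod>i\<in>I. f i (g i))"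
    by (simp add: restrict_PiE_dflt)
  also have "\<dots> = (\<Sum>g\<in>PiE_dflt I d A. \<Prod>i\<in>I. f i (g i))"
    by (subst sum.reindex[OF inj]) simp
  finally show ?thesis .
qed

lemma sum_fibres:
  fixes f :: "'b \<Rightarrow> real"
  assumes "finite T" "finite X" "g ` T \<subseteq> X"
  shows "(\<Sum>t\<in>T. f (g t)) = (\<Sum>x\<in>X. real (card {t \<in> T. g t = x}) * f x)"
proof -
  have "(\<Sum>t\<in>T. f (g t)) = (\<Sum>x\<in>X. \<Sum>t\<in>{t \<in> T. g t = x}. f (g t))"
    using assms by (intro sum.group[symmetric]) auto
  also have "\<dots> = (\<Sum>x\<in>X. real (card {t \<in> T. g t = x}) * f x)"
    by (intro sum.cong refl) simp
  finally show ?thesis .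
qed

definition character :: "nat \<Rightarrow> (nat \<Rightarrow> int) \<Rightarrow> (nat \<Rightarrow> real) \<Rightarrow> complex" where
  "character k \<xi> x = ee (- (\<Sum>i<k. of_int (\<xi> i) * x i))"

lemma norm_character [simp]: "cmod (character k \<xi> x) = 1"
  by (simp add: character_def)

lemma character_mult:
  "character k \<xi> x * character k \<zeta> x = character k (\<lambda>i. \<xi> i + \<zeta> i) x"
  by (simp add: character_def ee_add[symmetric] sum.distrib distrib_right)

lemma fourier_coeff_eq: "fourier_coeff k \<nu> \<xi> = (\<integral>x. character k \<xi> x \<partial>\<nu>)"
  by (simp add: fourier_coeff_def character_def ee_def)

lemma prod_trig_polynomial_expand:
  fixes c :: "nat \<Rightarrow> int \<Rightarrow> real" and p :: "nat \<Rightarrow> real \<Rightarrow> real"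
  assumes fin: "\<And>i. i < k \<Longrightarrow> finite (A i)"
    and p: "\<And>i y. i < k \<Longrightarrow> complex_of_real (p i y) = (\<Sum>m\<in>A i. c i m *\<^sub>R ee (- of_int m * y))"
  shows "complex_of_real (\<Prod>i<k. p i (real n * x i))
    = (\<Sum>m\<in>ivec k A. (\<Prod>i<k. c i (m i)) *\<^sub>R character k (\<lambda>i. int n * m i) x)"
proof -
  have "complex_of_real (\<Prod>i<k. p i (real n * x i))
      = (\<Prod>i<k. \<Sum>m\<in>A i. c i m *\<^sub>R ee (- (of_int (int n * m) * x i)))"
    unfolding of_real_prod by (intro prod.cong refl) (auto simp: p mult_ac)
  also have "\<dots> = (\<Sum>m\<in>ivec k A. \<Prod>i<k. c i (m i) *\<^sub>R ee (- (of_int (int n * m i) * x i)))"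
    using fin by (intro prod_sum_PiE_dflt) auto
  also have "\<dots> = (\<Sum>m\<in>ivec k A. (\<Prod>i<k. c i (m i)) *\<^sub>R character k (\<lambda>i. int n * m i) x)"
    unfolding character_def sum_negf[symmetric] ee_sum
    by (intro sum.cong refl) (simp add: scaleR_conv_of_real prod.distrib)
  finally show ?thesis .
qed

lemma ee_measurable [measurable]: "ee \<in> borel_measurable borel"
  unfolding ee_def by (intro borel_measurable_continuous_onI continuous_intros)

lemma nint_dist_measurable [measurable]: "nint_dist \<in> borel_measurable borel"
  unfolding nint_dist_def frac_def by measurable

text \<open>Contains every \<open>n * m\<close> with \<open>N \<le> n < 2 * N\<close> and
  \<open>\<bar>m i\<bar> \<le> 2 ^ l i\<close>, the frequencies met by a block of dilates of one
  box.\<close>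

abbreviation dilated_box :: "nat \<Rightarrow> nat \<Rightarrow> (nat \<Rightarrow> nat) \<Rightarrow> (nat \<Rightarrow> int) set" where
  "dilated_box k N l \<equiv> ivec k (\<lambda>i. {- (2 * int N * 2 ^ l i) .. 2 * int N * 2 ^ l i})"

locale cube_measure = prob_space \<mu> for k :: nat and \<mu> :: "(nat \<Rightarrow> real) measure" +
  assumes sets_eq: "sets \<mu> = sets (borel_k k)"
begin

abbreviation amp :: "(nat \<Rightarrow> int) \<Rightarrow> real" where
  "amp \<xi> \<equiv> cmod (fourier_coeff k \<mu> \<xi>)"

lemma component_measurable [measurable]: "i < k \<Longrightarrow> (\<lambda>x. x i) \<in> borel_measurable \<mu>"
  using sets_eq unfolding borel_k_def
  by (subst measurable_cong_sets[OF sets_eq refl]) (simp add: borel_k_def measurable_component_singleton)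

lemma character_measurable [measurable]: "character k \<xi> \<in> borel_measurable \<mu>"
  unfolding character_def by measurable

lemma character_integrable: "integrable \<mu> (character k \<xi>)"
  by (rule integrable_const_bound[where B = 1]) auto

lemma norm_fourier_coeff_le: "amp \<xi> \<le> 1"
proof -
  have "amp \<xi> \<le> (\<integral>x. cmod (character k \<xi> x) \<partial>\<mu>)"
    unfolding fourier_coeff_eq by (rule integral_norm_bound)
  then show ?thesis by (simp add: prob_space)
qed

lemma fourier_coeff_0: "fourier_coeff k \<mu> (\<lambda>_. 0) = 1"
proof -
  have "character k (\<lambda>_. 0) = (\<lambda>_. 1)" by (simp add: fun_eq_iff character_def)
  then show ?thesis by (simp add: fourier_coeff_eq prob_space)
qed

text \<open>The integral of a character is a Fourier coefficient, estimated in modulus term by term.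
  No cancellation between coefficients is exploited, hence an l1 condition on them.\<close>

lemma integral_character_sum_le:
  assumes "finite T" and w: "\<And>t. t \<in> T \<Longrightarrow> 0 \<le> w t"
    and S: "\<And>x. complex_of_real (S x) = (\<Sum>t\<in>T. w t *\<^sub>R character k (\<xi> t) x)"
  shows "integrable \<mu> S"
    "(\<integral>x. S x \<partial>\<mu>) \<le> (\<Sum>t\<in>T. w t * amp (\<xi> t))"
proof -
  have S': "S = (\<lambda>x. Re (\<Sum>t\<in>T. w t *\<^sub>R character k (\<xi> t) x))"
    by (simp flip: S)
  have int: "integrable \<mu> (\<lambda>x. \<Sum>t\<in>T. w t *\<^sub>R character k (\<xi> t) x)"
    by (intro Bochner_Integration.integrable_sum integrable_scaleR_right character_integrable)
  show "integrable \<mu> S" unfolding S' by (rule integrable_Re[OF int])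
  have "(\<integral>x. S x \<partial>\<mu>) = Re (\<integral>x. (\<Sum>t\<in>T. w t *\<^sub>R character k (\<xi> t) x) \<partial>\<mu>)"
    unfolding S' using int by (rule integral_Re)
  also have "\<dots> \<le> cmod (\<integral>x. (\<Sum>t\<in>T. w t *\<^sub>R character k (\<xi> t) x) \<partial>\<mu>)" by (rule complex_Re_le_cmod)
  also have "(\<integral>x. (\<Sum>t\<in>T. w t *\<^sub>R character k (\<xi> t) x) \<partial>\<mu>)
      = (\<Sum>t\<in>T. w t *\<^sub>R fourier_coeff k \<mu> (\<xi> t))"
    unfolding fourier_coeff_eq
    by (subst Bochner_Integration.integral_sum) (auto intro!: integrable_scaleR_right character_integrable)
  also have "cmod \<dots> \<le> (\<Sum>t\<in>T. w t * amp (\<xi> t))"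
    using w by (intro sum_norm_le) auto
  finally show "(\<integral>x. S x \<partial>\<mu>) \<le> (\<Sum>t\<in>T. w t * amp (\<xi> t))" .
qed

lemma integral_character_sum_square_le:
  assumes "finite T" and w: "\<And>t. t \<in> T \<Longrightarrow> 0 \<le> w t"
    and S: "\<And>x. complex_of_real (S x) = (\<Sum>t\<in>T. w t *\<^sub>R character k (\<xi> t) x)"
  shows "integrable \<mu> (\<lambda>x. (S x)\<^sup>2)"
    "(\<integral>x. (S x)\<^sup>2 \<partial>\<mu>) \<le> (\<Sum>t\<in>T. \<Sum>t'\<in>T. w t * w t' * amp (\<lambda>i. \<xi> t i + \<xi> t' i))"
proof -
  have eq: "complex_of_real ((S x)\<^sup>2)
      = (\<Sum>z\<in>T \<times> T. (w (fst z) * w (snd z)) *\<^sub>R character k (\<lambda>i. \<xi> (fst z) i + \<xi> (snd z) i) x)" for x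
  proof -
    have "complex_of_real ((S x)\<^sup>2)
      = (\<Sum>t\<in>T. \<Sum>t'\<in>T. (w t * w t') *\<^sub>R character k (\<lambda>i. \<xi> t i + \<xi> t' i) x)"
      unfolding power2_eq_square of_real_mult S sum_product
      by (intro sum.cong refl) (simp add: character_mult[symmetric])
    then show ?thesis by (simp add: sum.cartesian_product split_def)
  qed
  have nonneg: "\<And>z. z \<in> T \<times> T \<Longrightarrow> 0 \<le> w (fst z) * w (snd z)" using w by auto
  have fin: "finite (T \<times> T)" using assms(1) by simp
  show "integrable \<mu> (\<lambda>x. (S x)\<^sup>2)"
    by (rule integral_character_sum_le(1)[OF fin nonneg eq])
  have "(\<integral>x. (S x)\<^sup>2 \<partial>\<mu>) \<le> (\<Sum>z\<in>T \<times> T. (w (fst z) * w (snd z)) *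
      amp (\<lambda>i. \<xi> (fst z) i + \<xi> (snd z) i))"
    by (rule integral_character_sum_le(2)[OF fin nonneg eq])
  then show "(\<integral>x. (S x)\<^sup>2 \<partial>\<mu>) \<le> (\<Sum>t\<in>T. \<Sum>t'\<in>T. w t * w t' * amp (\<lambda>i. \<xi> t i + \<xi> t' i))"
    by (simp add: sum.cartesian_product split_def)
qed

text \<open>In each coordinate the factor 4 makes the majorant at least 1 on the box, and 8 comes
  from the bound on its coefficients; hence \<open>32 ^ k\<close>.\<close>

lemma measure_box_le:
  fixes l :: "nat \<Rightarrow> nat"
  shows "measure \<mu> {x \<in> space \<mu>. \<forall>i<k. nint_dist (real n * x i) \<le> 1 / 2 ^ l i}
    \<le> 32 ^ k / 2 ^ (\<Sum>i<k. l i) *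
       (\<Sum>m\<in>ivec k (\<lambda>i. {- (2 ^ l i) .. 2 ^ l i}). amp (\<lambda>i. int n * m i))"
proof -
  obtain h p where hp': "\<And>l. quarter_majorant l (h l) (p l)" using fejer_majorant by metis
  have hp: "\<And>l m. 0 \<le> h l m" "\<And>l m. h l m \<le> 8 / 2 ^ l"
      "\<And>l y. complex_of_real (p l y) = (\<Sum>m\<in>{- (2 ^ l) .. 2 ^ l}. h l m *\<^sub>R ee (- of_int m * y))"
      "\<And>l y. 0 \<le> p l y" "\<And>l y. nint_dist y \<le> 1 / 2 ^ l \<Longrightarrow> 1 / 4 \<le> p l y"
    using hp' unfolding quarter_majorant_def by auto
  let ?A = "\<lambda>i. {- (2 ^ l i) .. 2 ^ l i} :: int set"
  let ?E = "{x \<in> space \<mu>. \<forall>i<k. nint_dist (real n * x i) \<le> 1 / 2 ^ l i}"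
  let ?S = "\<lambda>x. \<Prod>i<k. p (l i) (real n * x i)"
  have fin: "finite (ivec k ?A)" by (intro finite_PiE_dflt) auto
  have w: "0 \<le> (\<Prod>i<k. h (l i) (m i))" for m by (intro prod_nonneg) (auto simp: hp)
  have expand: "complex_of_real (?S x)
      = (\<Sum>m\<in>ivec k ?A. (\<Prod>i<k. h (l i) (m i)) *\<^sub>R character k (\<lambda>i. int n * m i) x)" for x
    by (rule prod_trig_polynomial_expand) (auto simp: hp)
  note int = integral_character_sum_le[OF fin w expand]
  have meas: "?E \<in> sets \<mu>" by measurable
  have "measure \<mu> ?E = (\<integral>x. indicator ?E x \<partial>\<mu>)" using meas by simp
  also have "\<dots> \<le> (\<integral>x. 4 ^ k * ?S x \<partial>\<mu>)"
  proof (rule integral_mono)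
    show "integrable \<mu> (indicator ?E :: _ \<Rightarrow> real)" using meas by (simp add: emeasure_eq_measure)
    show "integrable \<mu> (\<lambda>x. 4 ^ k * ?S x)" using int(1) by simp
    show "indicator ?E x \<le> 4 ^ k * ?S x" for x
    proof (cases "x \<in> ?E")
      case True
      then have "(\<Prod>i<k. (1/4 :: real)) \<le> ?S x" by (intro prod_mono conjI hp(5)) auto
      then show ?thesis using True by (simp add: power_divide field_simps)
    next
      case False
      have "0 \<le> ?S x" by (intro prod_nonneg) (auto simp: hp)
      then show ?thesis using False by simp
    qed
  qed
  also have "\<dots> = 4 ^ k * (\<integral>x. ?S x \<partial>\<mu>)" by simp
  also have "\<dots> \<le> 4 ^ k * (\<Sum>m\<in>ivec k ?A. (\<Prod>i<k. h (l i) (m i)) * amp (\<lambda>i. int n * m i))"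
    using int(2) by (intro mult_left_mono) auto
  also have "\<dots> \<le> 4 ^ k * (\<Sum>m\<in>ivec k ?A. (\<Prod>i<k. 8 / 2 ^ l i) * amp (\<lambda>i. int n * m i))"
    by (intro mult_left_mono sum_mono mult_right_mono prod_mono) (auto simp: hp)
  also have "\<dots> = 32 ^ k / 2 ^ (\<Sum>i<k. l i) *
       (\<Sum>m\<in>ivec k ?A. amp (\<lambda>i. int n * m i))"
  proof -
    have "(\<Prod>i<k. 8 / (2::real) ^ l i) = 8 ^ k / 2 ^ (\<Sum>i<k. l i)"
      by (simp add: prod_dividef power_sum)
    moreover have "(32::real) ^ k = 4 ^ k * 8 ^ k" by (simp flip: power_mult_distrib)
    ultimately show ?thesis by (simp only: sum_distrib_left[symmetric]) simp
  qed
  finally show ?thesis .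
qed

text \<open>The zero vector contributes 1 for each \<open>n\<close>. For
  \<open>\<xi> \<noteq> 0\<close>, a pair with \<open>n * m = \<xi>\<close> is determined by
  \<open>n\<close>, a divisor of any fixed nonzero coordinate of \<open>\<xi>\<close>, so at most
  \<open>V\<close> pairs share one frequency.\<close>

lemma sum_measure_box_le:
  fixes l :: "nat \<Rightarrow> nat" and N :: nat and V :: real
  assumes N: "N > 0" and V0: "0 \<le> V"
    and V: "\<And>i h::int. i < k \<Longrightarrow> h \<noteq> 0 \<Longrightarrow> \<bar>h\<bar> \<le> 2 * int N * 2 ^ l i \<Longrightarrow> real (card {d. d dvd nat \<bar>h\<bar>}) \<le> V"
  shows "(\<Sum>n\<in>{N..<2*N}. measure \<mu> {x \<in> space \<mu>. \<forall>i<k. nint_dist (real n * x i) \<le> 1 / 2 ^ l i})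
    \<le> 32 ^ k / 2 ^ (\<Sum>i<k. l i) *
       (real N + V * (\<Sum>\<xi>\<in>dilated_box k N l. amp \<xi>))"
proof -
  let ?A = "\<lambda>i. {- (2 ^ l i) .. 2 ^ l i} :: int set"
  let ?B = "dilated_box k N l"
  let ?T = "{N..<2*N} \<times> (ivec k ?A - {\<lambda>_. 0})"
  let ?g = "\<lambda>(n, m). (\<lambda>i. int n * m i)"
  have finA: "finite (ivec k ?A)" and finB: "finite ?B" by (auto intro!: finite_PiE_dflt)
  have zero: "(\<lambda>_. 0) \<in> ivec k ?A" by (simp add: PiE_dflt_def)
  have gT: "?g ` ?T \<subseteq> ?B"
  proof (rule image_subsetI)
    fix t assume t: "t \<in> ?T"
    obtain n m where tnm: "t = (n, m)" by fastforce
    have n: "n \<in> {N..<2*N}" and m: "m \<in> ivec k ?A" using t by (auto simp: tnm)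
    have "int n * m i \<in> {- (2 * int N * 2 ^ l i) .. 2 * int N * 2 ^ l i}" if "i < k" for i
    proof -
      have "\<bar>m i\<bar> \<le> 2 ^ l i" using m that by (auto simp: PiE_dflt_def)
      then have "\<bar>int n * m i\<bar> \<le> (2 * int N) * 2 ^ l i"
        unfolding abs_mult using n by (intro mult_mono) auto
      then show ?thesis by auto
    qed
    then show "?g t \<in> ?B" using m by (auto simp: tnm PiE_dflt_def)
  qed
  have fibre: "real (card {t \<in> ?T. ?g t = \<xi>}) \<le> V" if \<xi>: "\<xi> \<in> ?B" for \<xi>
  proof (cases "{t \<in> ?T. ?g t = \<xi>} = {}")
    case True
    then show ?thesis using V0 by (simp only: card.empty of_nat_0)
  next
    case False
    then obtain n m where nm: "n \<in> {N..<2*N}" "m \<in> ivec k ?A" "m \<noteq> (\<lambda>_. 0)" "\<xi> = (\<lambda>i. int n * m i)" by auto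
    then obtain i where i: "m i \<noteq> 0" by auto
    then have ik: "i < k" using nm(2) by (force simp: PiE_dflt_def)
    have \<xi>i: "\<xi> i \<noteq> 0" using nm i N by simp
    have "inj_on fst {t \<in> ?T. ?g t = \<xi>}"
    proof (rule inj_onI)
      fix s t assume st: "s \<in> {t \<in> ?T. ?g t = \<xi>}" "t \<in> {t \<in> ?T. ?g t = \<xi>}" "fst s = fst t"
      obtain a m1 b m2 where ab: "s = (a, m1)" "t = (b, m2)" by fastforce
      have "a > 0" "a = b" using st N by (auto simp: ab)
      moreover have "int a * m1 i = int b * m2 i" for i
      proof -
        have "?g s = ?g t" using st by auto
        then show ?thesis by (simp add: ab fun_eq_iff)
      qed
      ultimately show "s = t" by (simp add: ab fun_eq_iff)
    qed
    moreover have "fst ` {t \<in> ?T. ?g t = \<xi>} \<subseteq> {d. d dvd nat \<bar>\<xi> i\<bar>}"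
    proof (rule image_subsetI)
      fix t assume t: "t \<in> {t \<in> ?T. ?g t = \<xi>}"
      obtain a m1 where am: "t = (a, m1)" by fastforce
      have "\<xi> = (\<lambda>i. int a * m1 i)" using t by (auto simp: am)
      then have "nat \<bar>\<xi> i\<bar> = a * nat \<bar>m1 i\<bar>" by (simp add: abs_mult nat_mult_distrib)
      then show "fst t \<in> {d. d dvd nat \<bar>\<xi> i\<bar>}" by (simp add: am)
    qed
    moreover have "finite {d. d dvd nat \<bar>\<xi> i\<bar>}" using \<xi>i by (intro finite_divisors_nat) auto
    ultimately have le: "card {t \<in> ?T. ?g t = \<xi>} \<le> card {d. d dvd nat \<bar>\<xi> i\<bar>}" by (rule card_inj_on_le)
    have "\<xi> i \<in> {- (2 * int N * 2 ^ l i) .. 2 * int N * 2 ^ l i}"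
      using \<xi> ik unfolding PiE_dflt_def by blast
    then have "\<bar>\<xi> i\<bar> \<le> 2 * int N * 2 ^ l i" by (simp add: abs_le_iff)
    then have "real (card {d. d dvd nat \<bar>\<xi> i\<bar>}) \<le> V" by (rule V[OF ik \<xi>i])
    then show ?thesis using le by linarith
  qed
  have "(\<Sum>n\<in>{N..<2*N}. \<Sum>m\<in>ivec k ?A. amp (\<lambda>i. int n * m i))
      = (\<Sum>n\<in>{N..<2*N}. amp (\<lambda>_. 0) + (\<Sum>m\<in>ivec k ?A - {\<lambda>_. 0}. amp (\<lambda>i. int n * m i)))"
    by (subst sum.remove[OF finA zero]) simp
  also have "\<dots> = real N + (\<Sum>t\<in>?T. amp (?g t))"
    by (simp add: sum.distrib fourier_coeff_0 sum.cartesian_product split_def)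
  finally have split: "(\<Sum>n\<in>{N..<2*N}. \<Sum>m\<in>ivec k ?A. amp (\<lambda>i. int n * m i)) = real N + (\<Sum>t\<in>?T. amp (?g t))" .
  have "(\<Sum>t\<in>?T. amp (?g t)) = (\<Sum>\<xi>\<in>?B. real (card {t \<in> ?T. ?g t = \<xi>}) * amp \<xi>)"
    using finA finB gT by (intro sum_fibres) auto
  also have "\<dots> \<le> (\<Sum>\<xi>\<in>?B. V * amp \<xi>)"
    by (intro sum_mono mult_right_mono fibre) auto
  finally have main: "(\<Sum>n\<in>{N..<2*N}. \<Sum>m\<in>ivec k ?A. amp (\<lambda>i. int n * m i)) \<le> real N + V * (\<Sum>\<xi>\<in>?B. amp \<xi>)"
    unfolding split by (simp add: sum_distrib_left)
  have "(\<Sum>n\<in>{N..<2*N}. measure \<mu> {x \<in> space \<mu>. \<forall>i<k. nint_dist (real n * x i) \<le> 1 / 2 ^ l i})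
    \<le> (\<Sum>n\<in>{N..<2*N}. 32 ^ k / 2 ^ (\<Sum>i<k. l i) * (\<Sum>m\<in>ivec k ?A. amp (\<lambda>i. int n * m i)))"
    by (intro sum_mono measure_box_le)
  also have "\<dots> \<le> 32 ^ k / 2 ^ (\<Sum>i<k. l i) * (real N + V * (\<Sum>\<xi>\<in>?B. amp \<xi>))"
    unfolding sum_distrib_left[symmetric] using main by (intro mult_left_mono) auto
  finally show ?thesis .
qed

end

section \<open>Correlations of two dilated kernels\<close>

text \<open>The ratio of the minimum of \<open>\<rho>\<close> and \<open>2 ^ s\<close> to their geometric mean. It decays geometrically in
  the distance of \<open>s\<close> from \<open>log 2 \<rho>\<close>, so a box correlates substantially with only boundedly many boxes of
  another scale; without this the variance would lose a power of the logarithm.\<close>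

definition offset_weight :: "real \<Rightarrow> nat \<Rightarrow> real" where
  "offset_weight \<rho> s = sqrt (min (\<rho> / 2 ^ s) (2 ^ s / \<rho>))"

text \<open>The ratio 5/7 is a rational substitute for \<open>1 / sqrt 2\<close>, slightly above it
  since \<open>25 / 49 > 1 / 2\<close>.\<close>

lemma sum_geometric_five_sevenths: "finite A \<Longrightarrow> (\<Sum>t\<in>A. (5 / 7 :: real) ^ t) \<le> 7 / 2"
proof -
  assume "finite A"
  have s: "summable (\<lambda>t. (5 / 7 :: real) ^ t)" by (rule summable_geometric) simp
  have "(\<Sum>t\<in>A. (5 / 7 :: real) ^ t) \<le> (\<Sum>t. (5 / 7) ^ t)"
    using \<open>finite A\<close> by (intro sum_le_suminf[OF s]) auto
  also have "\<dots> = 7 / 2" by (subst suminf_geometric) auto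
  finally show ?thesis .
qed

lemma sqrt_half_power_le: "sqrt ((1 / 2) ^ t) \<le> (5 / 7) ^ t"
proof (rule real_le_lsqrt)
  have "((1::real) / 2) ^ t \<le> (25 / 49) ^ t" by (intro power_mono) auto
  also have "\<dots> = ((5 / 7) ^ t)\<^sup>2" by (simp add: power2_eq_square flip: power_mult_distrib)
  finally show "((1::real) / 2) ^ t \<le> ((5 / 7) ^ t)\<^sup>2" .
qed auto

text \<open>The exponents with \<open>2 ^ s \<le> \<rho>\<close> are compared with the largest of
  them, the others with the smallest; away from these two the weights decay geometrically. The bound
  is uniform in \<open>\<rho>\<close> and in \<open>A\<close>.\<close>

lemma sum_offset_weight_le:
  assumes "\<rho> > 0" "finite A"
  shows "(\<Sum>s\<in>A. offset_weight \<rho> s) \<le> 7"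
proof -
  define A1 where "A1 = {s \<in> A. 2 ^ s \<le> \<rho>}"
  define A2 where "A2 = {s \<in> A. \<not> 2 ^ s \<le> \<rho>}"
  have fin: "finite A1" "finite A2" using assms by (auto simp: A1_def A2_def)
  have 1: "(\<Sum>s\<in>A1. offset_weight \<rho> s) \<le> 7 / 2"
  proof (cases "A1 = {}")
    case False
    define z where "z = Max A1"
    have z: "z \<in> A1" "\<And>s. s \<in> A1 \<Longrightarrow> s \<le> z" using fin False by (auto simp: z_def)
    have "(\<Sum>s\<in>A1. offset_weight \<rho> s) \<le> (\<Sum>s\<in>A1. (5 / 7) ^ (z - s))"
    proof (rule sum_mono)
      fix s assume s: "s \<in> A1"
      have "offset_weight \<rho> s \<le> sqrt (2 ^ s / \<rho>)" unfolding offset_weight_def by simp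
      also have "\<dots> \<le> sqrt (2 ^ s / 2 ^ z)"
        using z(1) assms by (intro real_sqrt_le_mono divide_left_mono) (auto simp: A1_def)
      also have "2 ^ s / 2 ^ z = ((1::real) / 2) ^ (z - s)"
        using z(2)[OF s] by (simp add: power_diff power_divide)
      also have "sqrt \<dots> \<le> (5 / 7) ^ (z - s)" by (rule sqrt_half_power_le)
      finally show "offset_weight \<rho> s \<le> (5 / 7) ^ (z - s)" .
    qed
    also have "\<dots> = (\<Sum>t\<in>(\<lambda>s. z - s) ` A1. (5 / 7) ^ t)"
      by (subst sum.reindex) (auto simp: inj_on_def dest!: z(2))
    also have "\<dots> \<le> 7 / 2" using fin by (intro sum_geometric_five_sevenths) auto
    finally show ?thesis .
  qed simp
  have 2: "(\<Sum>s\<in>A2. offset_weight \<rho> s) \<le> 7 / 2"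
  proof (cases "A2 = {}")
    case False
    define z where "z = Min A2"
    have z: "z \<in> A2" "\<And>s. s \<in> A2 \<Longrightarrow> z \<le> s" using fin False by (auto simp: z_def)
    have "(\<Sum>s\<in>A2. offset_weight \<rho> s) \<le> (\<Sum>s\<in>A2. (5 / 7) ^ (s - z))"
    proof (rule sum_mono)
      fix s assume s: "s \<in> A2"
      have "offset_weight \<rho> s \<le> sqrt (\<rho> / 2 ^ s)" unfolding offset_weight_def by simp
      also have "\<dots> \<le> sqrt (2 ^ z / 2 ^ s)"
        using z(1) assms by (intro real_sqrt_le_mono divide_right_mono) (auto simp: A2_def)
      also have "2 ^ z / 2 ^ s = ((1::real) / 2) ^ (s - z)"
        using z(2)[OF s] by (simp add: power_diff power_divide)
      also have "sqrt \<dots> \<le> (5 / 7) ^ (s - z)" by (rule sqrt_half_power_le)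
      finally show "offset_weight \<rho> s \<le> (5 / 7) ^ (s - z)" .
    qed
    also have "\<dots> = (\<Sum>t\<in>(\<lambda>s. s - z) ` A2. (5 / 7) ^ t)"
      by (subst sum.reindex) (auto simp: inj_on_def dest!: z(2))
    also have "\<dots> \<le> 7 / 2" using fin by (intro sum_geometric_five_sevenths) auto
    finally show ?thesis .
  qed simp
  have "(\<Sum>s\<in>A. offset_weight \<rho> s) = (\<Sum>s\<in>A1. offset_weight \<rho> s) + (\<Sum>s\<in>A2. offset_weight \<rho> s)"
    using assms by (subst sum.union_disjoint[symmetric]) (auto simp: A1_def A2_def intro!: sum.cong)
  then show ?thesis using 1 2 by linarith
qed

lemma offset_weight_nonneg: "0 < \<rho> \<Longrightarrow> 0 \<le> offset_weight \<rho> s"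
  by (simp add: offset_weight_def)

text \<open>Enlarging \<open>LL\<close> to the product of its coordinate projections lets the sum
  factor; all weights are nonnegative.\<close>

lemma sum_prod_offset_weight_le:
  fixes \<rho> :: "nat \<Rightarrow> real" and LL :: "(nat \<Rightarrow> nat) set"
  assumes "finite LL" "\<And>l i. l \<in> LL \<Longrightarrow> k \<le> i \<Longrightarrow> l i = 0" "\<And>i. i < k \<Longrightarrow> 0 < \<rho> i"
  shows "(\<Sum>l\<in>LL. \<Prod>i<k. offset_weight (\<rho> i) (l i)) \<le> 7 ^ k"
proof -
  let ?A = "\<lambda>i. (\<lambda>l. l i) ` LL"
  have "(\<Sum>l\<in>LL. \<Prod>i<k. offset_weight (\<rho> i) (l i)) \<le> (\<Sum>l\<in>PiE_dflt {..<k} 0 ?A. \<Prod>i<k. offset_weight (\<rho> i) (l i))"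
    using assms by (intro sum_mono2 finite_PiE_dflt) (auto simp: PiE_dflt_def intro!: prod_nonneg offset_weight_nonneg)
  also have "\<dots> = (\<Prod>i<k. \<Sum>s\<in>?A i. offset_weight (\<rho> i) s)"
    using assms by (intro prod_sum_PiE_dflt[symmetric]) auto
  also have "\<dots> \<le> (\<Prod>i<k. 7)"
    using assms by (intro prod_mono conjI sum_nonneg sum_offset_weight_le offset_weight_nonneg) auto
  finally show ?thesis by simp
qed

lemma min_eq_sqrt_offset:
  fixes a b :: real
  assumes "a > 0" "b > 0"
  shows "min (1 / (2 ^ s' * b)) (1 / (2 ^ s * a)) = sqrt (1 / (2 ^ s * 2 ^ s' * a * b)) * offset_weight (2 ^ s * a / b) s'"
proof -
  define X where "X = 1 / (2 ^ s' * b)"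
  define Z where "Z = 1 / (2 ^ s * a)"
  have pos: "X > 0" "Z > 0" using assms by (auto simp: X_def Z_def)
  have XZ: "1 / (2 ^ s * 2 ^ s' * a * b) = X * Z" by (simp add: X_def Z_def mult_ac)
  have q1: "2 ^ s * a / b / 2 ^ s' = X / Z" using assms by (simp add: X_def Z_def)
  have q2: "2 ^ s' / (2 ^ s * a / b) = Z / X" using assms by (simp add: X_def Z_def)
  have "sqrt (X * Z) * sqrt (min (X / Z) (Z / X)) = sqrt (X * Z * min (X / Z) (Z / X))"
    by (simp add: real_sqrt_mult)
  also have "X * Z * min (X / Z) (Z / X) = (min X Z)\<^sup>2"
  proof (cases "X \<le> Z")
    case True
    then have "X / Z \<le> 1" "1 \<le> Z / X" using pos by auto
    then have "min (X / Z) (Z / X) = X / Z" by (intro min_absorb1) linarith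
    then show ?thesis using True pos by (simp add: min_def power2_eq_square)
  next
    case False
    then have "Z / X \<le> 1" "1 \<le> X / Z" using pos by auto
    then have "min (X / Z) (Z / X) = Z / X" by (intro min_absorb2) linarith
    then show ?thesis using False pos by (simp add: min_def power2_eq_square)
  qed
  also have "sqrt ((min X Z)\<^sup>2) = min X Z" using pos by simp
  finally show ?thesis unfolding offset_weight_def q1 q2 XZ X_def[symmetric] Z_def[symmetric] by simp
qed

text \<open>The product of the geometric means depends on the exponents only through their sums
  \<open>L\<close> and \<open>L'\<close>, so it is constant over \<open>LL\<close>, and the offset
  weights alone are summed. One fixed box thus correlates with the whole family at a cost
  independent of the number of its members.\<close>

lemma sum_prod_min_le_one:
  fixes LL :: "(nat \<Rightarrow> nat) set" and a b :: real and k :: nat and s :: "nat \<Rightarrow> nat"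
  assumes fin: "finite LL" and supp: "\<And>l i. l \<in> LL \<Longrightarrow> k \<le> i \<Longrightarrow> l i = 0"
    and L: "\<And>l. l \<in> LL \<Longrightarrow> (\<Sum>i<k. l i) = L'" and s: "(\<Sum>i<k. s i) = L" and ab: "a > 0" "b > 0"
  shows "(\<Sum>l\<in>LL. \<Prod>i<k. min (1 / (2 ^ l i * b)) (1 / (2 ^ s i * a)))
    \<le> 7 ^ k * sqrt (1 / (2 ^ L * 2 ^ L' * (a * b) ^ k))"
proof -
  have "(\<Prod>i<k. min (1 / (2 ^ l i * b)) (1 / (2 ^ s i * a)))
      = sqrt (1 / (2 ^ L * 2 ^ L' * (a * b) ^ k)) * (\<Prod>i<k. offset_weight (2 ^ s i * a / b) (l i))"
    if "l \<in> LL" for l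
  proof -
    have "(\<Prod>i<k. sqrt (1 / (2 ^ s i * 2 ^ l i * a * b))) = sqrt (\<Prod>i<k. 1 / (2 ^ s i * 2 ^ l i * a * b))"
    proof (induction k)
      case (Suc k)
      then show ?case by (simp only: prod.lessThan_Suc real_sqrt_mult)
    qed simp
    also have "(\<Prod>i<k. 1 / (2 ^ s i * 2 ^ l i * a * b)) = 1 / (2 ^ L * 2 ^ L' * (a * b) ^ k)"
      unfolding s[symmetric] L[OF that, symmetric]
      by (simp add: prod_dividef prod.distrib power_sum power_mult_distrib)
    finally show ?thesis using ab by (simp add: min_eq_sqrt_offset prod.distrib)
  qed
  then have "(\<Sum>l\<in>LL. \<Prod>i<k. min (1 / (2 ^ l i * b)) (1 / (2 ^ s i * a)))
      = sqrt (1 / (2 ^ L * 2 ^ L' * (a * b) ^ k)) * (\<Sum>l\<in>LL. \<Prod>i<k. offset_weight (2 ^ s i * a / b) (l i))"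
    by (simp add: sum_distrib_left)
  also have "\<dots> \<le> sqrt (1 / (2 ^ L * 2 ^ L' * (a * b) ^ k)) * 7 ^ k"
    using ab by (intro mult_left_mono sum_prod_offset_weight_le fin supp) auto
  finally show ?thesis by (simp add: mult.commute)
qed

lemma min_le_sqrt_mult: "0 \<le> x \<Longrightarrow> 0 \<le> y \<Longrightarrow> min x y \<le> sqrt (x * y)" for x y :: real
  by (rule real_le_rsqrt) (auto simp: power2_eq_square min_def intro: mult_mono)

lemma sqrt_mult_le_add: "0 \<le> x \<Longrightarrow> 0 \<le> y \<Longrightarrow> sqrt (x * y) \<le> x + y" for x y :: real
  by (rule order_trans[OF arith_geo_mean_sqrt]) auto

text \<open>Fixing either of the two boxes gives a bound with \<open>card LL\<close> or with
  \<open>card LL'\<close>; the minimum is at most their geometric mean. Since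
  \<open>k \<ge> 2\<close>, the power \<open>(a * b) ^ k\<close> under the root provides a
  denominator of at least \<open>a * b\<close>.\<close>

lemma sum_prod_min_le_two:
  fixes LL LL' :: "(nat \<Rightarrow> nat) set" and a b :: real and k :: nat
  assumes fin: "finite LL" "finite LL'"
    and supp: "\<And>l i. l \<in> LL \<Longrightarrow> k \<le> i \<Longrightarrow> l i = 0" "\<And>l i. l \<in> LL' \<Longrightarrow> k \<le> i \<Longrightarrow> l i = 0"
    and L: "\<And>l. l \<in> LL \<Longrightarrow> (\<Sum>i<k. l i) = L" "\<And>l. l \<in> LL' \<Longrightarrow> (\<Sum>i<k. l i) = L'"
    and ab: "a \<ge> 1" "b \<ge> 1" and k: "k \<ge> 2"
  shows "(\<Sum>l\<in>LL. \<Sum>l'\<in>LL'. \<Prod>i<k. min (1 / (2 ^ l' i * b)) (1 / (2 ^ l i * a)))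
    \<le> 7 ^ k * (a * (real (card LL) / 2 ^ L) + b * (real (card LL') / 2 ^ L')) / ((a * b) * sqrt (a * b))"
proof -
  let ?q = "sqrt (1 / (2 ^ L * 2 ^ L' * (a * b) ^ k))"
  let ?f = "\<lambda>l l'. \<Prod>i<k. min (1 / (2 ^ l' i * b)) (1 / (2 ^ l i * a))"
  have ab0: "a > 0" "b > 0" "a * b \<ge> 1" using ab mult_mono[of 1 a 1 b] by auto
  have 1: "(\<Sum>l\<in>LL. \<Sum>l'\<in>LL'. ?f l l') \<le> real (card LL) * (7 ^ k * ?q)"
  proof -
    have "(\<Sum>l\<in>LL. \<Sum>l'\<in>LL'. ?f l l') \<le> (\<Sum>l\<in>LL. 7 ^ k * ?q)"
      using ab0 by (intro sum_mono sum_prod_min_le_one fin supp L) auto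
    then show ?thesis by simp
  qed
  have 2: "(\<Sum>l\<in>LL. \<Sum>l'\<in>LL'. ?f l l') \<le> real (card LL') * (7 ^ k * ?q)"
  proof -
    have "(\<Sum>l\<in>LL. \<Sum>l'\<in>LL'. ?f l l') = (\<Sum>l'\<in>LL'. \<Sum>l\<in>LL. ?f l l')" by (rule sum.swap)
    also have "\<dots> = (\<Sum>l'\<in>LL'. \<Sum>l\<in>LL. \<Prod>i<k. min (1 / (2 ^ l i * a)) (1 / (2 ^ l' i * b)))"
      by (simp add: min.commute)
    also have "\<dots> \<le> (\<Sum>l'\<in>LL'. 7 ^ k * sqrt (1 / (2 ^ L' * 2 ^ L * (b * a) ^ k)))"
      using ab0 by (intro sum_mono sum_prod_min_le_one fin supp L) auto
    also have "\<dots> = (\<Sum>l'\<in>LL'. 7 ^ k * ?q)" by (simp add: mult_ac)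
    finally show ?thesis by simp
  qed
  let ?x = "real (card LL) / 2 ^ L" and ?y = "real (card LL') / 2 ^ L'"
  have "(\<Sum>l\<in>LL. \<Sum>l'\<in>LL'. ?f l l') \<le> min (real (card LL)) (real (card LL')) * (7 ^ k * ?q)"
    using 1 2 by (auto simp: min_def)
  also have "\<dots> \<le> sqrt (real (card LL) * real (card LL')) * (7 ^ k * ?q)"
    using ab0 by (intro mult_right_mono min_le_sqrt_mult) auto
  also have "\<dots> = 7 ^ k * sqrt (?x * ?y / (a * b) ^ k)"
    by (simp add: real_sqrt_mult real_sqrt_divide)
  also have "\<dots> \<le> 7 ^ k * sqrt (?x * ?y / (a * b) ^ 2)"
    using ab0 k by (intro mult_left_mono real_sqrt_le_mono divide_left_mono power_increasing) auto
  \<comment> \<open>The factors \<open>a\<close> and \<open>b\<close> are distributed before the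
    geometric mean is replaced by a sum: the first density then has the coefficient
    \<open>1 / (sqrt a * (b * sqrt b))\<close>, which converges when summed over
    \<open>b\<close>.\<close>
  also have "?x * ?y / (a * b) ^ 2 = (a * ?x) * (b * ?y) / ((a * b) * sqrt (a * b))\<^sup>2"
    using ab0 by (simp add: power_mult_distrib power2_eq_square)
  also have "sqrt \<dots> = sqrt ((a * ?x) * (b * ?y)) / ((a * b) * sqrt (a * b))"
    using ab0 by (simp only: real_sqrt_divide real_sqrt_abs) simp
  also have "sqrt ((a * ?x) * (b * ?y)) \<le> a * ?x + b * ?y"
    using ab0 by (intro sqrt_mult_le_add) auto
  finally show ?thesis using ab0 by (simp add: divide_right_mono)
qed

text \<open>If \<open>n = g a\<close> and \<open>n' = g b\<close> with coprime \<open>a, b\<close>, the solutions of \<open>n u + n' v = 0\<close> are the pairs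
  \<open>(b t, - a t)\<close>.\<close>

lemma kernel_pair_sum_le:
  fixes c c' :: "int \<Rightarrow> real" and l l' n n' Y Y' :: nat
  assumes c: "\<And>m. 0 \<le> c m" "\<And>m. c m \<le> 1 / 2 ^ l" "\<And>m. m \<noteq> 0 \<Longrightarrow> c m \<le> 2 ^ l / (real_of_int m)\<^sup>2"
    and c': "\<And>m. 0 \<le> c' m" "\<And>m. c' m \<le> 1 / 2 ^ l'" "\<And>m. m \<noteq> 0 \<Longrightarrow> c' m \<le> 2 ^ l' / (real_of_int m)\<^sup>2"
    and n: "n > 0" "n' > 0"
  defines "a \<equiv> n div gcd n n'" and "b \<equiv> n' div gcd n n'"
  defines "S \<equiv> {(u, v) \<in> {- int Y..int Y} \<times> {- int Y'..int Y'}. u \<noteq> 0 \<and> int n * u + int n' * v = 0}"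
  shows "(\<Sum>(u, v)\<in>S. c u * c' v) \<le> 6 * min (1 / (2 ^ l' * real b)) (1 / (2 ^ l * real a))"
    and "b > Y \<Longrightarrow> S = {}"
proof -
  define g where "g = gcd n n'"
  have g0: "g > 0" using n by (simp add: g_def)
  have na: "n = g * a" "n' = g * b" by (simp_all add: a_def b_def g_def)
  have cop: "coprime a b" unfolding a_def b_def using n by (intro div_gcd_coprime) auto
  have ab0: "a > 0" "b > 0" using na n by (auto intro: gr0I)
  have par: "\<exists>t. t \<noteq> 0 \<and> u = int b * t \<and> v = - int a * t" if "(u, v) \<in> S" for u v
  proof -
    have "int g * (int a * u + int b * v) = 0" using that by (simp add: S_def na algebra_simps)
    then have eq: "int a * u = int b * (- v)" using g0 by simp
    then have "int b dvd int a * u" by simp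
    moreover have "coprime (int b) (int a)" using cop by (simp add: coprime_commute)
    ultimately obtain t where t: "u = int b * t" by (auto simp: coprime_dvd_mult_right_iff)
    then have "int b * (int a * t) = int b * (- v)" using eq by (simp add: algebra_simps)
    then have "int a * t = - v" using ab0 by (simp only: mult_cancel_left) auto
    then have "v = - int a * t" by simp
    then show ?thesis using t that by (auto simp: S_def)
  qed
  show "S = {}" if "b > Y"
  proof (rule ccontr)
    assume "S \<noteq> {}"
    then obtain u v where uv: "(u, v) \<in> S" by auto
    then obtain t where t: "t \<noteq> 0" "u = int b * t" using par by blast
    have "int b * 1 \<le> int b * \<bar>t\<bar>" using t by (intro mult_left_mono) auto
    also have "\<dots> = \<bar>u\<bar>" by (simp add: t abs_mult)
    also have "\<dots> \<le> int Y" using uv by (auto simp: S_def)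
    finally show False using that by simp
  qed
  have finS: "finite S"
    by (rule finite_subset[of _ "{- int Y..int Y} \<times> {- int Y'..int Y'}"]) (auto simp: S_def)
  define f where "f = (\<lambda>(u :: int, v :: int). nat \<bar>u div int b\<bar>)"
  have f_eq: "f (int b * t, v) = nat \<bar>t\<bar>" for t v using ab0 by (simp add: f_def)
  have fS: "f ` S \<subseteq> {1..Y}"
  proof (rule image_subsetI)
    fix z assume z: "z \<in> S"
    obtain u v where uv: "z = (u, v)" by fastforce
    obtain t where t: "t \<noteq> 0" "u = int b * t" using par z unfolding uv by blast
    have "1 * \<bar>t\<bar> \<le> int b * \<bar>t\<bar>" using ab0 by (intro mult_right_mono) auto
    also have "\<dots> = \<bar>u\<bar>" by (simp add: t abs_mult)
    also have "\<dots> \<le> int Y" using z by (auto simp: S_def uv)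
    finally show "f z \<in> {1..Y}" using t(1) unfolding uv t(2) f_eq by auto
  qed
  have fibre: "card {z \<in> S. f z = t} \<le> 2" for t
  proof -
    have "{z \<in> S. f z = t} \<subseteq> {(int b * int t, - int a * int t), (int b * - int t, - int a * - int t)}"
    proof
      fix z assume z: "z \<in> {z \<in> S. f z = t}"
      obtain u v where uv: "z = (u, v)" by fastforce
      obtain s where s: "u = int b * s" "v = - int a * s" using par z unfolding uv by blast
      have "nat \<bar>s\<bar> = t" using z by (simp add: uv s(1) f_eq)
      then have "s = int t \<or> s = - int t" by auto
      then show "z \<in> {(int b * int t, - int a * int t), (int b * - int t, - int a * - int t)}"
        by (auto simp: uv s)
    qed
    then have "card {z \<in> S. f z = t} \<le> card {(int b * int t, - int a * int t), (int b * - int t, - int a * - int t)}"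
      by (intro card_mono) auto
    also have "\<dots> \<le> 2" by (simp add: card_insert_if)
    finally show ?thesis .
  qed
  \<comment> \<open>Each value of \<open>\<bar>t\<bar>\<close> comes from at most two elements of
    \<open>S\<close>, and the sum over these values is at most \<open>3 * P\<close>; hence the 6.
    This is used once with the decay of \<open>c\<close> and once with that of \<open>c'\<close>,
    which gives the two arguments of the minimum.\<close>
  have main: "(\<Sum>(u, v)\<in>S. c u * c' v) \<le> 1 / (2 ^ l * 2 ^ l') * (6 * P)"
    if P: "0 \<le> P" "\<And>t. t \<noteq> 0 \<Longrightarrow> c (int b * t) * c' (- int a * t) \<le> 1 / (2 ^ l * 2 ^ l') * min 1 ((P / real_of_int t)\<^sup>2)" for P
  proof -
    let ?h = "\<lambda>t. 1 / (2 ^ l * 2 ^ l') * min 1 ((P / real t)\<^sup>2)"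
    have "(\<Sum>(u, v)\<in>S. c u * c' v) \<le> (\<Sum>z\<in>S. ?h (f z))"
    proof (rule sum_mono)
      fix z assume z: "z \<in> S"
      obtain u v where uv: "z = (u, v)" by fastforce
      obtain t where t: "t \<noteq> 0" "u = int b * t" "v = - int a * t" using par z unfolding uv by blast
      have "(P / real_of_int t)\<^sup>2 = (P / real (nat \<bar>t\<bar>))\<^sup>2" by (simp add: power_divide)
      then show "(case z of (u, v) \<Rightarrow> c u * c' v) \<le> ?h (f z)"
        using P(2)[OF t(1)] unfolding uv t(2) f_eq by (simp add: t)
    qed
    also have "\<dots> = (\<Sum>t=1..Y. real (card {z \<in> S. f z = t}) * ?h t)"
      using finS fS by (intro sum_fibres) auto
    also have "\<dots> \<le> (\<Sum>t=1..Y. 2 * ?h t)"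
    proof (intro sum_mono mult_right_mono)
      show "real (card {z \<in> S. f z = t}) \<le> 2" for t using fibre[of t] by linarith
    qed auto
    also have "\<dots> = 2 * (1 / (2 ^ l * 2 ^ l')) * (\<Sum>t=1..Y. min 1 ((P / real t)\<^sup>2))"
      by (simp add: sum_distrib_left mult_ac)
    also have "\<dots> \<le> 2 * (1 / (2 ^ l * 2 ^ l')) * (3 * P)"
      using P(1) by (intro mult_left_mono sum_min_inverse_square_le) auto
    finally show ?thesis by simp
  qed
  have decay: "e (int d * t) \<le> 1 / 2 ^ s * min 1 ((2 ^ s / real d / real_of_int t)\<^sup>2)"
    if e: "e (int d * t) \<le> 1 / 2 ^ s" "int d * t \<noteq> 0 \<Longrightarrow> e (int d * t) \<le> 2 ^ s / (real_of_int (int d * t))\<^sup>2"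
      and "d > 0" "t \<noteq> 0" for e :: "int \<Rightarrow> real" and d s :: nat and t :: int
  proof -
    have "e (int d * t) \<le> 1 / 2 ^ s * (2 ^ s / real d / real_of_int t)\<^sup>2"
      using e(2) that(3,4) by (simp add: power2_eq_square field_simps)
    then show ?thesis using e(1) by (cases "1 \<le> (2 ^ s / real d / real_of_int t)\<^sup>2") (auto simp: min_def)
  qed
  have dc: "c (int b * t) \<le> 1 / 2 ^ l * min 1 ((2 ^ l / real b / real_of_int t)\<^sup>2)" if "t \<noteq> 0" for t
    by (rule decay[of c b t l, OF c(2) c(3) ab0(2) that])
  have dc': "c' (int a * t) \<le> 1 / 2 ^ l' * min 1 ((2 ^ l' / real a / real_of_int t)\<^sup>2)" if "t \<noteq> 0" for t
    by (rule decay[of c' a t l', OF c'(2) c'(3) ab0(1) that])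
  have 1: "(\<Sum>(u, v)\<in>S. c u * c' v) \<le> 1 / (2 ^ l * 2 ^ l') * (6 * (2 ^ l / real b))"
  proof (rule main)
    fix t :: int assume "t \<noteq> 0"
    then have "c (int b * t) * c' (- int a * t) \<le> (1 / 2 ^ l * min 1 ((2 ^ l / real b / real_of_int t)\<^sup>2)) * (1 / 2 ^ l')"
      using ab0 c(1) c' by (intro mult_mono dc) auto
    then show "c (int b * t) * c' (- int a * t) \<le> 1 / (2 ^ l * 2 ^ l') * min 1 ((2 ^ l / real b / real_of_int t)\<^sup>2)"
      by simp
  qed simp
  have 2: "(\<Sum>(u, v)\<in>S. c u * c' v) \<le> 1 / (2 ^ l * 2 ^ l') * (6 * (2 ^ l' / real a))"
  proof (rule main)
    fix t :: int assume t: "t \<noteq> 0"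
    have "c (int b * t) * c' (int a * - t) \<le> (1 / 2 ^ l) * (1 / 2 ^ l' * min 1 ((2 ^ l' / real a / real_of_int (- t))\<^sup>2))"
      using ab0 c(1,2) c'(1) t by (intro mult_mono dc') auto
    then show "c (int b * t) * c' (- int a * t) \<le> 1 / (2 ^ l * 2 ^ l') * min 1 ((2 ^ l' / real a / real_of_int t)\<^sup>2)"
      by simp
  qed simp
  show "(\<Sum>(u, v)\<in>S. c u * c' v) \<le> 6 * min (1 / (2 ^ l' * real b)) (1 / (2 ^ l * real a))"
    using 1 2 by (simp add: min_def)
qed

text \<open>Expansion over the set \<open>T\<close> of coordinates that contribute \<open>B\<close>:
  the empty set cancels, the full set is the main part, and each of at most \<open>2 ^ k\<close>
  mixed terms is bounded by \<open>M\<close>.\<close>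

lemma prod_add_minus_prod_le:
  fixes A B A' B' :: "nat \<Rightarrow> real"
  assumes A: "\<And>i. i < k \<Longrightarrow> 0 \<le> A i \<and> A i \<le> A' i" and B: "\<And>i. i < k \<Longrightarrow> 0 \<le> B i \<and> B i \<le> B' i"
    and k: "k \<ge> 1"
    and M: "\<And>T. T \<subset> {..<k} \<Longrightarrow> T \<noteq> {} \<Longrightarrow> (\<Prod>i\<in>T. B' i) * (\<Prod>i\<in>{..<k} - T. A' i) \<le> M" and M0: "0 \<le> M"
  shows "(\<Prod>i<k. B i + A i) - (\<Prod>i<k. A i) \<le> (\<Prod>i<k. B' i) + 2 ^ k * M"
proof -
  let ?f = "\<lambda>T. (\<Prod>i\<in>T. B i) * (\<Prod>i\<in>{..<k} - T. A i)"
  let ?R = "Pow {..<k} - {{}, {..<k}}"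
  have ne: "{..<k} \<noteq> {}" using k by (auto simp: lessThan_empty_iff)
  have "(\<Prod>i<k. B i + A i) = (\<Sum>T\<in>Pow {..<k}. ?f T)" by (rule prod_add) simp
  also have "Pow {..<k} = insert {} (insert {..<k} ?R)" by auto
  also have "(\<Sum>T\<in>insert {} (insert {..<k} ?R). ?f T) = (\<Prod>i<k. A i) + ((\<Prod>i<k. B i) + (\<Sum>T\<in>?R. ?f T))"
    using ne by (subst sum.insert, simp, simp, subst sum.insert) auto
  finally have eq: "(\<Prod>i<k. B i + A i) - (\<Prod>i<k. A i) = (\<Prod>i<k. B i) + (\<Sum>T\<in>?R. ?f T)" by simp
  have "(\<Sum>T\<in>?R. ?f T) \<le> (\<Sum>T\<in>?R. M)"
  proof (rule sum_mono)
    fix T assume T: "T \<in> ?R"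
    then have "?f T \<le> (\<Prod>i\<in>T. B' i) * (\<Prod>i\<in>{..<k} - T. A' i)"
      using A B by (intro mult_mono prod_mono prod_nonneg) (auto intro: order_trans)
    also have "\<dots> \<le> M" using T by (intro M) auto
    finally show "?f T \<le> M" .
  qed
  also have "\<dots> \<le> 2 ^ k * M"
  proof -
    have "card ?R \<le> card (Pow {..<k})" by (intro card_mono) auto
    then have "real (card ?R) \<le> 2 ^ k" by (simp add: card_Pow)
    then show ?thesis using M0 by (simp add: mult_right_mono)
  qed
  finally have "(\<Sum>T\<in>?R. ?f T) \<le> 2 ^ k * M" .
  moreover have "(\<Prod>i<k. B i) \<le> (\<Prod>i<k. B' i)" using B by (intro prod_mono) auto
  ultimately show ?thesis using eq by linarith
qed


section \<open>Averages of reduced fractions and of gcds over dyadic blocks\<close>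

lemma sum_inverse_three_halves_le: "(\<Sum>t=1..T. 1 / (real t * sqrt (real t))) \<le> 3"
proof (cases "T \<ge> 1")
  case True
  \<comment> \<open>Telescoping: for \<open>t \<ge> 2\<close> the term is at most
    \<open>2 / sqrt (t - 1) - 2 / sqrt t\<close>.\<close>
  then have "(\<Sum>t=1..T. 1 / (real t * sqrt (real t))) \<le> 3 - 2 / sqrt (real T)"
  proof (induction T rule: dec_induct)
    case (step T)
    define p where "p = sqrt (real T)"
    define q where "q = sqrt (real (Suc T))"
    have pq: "p > 0" "p \<le> q" "q * q = p * p + 1" "q * q = real (Suc T)"
      using step by (auto simp: p_def q_def)
    have q0: "q > 0" using pq by linarith
    have "(q - p) * (q + p) = 1" using pq(3) by (simp add: algebra_simps)
    then have e: "q - p = 1 / (q + p)" using pq q0 by (simp add: field_simps)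
    have "1 / (q * q * q) = 2 / ((2 * q) * (q * q))" using q0 by simp
    also have "\<dots> \<le> 2 / ((q + p) * (p * q))"
      using pq q0 by (intro divide_left_mono mult_mono mult_pos_pos) auto
    also have "\<dots> = 2 * (q - p) / (p * q)" using pq q0 unfolding e by simp
    also have "\<dots> = 2 / p - 2 / q" using pq q0 by (simp add: field_simps)
    finally have "1 / (real (Suc T) * sqrt (real (Suc T))) \<le> 2 / p - 2 / q"
      unfolding pq(4)[symmetric] by (simp add: q0 less_imp_le)
    then show ?case using step.IH by (simp add: p_def q_def)
  qed simp
  also have "\<dots> \<le> 3" by simp
  finally show ?thesis .
qed simp

text \<open>For fixed \<open>n\<close>, the reduced numerator and denominator determine
  \<open>n'\<close>, so the sum over \<open>n'\<close> becomes one over free pairs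
  \<open>(a, b)\<close> with \<open>a\<close> dividing \<open>n\<close>. The sum over
  \<open>b\<close> converges, and the density \<open>1 / a\<close> of the multiples of
  \<open>a\<close> makes the one over \<open>a\<close> converge too. The bound has no logarithm and
  is uniform in \<open>X\<close>.\<close>

lemma sum_over_reduced_pairs_le:
  fixes N X :: nat
  assumes N: "N > 0"
  shows "(\<Sum>n\<in>{N..<2*N}. \<Sum>n'\<in>{1..<X}.
      1 / (sqrt (real (n div gcd n n')) * (real (n' div gcd n n') * sqrt (real (n' div gcd n n'))))) \<le> 18 * real N"
proof -
  define h where "h a b = 1 / (sqrt (real a) * (real b * sqrt (real b)))" for a b :: nat
  have h0: "0 \<le> h a b" for a b by (simp add: h_def)
  have inner: "(\<Sum>n'\<in>{1..<X}. h (n div gcd n n') (n' div gcd n n'))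
      \<le> (\<Sum>a=1..2*N. \<Sum>b=1..X. if a dvd n then h a b else 0)" if n: "n \<in> {N..<2*N}" for n
  proof -
    let ?f = "\<lambda>n'. (n div gcd n n', n' div gcd n n')"
    let ?P = "{(a, b) \<in> {1..2*N} \<times> {1..X}. a dvd n}"
    have n0: "n > 0" using n N by simp
    have inj: "inj_on ?f {1..<X}"
    proof (rule inj_onI)
      fix x y assume xy: "x \<in> {1..<X}" "y \<in> {1..<X}" "?f x = ?f y"
      have "(n div gcd n x) * gcd n x = (n div gcd n x) * gcd n y"
        using xy(3) by (metis Pair_inject dvd_div_mult_self gcd_dvd1)
      moreover have "n div gcd n x \<noteq> 0" using n0 by (metis dvd_div_mult_self gcd_dvd1 mult_zero_left less_irrefl)
      ultimately have "gcd n x = gcd n y" by (rule mult_left_cancel[THEN iffD1, rotated])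
      then show "x = y" using xy(3) by (metis Pair_inject dvd_div_mult_self gcd_dvd2)
    qed
    have sub: "?f ` {1..<X} \<subseteq> ?P"
    proof (rule image_subsetI)
      fix x assume x: "x \<in> {1..<X}"
      have "gcd n x \<le> n" "gcd n x \<le> x" "gcd n x > 0" using n0 x by (auto intro: gcd_le1_nat gcd_le2_nat)
      then have "n div gcd n x \<ge> 1" "x div gcd n x \<ge> 1" by (simp_all add: Suc_le_eq div_greater_zero_iff)
      moreover have "n div gcd n x \<le> 2 * N" using n by (intro le_trans[OF div_le_dividend]) auto
      moreover have "x div gcd n x \<le> X" using x by (intro le_trans[OF div_le_dividend]) auto
      moreover have "n div gcd n x dvd n" by (metis dvd_div_mult_self dvd_triv_left gcd_dvd1)
      ultimately show "?f x \<in> ?P" by auto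
    qed
    have finP: "finite ?P" by (rule finite_subset[of _ "{1..2*N} \<times> {1..X}"]) auto
    have "(\<Sum>n'\<in>{1..<X}. h (n div gcd n n') (n' div gcd n n')) = (\<Sum>(a, b)\<in>?f ` {1..<X}. h a b)"
      by (subst sum.reindex[OF inj]) simp
    also have "\<dots> \<le> (\<Sum>(a, b)\<in>?P. h a b)"
      using finP sub h0 by (intro sum_mono2) auto
    also have "\<dots> = (\<Sum>(a, b)\<in>{1..2*N} \<times> {1..X}. if a dvd n then h a b else 0)"
      by (rule sum.mono_neutral_cong_left) (auto split: if_split_asm)
    also have "\<dots> = (\<Sum>a=1..2*N. \<Sum>b=1..X. if a dvd n then h a b else 0)"
      by (rule sum.cartesian_product[symmetric])
    finally show ?thesis .
  qed
  have hb: "(\<Sum>b=1..X. h a b) \<le> 3 / sqrt (real a)" for a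
  proof -
    have "(\<Sum>b=1..X. h a b) = 1 / sqrt (real a) * (\<Sum>b=1..X. 1 / (real b * sqrt (real b)))"
      by (simp add: h_def sum_distrib_left)
    also have "\<dots> \<le> 1 / sqrt (real a) * 3" by (intro mult_left_mono sum_inverse_three_halves_le) auto
    finally show ?thesis by simp
  qed
  have "(\<Sum>n\<in>{N..<2*N}. \<Sum>n'\<in>{1..<X}. h (n div gcd n n') (n' div gcd n n'))
     \<le> (\<Sum>n\<in>{N..<2*N}. \<Sum>a=1..2*N. \<Sum>b=1..X. if a dvd n then h a b else 0)"
    by (intro sum_mono inner)
  also have "\<dots> = (\<Sum>a=1..2*N. \<Sum>n\<in>{N..<2*N}. \<Sum>b=1..X. if a dvd n then h a b else 0)" by (rule sum.swap)
  also have "\<dots> = (\<Sum>a=1..2*N. \<Sum>n\<in>{N..<2*N}. if a dvd n then (\<Sum>b=1..X. h a b) else 0)"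
    by (intro sum.cong refl) auto
  also have "\<dots> = (\<Sum>a=1..2*N. real (card {n \<in> {N..<2*N}. a dvd n}) * (\<Sum>b=1..X. h a b))"
    by (simp add: sum.If_cases Int_def)
  also have "\<dots> \<le> (\<Sum>a=1..2*N. (2 * real N / real a) * (3 / sqrt (real a)))"
    by (intro sum_mono mult_mono card_multiples_block_le hb sum_nonneg h0) auto
  also have "\<dots> = 6 * real N * (\<Sum>a=1..2*N. 1 / (real a * sqrt (real a)))"
    by (simp add: sum_distrib_left)
  also have "\<dots> \<le> 6 * real N * 3" by (intro mult_left_mono sum_inverse_three_halves_le) auto
  finally show ?thesis by (simp add: h_def)
qed

text \<open>The gcd is replaced by the sum of all common divisors. Each divisor \<open>g\<close> of
  \<open>n'\<close> divides at most \<open>2 * N / g\<close> of the \<open>n\<close>, so it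
  contributes at most \<open>2 * N\<close>.\<close>

lemma sum_gcd_block_le:
  fixes N n' :: nat
  assumes "n' > 0"
  shows "(\<Sum>n\<in>{N..<2*N}. real (gcd n n')) \<le> 2 * real N * real (card {d. d dvd n'})"
proof -
  have fin: "finite {d. d dvd n'}" using assms by simp
  have "(\<Sum>n\<in>{N..<2*N}. real (gcd n n')) \<le> (\<Sum>n\<in>{N..<2*N}. \<Sum>g\<in>{d. d dvd n'}. if g dvd n then real g else 0)"
  proof (rule sum_mono)
    fix n
    have "real (gcd n n') = (if gcd n n' dvd n then real (gcd n n') else 0)" by simp
    also have "\<dots> \<le> (\<Sum>g\<in>{d. d dvd n'}. if g dvd n then real g else 0)"
      by (rule member_le_sum[OF _ _ fin]) auto
    finally show "real (gcd n n') \<le> \<dots>" .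
  qed
  also have "\<dots> = (\<Sum>g\<in>{d. d dvd n'}. \<Sum>n\<in>{N..<2*N}. if g dvd n then real g else 0)" by (rule sum.swap)
  also have "\<dots> = (\<Sum>g\<in>{d. d dvd n'}. real (card {n \<in> {N..<2*N}. g dvd n}) * real g)"
    by (simp add: sum.If_cases Int_def)
  also have "\<dots> \<le> (\<Sum>g\<in>{d. d dvd n'}. 2 * real N)"
  proof (rule sum_mono)
    fix g assume "g \<in> {d. d dvd n'}"
    then have g0: "g > 0" using assms by (auto intro: gr0I)
    show "real (card {n \<in> {N..<2*N}. g dvd n}) * real g \<le> 2 * real N"
      using card_multiples_block_le[OF g0, of N] g0 by (simp add: field_simps)
  qed
  finally show ?thesis by (simp add: mult.commute)
qed

section \<open>The variance of the number of box hits\<close>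

definition dyadic_block :: "nat \<Rightarrow> nat set" where
  "dyadic_block j = {2 ^ j..<2 * 2 ^ j}"

text \<open>The strict boxes fit the divergence part, whose kernels are small where
  \<open>nint_dist\<close> is at least \<open>1 / 2 ^ l i\<close>; the closed ones fit the
  convergence part, whose majorants are at least 1/4 where it is at most that.\<close>

abbreviation box_times :: "nat \<Rightarrow> (nat \<Rightarrow> (nat \<Rightarrow> nat) set) \<Rightarrow> (nat \<Rightarrow> real) \<Rightarrow> nat set" where
  "box_times k LL x \<equiv> {n. \<exists>j. n \<in> dyadic_block j \<and> (\<exists>l\<in>LL j. \<forall>i<k. nint_dist (real n * x i) < 1 / 2 ^ l i)}"

abbreviation closed_box_times :: "nat \<Rightarrow> (nat \<Rightarrow> (nat \<Rightarrow> nat) set) \<Rightarrow> (nat \<Rightarrow> real) \<Rightarrow> nat set" where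
  "closed_box_times k LL x \<equiv> {n. \<exists>j. n \<in> dyadic_block j \<and> (\<exists>l\<in>LL j. \<forall>i<k. nint_dist (real n * x i) \<le> 1 / 2 ^ l i)}"

lemma finite_dyadic_block [simp]: "finite (dyadic_block j)"
  and card_dyadic_block [simp]: "card (dyadic_block j) = 2 ^ j"
  by (simp_all add: dyadic_block_def)

lemma dyadic_block_pos: "n \<in> dyadic_block j \<Longrightarrow> n > 0"
  unfolding dyadic_block_def using zero_less_power[of "2::nat" j] by (simp add: Suc_le_eq order_less_le_trans)

lemma sum_dyadic_blocks:
  fixes f :: "nat \<Rightarrow> 'a :: comm_monoid_add"
  shows "(\<Sum>j\<le>J. \<Sum>n\<in>dyadic_block j. f n) = (\<Sum>n\<in>{1..<2 * 2 ^ J}. f n)"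
proof (induction J)
  case (Suc J)
  have "{1..<2 * 2 ^ Suc J} = {1..<2 * 2 ^ J} \<union> dyadic_block (Suc J)"
    by (auto simp: dyadic_block_def)
  moreover have "{1..<2 * 2 ^ J} \<inter> dyadic_block (Suc J) = {}" by (auto simp: dyadic_block_def)
  ultimately show ?case using Suc by (simp add: sum.union_disjoint)
qed (simp add: dyadic_block_def numeral_2_eq_2)

text \<open>An exponent vector \<open>l\<close> stands for the box \<open>\<bar>y i\<bar> < 2 powr - l i\<close>; those in \<open>LL j\<close>, all of volume
  \<open>2 powr - L j\<close> up to a constant, are used for the dilates by \<open>n\<close> in the block \<open>[2 ^ j, 2 ^ (j + 1))\<close>.
  The smoothed box indicators have Fourier support in \<open>[- Y j, Y j]\<close>. The sequences \<open>K\<close>, \<open>V\<close> and \<open>F\<close>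
  bound the number of boxes, the divisor function and the \<open>\<ell>\<^sup>1\<close> mass of the Fourier coefficients
  up to block \<open>j\<close>.\<close>

locale box_family = cube_measure k \<mu> for k :: nat and \<mu> :: "(nat \<Rightarrow> real) measure" +
  fixes LL :: "nat \<Rightarrow> (nat \<Rightarrow> nat) set" and L Y :: "nat \<Rightarrow> nat"
    and c :: "nat \<Rightarrow> nat \<Rightarrow> int \<Rightarrow> real" and p :: "nat \<Rightarrow> nat \<Rightarrow> real \<Rightarrow> real"
    and K V F :: "nat \<Rightarrow> real" and Q :: real
  assumes k2: "k \<ge> 2"
    and finLL: "finite (LL j)"
    and LL_sum: "l \<in> LL j \<Longrightarrow> (\<Sum>i<k. l i) = L j"
    and LL_supp: "l \<in> LL j \<Longrightarrow> k \<le> i \<Longrightarrow> l i = 0"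
    and LL_Y: "l \<in> LL j \<Longrightarrow> i < k \<Longrightarrow> 2 ^ l i \<le> Y j"
    and jL: "j \<le> L j"
    and Y1: "1 \<le> Y j" and Ymono: "mono Y"
    and c_nonneg: "0 \<le> c j s m" and c_0: "c j s 0 = 1 / (2 * 2 ^ s)"
    and c_le: "c j s m \<le> 1 / 2 ^ s" and c_decay: "m \<noteq> 0 \<Longrightarrow> c j s m \<le> 2 ^ s / (real_of_int m)\<^sup>2"
    and p_expand: "l \<in> LL j \<Longrightarrow> i < k \<Longrightarrow>
        complex_of_real (p j (l i) y) = (\<Sum>m\<in>{- int (Y j)..int (Y j)}. c j (l i) m *\<^sub>R ee (- of_int m * y))"
    and K: "j \<le> j' \<Longrightarrow> real (card (LL j)) \<le> K j'"
    and V: "h \<noteq> 0 \<Longrightarrow> \<bar>h\<bar> \<le> 4 * 2 ^ j * int (Y j) \<Longrightarrow> real (card {d. d dvd nat \<bar>h\<bar>}) \<le> V j"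
    and V1: "1 \<le> V j"
    and F: "(\<Sum>\<xi>\<in>ibox k (4 * 2 ^ j * Y j). amp \<xi>) \<le> F j"
    and Q: "1 \<le> Q" and YQ: "real (Y j) ^ (k - 1) \<le> Q * 2 ^ j"
begin

definition wgt :: "nat \<Rightarrow> (nat \<Rightarrow> nat) \<Rightarrow> (nat \<Rightarrow> int) \<Rightarrow> real" where
  "wgt j l m = (\<Prod>i<k. c j (l i) (m i))"

abbreviation freqs :: "nat \<Rightarrow> (nat \<Rightarrow> int) set" where
  "freqs j \<equiv> ibox k (Y j) - {\<lambda>_. 0}"

lemma finite_ibox [simp]: "finite (ibox k' Y')"
  by (intro finite_PiE_dflt) auto

lemma wgt_nonneg: "0 \<le> wgt j l m"
  unfolding wgt_def by (intro prod_nonneg) (auto simp: c_nonneg)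

lemma wgt_le:
  assumes "l \<in> LL j"
  shows "wgt j l m \<le> 1 / 2 ^ L j"
proof -
  have "wgt j l m \<le> (\<Prod>i<k. 1 / 2 ^ l i)"
    unfolding wgt_def by (intro prod_mono conjI c_nonneg c_le)
  also have "\<dots> = 1 / 2 ^ L j"
    unfolding LL_sum[OF assms, symmetric] by (simp add: prod_dividef power_sum)
  finally show ?thesis .
qed

lemma K0: "0 \<le> K j"
  using K[of j j] by linarith

definition pair_freq :: "nat \<Rightarrow> nat \<Rightarrow> (nat \<Rightarrow> int) \<Rightarrow> (nat \<Rightarrow> int) \<Rightarrow> nat \<Rightarrow> int" where
  "pair_freq n n' m m' = (\<lambda>i. int n * m i + int n' * m' i)"

text \<open>Grouped by the value \<open>\<xi>\<close> of the combined frequency, the sum has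
  multiplicities bounded uniformly in \<open>\<xi>\<close> by \<open>card_vecsol_sum_le\<close>, and
  \<open>F\<close> bounds what is left. The frequency range of the smaller block is enlarged to that
  of the larger one.\<close>

lemma pair_sum_nonzero_le:
  assumes jj: "j \<le> j'"
  shows "(\<Sum>n\<in>dyadic_block j. \<Sum>n'\<in>dyadic_block j'. \<Sum>m\<in>freqs j. \<Sum>m'\<in>freqs j'.
      if pair_freq n n' m m' \<noteq> (\<lambda>_. 0) then amp (pair_freq n n' m m') else 0)
    \<le> 6 * real k * 8 ^ k * Q * 2 ^ j * real (Y j') * (V j')\<^sup>2 * F j'"
proof -
  let ?X = "ibox k (4 * 2 ^ j' * Y j') - {\<lambda>_. 0}"
  have YY: "Y j \<le> Y j'" using Ymono jj by (rule monoD)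
  have inner: "(\<Sum>m\<in>freqs j. \<Sum>m'\<in>freqs j'. if pair_freq n n' m m' \<noteq> (\<lambda>_. 0) then amp (pair_freq n n' m m') else 0)
      \<le> (\<Sum>\<xi>\<in>?X. real (card (vecsol k (Y j') n n' \<xi>)) * amp \<xi>)"
    if n: "n \<in> dyadic_block j" "n' \<in> dyadic_block j'" for n n'
  proof -
    let ?P = "{z \<in> freqs j \<times> freqs j'. pair_freq n n' (fst z) (snd z) \<noteq> (\<lambda>_. 0)}"
    let ?g = "\<lambda>z. pair_freq n n' (fst z) (snd z)"
    have finP: "finite ?P" by (rule finite_subset[of _ "freqs j \<times> freqs j'"]) auto
    have "n < 2 * 2 ^ j" "n' < 2 * 2 ^ j'" using n by (simp_all add: dyadic_block_def)
    moreover have "(2::nat) ^ j \<le> 2 ^ j'" using jj by (intro power_increasing) auto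
    ultimately have "n \<le> 2 * 2 ^ j'" "n' \<le> 2 * 2 ^ j'" by linarith+
    then have "int n \<le> int (2 * 2 ^ j')" "int n' \<le> int (2 * 2 ^ j')" by (simp_all only: of_nat_le_iff)
    then have nn: "int n \<le> 2 * 2 ^ j'" "int n' \<le> 2 * 2 ^ j'" by simp_all
    have gP: "?g ` ?P \<subseteq> ?X"
    proof (rule image_subsetI)
      fix z assume z: "z \<in> ?P"
      obtain m m' where mm: "z = (m, m')" by fastforce
      have m: "m \<in> ibox k (Y j)" "m' \<in> ibox k (Y j')" using z by (auto simp: mm)
      have "pair_freq n n' m m' i \<in> {- int (4 * 2 ^ j' * Y j')..int (4 * 2 ^ j' * Y j')}" if "i < k" for i
      proof -
        have "\<bar>m i\<bar> \<le> int (Y j)" "\<bar>m' i\<bar> \<le> int (Y j')"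
          using m that by (auto simp: PiE_dflt_def abs_le_iff)
        then have b: "\<bar>m i\<bar> \<le> int (Y j')" "\<bar>m' i\<bar> \<le> int (Y j')" using YY by linarith+
        have "\<bar>pair_freq n n' m m' i\<bar> \<le> \<bar>int n * m i\<bar> + \<bar>int n' * m' i\<bar>"
          unfolding pair_freq_def by (rule abs_triangle_ineq)
        \<comment> \<open>Two products of this size: the origin of the 4 in the hypotheses
          \<open>V\<close> and \<open>F\<close>.\<close>
        also have "\<dots> \<le> (2 * 2 ^ j') * int (Y j') + (2 * 2 ^ j') * int (Y j')"
          unfolding abs_mult using b nn by (intro add_mono mult_mono) auto
        finally show ?thesis by (auto simp: abs_le_iff mult_ac)
      qed
      then show "?g z \<in> ?X" using z m by (auto simp: mm PiE_dflt_def pair_freq_def)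
    qed
    have "(\<Sum>m\<in>freqs j. \<Sum>m'\<in>freqs j'. if pair_freq n n' m m' \<noteq> (\<lambda>_. 0) then amp (pair_freq n n' m m') else 0)
        = (\<Sum>z\<in>freqs j \<times> freqs j'. if ?g z \<noteq> (\<lambda>_. 0) then amp (?g z) else 0)"
      by (simp add: sum.cartesian_product split_def)
    also have "\<dots> = (\<Sum>z\<in>?P. amp (?g z))"
      by (rule sum.mono_neutral_cong_right) auto
    also have "\<dots> = (\<Sum>\<xi>\<in>?X. real (card {z \<in> ?P. ?g z = \<xi>}) * amp \<xi>)"
      by (rule sum_fibres[OF finP _ gP]) (intro finite_Diff finite_ibox)
    also have "\<dots> \<le> (\<Sum>\<xi>\<in>?X. real (card (vecsol k (Y j') n n' \<xi>)) * amp \<xi>)"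
    proof (intro sum_mono mult_right_mono of_nat_mono card_mono)
      fix \<xi>
      have "vecsol k (Y j') n n' \<xi> \<subseteq> ibox k (Y j') \<times> ibox k (Y j')"
        unfolding vecsol_def by blast
      then show "finite (vecsol k (Y j') n n' \<xi>)" by (rule finite_subset) simp
      have "ibox k (Y j) \<subseteq> ibox k (Y j')" using YY by (force simp: PiE_dflt_def)
      then show "{z \<in> ?P. ?g z = \<xi>} \<subseteq> vecsol k (Y j') n n' \<xi>"
        unfolding vecsol_def pair_freq_def by auto
    qed simp
    finally show ?thesis .
  qed
  have outer: "(\<Sum>n\<in>dyadic_block j. \<Sum>n'\<in>dyadic_block j'. real (card (vecsol k (Y j') n n' \<xi>)))
      \<le> 6 * real k * 8 ^ k * Q * 2 ^ j * real (Y j') * (V j')\<^sup>2" if \<xi>: "\<xi> \<in> ?X" for \<xi>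
  proof -
    obtain i0 where i0: "\<xi> i0 \<noteq> 0" using \<xi> by auto
    then have i0k: "i0 < k" using \<xi> by (force simp: PiE_dflt_def)
    have "(\<Sum>n\<in>{2 ^ j..<2 * 2 ^ j}. \<Sum>n'\<in>{2 ^ j'..<2 * 2 ^ j'}. real (card (vecsol k (Y j') n n' \<xi>)))
      \<le> 6 * real k * 8 ^ k * Q * real (2 ^ j) * real (Y j') * (V j')\<^sup>2"
    proof (rule card_vecsol_sum_le[OF k2])
      show "real (card {d. d dvd nat \<bar>h\<bar>}) \<le> V j'" if "h \<noteq> 0" "\<bar>h\<bar> \<le> 4 * int (2 ^ j') * int (Y j')" for h
        using that by (intro V) auto
      show "\<bar>\<xi> i\<bar> \<le> 4 * int (2 ^ j') * int (Y j')" if "i < k" for i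
      proof -
        have "\<xi> i \<in> {- int (4 * 2 ^ j' * Y j')..int (4 * 2 ^ j' * Y j')}"
          using \<xi> that unfolding PiE_dflt_def by blast
        then show ?thesis by (simp add: abs_le_iff)
      qed
      show "real (Y j') ^ (k - 1) \<le> Q * real (2 ^ j')" using YQ by simp
      show "0 \<le> V j'" using V1[of j'] by linarith
      show "(2::nat) ^ j \<le> 2 ^ j'" using jj by (intro power_increasing) auto
    qed (use i0 i0k Y1 Q in auto)
    then show ?thesis by (simp add: dyadic_block_def)
  qed
  have "(\<Sum>n\<in>dyadic_block j. \<Sum>n'\<in>dyadic_block j'. \<Sum>m\<in>freqs j. \<Sum>m'\<in>freqs j'.
      if pair_freq n n' m m' \<noteq> (\<lambda>_. 0) then amp (pair_freq n n' m m') else 0)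
    \<le> (\<Sum>n\<in>dyadic_block j. \<Sum>n'\<in>dyadic_block j'. \<Sum>\<xi>\<in>?X. real (card (vecsol k (Y j') n n' \<xi>)) * amp \<xi>)"
    by (intro sum_mono inner)
  also have "\<dots> = (\<Sum>n\<in>dyadic_block j. \<Sum>\<xi>\<in>?X. \<Sum>n'\<in>dyadic_block j'. real (card (vecsol k (Y j') n n' \<xi>)) * amp \<xi>)"
    by (intro sum.cong refl sum.swap)
  also have "\<dots> = (\<Sum>\<xi>\<in>?X. \<Sum>n\<in>dyadic_block j. \<Sum>n'\<in>dyadic_block j'. real (card (vecsol k (Y j') n n' \<xi>)) * amp \<xi>)"
    by (rule sum.swap)
  also have "\<dots> = (\<Sum>\<xi>\<in>?X. (\<Sum>n\<in>dyadic_block j. \<Sum>n'\<in>dyadic_block j'. real (card (vecsol k (Y j') n n' \<xi>))) * amp \<xi>)"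
    by (simp add: sum_distrib_right)
  also have "\<dots> \<le> (\<Sum>\<xi>\<in>?X. (6 * real k * 8 ^ k * Q * 2 ^ j * real (Y j') * (V j')\<^sup>2) * amp \<xi>)"
    by (intro sum_mono mult_right_mono outer) auto
  also have "\<dots> = (6 * real k * 8 ^ k * Q * 2 ^ j * real (Y j') * (V j')\<^sup>2) * (\<Sum>\<xi>\<in>?X. amp \<xi>)"
    by (simp add: sum_distrib_left)
  also have "\<dots> \<le> (6 * real k * 8 ^ k * Q * 2 ^ j * real (Y j') * (V j')\<^sup>2) * F j'"
  proof (rule mult_left_mono)
    have "(\<Sum>\<xi>\<in>?X. amp \<xi>) \<le> (\<Sum>\<xi>\<in>ibox k (4 * 2 ^ j' * Y j'). amp \<xi>)" by (intro sum_mono2) auto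
    then show "(\<Sum>\<xi>\<in>?X. amp \<xi>) \<le> F j'" using F[of j'] by linarith
    show "0 \<le> 6 * real k * 8 ^ k * Q * 2 ^ j * real (Y j') * (V j')\<^sup>2" using Q by simp
  qed
  finally show ?thesis .
qed

text \<open>Over all vectors the sum factors into coordinates, and each factor is
  \<open>A i\<close>, from the pair of zeros, plus \<open>B i\<close>, from the nonzero pairs.
  Leaving out the zero vectors removes at least the product of the \<open>A i\<close>. What remains
  is the product of the \<open>B i\<close>, the true correlation, and mixed terms, which are
  estimated crudely through \<open>2 ^ l i \<le> Y j\<close>.\<close>

lemma pair_sum_zero_le:
  assumes n: "n > 0" "n' > 0" and l: "l \<in> LL j" "l' \<in> LL j'"
  defines "a \<equiv> n div gcd n n'" and "b \<equiv> n' div gcd n n'"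
  shows "(\<Sum>m\<in>freqs j. \<Sum>m'\<in>freqs j'. if pair_freq n n' m m' = (\<lambda>_. 0) then wgt j l m * wgt j' l' m' else 0)
    \<le> 6 ^ k * (\<Prod>i<k. min (1 / (2 ^ l' i * real b)) (1 / (2 ^ l i * real a)))
      + 12 ^ k * real (Y j) ^ (k - 1) / (2 ^ L j * 2 ^ L j' * real b)"
proof -
  let ?I = "{- int (Y j)..int (Y j)}" and ?I' = "{- int (Y j')..int (Y j')}"
  define f where "f i u v = (if int n * u + int n' * v = 0 then c j (l i) u * c j' (l' i) v else 0)" for i u v
  define T where "T m m' = (if pair_freq n n' m m' = (\<lambda>_. 0) then wgt j l m * wgt j' l' m' else 0)" for m m'
  have T0: "0 \<le> T m m'" for m m' by (simp add: T_def wgt_nonneg)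
  define S where "S = {(u, v) \<in> ?I \<times> ?I'. u \<noteq> 0 \<and> int n * u + int n' * v = 0}"
  define A where "A i = c j (l i) 0 * c j' (l' i) 0" for i
  define B where "B i = (\<Sum>(u, v)\<in>S. c j (l i) u * c j' (l' i) v)" for i
  define A' where "A' i = 1 / (2 ^ l i * 2 ^ l' i :: real)" for i
  define B' where "B' i = 6 * min (1 / (2 ^ l' i * real b)) (1 / (2 ^ l i * real a))" for i
  have b0: "b > 0" unfolding b_def using n by (simp add: div_greater_zero_iff gcd_le2_nat)
  have prodf: "(\<Prod>i<k. f i (m i) (m' i)) = T m m'" if m: "m \<in> ibox k (Y j)" "m' \<in> ibox k (Y j')" for m m'
  proof (cases "\<forall>i<k. int n * m i + int n' * m' i = 0")
    case True
    have "pair_freq n n' m m' = (\<lambda>_. 0)"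
    proof
      fix i
      show "pair_freq n n' m m' i = 0"
        using True m by (cases "i < k") (auto simp: pair_freq_def PiE_dflt_def)
    qed
    then show ?thesis using True by (simp add: T_def f_def wgt_def prod.distrib)
  next
    case False
    then obtain i where i: "i < k" "int n * m i + int n' * m' i \<noteq> 0" by auto
    then have "(\<Prod>i<k. f i (m i) (m' i)) = 0" by (intro prod_zero) (auto simp: f_def)
    moreover have "pair_freq n n' m m' \<noteq> (\<lambda>_. 0)" using i by (auto simp: pair_freq_def fun_eq_iff)
    ultimately show ?thesis by (simp add: T_def)
  qed
  have total: "(\<Sum>m\<in>ibox k (Y j). \<Sum>m'\<in>ibox k (Y j'). T m m') = (\<Prod>i<k. \<Sum>u\<in>?I. \<Sum>v\<in>?I'. f i u v)"
  proof -
    have "(\<Prod>i<k. \<Sum>u\<in>?I. \<Sum>v\<in>?I'. f i u v) = (\<Sum>m\<in>ibox k (Y j). \<Prod>i<k. \<Sum>v\<in>?I'. f i (m i) v)"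
      by (intro prod_sum_PiE_dflt) auto
    also have "\<dots> = (\<Sum>m\<in>ibox k (Y j). \<Sum>m'\<in>ibox k (Y j'). \<Prod>i<k. f i (m i) (m' i))"
      by (intro sum.cong refl prod_sum_PiE_dflt) auto
    also have "\<dots> = (\<Sum>m\<in>ibox k (Y j). \<Sum>m'\<in>ibox k (Y j'). T m m')"
      by (intro sum.cong refl prodf) auto
    finally show ?thesis by simp
  qed
  have factor: "(\<Sum>u\<in>?I. \<Sum>v\<in>?I'. f i u v) = B i + A i" for i
  proof -
    have "(\<Sum>u\<in>?I. \<Sum>v\<in>?I'. f i u v) = (\<Sum>v\<in>?I'. f i 0 v) + (\<Sum>u\<in>?I - {0}. \<Sum>v\<in>?I'. f i u v)"
      by (rule sum.remove) auto
    also have "(\<Sum>v\<in>?I'. f i 0 v) = (\<Sum>v\<in>?I'. if v = 0 then A i else 0)"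
      using n by (intro sum.cong refl) (auto simp: f_def A_def)
    also have "\<dots> = A i" by simp
    also have "(\<Sum>u\<in>?I - {0}. \<Sum>v\<in>?I'. f i u v) = (\<Sum>(u, v)\<in>(?I - {0}) \<times> ?I'. f i u v)"
      by (rule sum.cartesian_product)
    also have "\<dots> = B i"
      unfolding B_def by (rule sum.mono_neutral_cong_right) (auto simp: S_def f_def split: if_split_asm)
    finally show ?thesis by simp
  qed
  have "(\<Sum>m\<in>freqs j. \<Sum>m'\<in>freqs j'. T m m') + (\<Prod>i<k. A i) \<le> (\<Sum>m\<in>ibox k (Y j). \<Sum>m'\<in>ibox k (Y j'). T m m')"
  proof -
    have z: "(\<lambda>_. 0) \<in> ibox k y" for y by (simp add: PiE_dflt_def)
    have "(\<Sum>m\<in>freqs j. \<Sum>m'\<in>freqs j'. T m m') \<le> (\<Sum>m\<in>freqs j. \<Sum>m'\<in>ibox k (Y j'). T m m')"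
      by (intro sum_mono sum_mono2) (auto simp: T0)
    moreover have "(\<Prod>i<k. A i) = T (\<lambda>_. 0) (\<lambda>_. 0)"
      by (simp add: T_def pair_freq_def A_def wgt_def prod.distrib)
    moreover have "T (\<lambda>_. 0) (\<lambda>_. 0) \<le> (\<Sum>m'\<in>ibox k (Y j'). T (\<lambda>_. 0) m')"
      by (rule member_le_sum[OF z]) (auto simp: T0)
    moreover have "(\<Sum>m\<in>ibox k (Y j). \<Sum>m'\<in>ibox k (Y j'). T m m')
        = (\<Sum>m'\<in>ibox k (Y j'). T (\<lambda>_. 0) m') + (\<Sum>m\<in>freqs j. \<Sum>m'\<in>ibox k (Y j'). T m m')"
      by (rule sum.remove[OF _ z]) simp
    ultimately show ?thesis by linarith
  qed
  then have le: "(\<Sum>m\<in>freqs j. \<Sum>m'\<in>freqs j'. T m m') \<le> (\<Prod>i<k. B i + A i) - (\<Prod>i<k. A i)"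
    unfolding total factor by linarith
  have AA': "0 \<le> A i \<and> A i \<le> A' i" for i
  proof -
    have "A i \<le> (1 / 2 ^ l i) * (1 / 2 ^ l' i)" unfolding A_def by (intro mult_mono c_le c_nonneg) auto
    then show ?thesis by (simp add: A_def A'_def c_nonneg)
  qed
  have pairs: "B i \<le> B' i" for i
    unfolding B_def B'_def a_def b_def S_def
    by (rule kernel_pair_sum_le(1)[OF c_nonneg c_le c_decay c_nonneg c_le c_decay n])
  have empty: "b > Y j \<Longrightarrow> S = {}"
    unfolding b_def S_def
    by (rule kernel_pair_sum_le(2)[where c = "c j 0" and c' = "c j' 0" and l = 0 and l' = 0,
        OF c_nonneg c_le c_decay c_nonneg c_le c_decay n])
  have B0: "0 \<le> B i" for i unfolding B_def by (intro sum_nonneg) (auto simp: c_nonneg)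
  have B'0: "0 \<le> B' i" for i by (simp add: B'_def)
  let ?M = "6 ^ k * real (Y j) ^ (k - 1) / (2 ^ L j * 2 ^ L j' * real b)"
  have "(\<Prod>i<k. B i + A i) - (\<Prod>i<k. A i) \<le> (\<Prod>i<k. B' i) + 2 ^ k * ?M"
  \<comment> \<open>In a nonzero solution \<open>u\<close> is a multiple of \<open>b\<close>, so for
    \<open>b > Y j\<close> only zero solutions exist. Otherwise \<open>Y j / b \<ge> 1\<close>, and
    in every mixed term its exponent may be raised to \<open>k - 1\<close>.\<close>
  proof (cases "b > Y j")
    case True
    then have "B i = 0" for i unfolding B_def using empty by simp
    then have "(\<Prod>i<k. B i + A i) - (\<Prod>i<k. A i) = 0" by simp
    also have "0 \<le> (\<Prod>i<k. B' i) + 2 ^ k * ?M"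
      by (intro add_nonneg_nonneg prod_nonneg) (auto simp: B'0)
    finally show ?thesis .
  next
    case False
    then have bY: "1 \<le> real (Y j) / real b" using b0 by simp
    show ?thesis
    proof (rule prod_add_minus_prod_le)
      fix U assume U: "U \<subset> {..<k}" "U \<noteq> {}"
      have "card U < card {..<k}" using U(1) by (intro psubset_card_mono) auto
      then have cU: "card U \<le> k - 1" by simp
      have "(\<Prod>i\<in>U. B' i) \<le> (\<Prod>i\<in>U. 6 * (real (Y j) / real b) * A' i)"
      proof (intro prod_mono conjI B'0)
        fix i assume "i \<in> U"
        then have i: "i < k" using U by auto
        have "B' i \<le> 6 * (1 / (2 ^ l' i * real b))" by (simp add: B'_def)
        also have "\<dots> = 6 * (2 ^ l i / real b) * A' i" by (simp add: A'_def)
        also have "\<dots> \<le> 6 * (real (Y j) / real b) * A' i"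
        proof -
          have "2 ^ l i \<le> real (Y j)" using LL_Y[OF l(1) i] by (metis of_nat_le_iff of_nat_numeral of_nat_power)
          then show ?thesis by (intro mult_right_mono mult_left_mono divide_right_mono) (auto simp: A'_def)
        qed
        finally show "B' i \<le> 6 * (real (Y j) / real b) * A' i" .
      qed
      also have "\<dots> = (6 * (real (Y j) / real b)) ^ card U * (\<Prod>i\<in>U. A' i)"
        by (simp only: prod.distrib prod_constant power_mult_distrib)
      finally have "(\<Prod>i\<in>U. B' i) * (\<Prod>i\<in>{..<k} - U. A' i)
          \<le> (6 * (real (Y j) / real b)) ^ card U * (\<Prod>i\<in>U. A' i) * (\<Prod>i\<in>{..<k} - U. A' i)"
        by (intro mult_right_mono prod_nonneg) (auto simp: A'_def)
      also have "\<dots> = (6 * (real (Y j) / real b)) ^ card U * (\<Prod>i<k. A' i)"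
        using U by (subst prod.subset_diff[of U "{..<k}"]) auto
      also have "(\<Prod>i<k. A' i) = 1 / (2 ^ L j * 2 ^ L j')"
        unfolding A'_def LL_sum[OF l(1), symmetric] LL_sum[OF l(2), symmetric]
        by (simp add: prod_dividef prod.distrib power_sum)
      also have "(6 * (real (Y j) / real b)) ^ card U \<le> 6 ^ k * (real (Y j) ^ (k - 1) / real b)"
      proof -
        have "(6 * (real (Y j) / real b)) ^ card U = 6 ^ card U * (real (Y j) / real b) ^ card U"
          by (rule power_mult_distrib)
        also have "\<dots> \<le> 6 ^ k * (real (Y j) / real b) ^ (k - 1)"
          using bY cU by (intro mult_mono power_increasing) auto
        also have "(real (Y j) / real b) ^ (k - 1) \<le> real (Y j) ^ (k - 1) / real b"
        proof -
          have "real b ^ 1 \<le> real b ^ (k - 1)" using b0 k2 by (intro power_increasing) auto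
          then show ?thesis unfolding power_divide using b0 by (intro divide_left_mono) auto
        qed
        finally show ?thesis by simp
      qed
      finally show "(\<Prod>i\<in>U. B' i) * (\<Prod>i\<in>{..<k} - U. A' i) \<le> ?M"
        by (simp add: field_simps)
    qed (use AA' B0 pairs k2 in auto)
  qed
  also have "(\<Prod>i<k. B' i) = 6 ^ k * (\<Prod>i<k. min (1 / (2 ^ l' i * real b)) (1 / (2 ^ l i * real a)))"
    unfolding B'_def by (simp only: prod.distrib) simp
  also have "2 ^ k * ?M = 12 ^ k * real (Y j) ^ (k - 1) / (2 ^ L j * 2 ^ L j' * real b)"
    by (simp flip: power_mult_distrib)
  finally show ?thesis using le unfolding T_def by linarith
qed

definition dens :: "nat \<Rightarrow> real" where
  "dens j = real (card (LL j)) / 2 ^ L j"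

lemma dens_nonneg: "0 \<le> dens j"
  by (simp add: dens_def)

text \<open>Not a covariance but an upper bound for one, centred at the Lebesgue means: every
  Fourier coefficient is replaced by its modulus, so the value is nonnegative.\<close>

definition cov :: "nat \<Rightarrow> nat \<Rightarrow> real" where
  "cov j j' = (\<Sum>n\<in>dyadic_block j. \<Sum>n'\<in>dyadic_block j'. \<Sum>l\<in>LL j. \<Sum>l'\<in>LL j'. \<Sum>m\<in>freqs j. \<Sum>m'\<in>freqs j'.
      wgt j l m * wgt j' l' m' * amp (pair_freq n n' m m'))"

lemma cov_nonneg: "0 \<le> cov j j'"
  unfolding cov_def by (intro sum_nonneg mult_nonneg_nonneg wgt_nonneg) auto

lemma cov_commute: "cov j j' = cov j' j"
proof -
  have pf: "pair_freq n n' m m' = pair_freq n' n m' m" for n n' m m'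
    by (simp add: pair_freq_def add.commute)
  have "cov j j' = (\<Sum>n'\<in>dyadic_block j'. \<Sum>n\<in>dyadic_block j. \<Sum>l\<in>LL j. \<Sum>l'\<in>LL j'. \<Sum>m\<in>freqs j. \<Sum>m'\<in>freqs j'.
      wgt j l m * wgt j' l' m' * amp (pair_freq n n' m m'))"
    unfolding cov_def by (rule sum.swap)
  also have "\<dots> = (\<Sum>n'\<in>dyadic_block j'. \<Sum>n\<in>dyadic_block j. \<Sum>l'\<in>LL j'. \<Sum>l\<in>LL j. \<Sum>m\<in>freqs j. \<Sum>m'\<in>freqs j'.
      wgt j l m * wgt j' l' m' * amp (pair_freq n n' m m'))"
    by (intro sum.cong refl sum.swap)
  also have "\<dots> = (\<Sum>n'\<in>dyadic_block j'. \<Sum>n\<in>dyadic_block j. \<Sum>l'\<in>LL j'. \<Sum>l\<in>LL j. \<Sum>m'\<in>freqs j'. \<Sum>m\<in>freqs j.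
      wgt j l m * wgt j' l' m' * amp (pair_freq n n' m m'))"
    by (intro sum.cong refl sum.swap)
  also have "\<dots> = cov j' j"
    unfolding cov_def by (intro sum.cong refl) (simp add: pf[of _ _ _ _] mult.commute)
  finally show ?thesis .
qed

definition reduced :: "nat \<Rightarrow> nat \<Rightarrow> nat" where
  "reduced n n' = n div gcd n n'"

text \<open>The bound for the correlation under Lebesgue measure, in the form of
  \<open>sum_prod_min_le_two\<close>, with \<open>a\<close> and \<open>b\<close> the reduced
  numerator and denominator of \<open>n / n'\<close>.\<close>

definition main_term :: "nat \<Rightarrow> nat \<Rightarrow> real" where
  "main_term j j' = (\<Sum>n\<in>dyadic_block j. \<Sum>n'\<in>dyadic_block j'.
      (real (reduced n n') * dens j + real (reduced n' n) * dens j')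
        / ((real (reduced n n') * real (reduced n' n)) * sqrt (real (reduced n n') * real (reduced n' n))))"

lemma main_term_nonneg: "0 \<le> main_term j j'"
  unfolding main_term_def by (intro sum_nonneg divide_nonneg_nonneg add_nonneg_nonneg mult_nonneg_nonneg dens_nonneg) auto

text \<open>\<open>Y j * F j\<close> comes from the nonzero frequencies and
  \<open>Y j ^ (k - 1)\<close> from the mixed solutions of frequency zero; both are divided by the
  length of the longer block.\<close>

definition err :: "nat \<Rightarrow> real" where
  "err j = (K j)\<^sup>2 * (V j)\<^sup>2 * (real (Y j) * F j + real (Y j) ^ (k - 1)) / 2 ^ j"

definition cst :: real where
  "cst = 6 * real k * 8 ^ k * Q + 2 * 12 ^ k"

lemma F0: "0 \<le> F j"
proof -
  have "0 \<le> (\<Sum>\<xi>\<in>ibox k (4 * 2 ^ j * Y j). amp \<xi>)" by (intro sum_nonneg) auto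
  then show ?thesis using F[of j] by linarith
qed

lemma err_nonneg: "0 \<le> err j"
  unfolding err_def using F0 by (intro divide_nonneg_nonneg mult_nonneg_nonneg add_nonneg_nonneg) auto

lemma cst_nonneg: "0 \<le> cst"
  unfolding cst_def using Q by simp

text \<open>By \<open>jL\<close> the boxes of block \<open>j\<close> have volume at most about
  \<open>1 / 2 ^ j\<close>. This cancels the length of the shorter block and leaves the gain
  \<open>1 / 2 ^ j'\<close> from the longer one.\<close>

lemma card_mult_le:
  assumes "j \<le> j'"
  shows "real (card (LL j)) * real (card (LL j')) / (2 ^ L j * 2 ^ L j') * 2 ^ j \<le> (K j')\<^sup>2 / 2 ^ j'"
proof -
  have "real (card (LL j)) * real (card (LL j')) \<le> K j' * K j'"
    using K[OF assms] K[of j' j'] K0 by (intro mult_mono) auto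
  moreover have "(2::real) ^ j * 2 ^ j' \<le> 2 ^ L j * 2 ^ L j'"
    using jL by (intro mult_mono power_increasing) auto
  ultimately have "real (card (LL j)) * real (card (LL j')) / (2 ^ L j * 2 ^ L j') \<le> (K j' * K j') / (2 ^ j * 2 ^ j')"
    by (intro frac_le) (auto intro: mult_nonneg_nonneg K0)
  then have "real (card (LL j)) * real (card (LL j')) / (2 ^ L j * 2 ^ L j') * 2 ^ j \<le> (K j' * K j') / (2 ^ j * 2 ^ j') * 2 ^ j"
    by (intro mult_right_mono) auto
  then show ?thesis by (simp add: power2_eq_square)
qed

lemma sum_inverse_reduced_le:
  assumes "j \<le> j'"
  shows "(\<Sum>n\<in>dyadic_block j. \<Sum>n'\<in>dyadic_block j'. 1 / real (reduced n' n)) \<le> 2 * 2 ^ j * V j'"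
proof -
  have "(\<Sum>n\<in>dyadic_block j. \<Sum>n'\<in>dyadic_block j'. 1 / real (reduced n' n))
      = (\<Sum>n'\<in>dyadic_block j'. \<Sum>n\<in>dyadic_block j. 1 / real (reduced n' n))" by (rule sum.swap)
  also have "\<dots> \<le> (\<Sum>n'\<in>dyadic_block j'. 2 * 2 ^ j * V j' / 2 ^ j')"
  proof (rule sum_mono)
    fix n' assume n': "n' \<in> dyadic_block j'"
    have n'0: "n' > 0" by (rule dyadic_block_pos[OF n'])
    have eq: "1 / real (reduced n' n) = real (gcd n n') / real n'" for n
    proof -
      have "real n' = real (reduced n' n) * real (gcd n' n)"
        unfolding reduced_def of_nat_mult[symmetric] by simp
      moreover have "real (gcd n' n) > 0" using n'0 by simp
      ultimately show ?thesis by (simp add: gcd.commute)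
    qed
    have n'2: "2 ^ j' \<le> n'" "n' < 2 * 2 ^ j'" using n' by (simp_all add: dyadic_block_def)
    have "(\<Sum>n\<in>dyadic_block j. 1 / real (reduced n' n)) = (\<Sum>n\<in>dyadic_block j. real (gcd n n')) / real n'"
      by (simp add: eq sum_divide_distrib)
    also have "\<dots> \<le> (2 * 2 ^ j * V j') / real n'"
    proof (rule divide_right_mono)
      have "(\<Sum>n\<in>dyadic_block j. real (gcd n n')) \<le> 2 * real (2 ^ j) * real (card {d. d dvd n'})"
        unfolding dyadic_block_def by (rule sum_gcd_block_le[OF n'0])
      also have "real (card {d. d dvd n'}) \<le> V j'"
      proof -
        have "n' \<le> 4 * 2 ^ j' * Y j'"
        proof -
          have "n' \<le> 4 * 2 ^ j' * 1" using n'2 by linarith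
          also have "\<dots> \<le> 4 * 2 ^ j' * Y j'" using Y1 by (intro mult_left_mono) auto
          finally show ?thesis .
        qed
        then have "int n' \<le> int (4 * 2 ^ j' * Y j')" by (simp only: of_nat_le_iff)
        then have "real (card {d. d dvd nat \<bar>int n'\<bar>}) \<le> V j'" using n'0 by (intro V) auto
        then show ?thesis by simp
      qed
      finally show "(\<Sum>n\<in>dyadic_block j. real (gcd n n')) \<le> 2 * 2 ^ j * V j'" by simp
    qed simp
    also have "\<dots> \<le> (2 * 2 ^ j * V j') / 2 ^ j'"
    proof (rule divide_left_mono)
      show "(2::real) ^ j' \<le> real n'" using n'2(1) by (metis of_nat_le_iff of_nat_numeral of_nat_power)
    qed (use V1[of j'] n'0 in auto)
    finally show "(\<Sum>n\<in>dyadic_block j. 1 / real (reduced n' n)) \<le> 2 * 2 ^ j * V j' / 2 ^ j'" .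
  qed
  also have "\<dots> = 2 * 2 ^ j * V j'" by simp
  finally show ?thesis .
qed

lemma cov_nonzero_part_le:
  assumes jj: "j \<le> j'"
  shows "(\<Sum>n\<in>dyadic_block j. \<Sum>n'\<in>dyadic_block j'. \<Sum>l\<in>LL j. \<Sum>l'\<in>LL j'.
      1 / (2 ^ L j * 2 ^ L j') * (\<Sum>m\<in>freqs j. \<Sum>m'\<in>freqs j'.
      if pair_freq n n' m m' \<noteq> (\<lambda>_. 0) then amp (pair_freq n n' m m') else 0))
    \<le> 6 * real k * 8 ^ k * Q * err j'"
proof -
  let ?G = "\<lambda>n n'. \<Sum>m\<in>freqs j. \<Sum>m'\<in>freqs j'.
      if pair_freq n n' m m' \<noteq> (\<lambda>_. 0) then amp (pair_freq n n' m m') else 0"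
  let ?x = "real (card (LL j)) * real (card (LL j')) / (2 ^ L j * 2 ^ L j')"
  have "(\<Sum>n\<in>dyadic_block j. \<Sum>n'\<in>dyadic_block j'. \<Sum>l\<in>LL j. \<Sum>l'\<in>LL j'. 1 / (2 ^ L j * 2 ^ L j') * ?G n n')
      = ?x * (\<Sum>n\<in>dyadic_block j. \<Sum>n'\<in>dyadic_block j'. ?G n n')"
    by (simp add: sum_distrib_left mult.assoc)
  also have "\<dots> \<le> ?x * (6 * real k * 8 ^ k * Q * 2 ^ j * real (Y j') * (V j')\<^sup>2 * F j')"
    by (intro mult_left_mono pair_sum_nonzero_le[OF jj]) auto
  also have "\<dots> = (?x * 2 ^ j) * (6 * real k * 8 ^ k * Q * real (Y j') * (V j')\<^sup>2 * F j')" by simp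
  also have "\<dots> \<le> ((K j')\<^sup>2 / 2 ^ j') * (6 * real k * 8 ^ k * Q * real (Y j') * (V j')\<^sup>2 * F j')"
    using Q F0 by (intro mult_right_mono card_mult_le[OF jj]) auto
  also have "\<dots> = 6 * real k * 8 ^ k * Q * ((K j')\<^sup>2 * (V j')\<^sup>2 * (real (Y j') * F j') / 2 ^ j')" by simp
  also have "\<dots> \<le> 6 * real k * 8 ^ k * Q * err j'"
    unfolding err_def using Q by (intro mult_left_mono divide_right_mono) auto
  finally show ?thesis .
qed

lemma cov_zero_part_le:
  assumes jj: "j \<le> j'"
  shows "(\<Sum>n\<in>dyadic_block j. \<Sum>n'\<in>dyadic_block j'. \<Sum>l\<in>LL j. \<Sum>l'\<in>LL j'. \<Sum>m\<in>freqs j. \<Sum>m'\<in>freqs j'.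
      if pair_freq n n' m m' = (\<lambda>_. 0) then wgt j l m * wgt j' l' m' else 0)
    \<le> 42 ^ k * main_term j j' + 2 * 12 ^ k * err j'"
proof -
  let ?M = "\<lambda>n n' l l'. \<Prod>i<k. min (1 / (2 ^ l' i * real (reduced n' n))) (1 / (2 ^ l i * real (reduced n n')))"
  let ?c = "12 ^ k * real (Y j) ^ (k - 1) / (2 ^ L j * 2 ^ L j')"
  let ?x = "real (card (LL j)) * real (card (LL j')) / (2 ^ L j * 2 ^ L j')"
  have red: "reduced n n' \<ge> 1" if "n > 0" for n n'
    using that unfolding reduced_def by (simp add: Suc_le_eq div_greater_zero_iff gcd_le1_nat)
  have "(\<Sum>n\<in>dyadic_block j. \<Sum>n'\<in>dyadic_block j'. \<Sum>l\<in>LL j. \<Sum>l'\<in>LL j'. \<Sum>m\<in>freqs j. \<Sum>m'\<in>freqs j'.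
      if pair_freq n n' m m' = (\<lambda>_. 0) then wgt j l m * wgt j' l' m' else 0)
    \<le> (\<Sum>n\<in>dyadic_block j. \<Sum>n'\<in>dyadic_block j'. \<Sum>l\<in>LL j. \<Sum>l'\<in>LL j'. 6 ^ k * ?M n n' l l' + ?c * (1 / real (reduced n' n)))"
  proof (intro sum_mono)
    fix n n' l l' assume n: "n \<in> dyadic_block j" "n' \<in> dyadic_block j'" and l: "l \<in> LL j" "l' \<in> LL j'"
    show "(\<Sum>m\<in>freqs j. \<Sum>m'\<in>freqs j'. if pair_freq n n' m m' = (\<lambda>_. 0) then wgt j l m * wgt j' l' m' else 0)
        \<le> 6 ^ k * ?M n n' l l' + ?c * (1 / real (reduced n' n))"
      using pair_sum_zero_le[OF dyadic_block_pos[OF n(1)] dyadic_block_pos[OF n(2)] l]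
      by (simp add: reduced_def gcd.commute)
  qed
  also have "\<dots> = 6 ^ k * (\<Sum>n\<in>dyadic_block j. \<Sum>n'\<in>dyadic_block j'. \<Sum>l\<in>LL j. \<Sum>l'\<in>LL j'. ?M n n' l l')
      + (\<Sum>n\<in>dyadic_block j. \<Sum>n'\<in>dyadic_block j'. \<Sum>l\<in>LL j. \<Sum>l'\<in>LL j'. ?c * (1 / real (reduced n' n)))"
    by (simp only: sum.distrib sum_distrib_left)
  also have "\<dots> \<le> 6 ^ k * (7 ^ k * main_term j j') + 2 * 12 ^ k * err j'"
  proof (intro add_mono mult_left_mono)
    show "(\<Sum>n\<in>dyadic_block j. \<Sum>n'\<in>dyadic_block j'. \<Sum>l\<in>LL j. \<Sum>l'\<in>LL j'. ?M n n' l l') \<le> 7 ^ k * main_term j j'"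
      unfolding main_term_def sum_distrib_left
    proof (intro sum_mono)
      fix n n' assume n: "n \<in> dyadic_block j" "n' \<in> dyadic_block j'"
      have ab: "1 \<le> real (reduced n n')" "1 \<le> real (reduced n' n)"
        using red dyadic_block_pos n by (metis of_nat_1 of_nat_le_iff)+
      have "(\<Sum>l\<in>LL j. \<Sum>l'\<in>LL j'. ?M n n' l l') \<le> 7 ^ k * (real (reduced n n') * (real (card (LL j)) / 2 ^ L j)
          + real (reduced n' n) * (real (card (LL j')) / 2 ^ L j'))
        / ((real (reduced n n') * real (reduced n' n)) * sqrt (real (reduced n n') * real (reduced n' n)))"
        by (rule sum_prod_min_le_two) (use finLL LL_supp LL_sum ab k2 in auto)
      then show "(\<Sum>l\<in>LL j. \<Sum>l'\<in>LL j'. ?M n n' l l') \<le> 7 ^ k * ((real (reduced n n') * dens j + real (reduced n' n) * dens j')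
        / ((real (reduced n n') * real (reduced n' n)) * sqrt (real (reduced n n') * real (reduced n' n))))"
        unfolding dens_def by simp
    qed
    have "(\<Sum>n\<in>dyadic_block j. \<Sum>n'\<in>dyadic_block j'. \<Sum>l\<in>LL j. \<Sum>l'\<in>LL j'. ?c * (1 / real (reduced n' n)))
        = 12 ^ k * real (Y j) ^ (k - 1) * ?x * (\<Sum>n\<in>dyadic_block j. \<Sum>n'\<in>dyadic_block j'. 1 / real (reduced n' n))"
    proof -
      have "(\<Sum>l\<in>LL j. \<Sum>l'\<in>LL j'. ?c * z) = (12 ^ k * real (Y j) ^ (k - 1) * ?x) * z" for z by simp
      then show ?thesis by (simp only: sum_distrib_left)
    qed
    also have "\<dots> \<le> 12 ^ k * real (Y j) ^ (k - 1) * ?x * (2 * 2 ^ j * V j')"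
      by (intro mult_left_mono sum_inverse_reduced_le jj) auto
    also have "\<dots> = 2 * 12 ^ k * (real (Y j) ^ (k - 1) * V j') * (?x * 2 ^ j)" by simp
    also have "\<dots> \<le> 2 * 12 ^ k * (real (Y j') ^ (k - 1) * (V j')\<^sup>2) * ((K j')\<^sup>2 / 2 ^ j')"
    proof (intro mult_mono card_mult_le jj mult_nonneg_nonneg power_mono)
      show "real (Y j) \<le> real (Y j')" using monoD[OF Ymono jj] by simp
      show "V j' \<le> (V j')\<^sup>2" using V1[of j'] by (simp add: power2_eq_square)
    qed (use V1[of j'] in auto)
    also have "\<dots> = 2 * 12 ^ k * ((K j')\<^sup>2 * (V j')\<^sup>2 * real (Y j') ^ (k - 1) / 2 ^ j')" by simp
    also have "\<dots> \<le> 2 * 12 ^ k * err j'"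
      unfolding err_def using F0 by (intro mult_left_mono divide_right_mono) auto
    finally show "(\<Sum>n\<in>dyadic_block j. \<Sum>n'\<in>dyadic_block j'. \<Sum>l\<in>LL j. \<Sum>l'\<in>LL j'. ?c * (1 / real (reduced n' n))) \<le> 2 * 12 ^ k * err j'" .
  qed simp
  also have "(6::real) ^ k * (7 ^ k * main_term j j') = 42 ^ k * main_term j j'"
    by (simp flip: mult.assoc power_mult_distrib)
  finally show ?thesis .
qed

lemma cov_le:
  assumes jj: "j \<le> j'"
  shows "cov j j' \<le> 42 ^ k * main_term j j' + cst * err j'"
proof -
  let ?fc = "\<lambda>n n' m m'. amp (pair_freq n n' m m')"
  let ?Z = "\<lambda>n n' l l' m m'. if pair_freq n n' m m' = (\<lambda>_. 0) then wgt j l m * wgt j' l' m' else 0"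
  let ?W = "\<lambda>n n' m m'. if pair_freq n n' m m' \<noteq> (\<lambda>_. 0) then ?fc n n' m m' else 0"
  have "cov j j' \<le> (\<Sum>n\<in>dyadic_block j. \<Sum>n'\<in>dyadic_block j'. \<Sum>l\<in>LL j. \<Sum>l'\<in>LL j'. \<Sum>m\<in>freqs j. \<Sum>m'\<in>freqs j'.
      ?Z n n' l l' m m' + 1 / (2 ^ L j * 2 ^ L j') * ?W n n' m m')"
    unfolding cov_def
  proof (intro sum_mono)
    fix n n' l l' m m' assume l: "l \<in> LL j" "l' \<in> LL j'"
    show "wgt j l m * wgt j' l' m' * ?fc n n' m m' \<le> ?Z n n' l l' m m' + 1 / (2 ^ L j * 2 ^ L j') * ?W n n' m m'"
    proof (cases "pair_freq n n' m m' = (\<lambda>_. 0)")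
      case True
      then show ?thesis by (simp add: fourier_coeff_0)
    next
      case False
      have "wgt j l m * wgt j' l' m' \<le> (1 / 2 ^ L j) * (1 / 2 ^ L j')"
        by (intro mult_mono wgt_le l wgt_nonneg) auto
      then have "wgt j l m * wgt j' l' m' * ?fc n n' m m' \<le> (1 / 2 ^ L j) * (1 / 2 ^ L j') * ?fc n n' m m'"
        by (rule mult_right_mono) simp
      then show ?thesis using False by simp
    qed
  qed
  also have "\<dots> = (\<Sum>n\<in>dyadic_block j. \<Sum>n'\<in>dyadic_block j'. \<Sum>l\<in>LL j. \<Sum>l'\<in>LL j'. \<Sum>m\<in>freqs j. \<Sum>m'\<in>freqs j'. ?Z n n' l l' m m')
     + (\<Sum>n\<in>dyadic_block j. \<Sum>n'\<in>dyadic_block j'. \<Sum>l\<in>LL j. \<Sum>l'\<in>LL j'. 1 / (2 ^ L j * 2 ^ L j') * (\<Sum>m\<in>freqs j. \<Sum>m'\<in>freqs j'. ?W n n' m m'))"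
    by (simp only: sum.distrib sum_distrib_left)
  also have "\<dots> \<le> (42 ^ k * main_term j j' + 2 * 12 ^ k * err j') + 6 * real k * 8 ^ k * Q * err j'"
    by (intro add_mono cov_zero_part_le cov_nonzero_part_le jj)
  also have "\<dots> = 42 ^ k * main_term j j' + cst * err j'" by (simp add: cst_def algebra_simps)
  finally show ?thesis .
qed

text \<open>Up to the factor \<open>1 / 2 ^ k\<close>, which comes from \<open>c_0\<close>, the
  expected value of \<open>hits\<close> under Lebesgue measure.\<close>

definition mass :: "nat \<Rightarrow> real" where
  "mass J = (\<Sum>j\<le>J. 2 ^ j * dens j)"

text \<open>The summand splits into a part linear in \<open>dens j\<close> and one linear in
  \<open>dens j'\<close>. In the first, \<open>n'\<close> runs over all blocks at once with
  \<open>n\<close> fixed, so that \<open>sum_over_reduced_pairs_le\<close> applies without a factor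
  for the number of blocks; the second is symmetric. This is why the variance is linear in the
  expectation.\<close>

lemma sum_main_term_le: "(\<Sum>j\<le>J. \<Sum>j'\<le>J. main_term j j') \<le> 36 * mass J"
proof -
  define h where "h n n' = 1 / (sqrt (real (reduced n n')) * (real (reduced n' n) * sqrt (real (reduced n' n))))" for n n'
  have split: "(real (reduced n n') * x + real (reduced n' n) * y)
        / ((real (reduced n n') * real (reduced n' n)) * sqrt (real (reduced n n') * real (reduced n' n)))
      = h n n' * x + h n' n * y" if "n > 0" "n' > 0" for n n' and x y :: real
  proof -
    have "reduced n n' > 0" "reduced n' n > 0"
      using that unfolding reduced_def by (simp_all add: div_greater_zero_iff gcd_le1_nat)
    then show ?thesis by (simp add: h_def real_sqrt_mult field_simps)
  qed
  have one: "(\<Sum>j\<le>J. \<Sum>j'\<le>J. \<Sum>n\<in>dyadic_block j. \<Sum>n'\<in>dyadic_block j'. h n n' * dens j) \<le> 18 * mass J"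
  proof -
    have "(\<Sum>j'\<le>J. \<Sum>n\<in>dyadic_block j. \<Sum>n'\<in>dyadic_block j'. h n n' * dens j) \<le> 18 * 2 ^ j * dens j" for j
    proof -
      have "(\<Sum>j'\<le>J. \<Sum>n\<in>dyadic_block j. \<Sum>n'\<in>dyadic_block j'. h n n' * dens j)
          = (\<Sum>n\<in>dyadic_block j. \<Sum>j'\<le>J. \<Sum>n'\<in>dyadic_block j'. h n n' * dens j)" by (rule sum.swap)
      also have "\<dots> = (\<Sum>n\<in>dyadic_block j. \<Sum>n'\<in>{1..<2 * 2 ^ J}. h n n' * dens j)"
        by (simp only: sum_dyadic_blocks)
      also have "\<dots> = (\<Sum>n\<in>dyadic_block j. \<Sum>n'\<in>{1..<2 * 2 ^ J}. h n n') * dens j"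
        by (simp only: sum_distrib_right)
      also have "\<dots> \<le> (18 * real (2 ^ j)) * dens j"
      proof (intro mult_right_mono dens_nonneg)
        have "h n n' = 1 / (sqrt (real (n div gcd n n')) * (real (n' div gcd n n') * sqrt (real (n' div gcd n n'))))" for n n'
          by (simp add: h_def reduced_def gcd.commute)
        then show "(\<Sum>n\<in>dyadic_block j. \<Sum>n'\<in>{1..<2 * 2 ^ J}. h n n') \<le> 18 * real (2 ^ j)"
          using sum_over_reduced_pairs_le[of "2 ^ j" "2 * 2 ^ J"] by (simp add: dyadic_block_def)
      qed
      finally show ?thesis by simp
    qed
    then have "(\<Sum>j\<le>J. \<Sum>j'\<le>J. \<Sum>n\<in>dyadic_block j. \<Sum>n'\<in>dyadic_block j'. h n n' * dens j)
        \<le> (\<Sum>j\<le>J. 18 * 2 ^ j * dens j)" by (intro sum_mono)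
    also have "\<dots> = 18 * mass J" by (simp add: mass_def sum_distrib_left mult.assoc)
    finally show ?thesis .
  qed
  have two: "(\<Sum>j\<le>J. \<Sum>j'\<le>J. \<Sum>n\<in>dyadic_block j. \<Sum>n'\<in>dyadic_block j'. h n' n * dens j') \<le> 18 * mass J"
  proof -
    have "(\<Sum>j\<le>J. \<Sum>j'\<le>J. \<Sum>n\<in>dyadic_block j. \<Sum>n'\<in>dyadic_block j'. h n' n * dens j')
        = (\<Sum>j'\<le>J. \<Sum>j\<le>J. \<Sum>n\<in>dyadic_block j. \<Sum>n'\<in>dyadic_block j'. h n' n * dens j')" by (rule sum.swap)
    also have "\<dots> = (\<Sum>j'\<le>J. \<Sum>j\<le>J. \<Sum>n'\<in>dyadic_block j'. \<Sum>n\<in>dyadic_block j. h n' n * dens j')"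
      by (intro sum.cong refl sum.swap)
    also have "\<dots> \<le> 18 * mass J" by (rule one)
    finally show ?thesis .
  qed
  have "(\<Sum>j\<le>J. \<Sum>j'\<le>J. main_term j j')
     = (\<Sum>j\<le>J. \<Sum>j'\<le>J. \<Sum>n\<in>dyadic_block j. \<Sum>n'\<in>dyadic_block j'. h n n' * dens j + h n' n * dens j')"
    unfolding main_term_def by (intro sum.cong refl split dyadic_block_pos)
  also have "\<dots> \<le> 18 * mass J + 18 * mass J"
    using one two by (simp only: sum.distrib)
  finally show ?thesis by simp
qed

text \<open>By symmetry it is enough to treat \<open>j \<le> j'\<close>; the error depends on
  \<open>j'\<close> alone and is therefore counted \<open>j' + 1\<close> times.\<close>

lemma sum_cov_le: "(\<Sum>j\<le>J. \<Sum>j'\<le>J. cov j j') \<le> 72 * 42 ^ k * mass J + 2 * cst * (\<Sum>j\<le>J. (real j + 1) * err j)"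
proof -
  let ?u = "\<lambda>j j'. if j \<le> j' then cov j j' else 0"
  have "(\<Sum>j\<le>J. \<Sum>j'\<le>J. cov j j') \<le> (\<Sum>j\<le>J. \<Sum>j'\<le>J. ?u j j' + ?u j' j)"
    using cov_commute cov_nonneg by (intro sum_mono) (auto simp: add_increasing)
  also have "\<dots> = (\<Sum>j\<le>J. \<Sum>j'\<le>J. ?u j j') + (\<Sum>j\<le>J. \<Sum>j'\<le>J. ?u j' j)"
    by (simp only: sum.distrib)
  also have "(\<Sum>j\<le>J. \<Sum>j'\<le>J. ?u j' j) = (\<Sum>j\<le>J. \<Sum>j'\<le>J. ?u j j')" by (rule sum.swap)
  finally have a: "(\<Sum>j\<le>J. \<Sum>j'\<le>J. cov j j') \<le> 2 * (\<Sum>j\<le>J. \<Sum>j'\<le>J. ?u j j')" by simp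
  have "(\<Sum>j\<le>J. \<Sum>j'\<le>J. ?u j j') \<le> (\<Sum>j\<le>J. \<Sum>j'\<le>J. 42 ^ k * main_term j j' + (if j \<le> j' then cst * err j' else 0))"
    using cov_le main_term_nonneg by (intro sum_mono) auto
  also have "\<dots> = 42 ^ k * (\<Sum>j\<le>J. \<Sum>j'\<le>J. main_term j j') + (\<Sum>j\<le>J. \<Sum>j'\<le>J. if j \<le> j' then cst * err j' else 0)"
    by (simp only: sum.distrib sum_distrib_left)
  also have "(\<Sum>j\<le>J. \<Sum>j'\<le>J. if j \<le> j' then cst * err j' else 0) = (\<Sum>j'\<le>J. \<Sum>j\<le>J. if j \<le> j' then cst * err j' else 0)"
    by (rule sum.swap)
  also have "\<dots> = (\<Sum>j'\<le>J. (real j' + 1) * (cst * err j'))"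
  proof (intro sum.cong refl)
    fix j' assume "j' \<in> {..J}"
    then have "{..J} \<inter> {j. j \<le> j'} = {..j'}" by auto
    then show "(\<Sum>j\<le>J. if j \<le> j' then cst * err j' else 0) = (real j' + 1) * (cst * err j')"
      by (simp add: sum.If_cases)
  qed
  also have "\<dots> = cst * (\<Sum>j\<le>J. (real j + 1) * err j)"
    by (simp add: sum_distrib_left mult_ac)
  finally have "(\<Sum>j\<le>J. \<Sum>j'\<le>J. ?u j j') \<le> 42 ^ k * (\<Sum>j\<le>J. \<Sum>j'\<le>J. main_term j j') + cst * (\<Sum>j\<le>J. (real j + 1) * err j)" .
  moreover have "(42::real) ^ k * (\<Sum>j\<le>J. \<Sum>j'\<le>J. main_term j j') \<le> 42 ^ k * (36 * mass J)"
    by (intro mult_left_mono sum_main_term_le) auto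
  ultimately show ?thesis using a by linarith
qed

definition hits :: "nat \<Rightarrow> (nat \<Rightarrow> real) \<Rightarrow> real" where
  "hits J x = (\<Sum>j\<le>J. \<Sum>n\<in>dyadic_block j. \<Sum>l\<in>LL j. \<Prod>i<k. p j (l i) (real n * x i))"

lemma hits_expand:
  "complex_of_real (hits J x - mass J / 2 ^ k)
    = (\<Sum>(j, n, l, m)\<in>(SIGMA j:{..J}. SIGMA n:dyadic_block j. SIGMA l:LL j. freqs j).
        wgt j l m *\<^sub>R character k (\<lambda>i. int n * m i) x)"
proof -
  have one: "complex_of_real (\<Prod>i<k. p j (l i) (real n * x i))
      = (\<Sum>m\<in>freqs j. wgt j l m *\<^sub>R character k (\<lambda>i. int n * m i) x) + of_real (1 / (2 ^ k * 2 ^ L j))"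
    if l: "l \<in> LL j" for j n l
  proof -
    have z: "(\<lambda>_. 0) \<in> ibox k (Y j)" by (simp add: PiE_dflt_def)
    have w0: "wgt j l (\<lambda>_. 0) = 1 / (2 ^ k * 2 ^ L j)"
      unfolding wgt_def c_0 LL_sum[OF l, symmetric] by (simp add: prod_dividef prod.distrib power_sum)
    have "complex_of_real (\<Prod>i<k. p j (l i) (real n * x i))
        = (\<Sum>m\<in>ibox k (Y j). (\<Prod>i<k. c j (l i) (m i)) *\<^sub>R character k (\<lambda>i. int n * m i) x)"
      by (rule prod_trig_polynomial_expand) (use l p_expand in auto)
    also have "\<dots> = wgt j l (\<lambda>_. 0) *\<^sub>R character k (\<lambda>i. int n * 0) x
        + (\<Sum>m\<in>freqs j. wgt j l m *\<^sub>R character k (\<lambda>i. int n * m i) x)"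
      unfolding wgt_def by (rule sum.remove[OF _ z]) simp
    also have "character k (\<lambda>i. int n * 0) x = 1" by (simp add: character_def)
    finally show ?thesis by (simp add: w0 scaleR_conv_of_real)
  qed
  have "complex_of_real (hits J x) = (\<Sum>j\<le>J. \<Sum>n\<in>dyadic_block j. \<Sum>l\<in>LL j.
      (\<Sum>m\<in>freqs j. wgt j l m *\<^sub>R character k (\<lambda>i. int n * m i) x) + of_real (1 / (2 ^ k * 2 ^ L j)))"
    unfolding hits_def of_real_sum by (intro sum.cong refl one)
  also have "\<dots> = (\<Sum>j\<le>J. \<Sum>n\<in>dyadic_block j. \<Sum>l\<in>LL j. \<Sum>m\<in>freqs j. wgt j l m *\<^sub>R character k (\<lambda>i. int n * m i) x)
      + of_real (mass J / 2 ^ k)"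
    by (simp add: sum.distrib mass_def dens_def sum_divide_distrib mult_ac)
  also have "(\<Sum>j\<le>J. \<Sum>n\<in>dyadic_block j. \<Sum>l\<in>LL j. \<Sum>m\<in>freqs j. wgt j l m *\<^sub>R character k (\<lambda>i. int n * m i) x)
     = (\<Sum>(j, n, l, m)\<in>(SIGMA j:{..J}. SIGMA n:dyadic_block j. SIGMA l:LL j. freqs j).
        wgt j l m *\<^sub>R character k (\<lambda>i. int n * m i) x)"
    by (simp add: sum.Sigma finLL split_def)
  finally show ?thesis by simp
qed

lemma variance_le:
  "integrable \<mu> (\<lambda>x. (hits J x - mass J / 2 ^ k)\<^sup>2)"
  "(\<integral>x. (hits J x - mass J / 2 ^ k)\<^sup>2 \<partial>\<mu>) \<le> (\<Sum>j\<le>J. \<Sum>j'\<le>J. cov j j')"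
proof -
  let ?T = "SIGMA j:{..J}. SIGMA n:dyadic_block j. SIGMA l:LL j. freqs j"
  let ?w = "\<lambda>(j, n, l, m). wgt j l m"
  let ?x = "\<lambda>(j, n, l, m). (\<lambda>i. int n * m i)"
  have fin: "finite ?T" by (intro finite_SigmaI) (auto simp: finLL)
  have w: "\<And>t. t \<in> ?T \<Longrightarrow> 0 \<le> ?w t" by (auto simp: wgt_nonneg)
  have ex: "complex_of_real (hits J x - mass J / 2 ^ k) = (\<Sum>t\<in>?T. ?w t *\<^sub>R character k (?x t) x)" for x
    unfolding hits_expand by (intro sum.cong refl) auto
  note I = integral_character_sum_square_le[OF fin w ex]
  show "integrable \<mu> (\<lambda>x. (hits J x - mass J / 2 ^ k)\<^sup>2)" by (rule I(1))
  let ?fc = "\<lambda>n n' m m'. amp (pair_freq n n' m m')"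
  have sum4: "(\<Sum>(j, n, l, m)\<in>?T. f j n l m) = (\<Sum>j\<le>J. \<Sum>n\<in>dyadic_block j. \<Sum>l\<in>LL j. \<Sum>m\<in>freqs j. f j n l m)"
    for f :: "nat \<Rightarrow> nat \<Rightarrow> (nat \<Rightarrow> nat) \<Rightarrow> (nat \<Rightarrow> int) \<Rightarrow> real"
    by (simp add: sum.Sigma finLL split_def)
  have "(\<Sum>t\<in>?T. \<Sum>t'\<in>?T. ?w t * ?w t' * amp (\<lambda>i. ?x t i + ?x t' i))
     = (\<Sum>(j, n, l, m)\<in>?T. \<Sum>(j', n', l', m')\<in>?T. wgt j l m * wgt j' l' m' * ?fc n n' m m')"
    by (simp add: pair_freq_def split_def)
  \<comment> \<open>The interchanges that follow move \<open>j'\<close>, \<open>n'\<close> and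
    \<open>l'\<close> outwards until the order is that of \<open>cov\<close>.\<close>
  also have "\<dots> = (\<Sum>j\<le>J. \<Sum>n\<in>dyadic_block j. \<Sum>l\<in>LL j. \<Sum>m\<in>freqs j.
      \<Sum>j'\<le>J. \<Sum>n'\<in>dyadic_block j'. \<Sum>l'\<in>LL j'. \<Sum>m'\<in>freqs j'. wgt j l m * wgt j' l' m' * ?fc n n' m m')"
    by (simp only: sum4)
  also have "\<dots> = (\<Sum>j\<le>J. \<Sum>n\<in>dyadic_block j. \<Sum>l\<in>LL j. \<Sum>j'\<le>J. \<Sum>m\<in>freqs j.
      \<Sum>n'\<in>dyadic_block j'. \<Sum>l'\<in>LL j'. \<Sum>m'\<in>freqs j'. wgt j l m * wgt j' l' m' * ?fc n n' m m')"
    by (intro sum.cong refl sum.swap)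
  also have "\<dots> = (\<Sum>j\<le>J. \<Sum>n\<in>dyadic_block j. \<Sum>l\<in>LL j. \<Sum>j'\<le>J. \<Sum>n'\<in>dyadic_block j'. \<Sum>m\<in>freqs j.
      \<Sum>l'\<in>LL j'. \<Sum>m'\<in>freqs j'. wgt j l m * wgt j' l' m' * ?fc n n' m m')"
    by (intro sum.cong refl sum.swap)
  also have "\<dots> = (\<Sum>j\<le>J. \<Sum>n\<in>dyadic_block j. \<Sum>l\<in>LL j. \<Sum>j'\<le>J. \<Sum>n'\<in>dyadic_block j'. \<Sum>l'\<in>LL j'. \<Sum>m\<in>freqs j.
      \<Sum>m'\<in>freqs j'. wgt j l m * wgt j' l' m' * ?fc n n' m m')"
    by (intro sum.cong refl sum.swap)
  also have "\<dots> = (\<Sum>j\<le>J. \<Sum>n\<in>dyadic_block j. \<Sum>j'\<le>J. \<Sum>l\<in>LL j. \<Sum>n'\<in>dyadic_block j'. \<Sum>l'\<in>LL j'. \<Sum>m\<in>freqs j.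
      \<Sum>m'\<in>freqs j'. wgt j l m * wgt j' l' m' * ?fc n n' m m')"
    by (intro sum.cong refl sum.swap)
  also have "\<dots> = (\<Sum>j\<le>J. \<Sum>n\<in>dyadic_block j. \<Sum>j'\<le>J. \<Sum>n'\<in>dyadic_block j'. \<Sum>l\<in>LL j. \<Sum>l'\<in>LL j'. \<Sum>m\<in>freqs j.
      \<Sum>m'\<in>freqs j'. wgt j l m * wgt j' l' m' * ?fc n n' m m')"
    by (intro sum.cong refl sum.swap)
  also have "\<dots> = (\<Sum>j\<le>J. \<Sum>j'\<le>J. cov j j')"
    unfolding cov_def by (intro sum.cong refl sum.swap)
  finally show "(\<integral>x. (hits J x - mass J / 2 ^ k)\<^sup>2 \<partial>\<mu>) \<le> (\<Sum>j\<le>J. \<Sum>j'\<le>J. cov j j')"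
    using I(2) by linarith
qed

end

section \<open>Divergence\<close>

lemma summable_poly_times_exp:
  fixes \<zeta> :: real
  assumes "\<zeta> > 0"
  shows "summable (\<lambda>j. (real j + 1) ^ a * 2 powr (- \<zeta> * real j))"
proof (rule summable_comparison_test_bigo)
  show "summable (\<lambda>j. norm (1 / real j ^ 2))"
    using inverse_power_summable[of 2, where ?'a = real] by (simp add: inverse_eq_divide)
  show "(\<lambda>j. (real j + 1) ^ a * 2 powr (- \<zeta> * real j)) \<in> O(\<lambda>j. 1 / real j ^ 2)"
    using assms by real_asymp
qed

lemma partial_sums_at_top:
  fixes f :: "nat \<Rightarrow> real"
  assumes "\<And>j. 0 \<le> f j" "\<not> summable f"
  shows "\<exists>J. B < (\<Sum>j\<le>J. f j)"
proof (rule ccontr)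
  assume "\<nexists>J. B < (\<Sum>j\<le>J. f j)"
  then have "(\<Sum>j\<le>J. f j) \<le> B" for J by (simp add: not_less)
  then have "summable f"
    using assms(1) by (intro bounded_imp_summable[where B = B]) auto
  then show False using assms by simp
qed

context box_family
begin

lemma hits_measurable [measurable]: "hits J \<in> borel_measurable \<mu>"
proof -
  have "hits J = (\<lambda>x. Re (complex_of_real (hits J x - mass J / 2 ^ k)) + mass J / 2 ^ k)" by simp
  also have "\<dots> \<in> borel_measurable \<mu>" unfolding hits_expand split_def by measurable
  finally show ?thesis .
qed

text \<open>The variance is at most linear in \<open>mass J\<close>, whereas Chebyshev's inequality
  divides it by a multiple of the square; the quotient becomes arbitrarily small since
  \<open>mass J\<close> is unbounded. Integral bounds \<open>B\<close> suffice, and they are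
  countably many.\<close>

lemma AE_hits_unbounded:
  assumes err: "summable (\<lambda>j. (real j + 1) * err j)" and div: "\<not> summable (\<lambda>j. 2 ^ j * dens j)"
  shows "AE x in \<mu>. \<forall>B. \<exists>J. B < hits J x"
proof -
  define C1 where "C1 = 72 * (42::real) ^ k"
  define C2 where "C2 = 2 * cst * (\<Sum>j. (real j + 1) * err j)"
  have C: "C1 \<ge> 0" "C2 \<ge> 0"
    using err cst_nonneg err_nonneg by (auto simp: C1_def C2_def intro!: mult_nonneg_nonneg suminf_nonneg)
  have var: "(\<integral>x. (hits J x - mass J / 2 ^ k)\<^sup>2 \<partial>\<mu>) \<le> C1 * mass J + C2" for J
  proof -
    have "(\<Sum>j\<le>J. (real j + 1) * err j) \<le> (\<Sum>j. (real j + 1) * err j)"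
      using err err_nonneg by (intro sum_le_suminf) auto
    then have "2 * cst * (\<Sum>j\<le>J. (real j + 1) * err j) \<le> C2"
      unfolding C2_def using cst_nonneg by (intro mult_left_mono) auto
    then show ?thesis using variance_le(2)[of J] sum_cov_le[of J] unfolding C1_def by linarith
  qed
  have small: "measure \<mu> {x \<in> space \<mu>. \<forall>J. hits J x \<le> B} = 0" for B :: real
  proof -
    let ?N = "{x \<in> space \<mu>. \<forall>J. hits J x \<le> B}"
    have "measure \<mu> ?N \<le> \<epsilon>" if \<epsilon>: "\<epsilon> > 0" for \<epsilon>
    proof -
      \<comment> \<open>Three requirements: \<open>mass J > 1\<close> absorbs the constant
        \<open>C2\<close>, the second puts \<open>B\<close> below half the mean, and the last makes
        Chebyshev's quotient at most \<open>\<epsilon>\<close>.\<close>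
      define G where "G = max (max 1 (2 ^ k * (2 * B))) (4 * 4 ^ k * (C1 + C2) / \<epsilon>)"
      obtain J where J: "G < mass J"
        using partial_sums_at_top[of "\<lambda>j. 2 ^ j * dens j" G] div dens_nonneg unfolding mass_def by auto
      define E where "E = mass J / 2 ^ k"
      have mJ: "mass J > 1" "mass J > 2 ^ k * (2 * B)" "mass J > 4 * 4 ^ k * (C1 + C2) / \<epsilon>"
        using J by (auto simp: G_def)
      have E0: "E > 0" using mJ by (simp add: E_def)
      have EB: "B \<le> E / 2" using mJ by (simp add: E_def field_simps)
      have "measure \<mu> ?N \<le> measure \<mu> {x \<in> space \<mu>. (hits J x - E)\<^sup>2 \<ge> (E / 2)\<^sup>2}"
      proof (rule finite_measure_mono)
        show "?N \<subseteq> {x \<in> space \<mu>. (hits J x - E)\<^sup>2 \<ge> (E / 2)\<^sup>2}"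
        proof
          fix x assume x: "x \<in> ?N"
          then have "hits J x \<le> B" by blast
          then have "hits J x \<le> E / 2" using EB by linarith
          then have "E / 2 \<le> E - hits J x" by simp
          then have "(E / 2)\<^sup>2 \<le> (E - hits J x)\<^sup>2" using E0 by (intro power_mono) auto
          then show "x \<in> {x \<in> space \<mu>. (hits J x - E)\<^sup>2 \<ge> (E / 2)\<^sup>2}" using x by (simp add: power2_commute)
        qed
      qed measurable
      also have "\<dots> \<le> (\<integral>x. (hits J x - E)\<^sup>2 \<partial>\<mu>) / (E / 2)\<^sup>2"
        using variance_le(1)[of J] E0 unfolding E_def
        by (intro integral_Markov_inequality_measure[where A = "{}"]) auto
      also have "\<dots> \<le> (C1 * mass J + C2) / (E / 2)\<^sup>2"
        using var[of J] unfolding E_def by (intro divide_right_mono) auto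
      also have "\<dots> \<le> ((C1 + C2) * mass J) / (E / 2)\<^sup>2"
        using C mJ mult_left_mono[of 1 "mass J" C2] by (intro divide_right_mono) (auto simp: distrib_right)
      also have "\<dots> = 4 * 4 ^ k * (C1 + C2) / mass J"
      proof -
        have "(2::real) ^ k * 2 ^ k = 4 ^ k" by (simp flip: power_mult_distrib)
        then show ?thesis using mJ by (simp add: E_def power2_eq_square field_simps)
      qed
      also have "\<dots> \<le> \<epsilon>"
        using mJ(1,3) \<epsilon> by (simp add: field_simps)
      finally show ?thesis .
    qed
    then have "measure \<mu> ?N \<le> 0" by (rule field_le_epsilon[where y = 0, simplified])
    then show ?thesis by (simp add: order_antisym)
  qed
  have "AE x in \<mu>. \<not> (\<forall>J. hits J x \<le> real B)" for B :: nat
  proof -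
    have "{x \<in> space \<mu>. \<forall>J. hits J x \<le> real B} \<in> null_sets \<mu>"
      using small[of "real B"] by (intro null_setsI) (auto simp: emeasure_eq_measure)
    then show ?thesis by (rule AE_I') auto
  qed
  then have "AE x in \<mu>. \<forall>B::nat. \<not> (\<forall>J. hits J x \<le> real B)" by (simp add: AE_all_countable)
  then show ?thesis
  proof (rule AE_mp, intro AE_I2 impI allI)
    fix x and B :: real assume x: "\<forall>B::nat. \<not> (\<forall>J. hits J x \<le> real B)"
    obtain B' :: nat where "B \<le> real B'" using real_arch_simple by blast
    moreover obtain J where "real B' < hits J x" using x by (meson not_le)
    ultimately show "\<exists>J. B < hits J x" by (intro exI[of _ J]) linarith
  qed
qed

text \<open>If all hits lay below \<open>M\<close>, then from block \<open>M\<close> on every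
  product would contain a factor at most \<open>\<tau> j\<close>, and \<open>hits\<close> would be
  bounded, contrary to what holds almost surely.\<close>

lemma AE_infinitely_many_hits:
  assumes err: "summable (\<lambda>j. (real j + 1) * err j)" and div: "\<not> summable (\<lambda>j. 2 ^ j * dens j)"
    and p: "\<And>l j i y. l \<in> LL j \<Longrightarrow> i < k \<Longrightarrow> 0 \<le> p j (l i) y \<and> p j (l i) y \<le> 4"
    and tail: "\<And>l j i y. l \<in> LL j \<Longrightarrow> i < k \<Longrightarrow> 1 / 2 ^ l i \<le> nint_dist y \<Longrightarrow> p j (l i) y \<le> \<tau> j"
    and \<tau>: "summable (\<lambda>j. 2 ^ j * real (card (LL j)) * \<tau> j)" "\<And>j. 0 \<le> \<tau> j"
  shows "AE x in \<mu>. infinite (box_times k LL x)"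
  using AE_hits_unbounded[OF err div]
proof (rule AE_mp, intro AE_I2 impI)
  fix x assume unb: "\<forall>B. \<exists>J. B < hits J x"
  let ?H = "(box_times k LL x)"
  show "infinite ?H"
  proof
    assume "finite ?H"
    then obtain M where M: "\<And>n. n \<in> ?H \<Longrightarrow> n < M" using finite_nat_set_iff_bounded[of ?H] by auto
    have le4: "(\<Prod>i<k. p j (l i) (y i)) \<le> 4 ^ k" if "l \<in> LL j" for j l and y :: "nat \<Rightarrow> real"
    proof -
      have "(\<Prod>i<k. p j (l i) (y i)) \<le> (\<Prod>i<k. 4)" using p[OF that] by (intro prod_mono) auto
      then show ?thesis by simp
    qed
    have le\<tau>: "(\<Prod>i<k. p j (l i) (real n * x i)) \<le> 4 ^ k * \<tau> j"
      if l: "l \<in> LL j" and n: "n \<in> dyadic_block j" and j: "M \<le> j" for j l n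
    proof -
      \<comment> \<open>\<open>M\<close> bounds the hits as integers and serves as a bound for block
        indices as well, since \<open>n \<ge> 2 ^ j > j\<close>.\<close>
      have "j < 2 ^ j" by simp
      also have "2 ^ j \<le> n" using n by (simp add: dyadic_block_def)
      finally have "n \<notin> ?H" using M[of n] j by linarith
      then obtain i where i: "i < k" "1 / 2 ^ l i \<le> nint_dist (real n * x i)"
        using l n by (auto simp: not_less)
      have "(\<Prod>i<k. p j (l i) (real n * x i)) = p j (l i) (real n * x i) * (\<Prod>i\<in>{..<k} - {i}. p j (l i) (real n * x i))"
        using i by (intro prod.remove) auto
      also have "\<dots> \<le> \<tau> j * (\<Prod>i\<in>{..<k} - {i}. 4)"
        using p[OF l] tail[OF l i] \<tau>(2) by (intro mult_mono prod_mono prod_nonneg) auto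
      also have "\<dots> = \<tau> j * 4 ^ (k - 1)" using i by simp
      also have "\<dots> \<le> \<tau> j * 4 ^ k" using \<tau>(2) by (intro mult_left_mono power_increasing) auto
      finally show ?thesis by (simp add: mult.commute)
    qed
    define A where "A = (\<Sum>j<M. 2 ^ j * real (card (LL j)) * 4 ^ k)"
    define T where "T = (\<Sum>j. 2 ^ j * real (card (LL j)) * \<tau> j)"
    have "hits J x \<le> A + 4 ^ k * T" for J
    proof -
      let ?u = "\<lambda>j. if j < M then 2 ^ j * real (card (LL j)) * 4 ^ k else 0"
      let ?v = "\<lambda>j. 2 ^ j * real (card (LL j)) * \<tau> j"
      have "hits J x \<le> (\<Sum>j\<le>J. ?u j + 4 ^ k * ?v j)"
        unfolding hits_def
      proof (rule sum_mono)
        fix j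
        show "(\<Sum>n\<in>dyadic_block j. \<Sum>l\<in>LL j. \<Prod>i<k. p j (l i) (real n * x i)) \<le> ?u j + 4 ^ k * ?v j"
        proof (cases "j < M")
          case True
          have "(\<Sum>n\<in>dyadic_block j. \<Sum>l\<in>LL j. \<Prod>i<k. p j (l i) (real n * x i)) \<le> (\<Sum>n\<in>dyadic_block j. \<Sum>l\<in>LL j. 4 ^ k)"
            by (intro sum_mono le4)
          moreover have "0 \<le> 4 ^ k * ?v j" using \<tau>(2) by simp
          ultimately show ?thesis using True by simp
        next
          case False
          have "(\<Sum>n\<in>dyadic_block j. \<Sum>l\<in>LL j. \<Prod>i<k. p j (l i) (real n * x i)) \<le> (\<Sum>n\<in>dyadic_block j. \<Sum>l\<in>LL j. 4 ^ k * \<tau> j)"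
            using False by (intro sum_mono le\<tau>) auto
          then show ?thesis using False by (simp add: mult_ac)
        qed
      qed
      also have "\<dots> = (\<Sum>j\<le>J. ?u j) + 4 ^ k * (\<Sum>j\<le>J. ?v j)"
        by (simp add: sum.distrib sum_distrib_left)
      also have "\<dots> \<le> A + 4 ^ k * T"
      proof (intro add_mono mult_left_mono)
        have "(\<Sum>j\<le>J. ?u j) = (\<Sum>j\<in>{..J} \<inter> {..<M}. 2 ^ j * real (card (LL j)) * 4 ^ k)"
          by (simp add: sum.If_cases lessThan_def)
        also have "\<dots> \<le> A" unfolding A_def by (intro sum_mono2) auto
        finally show "(\<Sum>j\<le>J. ?u j) \<le> A" .
        show "(\<Sum>j\<le>J. ?v j) \<le> T" unfolding T_def using \<tau> by (intro sum_le_suminf) auto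
      qed simp
      finally show ?thesis .
    qed
    then show False using unb by (meson not_le)
  qed
qed

end

lemma ibox_eq_freq_box: "ibox k N = freq_box k (real N)"
proof -
  have "\<bar>real_of_int t\<bar> \<le> real N \<longleftrightarrow> t \<in> {- int N..int N}" for t
  proof -
    have "\<bar>real_of_int t\<bar> \<le> real N \<longleftrightarrow> real_of_int \<bar>t\<bar> \<le> real_of_int (int N)" by simp
    then show ?thesis by (simp only: of_int_le_iff abs_le_iff) auto
  qed
  then show ?thesis by (auto simp: PiE_dflt_def freq_box_def)
qed

lemma card_bounded_vectors_le:
  assumes "\<And>l i. l \<in> LL \<Longrightarrow> i < k \<Longrightarrow> l i \<le> (j::nat)" "\<And>l i. l \<in> LL \<Longrightarrow> k \<le> i \<Longrightarrow> l i = (0::nat)"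
  shows "real (card LL) \<le> (real j + 1) ^ k"
proof -
  have "LL \<subseteq> PiE_dflt {..<k} 0 (\<lambda>_. {..j})"
  proof
    fix l assume "l \<in> LL"
    then show "l \<in> PiE_dflt {..<k} 0 (\<lambda>_. {..j})" using assms by (auto simp: PiE_dflt_def)
  qed
  then have "card LL \<le> card (PiE_dflt {..<k} (0::nat) (\<lambda>_. {..j}))" by (intro card_mono finite_PiE_dflt) auto
  also have "\<dots> = (j + 1) ^ k" by (subst card_PiE_dflt) auto
  finally have "real (card LL) \<le> real ((j + 1) ^ k)" by (rule of_nat_mono)
  then show ?thesis by (simp add: add.commute)
qed

context cube_measure
begin

text \<open>A choice of parameters for \<open>box_family\<close>. One \<open>\<eta>\<close> is
  allowed to the box exponents and another to the kernels through \<open>R j\<close>, about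
  \<open>2 powr (\<eta> * j)\<close>; so \<open>Y j\<close> is about
  \<open>2 powr (\<theta> * j)\<close> with \<open>\<theta> = 1 / k + 2 * \<eta>\<close>, and the
  two inequalities on \<open>\<eta>\<close> make the two parts of \<open>err\<close> exponentially
  small.\<close>

theorem AE_boxes_divergence:
  fixes \<kappa> \<eta> C0 :: real and LL :: "nat \<Rightarrow> (nat \<Rightarrow> nat) set" and L :: "nat \<Rightarrow> nat"
  assumes k2: "k \<ge> 2" and \<kappa>: "\<kappa> > 0" and C0: "\<And>Q. Q \<ge> 1 \<Longrightarrow> (\<Sum>\<xi>\<in>freq_box k Q. amp \<xi>) \<le> C0 * Q powr \<kappa>"
    and \<eta>: "\<eta> > 0" "(1 / real k + 2 * \<eta>) * (1 + \<kappa>) + \<kappa> < 1" "(1 / real k + 2 * \<eta>) * (real k - 1) < 1"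
    and finLL: "\<And>j. finite (LL j)" and LL_sum: "\<And>l j. l \<in> LL j \<Longrightarrow> (\<Sum>i<k. l i) = L j"
    and LL_supp: "\<And>l j i. l \<in> LL j \<Longrightarrow> k \<le> i \<Longrightarrow> l i = 0"
    and LL_le: "\<And>l j i. l \<in> LL j \<Longrightarrow> i < k \<Longrightarrow> real (l i) \<le> (1 / real k + \<eta>) * real j"
    and jL: "\<And>j. j \<le> L j" and div: "\<not> summable (\<lambda>j. 2 ^ j * (real (card (LL j)) / 2 ^ L j))"
  shows "AE x in \<mu>. infinite (box_times k LL x)"
proof -
  define \<theta> where "\<theta> = 1 / real k + 2 * \<eta>"
  have \<theta>0: "\<theta> > 0" using \<eta>(1) by (simp add: \<theta>_def add_nonneg_pos)
  have \<theta>1: "\<theta> < 1"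
  proof -
    have "\<theta> * 1 \<le> \<theta> * (1 + \<kappa>)" using \<theta>0 \<kappa> by (intro mult_left_mono) auto
    then show ?thesis using \<eta>(2) \<kappa> by (simp add: \<theta>_def)
  qed
  \<comment> \<open>Off the box a kernel is at most a constant times
    \<open>R j powr (1 - 2 * r)\<close>; this \<open>r\<close> makes it
    \<open>O(2 powr (- 3 * j))\<close>, more than enough against \<open>2 ^ j\<close> dilates and
    polynomially many boxes.\<close>
  obtain r :: nat where r: "real r \<ge> 2 / \<eta> + 1" using real_arch_simple by blast
  have r1: "r \<ge> 1"
  proof -
    have "0 < 2 / \<eta>" using \<eta>(1) by simp
    then have "real r \<ge> 1" using r by linarith
    then show ?thesis by simp
  qed
  have r3: "\<eta> * (2 * real r - 1) \<ge> 3"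
  proof -
    have "\<eta> * (4 / \<eta> + 1) \<le> \<eta> * (2 * real r - 1)" using r \<eta>(1) by (intro mult_left_mono) auto
    moreover have "\<eta> * (4 / \<eta> + 1) = 4 + \<eta>" using \<eta>(1) by (simp add: field_simps)
    ultimately show ?thesis using \<eta>(1) by linarith
  qed
  define R where "R j = nat \<lfloor>2 powr (\<eta> * real j)\<rfloor>" for j
  have R_ge1: "1 \<le> 2 powr (\<eta> * real j)" for j using \<eta>(1) by (intro ge_one_powr_ge_zero) auto
  have R1: "R j \<ge> 1" for j using R_ge1[of j] unfolding R_def by (simp add: le_nat_floor)
  have R_le: "real (R j) \<le> 2 powr (\<eta> * real j)" for j unfolding R_def by simp
  have R_ge: "2 powr (\<eta> * real j) / 2 \<le> real (R j)" for j
    using R_ge1[of j] R1[of j] unfolding R_def by linarith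
  have "\<exists>c p. \<forall>s. concentrated s (R j) r (c s) (p s)" for j
    using concentrated_kernel[OF R1[of j] r1] by metis
  then obtain c p where ker: "\<And>j s. concentrated s (R j) r (c j s) (p j s)" by metis
  have cp: "\<And>j s m. 0 \<le> c j s m" "\<And>j s. c j s 0 = 1 / (2 * 2 ^ s)" "\<And>j s m. c j s m \<le> 1 / 2 ^ s"
      "\<And>j s m. m \<noteq> 0 \<Longrightarrow> c j s m \<le> 2 ^ s / (real_of_int m)\<^sup>2"
      "\<And>j s m. int (r * 2 ^ s * R j) < \<bar>m\<bar> \<Longrightarrow> c j s m = 0"
      "\<And>j s y. complex_of_real (p j s y) = (\<Sum>m\<in>{- int (r * 2 ^ s * R j)..int (r * 2 ^ s * R j)}. c j s m *\<^sub>R ee (- of_int m * y))"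
      "\<And>j s y. 0 \<le> p j s y" "\<And>j s y. p j s y \<le> 4"
      "\<And>j s y. 1 / 2 ^ s \<le> nint_dist y \<Longrightarrow> p j s y \<le> real r * real (R j) / real (R j) ^ (2 * r)"
    using ker unfolding concentrated_def by auto
  define Y where "Y j = nat \<lceil>real r * 2 powr (\<theta> * real j)\<rceil>" for j
  have Yge: "real r * 2 powr (\<theta> * real j) \<le> real (Y j)" for j unfolding Y_def by (rule real_nat_ceiling_ge)
  have Yge1: "1 \<le> 2 powr (\<theta> * real j)" for j using \<theta>0 by (intro ge_one_powr_ge_zero) auto
  have rYge1: "1 \<le> real r * 2 powr (\<theta> * real j)" for j using mult_mono[of 1 "real r" 1 "2 powr (\<theta> * real j)"] Yge1[of j] r1 by simp
  have Yle: "real (Y j) \<le> 2 * real r * 2 powr (\<theta> * real j)" for j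
  proof -
    have "0 \<le> \<lceil>real r * 2 powr (\<theta> * real j)\<rceil>" using rYge1[of j] by linarith
    then have "real (Y j) \<le> real r * 2 powr (\<theta> * real j) + 1" unfolding Y_def by linarith
    then show ?thesis using rYge1[of j] by linarith
  qed
  have Y1: "1 \<le> Y j" for j
  proof -
    have "1 \<le> real (Y j)" using Yge[of j] rYge1[of j] by linarith
    then show ?thesis by simp
  qed
  have Ymono: "mono Y"
    unfolding Y_def using \<theta>0
    by (intro monoI nat_mono ceiling_mono mult_left_mono powr_mono) auto
  have deg: "r * 2 ^ l i * R j \<le> Y j" if "l \<in> LL j" "i < k" for l i j
  proof -
    have "(2::real) ^ l i = 2 powr real (l i)" by (simp add: powr_realpow)
    also have "\<dots> \<le> 2 powr ((1 / real k + \<eta>) * real j)" using LL_le[OF that] by (intro powr_mono) auto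
    finally have "real r * 2 ^ l i * real (R j) \<le> real r * 2 powr ((1 / real k + \<eta>) * real j) * 2 powr (\<eta> * real j)"
      using R_le[of j] by (intro mult_mono) auto
    also have "\<dots> = real r * 2 powr (\<theta> * real j)"
      by (simp add: \<theta>_def mult.assoc powr_add[symmetric] algebra_simps)
    also have "\<dots> \<le> real (Y j)" by (rule Yge)
    finally have "real (r * 2 ^ l i * R j) \<le> real (Y j)" by simp
    then show ?thesis by (simp only: of_nat_le_iff)
  qed
  have LL_Y: "2 ^ l i \<le> Y j" if "l \<in> LL j" "i < k" for l i j
  proof -
    have "1 * 2 ^ l i * 1 \<le> r * 2 ^ l i * R j" using r1 R1 by (intro mult_mono) auto
    then show ?thesis using deg[OF that] by linarith
  qed
  have p_expand: "complex_of_real (p j (l i) y) = (\<Sum>m\<in>{- int (Y j)..int (Y j)}. c j (l i) m *\<^sub>R ee (- of_int m * y))"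
    if "l \<in> LL j" "i < k" for l i j y
    unfolding cp(6) using deg[OF that] by (intro sum.mono_neutral_left) (auto simp del: of_nat_mult intro!: cp(5))
  have lj: "l i \<le> j" if "l \<in> LL j" "i < k" for l i j
  proof -
    have "1 / real k + \<eta> \<le> 1" using \<theta>1 \<eta>(1) by (simp add: \<theta>_def)
    then have "(1 / real k + \<eta>) * real j \<le> 1 * real j" by (intro mult_right_mono) auto
    then show ?thesis using LL_le[OF that] by simp
  qed
  define K where "K j = (real j + 1) ^ k" for j :: nat
  have K: "real (card (LL j)) \<le> K j'" if "j \<le> j'" for j j'
  proof -
    have "real (card (LL j)) \<le> (real j + 1) ^ k" by (rule card_bounded_vectors_le) (use lj LL_supp in auto)
    also have "\<dots> \<le> K j'" unfolding K_def using that by (intro power_mono) auto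
    finally show ?thesis .
  qed
  \<comment> \<open>\<open>z\<close> is the exponential gain in \<open>err\<close> before divisor
    bounds. With \<open>\<epsilon> = z / 8\<close> and frequencies below a constant times
    \<open>2 powr (2 * j)\<close>, the factor \<open>(V j)\<^sup>2\<close> costs half of it.\<close>
  define z where "z = 1 - max (\<theta> * (1 + \<kappa>) + \<kappa>) (\<theta> * (real k - 1))"
  have z0: "z > 0" using \<eta>(2,3) by (simp add: z_def \<theta>_def)
  define \<epsilon> where "\<epsilon> = z / 8"
  have \<epsilon>0: "\<epsilon> > 0" using z0 by (simp add: \<epsilon>_def)
  obtain Cd where Cd: "Cd \<ge> 1" "\<And>n::nat. n > 0 \<Longrightarrow> real (card {d. d dvd n}) \<le> Cd * real n powr \<epsilon>"
    using divisor_bound[OF \<epsilon>0] by metis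
  define X where "X j = 4 * 2 ^ j * real (Y j)" for j
  have X1: "X j \<ge> 1" for j
  proof -
    have "(1::real) \<le> 2 ^ j" by (rule one_le_power) simp
    then have "1 \<le> 4 * (2::real) ^ j" by linarith
    then have "1 * 1 \<le> (4 * 2 ^ j) * real (Y j)"
      using Y1[of j] by (intro mult_mono) auto
    then show ?thesis by (simp add: X_def)
  qed
  have Xle: "X j \<le> 8 * real r * 2 powr ((1 + \<theta>) * real j)" for j
  proof -
    have "X j \<le> 4 * 2 ^ j * (2 * real r * 2 powr (\<theta> * real j))" unfolding X_def by (intro mult_left_mono Yle) auto
    also have "\<dots> = 8 * real r * (2 powr real j * 2 powr (\<theta> * real j))" by (simp add: powr_realpow)
    also have "2 powr real j * 2 powr (\<theta> * real j) = 2 powr ((1 + \<theta>) * real j)"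
      by (simp add: powr_add[symmetric] algebra_simps)
    finally show ?thesis .
  qed
  define V where "V j = Cd * X j powr \<epsilon>" for j
  define F where "F j = C0 * X j powr \<kappa>" for j
  have V1: "1 \<le> V j" for j
    unfolding V_def using Cd(1) X1[of j] \<epsilon>0 mult_mono[of 1 Cd 1 "X j powr \<epsilon>"] by (simp add: ge_one_powr_ge_zero)
  have V: "real (card {d. d dvd nat \<bar>h\<bar>}) \<le> V j" if h: "h \<noteq> 0" "\<bar>h\<bar> \<le> 4 * 2 ^ j * int (Y j)" for h j
  proof -
    have "real (card {d. d dvd nat \<bar>h\<bar>}) \<le> Cd * real (nat \<bar>h\<bar>) powr \<epsilon>" using h by (intro Cd(2)) auto
    also have "\<dots> \<le> Cd * X j powr \<epsilon>"
    proof (intro mult_left_mono powr_mono2)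
      have "real_of_int \<bar>h\<bar> \<le> real_of_int (4 * 2 ^ j * int (Y j))" using h(2) by (simp only: of_int_le_iff)
      then show "real (nat \<bar>h\<bar>) \<le> X j" by (simp add: X_def)
    qed (use \<epsilon>0 Cd(1) in auto)
    finally show ?thesis by (simp add: V_def)
  qed
  have F: "(\<Sum>\<xi>\<in>ibox k (4 * 2 ^ j * Y j). amp \<xi>) \<le> F j" for j
  proof -
    have "real (4 * 2 ^ j * Y j) = X j" by (simp add: X_def)
    then show ?thesis unfolding ibox_eq_freq_box F_def using C0[OF X1[of j]] by simp
  qed
  define Q where "Q = (2 * real r) ^ (k - 1)"
  have Q1: "1 \<le> Q" unfolding Q_def using r1 by (intro one_le_power) auto
  have Ypow: "real (Y j) ^ (k - 1) \<le> Q * 2 powr (\<theta> * (real k - 1) * real j)" for j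
  proof -
    have "real (Y j) ^ (k - 1) \<le> (2 * real r * 2 powr (\<theta> * real j)) ^ (k - 1)" by (intro power_mono Yle) auto
    also have "\<dots> = Q * 2 powr (\<theta> * (real k - 1) * real j)"
      using k2 by (simp add: Q_def power_mult_distrib powr_power of_nat_diff mult_ac)
    finally show ?thesis .
  qed
  have YQ: "real (Y j) ^ (k - 1) \<le> Q * 2 ^ j" for j
  proof -
    have "\<theta> * (real k - 1) * real j \<le> 1 * real j" using \<eta>(3) by (intro mult_right_mono) (auto simp: \<theta>_def)
    then have "2 powr (\<theta> * (real k - 1) * real j) \<le> 2 powr (real j)" by (intro powr_mono) auto
    also have "\<dots> = 2 ^ j" by (simp add: powr_realpow)
    finally have "Q * 2 powr (\<theta> * (real k - 1) * real j) \<le> Q * 2 ^ j" using Q1 by (intro mult_left_mono) auto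
    then show ?thesis using Ypow[of j] by linarith
  qed
  interpret B: box_family k \<mu> LL L Y c p K V F Q
    by unfold_locales
      (use k2 finLL LL_sum LL_supp LL_Y jL Y1 Ymono cp(1-4) p_expand K V V1 F Q1 YQ in auto)
  define \<tau> where "\<tau> j = real r * real (R j) / real (R j) ^ (2 * r)" for j
  have \<tau>0: "0 \<le> \<tau> j" for j by (simp add: \<tau>_def)
  have \<tau>le: "\<tau> j \<le> real r * 2 ^ (2 * r - 1) * 2 powr (- 3 * real j)" for j
  proof -
    have R0: "real (R j) > 0" using R1[of j] by simp
    have "2 powr (3 * real j) \<le> 2 powr (\<eta> * real j * real (2 * r - 1))"
    proof (rule powr_mono)
      have "3 * real j \<le> (\<eta> * (2 * real r - 1)) * real j" using r3 by (intro mult_right_mono) auto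
      then show "3 * real j \<le> \<eta> * real j * real (2 * r - 1)" using r1 by (simp add: of_nat_diff mult_ac)
    qed simp
    also have "\<dots> = (2 powr (\<eta> * real j)) ^ (2 * r - 1)" by (simp add: powr_power mult.commute)
    also have "\<dots> \<le> (2 * real (R j)) ^ (2 * r - 1)" using R_ge[of j] by (intro power_mono) auto
    also have "\<dots> = 2 ^ (2 * r - 1) * real (R j) ^ (2 * r - 1)" by (rule power_mult_distrib)
    finally have a: "2 powr (3 * real j) \<le> 2 ^ (2 * r - 1) * real (R j) ^ (2 * r - 1)" .
    have "2 * r = Suc (2 * r - 1)" using r1 by simp
    then have "real (R j) ^ (2 * r) = real (R j) ^ (2 * r - 1) * real (R j)" by (metis power_Suc2)
    then have "\<tau> j = real r / real (R j) ^ (2 * r - 1)" using R0 by (simp add: \<tau>_def)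
    also have "\<dots> \<le> real r * (2 ^ (2 * r - 1) / 2 powr (3 * real j))"
    proof -
      have "1 / real (R j) ^ (2 * r - 1) \<le> 2 ^ (2 * r - 1) / 2 powr (3 * real j)"
        using a R0 by (simp add: field_simps)
      then have "real r * (1 / real (R j) ^ (2 * r - 1)) \<le> real r * (2 ^ (2 * r - 1) / 2 powr (3 * real j))"
        by (rule mult_left_mono) simp
      then show ?thesis by simp
    qed
    finally show ?thesis by (simp add: powr_minus field_simps)
  qed
  have sum\<tau>: "summable (\<lambda>j. 2 ^ j * real (card (LL j)) * \<tau> j)"
  proof (rule summable_comparison_test')
    show "summable (\<lambda>j. real r * 2 ^ (2 * r - 1) * ((real j + 1) ^ k * 2 powr (- 2 * real j)))"
      by (intro summable_mult summable_poly_times_exp) simp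
    show "norm (2 ^ j * real (card (LL j)) * \<tau> j) \<le> real r * 2 ^ (2 * r - 1) * ((real j + 1) ^ k * 2 powr (- 2 * real j))"
      if "j \<ge> 0" for j
    proof -
      have "2 ^ j * real (card (LL j)) * \<tau> j \<le> 2 powr real j * (real j + 1) ^ k * (real r * 2 ^ (2 * r - 1) * 2 powr (- 3 * real j))"
        using K[of j j] \<tau>0[of j] \<tau>le[of j] by (intro mult_mono) (auto simp: powr_realpow K_def)
      also have "\<dots> = real r * 2 ^ (2 * r - 1) * ((real j + 1) ^ k * (2 powr real j * 2 powr (- 3 * real j)))"
        by (simp only: mult_ac)
      also have "2 powr real j * 2 powr (- 3 * real j) = 2 powr (- 2 * real j)"
        by (simp add: powr_add[symmetric])
      finally show ?thesis using \<tau>0[of j] by simp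
    qed
  qed
  have sumerr: "summable (\<lambda>j. (real j + 1) * B.err j)"
  proof -
    have C0_nonneg: "0 \<le> C0"
    proof -
      have "0 \<le> F 0" by (rule B.F0)
      then show ?thesis using X1[of 0] by (simp add: F_def zero_le_mult_iff)
    qed
    define P where "P = 8 * real r"
    define D where "D = Cd\<^sup>2 * (P powr \<epsilon>)\<^sup>2 * (2 * real r * C0 * P powr \<kappa> + Q)"
    have P0: "P > 0" using r1 by (simp add: P_def)
    have Xpow: "X j powr e \<le> P powr e * 2 powr ((1 + \<theta>) * e * real j)" if "e \<ge> 0" for e j
    proof -
      have "X j powr e \<le> (P * 2 powr ((1 + \<theta>) * real j)) powr e"
        unfolding P_def using X1[of j] that by (intro powr_mono2 Xle) auto
      also have "\<dots> = P powr e * 2 powr ((1 + \<theta>) * real j * e)" using P0 by (simp add: powr_mult powr_powr)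
      finally show ?thesis by (simp add: mult_ac)
    qed
    have bound: "B.err j \<le> D * ((real j + 1) ^ (2 * k) * 2 powr (- (z / 2) * real j))" for j
    proof -
      have YF: "real (Y j) * F j \<le> 2 * real r * C0 * P powr \<kappa> * 2 powr ((1 - z) * real j)"
      proof -
        have "real (Y j) * F j \<le> (2 * real r * 2 powr (\<theta> * real j)) * (C0 * (P powr \<kappa> * 2 powr ((1 + \<theta>) * \<kappa> * real j)))"
          unfolding F_def using C0_nonneg \<kappa> by (intro mult_mono Yle mult_left_mono Xpow) auto
        also have "\<dots> = 2 * real r * C0 * P powr \<kappa> * (2 powr (\<theta> * real j) * 2 powr ((1 + \<theta>) * \<kappa> * real j))"
          by (simp only: mult_ac)
        also have "2 powr (\<theta> * real j) * 2 powr ((1 + \<theta>) * \<kappa> * real j) = 2 powr ((\<theta> * (1 + \<kappa>) + \<kappa>) * real j)"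
          by (simp add: powr_add[symmetric] algebra_simps)
        also have "2 * real r * C0 * P powr \<kappa> * \<dots> \<le> 2 * real r * C0 * P powr \<kappa> * 2 powr ((1 - z) * real j)"
          using C0_nonneg by (intro mult_left_mono powr_mono mult_right_mono) (auto simp: z_def)
        finally show ?thesis .
      qed
      have Yk: "real (Y j) ^ (k - 1) \<le> Q * 2 powr ((1 - z) * real j)"
      proof -
        have "Q * 2 powr (\<theta> * (real k - 1) * real j) \<le> Q * 2 powr ((1 - z) * real j)"
          using Q1 by (intro mult_left_mono powr_mono mult_right_mono) (auto simp: z_def)
        then show ?thesis using Ypow[of j] by linarith
      qed
      have "V j \<le> Cd * (P powr \<epsilon> * 2 powr ((1 + \<theta>) * \<epsilon> * real j))"
        unfolding V_def using Cd(1) \<epsilon>0 by (intro mult_left_mono Xpow) auto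
      also have "\<dots> \<le> Cd * (P powr \<epsilon> * 2 powr ((z / 4) * real j))"
        using Cd(1) \<epsilon>0 \<theta>1 \<theta>0 z0
        by (intro mult_left_mono powr_mono mult_right_mono) (auto simp: \<epsilon>_def)
      finally have "(V j)\<^sup>2 \<le> (Cd * (P powr \<epsilon> * 2 powr ((z / 4) * real j)))\<^sup>2" using V1[of j] by (intro power_mono) auto
      also have "\<dots> = Cd\<^sup>2 * (P powr \<epsilon>)\<^sup>2 * 2 powr ((z / 2) * real j)"
        by (simp add: power_mult_distrib powr_power)
      finally have V2: "(V j)\<^sup>2 \<le> Cd\<^sup>2 * (P powr \<epsilon>)\<^sup>2 * 2 powr ((z / 2) * real j)" .
      have "(K j)\<^sup>2 * (V j)\<^sup>2 * (real (Y j) * F j + real (Y j) ^ (k - 1))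
          \<le> (real j + 1) ^ (2 * k) * (Cd\<^sup>2 * (P powr \<epsilon>)\<^sup>2 * 2 powr ((z / 2) * real j))
             * ((2 * real r * C0 * P powr \<kappa> + Q) * 2 powr ((1 - z) * real j))"
      proof (intro mult_mono V2)
        show "(K j)\<^sup>2 \<le> (real j + 1) ^ (2 * k)" by (simp add: K_def power_mult[symmetric] mult.commute)
        show "real (Y j) * F j + real (Y j) ^ (k - 1) \<le> (2 * real r * C0 * P powr \<kappa> + Q) * 2 powr ((1 - z) * real j)"
          using YF Yk by (simp add: distrib_right)
      qed (auto intro!: add_nonneg_nonneg mult_nonneg_nonneg B.F0)
      also have "\<dots> = D * ((real j + 1) ^ (2 * k) * (2 powr ((z / 2) * real j) * 2 powr ((1 - z) * real j)))"
        by (simp only: D_def mult_ac)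
      also have "2 powr ((z / 2) * real j) * 2 powr ((1 - z) * real j) = 2 powr (- (z / 2) * real j) * 2 ^ j"
        by (simp add: powr_add[symmetric] powr_realpow[symmetric] algebra_simps)
      finally show ?thesis unfolding B.err_def by (simp add: field_simps)
    qed
    show ?thesis
    proof (rule summable_comparison_test')
      show "summable (\<lambda>j. D * ((real j + 1) ^ (2 * k + 1) * 2 powr (- (z / 2) * real j)))"
        using z0 by (intro summable_mult summable_poly_times_exp) simp
      show "norm ((real j + 1) * B.err j) \<le> D * ((real j + 1) ^ (2 * k + 1) * 2 powr (- (z / 2) * real j))" if "j \<ge> 0" for j
      proof -
        have "(real j + 1) * B.err j \<le> (real j + 1) * (D * ((real j + 1) ^ (2 * k) * 2 powr (- (z / 2) * real j)))"
          by (intro mult_left_mono bound) auto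
        then show ?thesis using B.err_nonneg[of j] by (simp add: mult_ac)
      qed
    qed
  qed
  show ?thesis
  proof (rule B.AE_infinitely_many_hits[OF sumerr _ _ _ sum\<tau> \<tau>0])
    show "\<not> summable (\<lambda>j. 2 ^ j * B.dens j)" using div by (simp add: B.dens_def)
    show "0 \<le> p j (l i) y \<and> p j (l i) y \<le> 4" for j l i y using cp(7,8) by blast
    show "p j (l i) y \<le> \<tau> j" if "1 / 2 ^ l i \<le> nint_dist y" for j l i y
      unfolding \<tau>_def using that by (rule cp(9))
  qed
qed

end

section \<open>Convergence\<close>

context cube_measure
begin

lemma box_measurable: "{x \<in> space \<mu>. \<forall>i<k. nint_dist (real n * x i) \<le> 1 / 2 ^ l i} \<in> sets \<mu>"
  by measurable

text \<open>Borel-Cantelli is applied to whole blocks, so that the first moment averages over all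
  dilates of a block. The measure of a block is at most a multiple of its Lebesgue size plus an
  exponentially small error; \<open>LL_le\<close> keeps the frequencies polynomial in
  \<open>2 ^ j\<close>, as the divisor bound requires.\<close>

theorem AE_boxes_convergence:
  fixes LL :: "nat \<Rightarrow> (nat \<Rightarrow> nat) set" and L :: "nat \<Rightarrow> nat" and \<zeta> C :: real
  assumes finLL: "\<And>j. finite (LL j)" and LL_sum: "\<And>l j. l \<in> LL j \<Longrightarrow> (\<Sum>i<k. l i) = L j"
    and LL_le: "\<And>l j i. l \<in> LL j \<Longrightarrow> i < k \<Longrightarrow> l i \<le> 3 * j + 3"
    and \<zeta>: "\<zeta> > 0" and C: "\<And>l j. l \<in> LL j \<Longrightarrow>
      (\<Sum>\<xi>\<in>dilated_box k (2 ^ j) l. amp \<xi>)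
        \<le> C * 2 powr ((1 - \<zeta>) * real j)"
    and conv: "summable (\<lambda>j. 2 ^ j * (real (card (LL j)) / 2 ^ L j))"
  shows "AE x in \<mu>. finite (closed_box_times k LL x)"
proof -
  define E where "E n l = {x \<in> space \<mu>. \<forall>i<k. nint_dist (real n * x i) \<le> 1 / 2 ^ l i}" for n l
  have E_meas: "E n l \<in> sets \<mu>" for n l unfolding E_def by (rule box_measurable)
  define U where "U j = (\<Union>l\<in>LL j. \<Union>n\<in>dyadic_block j. E n l)" for j
  have U_meas: "U j \<in> sets \<mu>" for j
    unfolding U_def by (intro sets.finite_UN finLL finite_dyadic_block E_meas)
  define \<epsilon> where "\<epsilon> = \<zeta> / 8"
  have \<epsilon>0: "\<epsilon> > 0" using \<zeta> by (simp add: \<epsilon>_def)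
  obtain Cd where Cd: "Cd \<ge> 1" "\<And>n::nat. n > 0 \<Longrightarrow> real (card {d. d dvd n}) \<le> Cd * real n powr \<epsilon>"
    using divisor_bound[OF \<epsilon>0] by metis
  define V where "V j = Cd * 2 powr (\<epsilon> * (4 * real j + 4))" for j :: nat
  have V: "real (card {d. d dvd nat \<bar>h\<bar>}) \<le> V j"
    if "l \<in> LL j" "i < k" "h \<noteq> 0" "\<bar>h\<bar> \<le> 2 * int (2 ^ j) * 2 ^ l i" for l j i and h :: int
  proof -
    have "\<bar>h\<bar> \<le> 2 ^ (4 * j + 4)"
    proof -
      have "2 * int (2 ^ j) * 2 ^ l i = (2::int) ^ (1 + j + l i)" by (simp add: power_add)
      also have "\<dots> \<le> 2 ^ (4 * j + 4)" using LL_le[OF that(1,2)] by (intro power_increasing) auto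
      finally show ?thesis using that(4) by linarith
    qed
    then have h: "real (nat \<bar>h\<bar>) \<le> 2 powr (4 * real j + 4)"
    proof -
      assume "\<bar>h\<bar> \<le> 2 ^ (4 * j + 4)"
      then have "real_of_int \<bar>h\<bar> \<le> real_of_int (2 ^ (4 * j + 4))" by (simp only: of_int_le_iff)
      also have "\<dots> = 2 ^ (4 * j + 4)" by simp
      also have "\<dots> = 2 powr real (4 * j + 4)" by (rule powr_realpow[symmetric]) simp
      finally show ?thesis by simp
    qed
    have "real (card {d. d dvd nat \<bar>h\<bar>}) \<le> Cd * real (nat \<bar>h\<bar>) powr \<epsilon>" using that by (intro Cd(2)) auto
    also have "\<dots> \<le> Cd * (2 powr (4 * real j + 4)) powr \<epsilon>"
      using h \<epsilon>0 Cd(1) by (intro mult_left_mono powr_mono2) auto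
    finally show ?thesis by (simp add: V_def powr_powr mult.commute)
  qed
  have V0: "0 \<le> V j" for j using Cd(1) by (simp add: V_def)
  let ?d = "\<lambda>j. 2 ^ j * (real (card (LL j)) / 2 ^ L j)"
  \<comment> \<open>The terms of a convergent series are bounded, so
    \<open>card (LL j) / 2 ^ L j \<le> D / 2 ^ j\<close>. This reduces the error to a constant times
    \<open>2 powr ((4 * \<epsilon> - \<zeta>) * j)\<close>, where
    \<open>4 * \<epsilon> = \<zeta> / 2\<close>.\<close>
  obtain D where D: "\<And>j. ?d j \<le> D"
  proof -
    have "Bseq ?d" using conv by (intro convergent_imp_Bseq summable_LIMSEQ_zero[THEN convergentI])
    then obtain K where K: "\<And>j. norm (?d j) \<le> K" by (auto simp: Bseq_def)
    show thesis
    proof (rule that[of K])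
      show "?d j \<le> K" for j using K[of j] unfolding real_norm_def by linarith
    qed
  qed
  have bound: "measure \<mu> (U j) \<le> 32 ^ k * ?d j + 32 ^ k * (D * (Cd * 2 powr (4 * \<epsilon>)) * \<bar>C\<bar>) * 2 powr (- (\<zeta> / 2) * real j)" for j
  proof -
    have "measure \<mu> (U j) \<le> (\<Sum>l\<in>LL j. \<Sum>n\<in>dyadic_block j. measure \<mu> (E n l))"
    proof -
      have "measure \<mu> (U j) \<le> (\<Sum>l\<in>LL j. measure \<mu> (\<Union>n\<in>dyadic_block j. E n l))"
        unfolding U_def by (intro measure_UNION_le finLL sets.finite_UN finite_dyadic_block E_meas)
      also have "\<dots> \<le> (\<Sum>l\<in>LL j. \<Sum>n\<in>dyadic_block j. measure \<mu> (E n l))"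
        by (intro sum_mono measure_UNION_le finite_dyadic_block E_meas)
      finally show ?thesis .
    qed
    also have "\<dots> \<le> (\<Sum>l\<in>LL j. 32 ^ k / 2 ^ L j * (2 ^ j + V j * (\<bar>C\<bar> * 2 powr ((1 - \<zeta>) * real j))))"
    proof (rule sum_mono)
      fix l assume l: "l \<in> LL j"
      let ?S = "\<Sum>\<xi>\<in>dilated_box k (2 ^ j) l. amp \<xi>"
      have "(\<Sum>n\<in>dyadic_block j. measure \<mu> (E n l)) \<le> 32 ^ k / 2 ^ (\<Sum>i<k. l i) * (real (2 ^ j) + V j * ?S)"
        unfolding dyadic_block_def E_def by (rule sum_measure_box_le) (use V[OF l] V0 in auto)
      also have "\<dots> \<le> 32 ^ k / 2 ^ L j * (2 ^ j + V j * (\<bar>C\<bar> * 2 powr ((1 - \<zeta>) * real j)))"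
      proof -
        have "?S \<le> C * 2 powr ((1 - \<zeta>) * real j)" by (rule C[OF l])
        also have "\<dots> \<le> \<bar>C\<bar> * 2 powr ((1 - \<zeta>) * real j)" by (intro mult_right_mono) auto
        finally show ?thesis unfolding LL_sum[OF l] using V0 by (intro mult_left_mono add_mono) auto
      qed
      finally show "(\<Sum>n\<in>dyadic_block j. measure \<mu> (E n l)) \<le> \<dots>" .
    qed
    also have "\<dots> = 32 ^ k * ?d j + 32 ^ k * (real (card (LL j)) / 2 ^ L j) * (V j * (\<bar>C\<bar> * 2 powr ((1 - \<zeta>) * real j)))"
      by (simp add: distrib_left mult_ac)
    also have "\<dots> \<le> 32 ^ k * ?d j + 32 ^ k * (D * 2 powr (- real j)) * (V j * (\<bar>C\<bar> * 2 powr ((1 - \<zeta>) * real j)))"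
    proof -
      have "real (card (LL j)) / 2 ^ L j = ?d j * 2 powr (- real j)"
        by (simp add: powr_minus powr_realpow field_simps)
      also have "\<dots> \<le> D * 2 powr (- real j)" by (intro mult_right_mono D) simp
      finally show ?thesis using V0 by (intro add_left_mono mult_right_mono mult_left_mono) auto
    qed
    also have "32 ^ k * (D * 2 powr (- real j)) * (V j * (\<bar>C\<bar> * 2 powr ((1 - \<zeta>) * real j)))
        = 32 ^ k * (D * (Cd * 2 powr (4 * \<epsilon>)) * \<bar>C\<bar>) * 2 powr (- (\<zeta> / 2) * real j)"
    proof -
      have "2 powr (- real j) * 2 powr (\<epsilon> * (4 * real j + 4)) * 2 powr ((1 - \<zeta>) * real j)
          = 2 powr (4 * \<epsilon>) * 2 powr (- (\<zeta> / 2) * real j)"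
        unfolding powr_add[symmetric] \<epsilon>_def by (rule arg_cong[where f = "\<lambda>t. 2 powr t"]) (simp add: field_simps)
      then show ?thesis unfolding V_def
        by (metis (no_types, opaque_lifting) mult.assoc mult.commute mult.left_commute)
    qed
    finally show ?thesis .
  qed
  have "summable (\<lambda>j. measure \<mu> (U j))"
  proof (rule summable_comparison_test')
    show "summable (\<lambda>j. 32 ^ k * ?d j + 32 ^ k * (D * (Cd * 2 powr (4 * \<epsilon>)) * \<bar>C\<bar>) * 2 powr (- (\<zeta> / 2) * real j))"
      using summable_poly_times_exp[of "\<zeta> / 2" 0] \<zeta> by (intro summable_add summable_mult conv) simp
    show "norm (measure \<mu> (U j)) \<le> 32 ^ k * ?d j + 32 ^ k * (D * (Cd * 2 powr (4 * \<epsilon>)) * \<bar>C\<bar>) * 2 powr (- (\<zeta> / 2) * real j)"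
      if "j \<ge> 0" for j using bound[of j] by simp
  qed
  then have "AE x in \<mu>. eventually (\<lambda>j. x \<in> space \<mu> - U j) sequentially"
    by (intro borel_cantelli_AE1 U_meas) (auto simp: emeasure_eq_measure)
  then show ?thesis
  proof (rule AE_mp, intro AE_I2 impI)
    fix x assume x: "x \<in> space \<mu>" and "eventually (\<lambda>j. x \<in> space \<mu> - U j) sequentially"
    then obtain J where J: "\<And>j. j \<ge> J \<Longrightarrow> x \<notin> U j" unfolding eventually_sequentially by auto
    have "(closed_box_times k LL x) \<subseteq> (\<Union>j<J. dyadic_block j)"
    proof
      fix n assume "n \<in> (closed_box_times k LL x)"
      then obtain j l where n: "n \<in> dyadic_block j" "l \<in> LL j" "\<forall>i<k. nint_dist (real n * x i) \<le> 1 / 2 ^ l i" by auto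
      then have "x \<in> U j" using x by (auto simp: U_def E_def)
      then have "j < J" using J by (meson not_le)
      then show "n \<in> (\<Union>j<J. dyadic_block j)" using n by auto
    qed
    then show "finite (closed_box_times k LL x)"
      by (rule finite_subset) auto
  qed
qed

text \<open>Every dilate of a point with an integral \<open>i\<close>-th coordinate lies in every slab around
  \<open>x i \<in> \<int>\<close>, so the first moment over a long block bounds the mass of the hyperplanes.\<close>

lemma AE_component_not_Ints:
  assumes \<kappa>: "0 < \<kappa>" "\<kappa> < 1" and C0: "\<And>Q. Q \<ge> 1 \<Longrightarrow> (\<Sum>\<xi>\<in>freq_box k Q. amp \<xi>) \<le> C0 * Q powr \<kappa>"
    and i: "i < k"
  shows "AE x in \<mu>. x i \<notin> \<int>"
proof -
  let ?Z = "{x \<in> space \<mu>. nint_dist (x i) = 0}"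
  have Zm: "?Z \<in> sets \<mu>" using i by measurable
  define \<epsilon> where "\<epsilon> = (1 - \<kappa>) / 2"
  have \<epsilon>0: "\<epsilon> > 0" using \<kappa> by (simp add: \<epsilon>_def)
  obtain Cd where Cd: "Cd \<ge> 1" "\<And>n::nat. n > 0 \<Longrightarrow> real (card {d. d dvd n}) \<le> Cd * real n powr \<epsilon>"
    using divisor_bound[OF \<epsilon>0] by metis
  \<comment> \<open>With the slab width \<open>1 / 2 ^ s\<close> fixed, \<open>j\<close> is taken so
    large that the error drops below the main term; afterwards \<open>s\<close> tends to infinity.
    The choice of \<open>\<epsilon>\<close> makes \<open>\<epsilon> + \<kappa> < 1\<close>.\<close>
  have main: "measure \<mu> ?Z \<le> 2 * 32 ^ k / 2 ^ s" for s :: nat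
  proof -
    define P where "P j = 2 * 2 ^ j * (2::real) ^ s" for j :: nat
    have "(\<lambda>j. Cd * P j powr \<epsilon> * (C0 * P j powr \<kappa>) / 2 ^ j) \<longlonglongrightarrow> 0"
    proof -
      have "(\<lambda>j. Cd * P j powr \<epsilon> * (C0 * P j powr \<kappa>) / 2 ^ j)
          = (\<lambda>j. Cd * C0 * (2 * 2 ^ s) powr (\<epsilon> + \<kappa>) * 2 powr (- \<epsilon> * real j))"
      proof
        fix j :: nat
        have "P j = (2 * 2 ^ s) * 2 powr real j" by (simp add: P_def powr_realpow)
        then have pw: "P j powr (\<epsilon> + \<kappa>) = (2 * 2 ^ s) powr (\<epsilon> + \<kappa>) * 2 powr (real j * (\<epsilon> + \<kappa>))"
          by (simp add: powr_mult powr_powr)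
        have "Cd * P j powr \<epsilon> * (C0 * P j powr \<kappa>) / 2 ^ j = Cd * C0 * P j powr (\<epsilon> + \<kappa>) * 2 powr (- real j)"
          by (simp add: powr_add powr_minus powr_realpow field_simps)
        also have "\<dots> = Cd * C0 * (2 * 2 ^ s) powr (\<epsilon> + \<kappa>) * (2 powr (real j * (\<epsilon> + \<kappa>)) * 2 powr (- real j))"
          unfolding pw by simp
        also have "2 powr (real j * (\<epsilon> + \<kappa>)) * 2 powr (- real j) = 2 powr (- \<epsilon> * real j)"
        proof -
          have "real j * (\<epsilon> + \<kappa>) + - real j = - \<epsilon> * real j" by (simp add: \<epsilon>_def field_simps)
          then show ?thesis by (simp only: powr_add[symmetric])
        qed
        finally show "Cd * P j powr \<epsilon> * (C0 * P j powr \<kappa>) / 2 ^ j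
            = Cd * C0 * (2 * 2 ^ s) powr (\<epsilon> + \<kappa>) * 2 powr (- \<epsilon> * real j)" .
      qed
      moreover have "(\<lambda>j. 2 powr (- \<epsilon> * real j)) \<longlonglongrightarrow> 0" using \<epsilon>0 by real_asymp
      ultimately show ?thesis by (simp add: tendsto_mult_right_zero)
    qed
    then have "eventually (\<lambda>j. Cd * P j powr \<epsilon> * (C0 * P j powr \<kappa>) / 2 ^ j < 1) sequentially"
      by (rule order_tendstoD) simp
    then obtain j where j: "Cd * P j powr \<epsilon> * (C0 * P j powr \<kappa>) / 2 ^ j < 1"
      unfolding eventually_sequentially by blast
    define l where "l = (\<lambda>i'. if i' = i then s else 0)"
    have Lsum: "(\<Sum>i'<k. l i') = s" using i by (simp add: l_def)
    have P1: "P j \<ge> 1"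
    proof -
      have "(1::real) \<le> 2 ^ (1 + j + s)" by (rule one_le_power) simp
      then show ?thesis by (simp add: P_def power_add)
    qed
    let ?B = "dilated_box k (2 ^ j) l"
    have lP: "2 * int (2 ^ j) * 2 ^ l i' \<le> 2 * 2 ^ j * 2 ^ s" for i'
      by (simp add: l_def)
    have S: "(\<Sum>\<xi>\<in>?B. amp \<xi>) \<le> C0 * P j powr \<kappa>"
    proof -
      have "?B \<subseteq> ibox k (2 * 2 ^ j * 2 ^ s)"
      proof
        fix \<xi> assume \<xi>: "\<xi> \<in> ?B"
        have "\<xi> i' \<in> {- int (2 * 2 ^ j * 2 ^ s)..int (2 * 2 ^ j * 2 ^ s)}" if "i' < k" for i'
        proof -
          have "\<xi> i' \<in> {- (2 * int (2 ^ j) * 2 ^ l i') .. 2 * int (2 ^ j) * 2 ^ l i'}" using \<xi> that unfolding PiE_dflt_def by blast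
          then have "- (2 * int (2 ^ j) * 2 ^ l i') \<le> \<xi> i' \<and> \<xi> i' \<le> 2 * int (2 ^ j) * 2 ^ l i'"
            by (simp only: atLeastAtMost_iff)
          then have "- (2 * 2 ^ j * 2 ^ s) \<le> \<xi> i' \<and> \<xi> i' \<le> 2 * 2 ^ j * 2 ^ s" using lP[of i'] by linarith
          then show ?thesis by simp
        qed
        then show "\<xi> \<in> ibox k (2 * 2 ^ j * 2 ^ s)" using \<xi> by (auto simp: PiE_dflt_def)
      qed
      then have "(\<Sum>\<xi>\<in>?B. amp \<xi>) \<le> (\<Sum>\<xi>\<in>ibox k (2 * 2 ^ j * 2 ^ s). amp \<xi>)"
        by (intro sum_mono2 finite_PiE_dflt) auto
      also have "\<dots> = (\<Sum>\<xi>\<in>freq_box k (P j). amp \<xi>)"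
        unfolding ibox_eq_freq_box by (simp add: P_def)
      also have "\<dots> \<le> C0 * P j powr \<kappa>" by (rule C0[OF P1])
      finally show ?thesis .
    qed
    have "2 ^ j * measure \<mu> ?Z = (\<Sum>n\<in>{2 ^ j..<2 * 2 ^ j :: nat}. measure \<mu> ?Z)" by simp
    also have "\<dots> \<le> (\<Sum>n\<in>{2 ^ j..<2 * 2 ^ j}. measure \<mu> {x \<in> space \<mu>. \<forall>i<k. nint_dist (real n * x i) \<le> 1 / 2 ^ l i})"
    proof (intro sum_mono finite_measure_mono box_measurable)
      fix n
      show "?Z \<subseteq> {x \<in> space \<mu>. \<forall>i<k. nint_dist (real n * x i) \<le> 1 / 2 ^ l i}"
      proof
        fix x assume x: "x \<in> ?Z"
        obtain z where "nint_dist (x i) = \<bar>x i - of_int z\<bar>" by (rule nint_dist_witness)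
        then have "x i = of_int z" using x by simp
        then have "nint_dist (real n * x i) \<le> 0" using nint_dist_le[of "real n * x i" "int n * z"] by simp
        then have "nint_dist (real n * x i') \<le> 1 / 2 ^ l i'" for i'
          using nint_dist_le_half[of "real n * x i'"] by (cases "i' = i") (auto simp: l_def intro: order_trans)
        then show "x \<in> {x \<in> space \<mu>. \<forall>i<k. nint_dist (real n * x i) \<le> 1 / 2 ^ l i}" using x by auto
      qed
    qed
    also have "\<dots> \<le> 32 ^ k / 2 ^ (\<Sum>i<k. l i) * (real (2 ^ j) + (Cd * P j powr \<epsilon>) * (\<Sum>\<xi>\<in>?B. amp \<xi>))"
    proof (rule sum_measure_box_le)
      show "real (card {d. d dvd nat \<bar>h\<bar>}) \<le> Cd * P j powr \<epsilon>"
        if "h \<noteq> 0" "\<bar>h\<bar> \<le> 2 * int (2 ^ j) * 2 ^ l i'" for h :: int and i'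
      proof -
        have "\<bar>h\<bar> \<le> 2 * 2 ^ j * 2 ^ s" using that(2) lP[of i'] by linarith
        then have "real_of_int \<bar>h\<bar> \<le> real_of_int (2 * 2 ^ j * 2 ^ s)" by (simp only: of_int_le_iff)
        then have "real (nat \<bar>h\<bar>) \<le> P j" by (simp add: P_def)
        then have "Cd * real (nat \<bar>h\<bar>) powr \<epsilon> \<le> Cd * P j powr \<epsilon>"
          using Cd(1) \<epsilon>0 by (intro mult_left_mono powr_mono2) auto
        then show ?thesis using Cd(2)[of "nat \<bar>h\<bar>"] that(1) by simp
      qed
    qed (use Cd(1) in auto)
    also have "\<dots> \<le> 32 ^ k / 2 ^ s * (2 ^ j + (Cd * P j powr \<epsilon>) * (C0 * P j powr \<kappa>))"
      unfolding Lsum using S Cd(1) by (intro mult_left_mono add_mono) auto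
    also have "\<dots> \<le> 32 ^ k / 2 ^ s * (2 ^ j + 2 ^ j)"
      using j by (intro mult_left_mono add_mono) (auto simp: field_simps)
    finally have "2 ^ j * measure \<mu> ?Z \<le> 2 ^ j * (2 * 32 ^ k / 2 ^ s)" by (simp add: mult_ac)
    then show ?thesis by (simp only: mult_le_cancel_left_pos zero_less_power zero_less_numeral)
  qed
  have "measure \<mu> ?Z \<le> 0"
  proof (rule LIMSEQ_le_const)
    show "(\<lambda>s. 2 * 32 ^ k / 2 ^ s :: real) \<longlonglongrightarrow> 0" by real_asymp
    show "\<exists>N. \<forall>s\<ge>N. measure \<mu> ?Z \<le> 2 * 32 ^ k / 2 ^ s" using main by blast
  qed
  then have "?Z \<in> null_sets \<mu>"
    using Zm by (intro null_setsI) (auto simp: emeasure_eq_measure order_antisym)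
  then show ?thesis
  proof (rule AE_I')
    show "{x \<in> space \<mu>. \<not> x i \<notin> \<int>} \<subseteq> ?Z"
    proof
      fix x assume "x \<in> {x \<in> space \<mu>. \<not> x i \<notin> \<int>}"
      then obtain z where "x \<in> space \<mu>" "x i = of_int z" by (auto elim: Ints_cases)
      then show "x \<in> ?Z" using nint_dist_le[of "x i" z] nint_dist_nonneg[of "x i"] by simp
    qed
  qed
qed

text \<open>The zero frequency alone contributes 1 to every sum, so the bound cannot decay.\<close>

lemma dim_exponent_le:
  assumes "\<And>Q. Q \<ge> 1 \<Longrightarrow> (\<Sum>\<xi>\<in>freq_box k Q. amp \<xi>) \<le> C * Q powr (real k - s)"
  shows "s \<le> real k"
proof (rule ccontr)
  assume "\<not> s \<le> real k"
  then have neg: "real k - s < 0" by simp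
  have one: "1 \<le> C * Q powr (real k - s)" if "Q \<ge> 1" for Q
  proof -
    have eq: "freq_box k Q = ibox k (nat \<lfloor>Q\<rfloor>)"
    proof -
      have "\<bar>real_of_int t\<bar> \<le> Q \<longleftrightarrow> \<bar>real_of_int t\<bar> \<le> real (nat \<lfloor>Q\<rfloor>)" for t
      proof -
        have "\<bar>real_of_int t\<bar> \<le> Q \<longleftrightarrow> \<bar>t\<bar> \<le> \<lfloor>Q\<rfloor>" by (simp add: le_floor_iff)
        also have "\<dots> \<longleftrightarrow> real_of_int \<bar>t\<bar> \<le> real_of_int \<lfloor>Q\<rfloor>" by (simp only: of_int_le_iff)
        finally show ?thesis using that by simp
      qed
      then show ?thesis unfolding ibox_eq_freq_box freq_box_def by simp
    qed
    have "amp (\<lambda>_. 0) \<le> (\<Sum>\<xi>\<in>freq_box k Q. amp \<xi>)"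
    proof (rule member_le_sum)
      show "(\<lambda>_. 0) \<in> freq_box k Q" using that by (simp add: freq_box_def)
      show "finite (freq_box k Q)" unfolding eq by (intro finite_PiE_dflt) auto
    qed simp
    then show ?thesis using assms[OF that] by (simp add: fourier_coeff_0)
  qed
  have "(\<lambda>n. C * real (Suc n) powr (real k - s)) \<longlonglongrightarrow> C * 0"
    by (intro tendsto_mult tendsto_const tendsto_neg_powr[OF neg] filterlim_compose[OF filterlim_real_sequentially filterlim_Suc])
  moreover have "\<forall>n\<ge>0. 1 \<le> C * real (Suc n) powr (real k - s)" using one by simp
  ultimately have "1 \<le> C * 0" by (intro LIMSEQ_le_const) auto
  then show False by simp
qed

text \<open>To extract an exponent above \<open>t\<close> from the supremum, an element of the set
  is required: 0 belongs to it because there are at most \<open>(3 * Q) ^ k\<close> frequencies,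
  each with a coefficient of modulus at most 1.\<close>

lemma dim_gtD:
  assumes t: "t < fourier_l1_dim k \<mu>"
  obtains s C where "s > t" "s \<ge> 0" "s \<le> real k"
    "\<And>Q. Q \<ge> 1 \<Longrightarrow> (\<Sum>\<xi>\<in>freq_box k Q. amp \<xi>) \<le> C * Q powr (real k - s)"
proof -
  let ?A = "{s. 0 \<le> s \<and> (\<exists>C. \<forall>Q\<ge>1.
      (\<Sum>\<xi>\<in>freq_box k Q. amp \<xi>) \<le> C * Q powr (real k - s))}"
  have "0 \<in> ?A"
  proof -
    have "(\<Sum>\<xi>\<in>freq_box k Q. amp \<xi>) \<le> 3 ^ k * Q powr (real k - 0)" if Q: "Q \<ge> 1" for Q
    proof -
      have fin: "freq_box k Q \<subseteq> ibox k (nat \<lfloor>Q\<rfloor>)"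
      proof
        fix \<xi> assume \<xi>: "\<xi> \<in> freq_box k Q"
        have "\<xi> i \<in> {- int (nat \<lfloor>Q\<rfloor>)..int (nat \<lfloor>Q\<rfloor>)}" if "i < k" for i
        proof -
          have "\<bar>real_of_int (\<xi> i)\<bar> \<le> Q" using \<xi> that by (simp add: freq_box_def)
          then have "\<bar>\<xi> i\<bar> \<le> \<lfloor>Q\<rfloor>" by (simp add: le_floor_iff)
          then show ?thesis using Q by (auto simp: abs_le_iff)
        qed
        then show "\<xi> \<in> ibox k (nat \<lfloor>Q\<rfloor>)" using \<xi> by (auto simp: PiE_dflt_def freq_box_def)
      qed
      have "(\<Sum>\<xi>\<in>freq_box k Q. amp \<xi>) \<le> (\<Sum>\<xi>\<in>ibox k (nat \<lfloor>Q\<rfloor>). 1)"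
        using fin norm_fourier_coeff_le
        by (intro sum_le_included[where i = "\<lambda>x. x"] finite_subset[OF fin] finite_PiE_dflt) auto
      also have "\<dots> = (2 * real (nat \<lfloor>Q\<rfloor>) + 1) ^ k" by (simp add: card_PiE_dflt)
      also have "\<dots> \<le> (3 * Q) ^ k"
      proof (rule power_mono)
        have "real (nat \<lfloor>Q\<rfloor>) \<le> Q" using Q by simp
        then show "2 * real (nat \<lfloor>Q\<rfloor>) + 1 \<le> 3 * Q" using Q by linarith
      qed simp
      also have "\<dots> = 3 ^ k * Q powr (real k - 0)" using Q by (simp add: power_mult_distrib powr_realpow)
      finally show ?thesis .
    qed
    then show ?thesis by blast
  qed
  then have "?A \<noteq> {}" by blast
  then obtain s where s: "s \<in> ?A" "t < s"
    using less_cSupD[of ?A t] t unfolding fourier_l1_dim_def by blast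
  then obtain C where "\<forall>Q\<ge>1. (\<Sum>\<xi>\<in>freq_box k Q. amp \<xi>) \<le> C * Q powr (real k - s)" by blast
  then show thesis using s that[of s C] dim_exponent_le[of C s] by blast
qed

end

lemma dim1_gtD:
  assumes "prob_space \<nu>" "t < fourier_l1_dim1 \<nu>"
  obtains s C where "s > t"
    "\<And>Q. Q \<ge> 1 \<Longrightarrow> (\<Sum>\<xi>\<in>{\<xi>::int. \<bar>real_of_int \<xi>\<bar> \<le> Q}. cmod (fourier_coeff1 \<nu> \<xi>)) \<le> C * Q powr (1 - s)"
proof -
  interpret prob_space \<nu> by fact
  let ?A = "{s. 0 \<le> s \<and> (\<exists>C. \<forall>Q\<ge>1.
      (\<Sum>\<xi>\<in>{\<xi>::int. \<bar>real_of_int \<xi>\<bar> \<le> Q}. cmod (fourier_coeff1 \<nu> \<xi>)) \<le> C * Q powr (1 - s))}"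
  have le1: "cmod (fourier_coeff1 \<nu> \<xi>) \<le> 1" for \<xi>
  proof -
    have "cmod (fourier_coeff1 \<nu> \<xi>) \<le> (\<integral>x. cmod (cis (- 2 * pi * (of_int \<xi> * x))) \<partial>\<nu>)"
      unfolding fourier_coeff1_def by (rule integral_norm_bound)
    then show ?thesis by (simp add: prob_space)
  qed
  have "0 \<in> ?A"
  proof -
    have "(\<Sum>\<xi>\<in>{\<xi>::int. \<bar>real_of_int \<xi>\<bar> \<le> Q}. cmod (fourier_coeff1 \<nu> \<xi>)) \<le> 3 * Q powr (1 - 0)" if Q: "Q \<ge> 1" for Q
    proof -
      have eq: "{\<xi>::int. \<bar>real_of_int \<xi>\<bar> \<le> Q} = {- \<lfloor>Q\<rfloor>..\<lfloor>Q\<rfloor>}"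
      proof -
        have iff: "\<bar>real_of_int \<xi>\<bar> \<le> Q \<longleftrightarrow> \<bar>\<xi>\<bar> \<le> \<lfloor>Q\<rfloor>" for \<xi> by (simp add: le_floor_iff)
        have "{\<xi>. \<bar>\<xi>\<bar> \<le> \<lfloor>Q\<rfloor>} = {- \<lfloor>Q\<rfloor>..\<lfloor>Q\<rfloor>}" by (auto simp: abs_le_iff)
        then show ?thesis by (simp only: iff)
      qed
      have "(\<Sum>\<xi>\<in>{\<xi>::int. \<bar>real_of_int \<xi>\<bar> \<le> Q}. cmod (fourier_coeff1 \<nu> \<xi>)) \<le> (\<Sum>\<xi>\<in>{- \<lfloor>Q\<rfloor>..\<lfloor>Q\<rfloor>}. 1)"
        unfolding eq by (intro sum_mono le1)
      also have "\<dots> = 2 * real_of_int \<lfloor>Q\<rfloor> + 1" using Q by simp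
      also have "\<dots> \<le> 3 * Q" using Q of_int_floor_le[of Q] by linarith
      also have "\<dots> = 3 * Q powr (1 - 0)" using Q by simp
      finally show ?thesis .
    qed
    then show ?thesis by blast
  qed
  then have "?A \<noteq> {}" by blast
  then obtain s where "s \<in> ?A" "t < s"
    using less_cSupD[of ?A t] assms(2) unfolding fourier_l1_dim1_def by blast
  then show thesis using that by blast
qed

lemma ex_dyadic_block:
  assumes "n \<ge> 1"
  obtains j where "n \<in> dyadic_block j"
proof -
  have "n < 2 * 2 ^ n" using less_exp[of n] by linarith
  then have "n \<in> {1..<2 * 2 ^ n}" using assms by simp
  moreover have "{1..<2 * 2 ^ J} \<subseteq> (\<Union>j\<le>J. dyadic_block j)" for J
  proof (induction J)
    case (Suc J)
    have "{1..<2 * 2 ^ Suc J} = {1..<2 * 2 ^ J} \<union> dyadic_block (Suc J)" by (auto simp: dyadic_block_def)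
    then show ?case using Suc by (auto simp: atMost_Suc)
  qed (auto simp: dyadic_block_def)
  ultimately show thesis using that by blast
qed

section \<open>Cauchy condensation\<close>

lemma condensation_upper:
  fixes f h :: "nat \<Rightarrow> real"
  assumes f: "\<And>n. n \<ge> 1 \<Longrightarrow> 0 \<le> f n" and le: "\<And>n j. n \<in> dyadic_block j \<Longrightarrow> f n \<le> h j" and h: "\<And>j. 0 \<le> h j"
    and sum: "summable (\<lambda>j. 2 ^ j * h j)"
  shows "summable (\<lambda>n. f (Suc n))"
proof (rule bounded_imp_summable)
  show "0 \<le> f (Suc n)" for n using f by simp
  show "(\<Sum>i\<le>n. f (Suc i)) \<le> (\<Sum>j. 2 ^ j * h j)" for n
  proof -
    have "(\<Sum>i\<le>n. f (Suc i)) = (\<Sum>m\<in>{1..Suc n}. f m)"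
    proof -
      have "{1..Suc n} = Suc ` {..n}" by (simp add: image_Suc_atMost)
      then show ?thesis by (simp add: sum.reindex del: sum.cl_ivl_Suc)
    qed
    also have "\<dots> \<le> (\<Sum>m\<in>{1..<2 * 2 ^ Suc n}. f m)"
      using f less_exp[of "Suc n"] by (intro sum_mono2) auto
    also have "\<dots> = (\<Sum>j\<le>Suc n. \<Sum>m\<in>dyadic_block j. f m)" by (rule sum_dyadic_blocks[symmetric])
    also have "\<dots> \<le> (\<Sum>j\<le>Suc n. \<Sum>m\<in>dyadic_block j. h j)" by (intro sum_mono le)
    also have "\<dots> = (\<Sum>j\<le>Suc n. 2 ^ j * h j)" by simp
    also have "\<dots> \<le> (\<Sum>j. 2 ^ j * h j)" using h by (intro sum_le_suminf sum) auto
    finally show ?thesis .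
  qed
qed

lemma condensation_lower:
  fixes f h :: "nat \<Rightarrow> real"
  assumes f: "\<And>n. n \<ge> 1 \<Longrightarrow> 0 \<le> f n" and le: "\<And>n j. n \<in> dyadic_block j \<Longrightarrow> h j \<le> f n" and h: "\<And>j. 0 \<le> h j"
    and sum: "summable (\<lambda>n. f (Suc n))"
  shows "summable (\<lambda>j. 2 ^ j * h j)"
proof (rule bounded_imp_summable)
  show "0 \<le> 2 ^ j * h j" for j using h by simp
  show "(\<Sum>j\<le>J. 2 ^ j * h j) \<le> (\<Sum>n. f (Suc n))" for J
  proof -
    have "(\<Sum>j\<le>J. 2 ^ j * h j) = (\<Sum>j\<le>J. \<Sum>n\<in>dyadic_block j. h j)" by simp
    also have "\<dots> \<le> (\<Sum>j\<le>J. \<Sum>n\<in>dyadic_block j. f n)" by (intro sum_mono le)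
    also have "\<dots> = (\<Sum>n\<in>{1..<2 * 2 ^ J}. f n)" by (rule sum_dyadic_blocks)
    also have "\<dots> = (\<Sum>n\<in>Suc ` {0..<2 * 2 ^ J - 1}. f n)"
      by (intro sum.cong refl) (simp add: image_Suc_atLeastLessThan)
    also have "\<dots> = (\<Sum>n\<in>{0..<2 * 2 ^ J - 1}. f (Suc n))" by (subst sum.reindex) auto
    also have "\<dots> \<le> (\<Sum>n. f (Suc n))" using f by (intro sum_le_suminf sum) auto
    finally show ?thesis .
  qed
qed

text \<open>If the truncated terms tend to 0 and \<open>w j \<ge> 1\<close>, then
  \<open>t j < 1\<close> eventually. This undoes the truncation in the divergence parts, where boxes
  of volume larger than \<open>1 / 2 ^ j\<close> are shrunk; starting at \<open>j = 1\<close> admits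
  the weights \<open>j ^ (k - 1)\<close>.\<close>

lemma summable_min_imp_summable:
  fixes w t :: "nat \<Rightarrow> real"
  assumes "\<And>j. j \<ge> 1 \<Longrightarrow> 1 \<le> w j" "summable (\<lambda>j. w j * min (t j) 1)"
  shows "summable (\<lambda>j. w j * t j)"
proof -
  have "(\<lambda>j. w j * min (t j) 1) \<longlonglongrightarrow> 0" by (rule summable_LIMSEQ_zero) fact
  then have "eventually (\<lambda>j. w j * min (t j) 1 < 1) sequentially" by (rule order_tendstoD) simp
  moreover have "eventually (\<lambda>j. j \<ge> 1) sequentially" by (rule eventually_ge_at_top)
  ultimately have "eventually (\<lambda>j. w j * min (t j) 1 = w j * t j) sequentially"
  proof eventually_elim
    case (elim j)
    have "t j < 1"
    proof (rule ccontr)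
      assume "\<not> t j < 1"
      then have "min (t j) 1 = 1" by simp
      then show False using elim assms(1)[of j] by simp
    qed
    then show ?case by simp
  qed
  then show ?thesis using assms(2) summable_cong by metis
qed

section \<open>Khinchin's theorem\<close>

text \<open>\<open>a\<close> may be 0 or extremely small, hence the cap: a level equal to
  \<open>cap\<close> carries no lower bound on \<open>a\<close>.\<close>

lemma dyadic_level_above:
  fixes a :: real
  assumes "0 \<le> a" "a \<le> 1"
  obtains l where "l \<le> cap" "a \<le> 1 / 2 ^ l" "l = cap \<or> 1 / 2 ^ l \<le> 2 * a"
proof -
  have "\<exists>l\<le>cap. a \<le> 1 / 2 ^ l \<and> (l = cap \<or> 1 / 2 ^ l \<le> 2 * a)"
  proof (induction cap)
    case (Suc cap)
    then obtain l where l: "l \<le> cap" "a \<le> 1 / 2 ^ l" "l = cap \<or> 1 / 2 ^ l \<le> 2 * a" by auto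
    show ?case
    proof (cases "1 / 2 ^ l \<le> 2 * a")
      case False
      then have "l = cap" "a \<le> 1 / 2 ^ Suc cap" using l by (auto simp: field_simps)
      then show ?thesis by blast
    qed (use l in \<open>auto intro: exI[of _ l]\<close>)
  qed (use assms in auto)
  then show thesis using that by blast
qed

lemma dyadic_level_below:
  fixes a :: real
  assumes "0 < a" "a \<le> 1"
  obtains m :: nat where "1 / 2 ^ m \<le> a" "a \<le> 2 / 2 ^ m"
proof -
  obtain n :: nat where n: "(1 / 2) ^ n < a" using real_arch_pow_inv[of a "1 / 2"] assms by auto
  define m where "m = (LEAST m. 1 / 2 ^ m \<le> a)"
  have ex: "1 / 2 ^ n \<le> a" using n by (simp add: power_divide)
  have m: "1 / 2 ^ m \<le> a" unfolding m_def by (rule LeastI[of _ n]) (rule ex)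
  have "a \<le> 2 / 2 ^ m"
  proof (cases m)
    case 0
    then show ?thesis using assms by simp
  next
    case (Suc m')
    then have "\<not> 1 / 2 ^ m' \<le> a" unfolding m_def using not_less_Least[of m' "\<lambda>m. 1 / 2 ^ m \<le> a"] by simp
    then show ?thesis using Suc by simp
  qed
  then show thesis using m that by blast
qed

lemma real_nat_ceiling_le_add_1: "0 \<le> x \<Longrightarrow> real (nat \<lceil>x\<rceil>) \<le> x + 1"
  using ceiling_correct[of x] by (simp add: less_imp_le)

lemma admissible_psiD:
  assumes "admissible_psi \<psi>" "n \<in> dyadic_block j"
  shows "0 \<le> \<psi> n" "\<psi> n < 1" "\<psi> n \<le> \<psi> (2 ^ j)" "\<psi> (2 ^ Suc j) \<le> \<psi> n"
  using assms dyadic_block_pos[OF assms(2)] by (auto simp: admissible_psi_def dyadic_block_def)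

lemma admissible_psi_power:
  assumes "admissible_psi \<psi>"
  shows "0 \<le> \<psi> (2 ^ j)" "\<psi> (2 ^ j) \<le> 1"
  using assms by (auto simp: admissible_psi_def less_imp_le)

lemma two_powr_of_nat: "(2::real) powr (real a) = 2 ^ a"
  by (simp add: powr_realpow)

lemma exists_small_eta:
  fixes \<kappa> :: real
  assumes k2: "k \<ge> 2" and \<kappa>: "0 < \<kappa>" "\<kappa> < (real k - 1) / (real k + 1)"
  obtains \<eta> where "\<eta> > 0" "(1 / real k + 2 * \<eta>) * (1 + \<kappa>) + \<kappa> < 1" "(1 / real k + 2 * \<eta>) * (real k - 1) < 1"
proof -
  \<comment> \<open>The slack of the first inequality at \<open>\<eta> = 0\<close>, positive by the
    hypothesis on \<open>\<kappa>\<close>. The second one has slack \<open>1 / k\<close> there; of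
    each slack at most half is spent.\<close>
  define a where "a = 1 - (1 / real k) * (1 + \<kappa>) - \<kappa>"
  have k0: "real k > 0" using k2 by simp
  have "\<kappa> * (real k + 1) < real k - 1" using \<kappa>(2) by (simp add: field_simps)
  then have "a > 0" using k0 by (simp add: a_def field_simps)
  define \<eta> where "\<eta> = min (a / (4 * (1 + \<kappa>))) (1 / (4 * real k * real k))"
  have \<eta>0: "\<eta> > 0" using \<open>a > 0\<close> \<kappa>(1) k0 by (simp add: \<eta>_def)
  show thesis
  proof (rule that[OF \<eta>0])
    have "2 * \<eta> * (1 + \<kappa>) \<le> 2 * (a / (4 * (1 + \<kappa>))) * (1 + \<kappa>)"
      using \<kappa>(1) by (intro mult_right_mono mult_left_mono) (auto simp: \<eta>_def)
    also have "\<dots> = a / 2" using \<kappa>(1) by (simp add: field_simps)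
    finally have "2 * \<eta> * (1 + \<kappa>) < a" using \<open>a > 0\<close> by linarith
    then show "(1 / real k + 2 * \<eta>) * (1 + \<kappa>) + \<kappa> < 1" by (simp add: a_def distrib_right)
    have "2 * \<eta> * (real k - 1) \<le> 2 * (1 / (4 * real k * real k)) * real k"
      using k2 \<eta>0 by (intro mult_mono) (auto simp: \<eta>_def)
    also have "\<dots> = (1 / real k) / 2" using k0 by (simp add: field_simps)
    also have "\<dots> < 1 / real k" using k0 by (simp add: field_simps)
    finally show "(1 / real k + 2 * \<eta>) * (real k - 1) < 1" using k0 by (simp add: field_simps)
  qed
qed

lemma summable_shift_dyadic:
  fixes \<psi> :: "nat \<Rightarrow> real"
  shows "summable (\<lambda>j. 2 ^ j * \<psi> (2 ^ Suc j) ^ k) \<longleftrightarrow> summable (\<lambda>j. 2 ^ j * \<psi> (2 ^ j) ^ k)"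
proof -
  have "summable (\<lambda>j. 2 ^ j * \<psi> (2 ^ j) ^ k) \<longleftrightarrow> summable (\<lambda>j. 2 * (2 ^ j * \<psi> (2 ^ Suc j) ^ k))"
    by (subst summable_Suc_iff[symmetric]) (simp add: mult.assoc)
  also have "\<dots> \<longleftrightarrow> summable (\<lambda>j. 2 ^ j * \<psi> (2 ^ Suc j) ^ k)" by (rule summable_cmult_iff[THEN trans]) simp
  finally show ?thesis ..
qed

text \<open>The two conditions on \<open>\<eta>\<close> leave room for a small perturbation: at \<open>\<eta> = 0\<close> the first one reads
  \<open>\<kappa> < (k - 1) / (k + 1)\<close>, which is the hypothesis on the Fourier \<open>\<ell>\<^sup>1\<close> dimension, and the
  second one is void.\<close>

locale exponent_measure = cube_measure k \<mu> for k :: nat and \<mu> :: "(nat \<Rightarrow> real) measure" +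
  fixes \<kappa> \<eta> C0 :: real
  assumes k2: "k \<ge> 2"
    and supp: "measure \<mu> (PiE {..<k} (\<lambda>_. {0..1})) = 1"
    and \<kappa>0: "\<kappa> > 0"
    and C0: "Q \<ge> 1 \<Longrightarrow> (\<Sum>\<xi>\<in>freq_box k Q. amp \<xi>) \<le> C0 * Q powr \<kappa>"
    and \<eta>: "\<eta> > 0" "(1 / real k + 2 * \<eta>) * (1 + \<kappa>) + \<kappa> < 1" "(1 / real k + 2 * \<eta>) * (real k - 1) < 1"
begin

lemma k_pos: "real k > 0"
  using k2 by simp

lemma theta_less: "1 / real k + 2 * \<eta> < 1 - \<kappa>"
proof -
  define \<theta> where "\<theta> = 1 / real k + 2 * \<eta>"
  have "0 < \<theta>" unfolding \<theta>_def using k_pos \<eta>(1) by (intro add_pos_pos) auto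
  then have "\<theta> * 1 \<le> \<theta> * (1 + \<kappa>)" using \<kappa>0 by (intro mult_left_mono) auto
  then show ?thesis using \<eta>(2) unfolding \<theta>_def[symmetric] by linarith
qed

lemma kappa_less_1: "\<kappa> < 1"
  using theta_less k_pos \<eta>(1) by (smt (verit) divide_pos_pos)

lemma C0_nonneg: "0 \<le> C0"
proof -
  have "0 \<le> (\<Sum>\<xi>\<in>freq_box k 1. amp \<xi>)" by (intro sum_nonneg) auto
  also have "\<dots> \<le> C0 * 1 powr \<kappa>" by (rule C0) simp
  finally show ?thesis by simp
qed

lemma space_mu: "space \<mu> = PiE {..<k} (\<lambda>_. UNIV)"
  using sets_eq_imp_space_eq[OF sets_eq] by (simp add: borel_k_def space_PiM)

text \<open>The support hypothesis speaks of the closed cube, \<open>W_set\<close> and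
  \<open>W_mult_set\<close> of the half-open one. The difference lies in hyperplanes of integral
  coordinate, which are null.\<close>

lemma AE_half_open_cube: "AE x in \<mu>. x \<in> PiE {..<k} (\<lambda>_. {0..<1})"
proof -
  have "AE x in \<mu>. x \<in> PiE {..<k} (\<lambda>_. {0..1})" by (rule AE_prob_1[OF supp])
  moreover have "AE x in \<mu>. \<forall>i\<in>{..<k}. x i \<notin> \<int>"
    using AE_component_not_Ints[OF \<kappa>0 kappa_less_1 C0] by (intro AE_finite_allI) auto
  ultimately show ?thesis
  proof eventually_elim
    case (elim x)
    have "x i \<in> {0..<1}" if "i < k" for i
    proof -
      have "x i \<noteq> 1" using elim(2) that by force
      moreover have "x i \<in> {0..1}" using elim(1) that by (simp add: PiE_iff)
      ultimately show ?thesis by auto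
    qed
    then show ?case using elim(1) by (auto simp: PiE_def)
  qed
qed

lemma W_set_eq:
  "W_set k \<psi> = {x \<in> PiE {..<k} (\<lambda>_. {0..<1}). infinite {n. 1 \<le> n \<and> (\<forall>i<k. nint_dist (real n * x i) < \<psi> n)}}"
proof -
  have "Max ((\<lambda>i. nint_dist (real n * x i)) ` {..<k}) < \<psi> n \<longleftrightarrow> (\<forall>i<k. nint_dist (real n * x i) < \<psi> n)" for n x
    using k2 by (subst Max_less_iff) (auto simp: lessThan_empty_iff)
  then show ?thesis unfolding W_set_def by simp
qed

lemma cube_limsup_measurable:
  assumes [measurable]: "\<And>n::nat. Measurable.pred \<mu> (P n)"
  shows "{x \<in> PiE {..<k} (\<lambda>_. {0..<1}). infinite {n. 1 \<le> n \<and> P n x}} \<in> sets \<mu>"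
proof -
  have "{x \<in> PiE {..<k} (\<lambda>_. {0..<1}). infinite {n. 1 \<le> n \<and> P n x}}
     = {x \<in> space \<mu>. (\<forall>i<k. 0 \<le> x i \<and> x i < 1) \<and> (\<forall>m. \<exists>n. n > m \<and> 1 \<le> n \<and> P n x)}"
    unfolding infinite_nat_iff_unbounded space_mu by (auto simp: PiE_def Pi_def)
  also have "\<dots> \<in> sets \<mu>" by measurable
  finally show ?thesis .
qed

lemma W_set_measurable: "W_set k \<psi> \<in> sets \<mu>"
  unfolding W_set_eq by (intro cube_limsup_measurable) measurable

lemma W_mult_set_measurable: "W_mult_set k \<psi> \<in> sets \<mu>"
  unfolding W_mult_set_def by (intro cube_limsup_measurable) measurable

lemma khinchin_convergence:
  assumes \<psi>: "admissible_psi \<psi>" and sum: "summable (\<lambda>n. \<psi> (Suc n) ^ k)"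
  shows "W_set k \<psi> \<in> null_sets \<mu>"
proof -
  have "summable (\<lambda>j. 2 ^ j * \<psi> (2 ^ Suc j) ^ k)"
  proof (rule condensation_lower[where f = "\<lambda>n. \<psi> n ^ k", OF _ _ _ sum])
    show "\<psi> (2 ^ Suc j) ^ k \<le> \<psi> n ^ k" if "n \<in> dyadic_block j" for n j
      using admissible_psiD[OF \<psi> that] admissible_psi_power[OF \<psi>, of "Suc j"] by (intro power_mono) auto
    show "0 \<le> \<psi> n ^ k" if "n \<ge> 1" for n using \<psi> that by (simp add: admissible_psi_def)
    show "0 \<le> \<psi> (2 ^ Suc j) ^ k" for j using admissible_psi_power[OF \<psi>, of "Suc j"] by simp
  qed
  then have sum2: "summable (\<lambda>j. 2 ^ j * \<psi> (2 ^ j) ^ k)" by (simp only: summable_shift_dyadic)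
  \<comment> \<open>When \<open>\<psi>\<close> is very small its boxes would need frequencies beyond
    the reach of the l1 hypothesis. They are replaced by boxes of side about
    \<open>2 powr (- (1 / k + \<eta>) * j)\<close>, which adds only a geometric series to the sum of
    volumes.\<close>
  define cap where "cap j = nat \<lceil>(1 / real k + \<eta>) * real j\<rceil>" for j
  have a0: "0 < 1 / real k + \<eta>" using k_pos \<eta>(1) by (intro add_pos_pos) auto
  have cap_ge: "(1 / real k + \<eta>) * real j \<le> real (cap j)" for j unfolding cap_def by (rule real_nat_ceiling_ge)
  have cap_le: "real (cap j) \<le> (1 / real k + \<eta>) * real j + 1" for j
    using a0 unfolding cap_def by (intro real_nat_ceiling_le_add_1) auto
  have "\<forall>j. \<exists>l. l \<le> cap j \<and> \<psi> (2 ^ j) \<le> 1 / 2 ^ l \<and> (l = cap j \<or> 1 / 2 ^ l \<le> 2 * \<psi> (2 ^ j))"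
    using dyadic_level_above[OF admissible_psi_power[OF \<psi>]] by metis
  then obtain l where l: "\<And>j. l j \<le> cap j" "\<And>j. \<psi> (2 ^ j) \<le> 1 / 2 ^ l j"
      "\<And>j. l j = cap j \<or> 1 / 2 ^ l j \<le> 2 * \<psi> (2 ^ j)"
    by (auto dest!: choice)
  define v where "v j i = (if i < k then l j else 0)" for j i
  define LL where "LL j = {v j}" for j
  define \<zeta> where "\<zeta> = 1 - \<kappa> * (1 + 1 / real k + \<eta>)"
  have \<zeta>0: "\<zeta> > 0"
  proof -
    have "\<kappa> * (1 + 1 / real k + \<eta>) = \<kappa> + \<kappa> * (1 / real k + \<eta>)" by (simp add: algebra_simps)
    also have "\<dots> \<le> \<kappa> + (1 + \<kappa>) * (1 / real k + 2 * \<eta>)"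
      using a0 \<kappa>0 \<eta>(1) by (intro add_left_mono mult_mono) auto
    also have "\<dots> < 1" using \<eta>(2) by (simp add: algebra_simps)
    finally show ?thesis by (simp add: \<zeta>_def)
  qed
  have "AE x in \<mu>. finite (closed_box_times k LL x)"
  proof (rule AE_boxes_convergence[where L = "\<lambda>j. k * l j" and \<zeta> = \<zeta> and C = "C0 * 4 powr \<kappa>"])
    show "finite (LL j)" for j by (simp add: LL_def)
    show "(\<Sum>i<k. l' i) = k * l j" if "l' \<in> LL j" for l' j
      using that by (simp add: LL_def v_def)
    show "l' i \<le> 3 * j + 3" if "l' \<in> LL j" "i < k" for l' j i
    proof -
      have "(1 / real k + \<eta>) * real j \<le> 1 * real j"
        using theta_less \<kappa>0 \<eta>(1) by (intro mult_right_mono) auto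
      then have "real (cap j) \<le> real j + 1" using cap_le[of j] by linarith
      then have "cap j \<le> j + 1" by linarith
      then show ?thesis using l(1)[of j] that by (simp add: LL_def v_def)
    qed
    show "0 < \<zeta>" by (rule \<zeta>0)
    show "(\<Sum>\<xi>\<in>dilated_box k (2 ^ j) l'. amp \<xi>)
        \<le> C0 * 4 powr \<kappa> * 2 powr ((1 - \<zeta>) * real j)" if "l' \<in> LL j" for l' j
    proof -
      have "dilated_box k (2 ^ j) l' = ibox k (2 * 2 ^ j * 2 ^ l j)"
        using that by (auto simp: LL_def v_def PiE_dflt_def)
      then have "(\<Sum>\<xi>\<in>dilated_box k (2 ^ j) l'. amp \<xi>)
          = (\<Sum>\<xi>\<in>freq_box k (real (2 * 2 ^ j * 2 ^ l j)). amp \<xi>)"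
        by (simp only: ibox_eq_freq_box)
      also have "\<dots> \<le> C0 * real (2 * 2 ^ j * 2 ^ l j) powr \<kappa>"
      proof (rule C0)
        have "1 \<le> (2::real) ^ (1 + j + l j)" by (rule one_le_power) simp
        also have "\<dots> = real (2 * 2 ^ j * 2 ^ l j)" by (simp add: power_add)
        finally show "1 \<le> real (2 * 2 ^ j * 2 ^ l j)" .
      qed
      also have "\<dots> \<le> C0 * (4 * 2 powr ((1 + 1 / real k + \<eta>) * real j)) powr \<kappa>"
      proof (intro mult_left_mono powr_mono2 C0_nonneg)
        have "real (2 * 2 ^ j * 2 ^ l j) = 2 * 2 powr real j * 2 powr real (l j)" by (simp add: powr_realpow)
        also have "\<dots> \<le> 2 * 2 powr real j * 2 powr ((1 / real k + \<eta>) * real j + 1)"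
          using l(1)[of j] cap_le[of j] by (intro mult_left_mono powr_mono) auto
        also have "\<dots> = 4 * (2 powr real j * 2 powr ((1 / real k + \<eta>) * real j))" by (simp add: powr_add)
        also have "2 powr real j * 2 powr ((1 / real k + \<eta>) * real j) = 2 powr ((1 + 1 / real k + \<eta>) * real j)"
          by (simp add: powr_add[symmetric] algebra_simps)
        finally show "real (2 * 2 ^ j * 2 ^ l j) \<le> 4 * 2 powr ((1 + 1 / real k + \<eta>) * real j)" .
      qed (use \<kappa>0 in auto)
      also have "\<dots> = C0 * 4 powr \<kappa> * 2 powr ((1 - \<zeta>) * real j)"
        by (simp add: powr_mult powr_powr \<zeta>_def mult_ac)
      finally show ?thesis .
    qed
    show "summable (\<lambda>j. 2 ^ j * (real (card (LL j)) / 2 ^ (k * l j)))"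
    proof (rule summable_comparison_test')
      show "summable (\<lambda>j. 2 ^ k * (2 ^ j * \<psi> (2 ^ j) ^ k) + 2 powr (- (real k * \<eta>) * real j))"
        using summable_poly_times_exp[of "real k * \<eta>" 0] k_pos \<eta>(1)
        by (intro summable_add summable_mult sum2) simp
      show "norm (2 ^ j * (real (card (LL j)) / 2 ^ (k * l j))) \<le> 2 ^ k * (2 ^ j * \<psi> (2 ^ j) ^ k) + 2 powr (- (real k * \<eta>) * real j)" if "j \<ge> 0" for j
      proof -
        have eq: "2 ^ j * (real (card (LL j)) / 2 ^ (k * l j)) = 2 ^ j * (1 / 2 ^ l j) ^ k"
          by (simp add: LL_def power_divide power_mult[symmetric] mult.commute)
        have psi0: "0 \<le> \<psi> (2 ^ j)" by (rule admissible_psi_power[OF \<psi>])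
        have "2 ^ j * (1 / 2 ^ l j) ^ k \<le> 2 ^ k * (2 ^ j * \<psi> (2 ^ j) ^ k) + 2 powr (- (real k * \<eta>) * real j)"
          using l(3)[of j]
        proof
          assume "l j = cap j"
          then have "(1 / 2 ^ l j) ^ k = (2 powr (- real (cap j))) ^ k" by (simp add: powr_minus powr_realpow divide_inverse)
          also have "\<dots> \<le> (2 powr (- ((1 / real k + \<eta>) * real j))) ^ k"
            using cap_ge[of j] by (intro power_mono powr_mono) auto
          also have "\<dots> = 2 powr (real k * - ((1 / real k + \<eta>) * real j))" by (simp add: powr_power mult.commute)
          also have "real k * - ((1 / real k + \<eta>) * real j) = - real j + - (real k * \<eta>) * real j"
            using k_pos by (simp add: field_simps)
          finally have "2 ^ j * (1 / 2 ^ l j) ^ k \<le> 2 powr real j * 2 powr (- real j + - (real k * \<eta>) * real j)"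
            by (simp add: powr_realpow)
          also have "\<dots> = 2 powr (- (real k * \<eta>) * real j)" by (simp add: powr_add[symmetric])
          finally show ?thesis using psi0 by (simp add: add_increasing)
        next
          assume "1 / 2 ^ l j \<le> 2 * \<psi> (2 ^ j)"
          then have "2 ^ j * (1 / 2 ^ l j) ^ k \<le> 2 ^ j * (2 * \<psi> (2 ^ j)) ^ k" by (intro mult_left_mono power_mono) auto
          also have "\<dots> = 2 ^ k * (2 ^ j * \<psi> (2 ^ j) ^ k)" by (simp add: power_mult_distrib)
          finally show ?thesis by (simp add: add_increasing2)
        qed
        then show ?thesis unfolding eq by simp
      qed
    qed
  qed
  then have "AE x in \<mu>. x \<notin> W_set k \<psi>"
  proof eventually_elim
    case (elim x)
    have "{n. 1 \<le> n \<and> (\<forall>i<k. nint_dist (real n * x i) < \<psi> n)}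
        \<subseteq> (closed_box_times k LL x)"
    proof (rule subsetI, clarify)
      fix n assume n: "1 \<le> n" "\<forall>i<k. nint_dist (real n * x i) < \<psi> n"
      obtain j where j: "n \<in> dyadic_block j" using ex_dyadic_block[OF n(1)] by blast
      have "\<psi> n \<le> 1 / 2 ^ l j" using admissible_psiD(3)[OF \<psi> j] l(2)[of j] by linarith
      then have "\<forall>i<k. nint_dist (real n * x i) \<le> 1 / 2 ^ v j i" using n(2) by (fastforce simp: v_def)
      then show "\<exists>j. n \<in> dyadic_block j \<and> (\<exists>l\<in>LL j. \<forall>i<k. nint_dist (real n * x i) \<le> 1 / 2 ^ l i)"
        using j by (auto simp: LL_def)
    qed
    then show ?case using elim finite_subset unfolding W_set_eq by blast
  qed
  then show ?thesis using AE_iff_null_sets[OF W_set_measurable] by simp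
qed

lemma khinchin_divergence:
  assumes \<psi>: "admissible_psi \<psi>" and div: "\<not> summable (\<lambda>n. \<psi> (Suc n) ^ k)"
  shows "AE x in \<mu>. x \<in> W_set k \<psi>"
proof -
  \<comment> \<open>A lower bound for \<open>\<psi>\<close> on block \<open>j\<close>: boxes fitted
    to \<open>a j\<close> serve all dilates in the block.\<close>
  define a where "a j = \<psi> (2 ^ Suc j)" for j
  have a01: "0 \<le> a j" "a j \<le> 1" for j unfolding a_def by (rule admissible_psi_power[OF \<psi>])+
  have "\<forall>j. \<exists>m::nat. 0 < a j \<longrightarrow> 1 / 2 ^ m \<le> a j \<and> a j \<le> 2 / 2 ^ m"
    using dyadic_level_below[OF _ a01(2)] by metis
  then have "\<exists>m::nat \<Rightarrow> nat. \<forall>j. 0 < a j \<longrightarrow> 1 / 2 ^ m j \<le> a j \<and> a j \<le> 2 / 2 ^ m j" by (rule choice)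
  then obtain m :: "nat \<Rightarrow> nat" where m: "\<And>j. 0 < a j \<Longrightarrow> 1 / 2 ^ m j \<le> a j" "\<And>j. 0 < a j \<Longrightarrow> a j \<le> 2 / 2 ^ m j"
    by blast
  \<comment> \<open>The sides are shrunk, if necessary, until the volume is at most
    \<open>1 / 2 ^ j\<close>, as the box family demands. Up to constants this truncates
    \<open>2 ^ j * a j ^ k\<close> at 1, which preserves divergence.\<close>
  define l where "l j = max (nat \<lceil>real j / real k\<rceil>) (m j)" for j
  define v where "v j i = (if i < k then l j else 0)" for j i
  \<comment> \<open>Blocks where \<open>a j\<close> vanishes or is too small for the range of
    exponents are dropped; apart from finitely many blocks, their terms are dominated by a geometric
    series with ratio \<open>2 powr (- (k * \<eta>))\<close>.\<close>
  define LL where "LL j = (if 0 < a j \<and> real (l j) \<le> (1 / real k + \<eta>) * real j then {v j} else {})" for j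
  have ceil: "real j \<le> real k * real (nat \<lceil>real j / real k\<rceil>)" for j
  proof -
    have "real j / real k \<le> real (nat \<lceil>real j / real k\<rceil>)" by (rule real_nat_ceiling_ge)
    then have "real j \<le> real (nat \<lceil>real j / real k\<rceil>) * real k" by (simp only: pos_divide_le_eq[OF k_pos])
    then show ?thesis by (simp only: mult.commute)
  qed
  have jL: "j \<le> k * l j" for j
  proof -
    have "real k * real (nat \<lceil>real j / real k\<rceil>) \<le> real k * real (l j)" unfolding l_def by (intro mult_left_mono) auto
    then have "real j \<le> real (k * l j)" using ceil[of j] by simp
    then show ?thesis by (simp only: of_nat_le_iff)
  qed
  have nsum: "\<not> summable (\<lambda>j. 2 ^ j * (real (card (LL j)) / 2 ^ (k * l j)))"
  proof
    assume g: "summable (\<lambda>j. 2 ^ j * (real (card (LL j)) / 2 ^ (k * l j)))"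
    have "summable (\<lambda>j. 1 * min (2 ^ j * a j ^ k) 1)"
    proof (rule summable_comparison_test')
      show "summable (\<lambda>j. 2 ^ k * (2 ^ j * (real (card (LL j)) / 2 ^ (k * l j))) + 2 ^ k * 2 powr (- (real k * \<eta>) * real j))"
        using summable_poly_times_exp[of "real k * \<eta>" 0] k_pos \<eta>(1)
        by (intro summable_add summable_mult g) simp
      show "norm (1 * min (2 ^ j * a j ^ k) 1)
          \<le> 2 ^ k * (2 ^ j * (real (card (LL j)) / 2 ^ (k * l j))) + 2 ^ k * 2 powr (- (real k * \<eta>) * real j)"
        if j: "j \<ge> nat \<lceil>1 / \<eta>\<rceil>" for j
      proof -
        have "1 / \<eta> \<le> real j" using j by linarith
        then have \<eta>j: "1 \<le> \<eta> * real j" using \<eta>(1) by (simp add: field_simps)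
        have ceil_le: "real (nat \<lceil>real j / real k\<rceil>) \<le> real j / real k + 1" by (intro real_nat_ceiling_le_add_1) auto
        have nn: "norm (1 * min (2 ^ j * a j ^ k) 1) = min (2 ^ j * a j ^ k) 1" using a01[of j] by simp
        have "min (2 ^ j * a j ^ k) 1 \<le> 2 ^ k * (2 ^ j * (real (card (LL j)) / 2 ^ (k * l j))) + 2 ^ k * 2 powr (- (real k * \<eta>) * real j)"
        proof (cases "0 < a j")
          case True
          have le_m: "2 ^ j * a j ^ k \<le> 2 ^ k * (2 ^ j / 2 ^ (k * m j))"
          proof -
            have "2 ^ j * a j ^ k \<le> 2 ^ j * (2 / 2 ^ m j) ^ k" using m(2)[OF True] a01 by (intro mult_left_mono power_mono) auto
            then show ?thesis by (simp add: power_divide power_mult[symmetric] mult.commute)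
          qed
          show ?thesis
          proof (cases "real (l j) \<le> (1 / real k + \<eta>) * real j")
            case in_range: True
            then have card1: "card (LL j) = 1" using True by (simp add: LL_def)
            have "min (2 ^ j * a j ^ k) 1 \<le> 2 ^ k * (2 ^ j / 2 ^ (k * l j))"
            proof (cases "l j = m j")
              case False
              then have lc: "l j = nat \<lceil>real j / real k\<rceil>" by (simp add: l_def max_def split: if_splits)
              have "real (k * l j) \<le> real (j + k)"
              proof -
                have "real k * real (l j) \<le> real k * (real j / real k + 1)"
                  using ceil_le unfolding lc by (intro mult_left_mono) auto
                then show ?thesis using k_pos by (simp add: distrib_left)
              qed
              then have "k * l j \<le> j + k" by (simp only: of_nat_le_iff)
              then have "(2::real) ^ (k * l j) \<le> 2 ^ (j + k)" by (intro power_increasing) auto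
              then have "1 \<le> (2::real) ^ k * (2 ^ j / 2 ^ (k * l j))" by (simp add: power_add field_simps)
              then show ?thesis by (rule min.coboundedI2)
            qed (use le_m in simp)
            then show ?thesis by (simp add: card1 add_increasing2)
          next
            case False
            have "real j / real k + 1 \<le> (1 / real k + \<eta>) * real j" using \<eta>j by (simp add: distrib_right)
            then have "real (nat \<lceil>real j / real k\<rceil>) \<le> (1 / real k + \<eta>) * real j" using ceil_le by linarith
            moreover have "real (l j) = max (real (nat \<lceil>real j / real k\<rceil>)) (real (m j))" by (simp only: l_def of_nat_max)
            ultimately have "real (m j) > (1 / real k + \<eta>) * real j" using False by linarith
            then have "real k * ((1 / real k + \<eta>) * real j) \<le> real k * real (m j)" by (intro mult_left_mono) auto
            moreover have "real k * ((1 / real k + \<eta>) * real j) = real j + real k * \<eta> * real j" using k_pos by (simp add: field_simps)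
            ultimately have "real j - real (k * m j) \<le> - (real k * \<eta>) * real j" by simp
            then have "2 powr (real j - real (k * m j)) \<le> 2 powr (- (real k * \<eta>) * real j)" by (intro powr_mono) auto
            moreover have "2 powr (real j - real (k * m j)) = 2 ^ j / 2 ^ (k * m j)"
              by (simp only: powr_diff two_powr_of_nat)
            ultimately have "2 ^ j / 2 ^ (k * m j) \<le> 2 powr (- (real k * \<eta>) * real j)" by (simp only:)
            then have "2 ^ k * (2 ^ j / 2 ^ (k * m j)) \<le> 2 ^ k * 2 powr (- (real k * \<eta>) * real j)"
              by (rule mult_left_mono) simp
            then have "min (2 ^ j * a j ^ k) 1 \<le> 2 ^ k * 2 powr (- (real k * \<eta>) * real j)" using le_m by linarith
            then show ?thesis by (simp add: add_increasing)
          qed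
        next
          case False
          then have "a j = 0" using a01(1)[of j] by linarith
          then show ?thesis using k2 by (simp add: LL_def zero_power)
        qed
        then show ?thesis unfolding nn .
      qed
    qed
    then have "summable (\<lambda>j. 1 * (2 ^ j * a j ^ k))" by (rule summable_min_imp_summable[rotated]) simp
    then have "summable (\<lambda>j. 2 ^ j * \<psi> (2 ^ j) ^ k)"
      by (simp only: a_def mult_1 summable_shift_dyadic)
    then have "summable (\<lambda>n. \<psi> (Suc n) ^ k)"
    proof (rule condensation_upper[where f = "\<lambda>n. \<psi> n ^ k", rotated 3])
      show "\<psi> n ^ k \<le> \<psi> (2 ^ j) ^ k" if "n \<in> dyadic_block j" for n j
        using admissible_psiD[OF \<psi> that] by (intro power_mono) auto
      show "0 \<le> \<psi> n ^ k" if "n \<ge> 1" for n using \<psi> that by (simp add: admissible_psi_def)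
      show "0 \<le> \<psi> (2 ^ j) ^ k" for j using admissible_psi_power[OF \<psi>, of j] by simp
    qed
    then show False using div by simp
  qed
  have "AE x in \<mu>. infinite (box_times k LL x)"
  proof (rule AE_boxes_divergence[OF k2 \<kappa>0 C0 \<eta>, where L = "\<lambda>j. k * l j"])
    show "finite (LL j)" for j by (simp add: LL_def)
    show "(\<Sum>i<k. l' i) = k * l j" if "l' \<in> LL j" for l' j
      using that by (simp add: LL_def v_def split: if_splits)
    show "l' i = 0" if "l' \<in> LL j" "k \<le> i" for l' j i
      using that by (simp add: LL_def v_def split: if_splits)
    show "real (l' i) \<le> (1 / real k + \<eta>) * real j" if "l' \<in> LL j" "i < k" for l' j i
      using that by (simp add: LL_def v_def split: if_splits)
    show "j \<le> k * l j" for j by (rule jL)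
    show "\<not> summable (\<lambda>j. 2 ^ j * (real (card (LL j)) / 2 ^ (k * l j)))" by (rule nsum)
  qed
  with AE_half_open_cube show ?thesis
  proof eventually_elim
    case (elim x)
    have "(box_times k LL x)
       \<subseteq> {n. 1 \<le> n \<and> (\<forall>i<k. nint_dist (real n * x i) < \<psi> n)}"
    proof (rule subsetI, clarify)
      fix n j l' assume n: "n \<in> dyadic_block j" and l': "l' \<in> LL j" "\<forall>i<k. nint_dist (real n * x i) < 1 / 2 ^ l' i"
      have aj: "0 < a j" "l' = v j" using l'(1) by (auto simp: LL_def split: if_splits)
      have "1 / 2 ^ l j \<le> (1::real) / 2 ^ m j" unfolding l_def by (intro divide_left_mono power_increasing) auto
      also have "\<dots> \<le> \<psi> n" using m(1)[OF aj(1)] admissible_psiD(4)[OF \<psi> n] by (simp add: a_def)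
      finally show "1 \<le> n \<and> (\<forall>i<k. nint_dist (real n * x i) < \<psi> n)"
        using l'(2) dyadic_block_pos[OF n] by (force simp: aj(2) v_def)
    qed
    then show ?case using elim finite_subset unfolding W_set_eq by blast
  qed
qed

lemma khinchin: "khinchin k \<mu>"
  unfolding khinchin_def
proof (intro allI impI conjI)
  fix \<psi> assume \<psi>: "admissible_psi \<psi>"
  show "W_set k \<psi> \<in> null_sets \<mu>" if "summable (\<lambda>n. \<psi> (Suc n) ^ k)"
    using \<psi> that by (rule khinchin_convergence)
  show "W_set k \<psi> \<in> sets \<mu>" by (rule W_set_measurable)
  show "prob (W_set k \<psi>) = 1" if "\<not> summable (\<lambda>n. \<psi> (Suc n) ^ k)"
    unfolding prob_eq_1[OF W_set_measurable] using \<psi> that by (rule khinchin_divergence)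
qed

end

section \<open>Gallagher's theorem\<close>

lemma bounded_sum_below:
  fixes b :: "nat \<Rightarrow> nat"
  assumes "t \<le> (\<Sum>i<k. b i)"
  obtains l where "\<And>i. i < k \<Longrightarrow> l i \<le> b i" "\<And>i. k \<le> i \<Longrightarrow> l i = 0" "(\<Sum>i<k. l i) = t"
proof -
  have "\<exists>l. (\<forall>i<k. l i \<le> b i) \<and> (\<forall>i\<ge>k. l i = 0) \<and> (\<Sum>i<k. l i) = t"
    using assms
  proof (induction k arbitrary: t)
    case 0
    then show ?case by (intro exI[of _ "\<lambda>_. 0"]) simp
  next
    case (Suc k)
    define t' where "t' = min t (\<Sum>i<k. b i)"
    obtain l where l: "\<forall>i<k. l i \<le> b i" "\<forall>i\<ge>k. l i = 0" "(\<Sum>i<k. l i) = t'"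
      using Suc.IH[of t'] by (auto simp: t'_def)
    show ?case
    proof (intro exI[of _ "l(k := t - t')"] conjI allI impI)
      show "(l(k := t - t')) i \<le> b i" if "i < Suc k" for i
        using that l(1) Suc.prems by (cases "i = k") (auto simp: t'_def)
      show "(l(k := t - t')) i = 0" if "Suc k \<le> i" for i using that l(2) by simp
      have "(\<Sum>i<k. (l(k := t - t')) i) = (\<Sum>i<k. l i)" by (intro sum.cong) auto
      then show "(\<Sum>i<Suc k. (l(k := t - t')) i) = t" using l(3) by (simp add: t'_def)
    qed
  qed
  then show thesis using that by blast
qed

text \<open>Rounding each \<open>d i\<close> up to a dyadic number costs at most a factor 2, so the
  exponents add up to at least \<open>L - k\<close>, also when one of them reaches the cap
  \<open>L\<close>; they are then lowered until the sum is exactly that.\<close>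

lemma hyperbolic_region_cover:
  fixes d :: "nat \<Rightarrow> real"
  assumes d: "\<And>i. i < k \<Longrightarrow> 0 \<le> d i \<and> d i \<le> 1" and prod: "(\<Prod>i<k. d i) \<le> 1 / 2 ^ L"
  obtains l where "\<And>i. k \<le> i \<Longrightarrow> l i = 0" "(\<Sum>i<k. l i) = L - k" "\<And>i. i < k \<Longrightarrow> d i \<le> 1 / 2 ^ l i"
proof -
  have "\<forall>i. \<exists>b::nat. i < k \<longrightarrow> d i \<le> 1 / 2 ^ b \<and> (b = L \<or> 1 / 2 ^ b \<le> 2 * d i)"
  proof
    fix i
    show "\<exists>b::nat. i < k \<longrightarrow> d i \<le> 1 / 2 ^ b \<and> (b = L \<or> 1 / 2 ^ b \<le> 2 * d i)"
    proof (cases "i < k")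
      case True
      then show ?thesis using dyadic_level_above[of "d i" L] d[OF True] by blast
    qed simp
  qed
  then have "\<exists>b::nat \<Rightarrow> nat. \<forall>i. i < k \<longrightarrow> d i \<le> 1 / 2 ^ b i \<and> (b i = L \<or> 1 / 2 ^ b i \<le> 2 * d i)" by (rule choice)
  then obtain b :: "nat \<Rightarrow> nat" where b: "\<And>i. i < k \<Longrightarrow> d i \<le> 1 / 2 ^ b i" "\<And>i. i < k \<Longrightarrow> b i = L \<or> 1 / 2 ^ b i \<le> 2 * d i"
    by blast
  have "L - k \<le> (\<Sum>i<k. b i)"
  proof (cases "\<exists>i<k. b i = L")
    case True
    then obtain i where "i < k" "b i = L" by blast
    then have "L \<le> (\<Sum>i<k. b i)" using member_le_sum[of i "{..<k}" b] by simp
    then show ?thesis by simp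
  next
    case False
    then have "(\<Prod>i<k. 1 / 2 ^ b i) \<le> (\<Prod>i<k. 2 * d i)" using b(2) by (intro prod_mono) auto
    also have "\<dots> = 2 ^ k * (\<Prod>i<k. d i)" by (simp add: prod.distrib)
    also have "\<dots> \<le> 2 ^ k * (1 / 2 ^ L)" by (intro mult_left_mono prod) simp
    finally have "1 / 2 ^ (\<Sum>i<k. b i) \<le> (2::real) ^ k / 2 ^ L" by (simp add: prod_dividef power_sum)
    then have "(2::real) ^ L \<le> 2 ^ (k + (\<Sum>i<k. b i))" by (simp add: power_add field_simps)
    then have "L \<le> k + (\<Sum>i<k. b i)" by simp
    then show ?thesis by simp
  qed
  then obtain l where l: "\<And>i. i < k \<Longrightarrow> l i \<le> b i" "\<And>i. k \<le> i \<Longrightarrow> l i = 0" "(\<Sum>i<k. l i) = L - k"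
    by (rule bounded_sum_below) blast
  show thesis
  proof (rule that[OF l(2,3)])
    show "d i \<le> 1 / 2 ^ l i" if "i < k" for i
    proof -
      have "(1::real) / 2 ^ b i \<le> 1 / 2 ^ l i" using l(1)[OF that] by (intro divide_left_mono power_increasing) auto
      then show ?thesis using b(1)[OF that] by linarith
    qed
  qed
qed

definition compositions :: "nat \<Rightarrow> nat \<Rightarrow> (nat \<Rightarrow> nat) set" where
  "compositions k L = {l. (\<Sum>i<k. l i) = L \<and> (\<forall>i\<ge>k. l i = 0)}"

lemma compositions_le: "l \<in> compositions k L \<Longrightarrow> i < k \<Longrightarrow> l i \<le> L"
  using member_le_sum[of i "{..<k}" l] by (auto simp: compositions_def)

lemma finite_compositions: "finite (compositions k L)"
proof (rule finite_subset)
  show "compositions k L \<subseteq> PiE_dflt {..<k} 0 (\<lambda>_. {..L})"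
  proof
    fix l assume l: "l \<in> compositions k L"
    then show "l \<in> PiE_dflt {..<k} 0 (\<lambda>_. {..L})"
      using compositions_le[OF l] by (auto simp: PiE_dflt_def compositions_def)
  qed
qed (auto intro!: finite_PiE_dflt)

text \<open>The last part is determined by the first \<open>k - 1\<close>. This is the source of the
  power of the logarithm in the convergence condition.\<close>

lemma card_compositions_le:
  assumes "k \<ge> 1"
  shows "real (card (compositions k L)) \<le> (real L + 1) ^ (k - 1)"
proof -
  obtain k' where k': "k = Suc k'" using assms by (cases k) auto
  let ?f = "\<lambda>l i. if i < k' then l i else (0::nat)"
  let ?B = "PiE_dflt {..<k'} (0::nat) (\<lambda>_. {..L})"
  have "inj_on ?f (compositions k L)"
  proof (rule inj_onI)
    fix x y assume x: "x \<in> compositions k L" and y: "y \<in> compositions k L" and eq: "?f x = ?f y"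
    have low: "x i = y i" if "i < k'" for i using fun_cong[OF eq, of i] that by simp
    then have "(\<Sum>i<k'. x i) = (\<Sum>i<k'. y i)" by (intro sum.cong) auto
    then have "x k' = y k'" using x y by (simp add: compositions_def k')
    moreover have "x i = y i" if "i > k'" for i using x y that by (simp add: compositions_def k')
    ultimately show "x = y" using low by (intro ext) (metis linorder_neqE_nat)
  qed
  moreover have "?f ` compositions k L \<subseteq> ?B"
  proof (rule image_subsetI)
    fix l assume l: "l \<in> compositions k L"
    then show "?f l \<in> ?B" using compositions_le[OF l] by (auto simp: PiE_dflt_def k')
  qed
  moreover have "finite ?B" by (intro finite_PiE_dflt) auto
  ultimately have "card (compositions k L) \<le> card ?B" by (rule card_inj_on_le)
  also have "\<dots> = (L + 1) ^ k'" by (simp add: card_PiE_dflt)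
  finally have "real (card (compositions k L)) \<le> real ((L + 1) ^ k')" by (rule of_nat_mono)
  then show ?thesis by (simp add: k' add.commute)
qed

text \<open>The divergence part uses only the boxes all of whose sides are close to \<open>2 powr - (j / k)\<close>. They are
  still a positive proportion of all boxes of their volume, and for them the dimension of \<open>\<mu>\<close> itself
  is enough: the dimensions of the factors play no role.\<close>

lemma card_balanced_compositions_ge:
  fixes \<eta> \<delta> :: real and k j L :: nat
  assumes k: "k \<ge> 1" and \<delta>: "0 \<le> \<delta>" "\<delta> \<le> \<eta>" "\<delta> * (real k - 1) \<le> 1 / real k"
    and L: "j \<le> L" "real L \<le> (1 + \<eta> / 2) * real j" and j: "real k - 1 \<le> \<eta> / 2 * real j"
  shows "(\<delta> * real j) ^ (k - 1) \<le> real (card {l \<in> compositions k L. \<forall>i<k. real (l i) \<le> (1 / real k + \<eta>) * real j})"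
proof -
  obtain k' where k': "k = Suc k'" using k by (cases k) auto
  \<comment> \<open>Each of the first \<open>k - 1\<close> parts is \<open>b + t i\<close> with
    \<open>t i \<le> \<tau>\<close>, and the last takes the remainder. The bound on
    \<open>\<delta> * (k - 1)\<close> keeps the remainder nonnegative; the lower bound on
    \<open>j\<close> keeps it balanced, since rounding in \<open>b\<close> may add up to 1 per
    part.\<close>
  define b where "b = j div k"
  define \<tau> where "\<tau> = nat \<lfloor>\<delta> * real j\<rfloor>"
  let ?A = "PiE_dflt {..<k'} (0::nat) (\<lambda>_. {..\<tau>})"
  let ?C = "{l \<in> compositions k L. \<forall>i<k. real (l i) \<le> (1 / real k + \<eta>) * real j}"
  let ?s = "\<lambda>t. \<Sum>i<k'. b + t i"
  let ?f = "\<lambda>t i. if i < k' then b + t i else if i = k' then L - ?s t else (0::nat)"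
  have k0: "real k > 0" using k by simp
  have b_le: "real b \<le> real j / real k" unfolding b_def by (rule of_nat_div_le_of_nat)
  have b_ge: "real j / real k - 1 \<le> real b"
  proof -
    have "real j = real (k * b + j mod k)" by (simp add: b_def)
    moreover have "real (j mod k) \<le> real k" using k by (simp add: less_imp_le)
    ultimately have "real j \<le> real k * (real b + 1)" by (simp add: distrib_left)
    then have "real j / real k \<le> real b + 1" using k0 by (simp add: pos_divide_le_eq mult.commute)
    then show ?thesis by simp
  qed
  have \<tau>_le: "real \<tau> \<le> \<delta> * real j" using \<delta>(1) by (simp add: \<tau>_def)
  have kk: "real k' = real k - 1" by (simp add: k')
  have s_le: "?s t \<le> L" if t: "t \<in> ?A" for t
  proof -
    have "real (?s t) = (\<Sum>i<k'. real b + real (t i))" by simp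
    also have "\<dots> \<le> (\<Sum>i<k'. real b + real \<tau>)"
      using t by (intro sum_mono) (simp add: PiE_dflt_def)
    also have "\<dots> = real k' * (real b + real \<tau>)" by simp
    also have "\<dots> \<le> real k' * (real j / real k + \<delta> * real j)" using b_le \<tau>_le by (intro mult_left_mono add_mono) auto
    also have "\<dots> = (real k - 1) / real k * real j + (\<delta> * (real k - 1)) * real j" by (simp add: kk algebra_simps)
    also have "\<dots> \<le> (real k - 1) / real k * real j + 1 / real k * real j" using \<delta>(3) by (intro add_left_mono mult_right_mono) auto
    also have "\<dots> = real j" using k0 by (simp add: field_simps)
    finally have "?s t \<le> j" by (simp only: of_nat_le_iff)
    then show ?thesis using L(1) by linarith
  qed
  have "inj_on ?f ?A"
  proof (rule inj_onI)
    fix x y assume x: "x \<in> ?A" and y: "y \<in> ?A" and eq: "?f x = ?f y"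
    show "x = y"
    proof
      fix i
      show "x i = y i"
        using fun_cong[OF eq, of i] x y by (cases "i < k'") (auto simp: PiE_dflt_def)
    qed
  qed
  moreover have "?f ` ?A \<subseteq> ?C"
  proof (rule image_subsetI)
    fix t assume t: "t \<in> ?A"
    have sum_f: "(\<Sum>i<k'. ?f t i) = ?s t" by (intro sum.cong) auto
    have "(\<Sum>i<k. ?f t i) = L" unfolding k' sum.lessThan_Suc sum_f using s_le[OF t] by simp
    moreover have "\<forall>i\<ge>k. ?f t i = 0" by (simp add: k')
    moreover have "real (?f t i) \<le> (1 / real k + \<eta>) * real j" if "i < k" for i
    proof (cases "i < k'")
      case True
      have "t i \<in> {..\<tau>}" using t True unfolding PiE_dflt_def by blast
      then have "real (t i) \<le> real \<tau>" by simp
      then have "real (b + t i) \<le> real j / real k + \<delta> * real j"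
        unfolding of_nat_add using b_le \<tau>_le by linarith
      also have "\<dots> \<le> real j / real k + \<eta> * real j" using \<delta>(2) by (intro add_left_mono mult_right_mono) auto
      finally show ?thesis using True by (simp add: distrib_right)
    next
      case False
      then have i: "i = k'" using that by (simp add: k')
      have "real k' * (real j / real k - 1) \<le> real k' * real b" by (intro mult_left_mono b_ge) simp
      also have "\<dots> = real (\<Sum>i<k'. b)" by simp
      also have "\<dots> \<le> real (?s t)" by (intro of_nat_mono sum_mono) simp
      finally have "real (L - ?s t) \<le> (1 + \<eta> / 2) * real j - real k' * (real j / real k - 1)"
        using L(2) s_le[OF t] by (simp add: of_nat_diff)
      also have "\<dots> = real j / real k + \<eta> / 2 * real j + (real k - 1)"
        unfolding kk using k0 by (simp add: field_simps)
      also have "\<dots> \<le> real j / real k + \<eta> / 2 * real j + \<eta> / 2 * real j" using j by simp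
      also have "\<dots> = (1 / real k + \<eta>) * real j" by (simp add: distrib_right)
      finally show ?thesis using i by simp
    qed
    ultimately show "?f t \<in> ?C" by (simp add: compositions_def)
  qed
  moreover have "finite ?C" using finite_compositions[of k L] by simp
  ultimately have "card ?A \<le> card ?C" by (rule card_inj_on_le)
  moreover have "card ?A = (\<tau> + 1) ^ k'" by (simp add: card_PiE_dflt)
  ultimately have "(\<tau> + 1) ^ k' \<le> card ?C" by simp
  then have "real ((\<tau> + 1) ^ k') \<le> real (card ?C)" by (rule of_nat_mono)
  moreover have "(\<delta> * real j) ^ (k - 1) \<le> real ((\<tau> + 1) ^ k')"
  proof -
    have "\<delta> * real j \<le> real \<tau> + 1" unfolding \<tau>_def by linarith
    then have "(\<delta> * real j) ^ k' \<le> (real \<tau> + 1) ^ k'" using \<delta>(1) by (intro power_mono) auto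
    then show ?thesis by (simp add: k' add.commute)
  qed
  ultimately show ?thesis by linarith
qed

lemma ln_dyadic_block:
  assumes "n \<in> dyadic_block j"
  shows "real j * ln 2 \<le> ln (real n)" "ln (real n) \<le> real j + 1"
proof -
  have n: "2 ^ j \<le> n" "n < 2 * 2 ^ j" using assms by (simp_all add: dyadic_block_def)
  have "(2::real) ^ j \<le> real n" using n(1) by (metis of_nat_le_iff of_nat_numeral of_nat_power)
  then have "ln (2 ^ j) \<le> ln (real n)" by (intro ln_mono) auto
  then show "real j * ln 2 \<le> ln (real n)" by (simp add: ln_realpow)
  have "real n \<le> 2 ^ Suc j" using n(2) by (metis less_imp_le of_nat_le_iff of_nat_numeral of_nat_power power_Suc)
  then have "ln (real n) \<le> ln (2 ^ Suc j)" using dyadic_block_pos[OF assms] by (intro ln_mono) auto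
  also have "\<dots> = real (Suc j) * ln 2" by (rule ln_realpow)
  also have "\<dots> \<le> real (Suc j) * 1" using ln_2_less_1 by (intro mult_left_mono) auto
  finally show "ln (real n) \<le> real j + 1" by simp
qed

context exponent_measure
begin

lemma gallagher_divergence:
  assumes \<psi>: "admissible_psi \<psi>" and div: "\<not> summable (\<lambda>n. \<psi> (Suc n) * ln (real (Suc n)) ^ (k - 1))"
  shows "AE x in \<mu>. x \<in> W_mult_set k \<psi>"
proof -
  define a where "a j = \<psi> (2 ^ Suc j)" for j
  have a01: "0 \<le> a j" "a j \<le> 1" for j unfolding a_def by (rule admissible_psi_power[OF \<psi>])+
  have "\<forall>j. \<exists>m::nat. 0 < a j \<longrightarrow> 1 / 2 ^ m \<le> a j \<and> a j \<le> 2 / 2 ^ m"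
    using dyadic_level_below[OF _ a01(2)] by metis
  then have "\<exists>m::nat \<Rightarrow> nat. \<forall>j. 0 < a j \<longrightarrow> 1 / 2 ^ m j \<le> a j \<and> a j \<le> 2 / 2 ^ m j" by (rule choice)
  then obtain m :: "nat \<Rightarrow> nat" where m: "\<And>j. 0 < a j \<Longrightarrow> 1 / 2 ^ m j \<le> a j" "\<And>j. 0 < a j \<Longrightarrow> a j \<le> 2 / 2 ^ m j"
    by blast
  \<comment> \<open>The truncation at \<open>1 / 2 ^ j\<close> now concerns the product of the
    sides.\<close>
  define L where "L j = max j (m j)" for j
  define LL where "LL j = (if 0 < a j then {l \<in> compositions k (L j). \<forall>i<k. real (l i) \<le> (1 / real k + \<eta>) * real j} else {})" for j
  define \<delta> where "\<delta> = min \<eta> (1 / (real k * real k))"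
  have \<delta>0: "\<delta> > 0" using \<eta>(1) k_pos by (simp add: \<delta>_def)
  have \<delta>k: "\<delta> * (real k - 1) \<le> 1 / real k"
  proof -
    have "\<delta> * (real k - 1) \<le> 1 / (real k * real k) * real k" using \<delta>0 k2 by (intro mult_mono) (auto simp: \<delta>_def)
    then show ?thesis using k_pos by simp
  qed
  let ?g = "\<lambda>j. 2 ^ j * (real (card (LL j)) / 2 ^ L j)"
  let ?w = "\<lambda>j. real j ^ (k - 1)"
  have nsum: "\<not> summable ?g"
  proof
    assume g: "summable ?g"
    have "summable (\<lambda>j. ?w j * min (2 ^ j * a j) 1)"
    proof (rule summable_comparison_test')
      show "summable (\<lambda>j. 2 / \<delta> ^ (k - 1) * ?g j + 2 * ((real j + 1) ^ (k - 1) * 2 powr (- (\<eta> / 2) * real j)))"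
        using \<eta>(1) by (intro summable_add summable_mult g summable_poly_times_exp) simp
      show "norm (?w j * min (2 ^ j * a j) 1) \<le> 2 / \<delta> ^ (k - 1) * ?g j + 2 * ((real j + 1) ^ (k - 1) * 2 powr (- (\<eta> / 2) * real j))"
        if j: "j \<ge> nat \<lceil>2 * real k / \<eta>\<rceil>" for j
      proof -
        have "2 * real k / \<eta> \<le> real j" using j by linarith
        then have \<eta>j: "real k \<le> \<eta> / 2 * real j" using \<eta>(1) by (simp add: field_simps)
        have g0: "0 \<le> 2 / \<delta> ^ (k - 1) * ?g j" using \<delta>0 by simp
        have nn: "norm (?w j * min (2 ^ j * a j) 1) = ?w j * min (2 ^ j * a j) 1" using a01[of j] by simp
        have "?w j * min (2 ^ j * a j) 1 \<le> 2 / \<delta> ^ (k - 1) * ?g j + 2 * ((real j + 1) ^ (k - 1) * 2 powr (- (\<eta> / 2) * real j))"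
        proof (cases "0 < a j")
          case True
          have le_m: "2 ^ j * a j \<le> 2 * (2 ^ j / 2 ^ m j)"
            using mult_left_mono[OF m(2)[OF True], of "2 ^ j"] by (simp add: mult_ac)
          show ?thesis
          \<comment> \<open>In this range there are at least \<open>(\<delta> * j) ^ (k - 1)\<close>
            balanced boxes, matching the power of the logarithm. Beyond it \<open>a j\<close> is so
            small that the terms are dominated by a polynomial times a geometric sequence.\<close>
          proof (cases "real (L j) \<le> (1 + \<eta> / 2) * real j")
            case in_range: True
            have "(\<delta> * real j) ^ (k - 1) \<le> real (card (LL j))"
              unfolding LL_def using True in_range \<delta>0 \<delta>k \<eta>j k2
              by (simp only: if_True) (intro card_balanced_compositions_ge, auto simp: \<delta>_def L_def)
            then have c: "?w j \<le> real (card (LL j)) / \<delta> ^ (k - 1)"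
              using \<delta>0 by (simp add: power_mult_distrib field_simps)
            have d: "min (2 ^ j * a j) 1 \<le> 2 * (2 ^ j / 2 ^ L j)"
            proof (cases "L j = m j")
              case True
              have "min (2 ^ j * a j) 1 \<le> 2 ^ j * a j" by (rule min.cobounded1)
              then show ?thesis using le_m True by simp
            next
              case False
              then have "L j = j" by (simp add: L_def max_def split: if_splits)
              then show ?thesis by simp
            qed
            have "?w j * min (2 ^ j * a j) 1 \<le> (real (card (LL j)) / \<delta> ^ (k - 1)) * (2 * (2 ^ j / 2 ^ L j))"
              using a01[of j] \<delta>0 by (intro mult_mono c d) auto
            also have "\<dots> = 2 / \<delta> ^ (k - 1) * ?g j" by simp
            finally show ?thesis by (simp add: add_increasing2)
          next
            case False
            have "real j \<le> (1 + \<eta> / 2) * real j" using \<eta>(1) by (simp add: distrib_right)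
            moreover have "real (L j) = max (real j) (real (m j))" by (simp only: L_def of_nat_max)
            ultimately have "real (m j) > (1 + \<eta> / 2) * real j" using False by linarith
            then have "real j - real (m j) \<le> - (\<eta> / 2) * real j" by (simp add: distrib_right)
            then have "2 powr (real j - real (m j)) \<le> 2 powr (- (\<eta> / 2) * real j)" by (intro powr_mono) auto
            moreover have "2 powr (real j - real (m j)) = 2 ^ j / 2 ^ m j"
              by (simp only: powr_diff two_powr_of_nat)
            ultimately have "2 ^ j / 2 ^ m j \<le> 2 powr (- (\<eta> / 2) * real j)" by (simp only:)
            then have "min (2 ^ j * a j) 1 \<le> 2 * 2 powr (- (\<eta> / 2) * real j)" using le_m by linarith
            then have "?w j * min (2 ^ j * a j) 1 \<le> (real j + 1) ^ (k - 1) * (2 * 2 powr (- (\<eta> / 2) * real j))"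
              using a01[of j] by (intro mult_mono power_mono) auto
            then show ?thesis using g0 by linarith
          qed
        next
          case False
          then have "a j = 0" using a01(1)[of j] by linarith
          then show ?thesis by (simp add: LL_def)
        qed
        then show ?thesis unfolding nn .
      qed
    qed
    then have s1: "summable (\<lambda>j. ?w j * (2 ^ j * a j))" by (rule summable_min_imp_summable[rotated]) simp
    have "summable (\<lambda>j. 2 ^ Suc j * (\<psi> (2 ^ Suc j) * (real (Suc j) + 1) ^ (k - 1)))"
    proof (rule summable_comparison_test')
      show "summable (\<lambda>j. 2 * 3 ^ (k - 1) * (?w j * (2 ^ j * a j)))" by (intro summable_mult s1)
      show "norm (2 ^ Suc j * (\<psi> (2 ^ Suc j) * (real (Suc j) + 1) ^ (k - 1))) \<le> 2 * 3 ^ (k - 1) * (?w j * (2 ^ j * a j))"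
        if "j \<ge> 1" for j
      proof -
        have "(real (Suc j) + 1) ^ (k - 1) \<le> (3 * real j) ^ (k - 1)" using that by (intro power_mono) auto
        then have "2 ^ Suc j * (a j * (real (Suc j) + 1) ^ (k - 1)) \<le> 2 ^ Suc j * (a j * (3 * real j) ^ (k - 1))"
          using a01[of j] by (intro mult_left_mono) auto
        also have "\<dots> = 2 * 3 ^ (k - 1) * (?w j * (2 ^ j * a j))" by (simp add: power_mult_distrib mult_ac)
        finally have le: "2 ^ Suc j * (a j * (real (Suc j) + 1) ^ (k - 1)) \<le> 2 * 3 ^ (k - 1) * (?w j * (2 ^ j * a j))" .
        have "0 \<le> 2 ^ Suc j * (a j * (real (Suc j) + 1) ^ (k - 1))"
          using a01[of j] by (intro mult_nonneg_nonneg) auto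
        then show ?thesis using le unfolding a_def by (simp only: real_norm_def abs_of_nonneg)
      qed
    qed
    then have "summable (\<lambda>j. 2 ^ j * (\<psi> (2 ^ j) * (real j + 1) ^ (k - 1)))" by (subst (asm) summable_Suc_iff)
    then have "summable (\<lambda>n. \<psi> (Suc n) * ln (real (Suc n)) ^ (k - 1))"
    proof (rule condensation_upper[where f = "\<lambda>n. \<psi> n * ln (real n) ^ (k - 1)", rotated 3])
      show "\<psi> n * ln (real n) ^ (k - 1) \<le> \<psi> (2 ^ j) * (real j + 1) ^ (k - 1)" if n: "n \<in> dyadic_block j" for n j
        using admissible_psiD[OF \<psi> n] ln_dyadic_block[OF n] dyadic_block_pos[OF n] admissible_psi_power[OF \<psi>, of j]
        by (intro mult_mono power_mono) (auto simp: Suc_le_eq)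
      show "0 \<le> \<psi> n * ln (real n) ^ (k - 1)" if "n \<ge> 1" for n using \<psi> that by (simp add: admissible_psi_def)
      show "0 \<le> \<psi> (2 ^ j) * (real j + 1) ^ (k - 1)" for j using admissible_psi_power[OF \<psi>, of j] by simp
    qed
    then show False using div by simp
  qed
  have "AE x in \<mu>. infinite (box_times k LL x)"
  proof (rule AE_boxes_divergence[OF k2 \<kappa>0 C0 \<eta> _ _ _ _ _ nsum])
    show "finite (LL j)" for j using finite_compositions[of k "L j"] by (simp add: LL_def)
    show "(\<Sum>i<k. l i) = L j" if "l \<in> LL j" for l j
      using that by (simp add: LL_def compositions_def split: if_splits)
    show "l i = 0" if "l \<in> LL j" "k \<le> i" for l j i
      using that by (simp add: LL_def compositions_def split: if_splits)
    show "real (l i) \<le> (1 / real k + \<eta>) * real j" if "l \<in> LL j" "i < k" for l j i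
      using that by (simp add: LL_def split: if_splits)
    show "j \<le> L j" for j by (simp add: L_def)
  qed
  with AE_half_open_cube show ?thesis
  proof eventually_elim
    case (elim x)
    have "(box_times k LL x)
       \<subseteq> {n. 1 \<le> n \<and> (\<Prod>i<k. nint_dist (real n * x i)) < \<psi> n}"
    proof (rule subsetI, clarify)
      fix n j l assume n: "n \<in> dyadic_block j" and l: "l \<in> LL j" "\<forall>i<k. nint_dist (real n * x i) < 1 / 2 ^ l i"
      have aj: "0 < a j" and lc: "l \<in> compositions k (L j)" using l(1) by (auto simp: LL_def split: if_splits)
      have "(\<Prod>i<k. nint_dist (real n * x i)) < (\<Prod>i<k. 1 / 2 ^ l i)"
        using l(2) k2 by (intro prod_mono_strict[of 0]) (auto simp: nint_dist_nonneg less_imp_le)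
      also have "\<dots> = 1 / 2 ^ L j" using lc by (simp add: compositions_def prod_dividef power_sum[symmetric])
      also have "\<dots> \<le> 1 / 2 ^ m j" unfolding L_def by (intro divide_left_mono power_increasing) auto
      also have "\<dots> \<le> \<psi> n" using m(1)[OF aj] admissible_psiD(4)[OF \<psi> n] by (simp add: a_def)
      finally show "1 \<le> n \<and> (\<Prod>i<k. nint_dist (real n * x i)) < \<psi> n" using dyadic_block_pos[OF n] by simp
    qed
    then show ?case using elim finite_subset unfolding W_mult_set_def by blast
  qed
qed

lemma gallagher_convergence:
  assumes \<psi>: "admissible_psi \<psi>" and sum: "summable (\<lambda>n. \<psi> (Suc n) * ln (real (Suc n)) ^ (k - 1))"
    and \<kappa>1: "0 < \<kappa>1" "\<kappa>1 < 1 / (real k + 1)" and C1: "0 \<le> C1"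
    and box: "\<And>X::nat \<Rightarrow> nat. (\<And>i. 1 \<le> X i) \<Longrightarrow>
      (\<Sum>\<xi>\<in>ivec k (\<lambda>i. {- int (X i)..int (X i)}). amp \<xi>) \<le> (\<Prod>i<k. C1 * real (X i) powr \<kappa>1)"
  shows "W_mult_set k \<psi> \<in> null_sets \<mu>"
proof -
  have "\<kappa>1 * (real k + 1) < 1" using \<kappa>1(2) k_pos by (simp add: field_simps)
  then have gap: "0 < 1 - \<kappa>1 * (real k + 1)" by simp
  \<comment> \<open>At most half of the gap in \<open>\<kappa>1 * (k + 1) < 1\<close> pays for
    raising the exponent of the smallest volume from 1 to \<open>1 + \<theta>\<close>.\<close>
  define \<theta> where "\<theta> = min 1 ((1 - \<kappa>1 * (real k + 1)) / (2 * \<kappa>1))"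
  have \<theta>: "0 < \<theta>" "\<theta> \<le> 1" using gap \<kappa>1(1) by (auto simp: \<theta>_def)
  define \<zeta> where "\<zeta> = 1 - \<kappa>1 * (real k + 1 + \<theta>)"
  have \<zeta>0: "0 < \<zeta>"
  proof -
    have "\<kappa>1 * \<theta> \<le> \<kappa>1 * ((1 - \<kappa>1 * (real k + 1)) / (2 * \<kappa>1))" using \<kappa>1(1) by (intro mult_left_mono) (auto simp: \<theta>_def)
    also have "\<dots> = (1 - \<kappa>1 * (real k + 1)) / 2" using \<kappa>1(1) by simp
    finally show ?thesis using gap unfolding \<zeta>_def by (simp add: distrib_left)
  qed
  define cap where "cap j = nat \<lceil>(1 + \<theta>) * real j\<rceil>" for j
  have cap_ge: "(1 + \<theta>) * real j \<le> real (cap j)" for j unfolding cap_def by (rule real_nat_ceiling_ge)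
  have cap_le: "real (cap j) \<le> (1 + \<theta>) * real j + 1" for j
    using \<theta> unfolding cap_def by (intro real_nat_ceiling_le_add_1) auto
  have cap_le2: "real (cap j) \<le> 2 * real j + 1" for j
    using cap_le[of j] \<theta> mult_right_mono[of "1 + \<theta>" 2 "real j"] by simp
  have "\<forall>j. \<exists>l. l \<le> cap j \<and> \<psi> (2 ^ j) \<le> 1 / 2 ^ l \<and> (l = cap j \<or> 1 / 2 ^ l \<le> 2 * \<psi> (2 ^ j))"
    using dyadic_level_above[OF admissible_psi_power[OF \<psi>]] by metis
  then obtain M where M: "\<And>j. M j \<le> cap j" "\<And>j. \<psi> (2 ^ j) \<le> 1 / 2 ^ M j"
      "\<And>j. M j = cap j \<or> 1 / 2 ^ M j \<le> 2 * \<psi> (2 ^ j)"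
    by (auto dest!: choice)
  define L where "L j = M j - k" for j
  define LL where "LL j = compositions k (L j)" for j
  have L_le: "L j \<le> cap j" for j using M(1)[of j] by (simp add: L_def)
  have card_le: "real (card (LL j)) \<le> (2 * real j + 2) ^ (k - 1)" for j
  proof -
    have "real (card (LL j)) \<le> (real (L j) + 1) ^ (k - 1)" unfolding LL_def using k2 by (intro card_compositions_le) auto
    also have "\<dots> \<le> (2 * real j + 2) ^ (k - 1)"
    proof (rule power_mono)
      have "real (L j) \<le> real (cap j)" using L_le[of j] by simp
      then show "real (L j) + 1 \<le> 2 * real j + 2" using cap_le2[of j] by linarith
    qed simp
    finally show ?thesis .
  qed
  have sum2: "summable (\<lambda>j. 2 ^ j * (\<psi> (2 ^ j) * (2 * real j + 2) ^ (k - 1)))"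
  proof -
    have s0: "summable (\<lambda>j. 2 ^ j * (\<psi> (2 ^ Suc j) * (real j * ln 2) ^ (k - 1)))"
    proof (rule condensation_lower[where f = "\<lambda>n. \<psi> n * ln (real n) ^ (k - 1)", OF _ _ _ sum])
      show "\<psi> (2 ^ Suc j) * (real j * ln 2) ^ (k - 1) \<le> \<psi> n * ln (real n) ^ (k - 1)" if n: "n \<in> dyadic_block j" for n j
        using admissible_psiD[OF \<psi> n] ln_dyadic_block[OF n] by (intro mult_mono power_mono) auto
      show "0 \<le> \<psi> n * ln (real n) ^ (k - 1)" if "n \<ge> 1" for n using \<psi> that by (simp add: admissible_psi_def)
      show "0 \<le> \<psi> (2 ^ Suc j) * (real j * ln 2) ^ (k - 1)" for j
        by (intro mult_nonneg_nonneg admissible_psi_power[OF \<psi>] zero_le_power) (simp_all add: ln_ge_zero)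
    qed
    have "summable (\<lambda>j. 2 ^ Suc j * (\<psi> (2 ^ Suc j) * (2 * real (Suc j) + 2) ^ (k - 1)))"
    proof (rule summable_comparison_test')
      show "summable (\<lambda>j. 2 * (6 / ln 2) ^ (k - 1) * (2 ^ j * (\<psi> (2 ^ Suc j) * (real j * ln 2) ^ (k - 1))))"
        by (intro summable_mult s0)
      show "norm (2 ^ Suc j * (\<psi> (2 ^ Suc j) * (2 * real (Suc j) + 2) ^ (k - 1)))
          \<le> 2 * (6 / ln 2) ^ (k - 1) * (2 ^ j * (\<psi> (2 ^ Suc j) * (real j * ln 2) ^ (k - 1)))" if "j \<ge> 1" for j
      proof -
        have p0: "0 \<le> \<psi> (2 ^ Suc j)" by (rule admissible_psi_power[OF \<psi>])
        have "(2 * real (Suc j) + 2) ^ (k - 1) \<le> (6 / ln 2 * (real j * ln 2)) ^ (k - 1)"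
          using that by (intro power_mono) auto
        then have "2 ^ Suc j * (\<psi> (2 ^ Suc j) * (2 * real (Suc j) + 2) ^ (k - 1))
            \<le> 2 ^ Suc j * (\<psi> (2 ^ Suc j) * (6 / ln 2 * (real j * ln 2)) ^ (k - 1))"
          using p0 by (intro mult_left_mono) auto
        also have "(6 / ln 2 * (real j * ln 2)) ^ (k - 1) = (6 / ln 2) ^ (k - 1) * (real j * ln 2) ^ (k - 1)"
          by (rule power_mult_distrib)
        finally show ?thesis using p0 by (simp add: mult_ac)
      qed
    qed
    then show ?thesis by (subst (asm) summable_Suc_iff)
  qed
  have "AE x in \<mu>. finite (closed_box_times k LL x)"
  proof (rule AE_boxes_convergence[where L = L and \<zeta> = \<zeta> and C = "C1 ^ k * 2 powr (\<kappa>1 * (real k + 1))"])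
    show "finite (LL j)" for j by (simp add: LL_def finite_compositions)
    show "(\<Sum>i<k. l i) = L j" if "l \<in> LL j" for l j using that by (simp add: LL_def compositions_def)
    show "l i \<le> 3 * j + 3" if "l \<in> LL j" "i < k" for l j i
    proof -
      have "l i \<le> L j" using compositions_le[of l k "L j" i] that by (simp add: LL_def)
      moreover have "cap j \<le> 2 * j + 1" using cap_le2[of j] by linarith
      ultimately show ?thesis using L_le[of j] by linarith
    qed
    show "0 < \<zeta>" by (rule \<zeta>0)
    show "(\<Sum>\<xi>\<in>dilated_box k (2 ^ j) l. amp \<xi>)
        \<le> C1 ^ k * 2 powr (\<kappa>1 * (real k + 1)) * 2 powr ((1 - \<zeta>) * real j)" if l: "l \<in> LL j" for l j
    proof -
      have "(\<Sum>\<xi>\<in>dilated_box k (2 ^ j) l. amp \<xi>)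
          = (\<Sum>\<xi>\<in>ivec k (\<lambda>i. {- int (2 ^ (1 + j + l i))..int (2 ^ (1 + j + l i))}). amp \<xi>)"
        by (simp add: power_add mult.assoc)
      also have "\<dots> \<le> (\<Prod>i<k. C1 * real (2 ^ (1 + j + l i)) powr \<kappa>1)" by (rule box) simp
      also have "\<dots> = (\<Prod>i<k. C1 * 2 powr (\<kappa>1 * real (1 + j + l i)))"
        by (simp only: of_nat_power of_nat_numeral two_powr_of_nat[symmetric] powr_powr mult.commute)
      also have "\<dots> = C1 ^ k * (\<Prod>i<k. 2 powr (\<kappa>1 * real (1 + j + l i)))" by (simp only: prod.distrib) simp
      also have "(\<Prod>i<k. 2 powr (\<kappa>1 * real (1 + j + l i))) = 2 powr (\<Sum>i<k. \<kappa>1 * real (1 + j + l i))"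
        by (rule powr_sum[symmetric]) auto
      \<comment> \<open>Because every coordinate has the same exponent \<open>\<kappa>1\<close>, the
        shape of the box disappears; there remain \<open>k * j\<close> from the dilation and
        \<open>L j\<close>, at most \<open>(1 + \<theta>) * j + 1\<close>, from the volume.\<close>
      also have "(\<Sum>i<k. \<kappa>1 * real (1 + j + l i)) = \<kappa>1 * (real k * (1 + real j) + real (L j))"
      proof -
        have "(\<Sum>i<k. real (l i)) = real (L j)" using l by (simp add: LL_def compositions_def flip: of_nat_sum)
        then show ?thesis by (simp add: sum_distrib_left[symmetric] sum.distrib distrib_left)
      qed
      also have "C1 ^ k * 2 powr (\<kappa>1 * (real k * (1 + real j) + real (L j)))
          \<le> C1 ^ k * 2 powr (\<kappa>1 * (real k + 1) + (1 - \<zeta>) * real j)"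
      proof (intro mult_left_mono powr_mono)
        have "real (L j) \<le> (1 + \<theta>) * real j + 1" using L_le[of j] cap_le[of j] by linarith
        then have "\<kappa>1 * (real k * (1 + real j) + real (L j)) \<le> \<kappa>1 * (real k * (1 + real j) + ((1 + \<theta>) * real j + 1))"
          using \<kappa>1(1) by (intro mult_left_mono add_left_mono) auto
        also have "\<dots> = \<kappa>1 * (real k + 1) + (1 - \<zeta>) * real j" by (simp add: \<zeta>_def algebra_simps)
        finally show "\<kappa>1 * (real k * (1 + real j) + real (L j)) \<le> \<kappa>1 * (real k + 1) + (1 - \<zeta>) * real j" .
      qed (use C1 in auto)
      finally show ?thesis by (simp add: powr_add mult.assoc)
    qed
    show "summable (\<lambda>j. 2 ^ j * (real (card (LL j)) / 2 ^ L j))"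
    proof (rule summable_comparison_test')
      show "summable (\<lambda>j. 2 ^ k * (2 * (2 ^ j * (\<psi> (2 ^ j) * (2 * real j + 2) ^ (k - 1)))
          + 2 ^ (k - 1) * ((real j + 1) ^ (k - 1) * 2 powr (- \<theta> * real j))))"
        using \<theta> by (intro summable_mult summable_add sum2 summable_poly_times_exp)
      show "norm (2 ^ j * (real (card (LL j)) / 2 ^ L j)) \<le> 2 ^ k * (2 * (2 ^ j * (\<psi> (2 ^ j) * (2 * real j + 2) ^ (k - 1)))
          + 2 ^ (k - 1) * ((real j + 1) ^ (k - 1) * 2 powr (- \<theta> * real j)))" if "j \<ge> 0" for j
      proof -
        have p0: "0 \<le> \<psi> (2 ^ j)" by (rule admissible_psi_power[OF \<psi>])
        have "1 / 2 ^ L j \<le> 2 ^ k * (1 / (2::real) ^ M j)"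
        proof -
          have "(2::real) ^ M j \<le> 2 ^ (k + L j)" unfolding L_def by (intro power_increasing) auto
          then show ?thesis by (simp add: power_add field_simps)
        qed
        also have "\<dots> \<le> 2 ^ k * (2 * \<psi> (2 ^ j) + 2 powr (- ((1 + \<theta>) * real j)))"
        proof (rule mult_left_mono)
          show "1 / 2 ^ M j \<le> 2 * \<psi> (2 ^ j) + 2 powr (- ((1 + \<theta>) * real j))"
            using M(3)[of j]
          proof
            assume "M j = cap j"
            then have "1 / 2 ^ M j = 2 powr (- real (cap j))" by (simp add: powr_minus powr_realpow divide_inverse)
            also have "\<dots> \<le> 2 powr (- ((1 + \<theta>) * real j))" using cap_ge[of j] by (intro powr_mono) auto
            finally show ?thesis using p0 by linarith
          next
            assume "1 / 2 ^ M j \<le> 2 * \<psi> (2 ^ j)"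
            then show ?thesis by (rule order_trans) simp
          qed
        qed simp
        finally have inv: "1 / 2 ^ L j \<le> 2 ^ k * (2 * \<psi> (2 ^ j) + 2 powr (- ((1 + \<theta>) * real j)))" .
        have "2 ^ j * (real (card (LL j)) / 2 ^ L j) = 2 ^ j * (real (card (LL j)) * (1 / 2 ^ L j))" by simp
        also have "\<dots> \<le> 2 ^ j * ((2 * real j + 2) ^ (k - 1) * (2 ^ k * (2 * \<psi> (2 ^ j) + 2 powr (- ((1 + \<theta>) * real j)))))"
          by (intro mult_left_mono mult_mono card_le inv) auto
        also have "\<dots> = 2 ^ k * (2 * (2 ^ j * (\<psi> (2 ^ j) * (2 * real j + 2) ^ (k - 1)))
            + (2 * real j + 2) ^ (k - 1) * (2 ^ j * 2 powr (- ((1 + \<theta>) * real j))))"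
          by (simp add: algebra_simps)
        also have "(2 * real j + 2) ^ (k - 1) * (2 ^ j * 2 powr (- ((1 + \<theta>) * real j)))
            = 2 ^ (k - 1) * ((real j + 1) ^ (k - 1) * 2 powr (- \<theta> * real j))"
        proof -
          have "2 * real j + 2 = 2 * (real j + 1)" by simp
          then have "(2 * real j + 2) ^ (k - 1) = 2 ^ (k - 1) * (real j + 1) ^ (k - 1)" by (simp only: power_mult_distrib)
          moreover have "2 ^ j * 2 powr (- ((1 + \<theta>) * real j)) = 2 powr (- \<theta> * real j)"
            unfolding two_powr_of_nat[symmetric] powr_add[symmetric] by (simp add: algebra_simps)
          ultimately show ?thesis by (simp only: mult.assoc)
        qed
        finally have le: "2 ^ j * (real (card (LL j)) / 2 ^ L j) \<le> 2 ^ k * (2 * (2 ^ j * (\<psi> (2 ^ j) * (2 * real j + 2) ^ (k - 1)))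
          + 2 ^ (k - 1) * ((real j + 1) ^ (k - 1) * 2 powr (- \<theta> * real j)))" .
        have "0 \<le> 2 ^ j * (real (card (LL j)) / 2 ^ L j)" by simp
        then show ?thesis using le by (simp only: real_norm_def abs_of_nonneg)
      qed
    qed
  qed
  then have "AE x in \<mu>. x \<notin> W_mult_set k \<psi>"
  proof eventually_elim
    case (elim x)
    have "{n. 1 \<le> n \<and> (\<Prod>i<k. nint_dist (real n * x i)) < \<psi> n}
        \<subseteq> (closed_box_times k LL x)"
    proof (rule subsetI, clarify)
      fix n :: nat assume n: "1 \<le> n" "(\<Prod>i<k. nint_dist (real n * x i)) < \<psi> n"
      obtain j where j: "n \<in> dyadic_block j" using ex_dyadic_block[OF n(1)] by blast
      have "(\<Prod>i<k. nint_dist (real n * x i)) \<le> 1 / 2 ^ M j" using n(2) admissible_psiD(3)[OF \<psi> j] M(2)[of j] by linarith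
      moreover have "0 \<le> nint_dist (real n * x i) \<and> nint_dist (real n * x i) \<le> 1" for i
        using nint_dist_nonneg[of "real n * x i"] nint_dist_le_half[of "real n * x i"] by linarith
      ultimately obtain l where l: "\<And>i. k \<le> i \<Longrightarrow> l i = 0" "(\<Sum>i<k. l i) = M j - k" "\<And>i. i < k \<Longrightarrow> nint_dist (real n * x i) \<le> 1 / 2 ^ l i"
        using hyperbolic_region_cover[of k "\<lambda>i. nint_dist (real n * x i)" "M j"] by blast
      then have "l \<in> LL j" by (simp add: LL_def L_def compositions_def)
      then show "\<exists>j. n \<in> dyadic_block j \<and> (\<exists>l\<in>LL j. \<forall>i<k. nint_dist (real n * x i) \<le> 1 / 2 ^ l i)"
        using j l(3) by blast
    qed
    then show ?case using elim finite_subset unfolding W_mult_set_def by blast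
  qed
  then show ?thesis using AE_iff_null_sets[OF W_mult_set_measurable] by simp
qed

end

section \<open>Product measures\<close>

lemma fourier_coeff_PiM:
  assumes "\<And>j. j < k \<Longrightarrow> prob_space (\<mu>s j)" "\<And>j. j < k \<Longrightarrow> sets (\<mu>s j) = sets borel"
  shows "fourier_coeff k (PiM {..<k} \<mu>s) \<xi> = (\<Prod>i<k. fourier_coeff1 (\<mu>s i) (\<xi> i))"
proof -
  \<comment> \<open>\<open>product_sigma_finite\<close> ranges over all indices, so the family is
    filled up with point masses from \<open>k\<close> on.\<close>
  define N where "N i = (if i < k then \<mu>s i else return borel 0)" for i
  have N: "prob_space (N i)" "sets (N i) = sets borel" for i
    using assms by (auto simp: N_def prob_space_return)
  interpret product_sigma_finite N
    using N(1) by (simp add: product_sigma_finite_def prob_space_imp_sigma_finite)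
  have PN: "PiM {..<k} \<mu>s = PiM {..<k} N" by (intro PiM_cong) (auto simp: N_def)
  have char: "character k \<xi> x = (\<Prod>i<k. cis (- 2 * pi * (of_int (\<xi> i) * x i)))" for x
    unfolding character_def sum_negf[symmetric] ee_sum by (simp add: ee_def)
  have "fourier_coeff k (PiM {..<k} \<mu>s) \<xi> = (\<Prod>i<k. \<integral>y. cis (- 2 * pi * (of_int (\<xi> i) * y)) \<partial>N i)"
    unfolding fourier_coeff_eq char PN
  proof (rule product_integral_prod)
    fix i
    interpret P: prob_space "N i" by (rule N(1))
    have "(\<lambda>y. cis (- 2 * pi * (of_int (\<xi> i) * y))) \<in> borel_measurable borel"
      by (intro borel_measurable_continuous_onI continuous_intros)
    then have "(\<lambda>y. cis (- 2 * pi * (of_int (\<xi> i) * y))) \<in> borel_measurable (N i)"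
      by (subst measurable_cong_sets[OF N(2) refl])
    then show "integrable (N i) (\<lambda>y. cis (- 2 * pi * (of_int (\<xi> i) * y)))"
      by (intro P.integrable_const_bound[where B = 1]) auto
  qed simp
  also have "\<dots> = (\<Prod>i<k. fourier_coeff1 (\<mu>s i) (\<xi> i))"
    by (intro prod.cong refl) (simp add: fourier_coeff1_def N_def)
  finally show ?thesis .
qed

lemma product_box_sum_le:
  fixes \<mu>s :: "nat \<Rightarrow> real measure" and t :: real
  assumes ps: "\<And>j. j < k \<Longrightarrow> prob_space (\<mu>s j)" "\<And>j. j < k \<Longrightarrow> sets (\<mu>s j) = sets borel"
    and dim: "\<And>j. j < k \<Longrightarrow> 1 - t < fourier_l1_dim1 (\<mu>s j)" and t: "t > 0"
  obtains \<kappa>1 C1 where "0 < \<kappa>1" "\<kappa>1 < t" "0 \<le> C1"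
    "\<And>X::nat \<Rightarrow> nat. (\<And>i. 1 \<le> X i) \<Longrightarrow>
      (\<Sum>\<xi>\<in>ivec k (\<lambda>i. {- int (X i)..int (X i)}). cmod (fourier_coeff k (PiM {..<k} \<mu>s) \<xi>)) \<le> (\<Prod>i<k. C1 * real (X i) powr \<kappa>1)"
proof -
  let ?P = "\<lambda>j s C. 1 - t < s \<and> (\<forall>Q\<ge>1. (\<Sum>\<xi>\<in>{\<xi>::int. \<bar>real_of_int \<xi>\<bar> \<le> Q}. cmod (fourier_coeff1 (\<mu>s j) \<xi>)) \<le> C * Q powr (1 - s))"
  have "\<forall>j. \<exists>s. j < k \<longrightarrow> (\<exists>C. ?P j s C)"
  proof
    fix j show "\<exists>s. j < k \<longrightarrow> (\<exists>C. ?P j s C)"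
    proof (cases "j < k")
      case True
      then show ?thesis by (rule dim1_gtD[OF ps(1) dim]) (use True in blast)+
    qed simp
  qed
  then have "\<exists>s. \<forall>j. j < k \<longrightarrow> (\<exists>C. ?P j (s j) C)" by (rule choice)
  then obtain s where s: "\<And>j. j < k \<Longrightarrow> \<exists>C. ?P j (s j) C" by blast
  then have "\<forall>j. \<exists>C. j < k \<longrightarrow> ?P j (s j) C" by blast
  then have "\<exists>C. \<forall>j. j < k \<longrightarrow> ?P j (s j) (C j)" by (rule choice)
  then obtain C where C: "\<And>j. j < k \<Longrightarrow> ?P j (s j) (C j)" by blast
  \<comment> \<open>One exponent serves all factors; the element \<open>t / 2\<close> keeps it
    positive and the set nonempty.\<close>
  define A where "A = insert (t / 2) ((\<lambda>j. 1 - s j) ` {..<k})"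
  define \<kappa>1 where "\<kappa>1 = Max A"
  have finA: "finite A" "A \<noteq> {}" by (auto simp: A_def)
  have pos: "0 < \<kappa>1"
  proof -
    have "t / 2 \<le> \<kappa>1" unfolding \<kappa>1_def using finA by (intro Max_ge) (auto simp: A_def)
    then show ?thesis using t by linarith
  qed
  have less: "\<kappa>1 < t" unfolding \<kappa>1_def using finA C t by (subst Max_less_iff) (force simp: A_def)+
  define C1 where "C1 = (\<Sum>j<k. \<bar>C j\<bar>)"
  have C1: "0 \<le> C1" unfolding C1_def by (intro sum_nonneg) auto
  have one: "(\<Sum>\<xi>\<in>{- int N..int N}. cmod (fourier_coeff1 (\<mu>s j) \<xi>)) \<le> C1 * real N powr \<kappa>1"
    if j: "j < k" and N: "1 \<le> N" for j N
  proof -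
    have eq: "{\<xi>::int. \<bar>real_of_int \<xi>\<bar> \<le> real N} = {- int N..int N}"
    proof -
      have iff: "\<bar>real_of_int \<xi>\<bar> \<le> real N \<longleftrightarrow> \<bar>\<xi>\<bar> \<le> int N" for \<xi>
      proof -
        have "\<bar>real_of_int \<xi>\<bar> \<le> real N \<longleftrightarrow> real_of_int \<bar>\<xi>\<bar> \<le> real_of_int (int N)" by simp
        then show ?thesis by (simp only: of_int_le_iff)
      qed
      show ?thesis unfolding iff by (auto simp: abs_le_iff)
    qed
    have "(\<Sum>\<xi>\<in>{- int N..int N}. cmod (fourier_coeff1 (\<mu>s j) \<xi>)) \<le> C j * real N powr (1 - s j)"
      using C[OF j] N unfolding eq[symmetric] by auto
    also have "\<dots> \<le> C1 * real N powr \<kappa>1"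
    proof (rule mult_mono)
      have "\<bar>C j\<bar> \<le> C1" unfolding C1_def using j by (intro member_le_sum) auto
      then show "C j \<le> C1" by linarith
      have "1 - s j \<le> \<kappa>1" unfolding \<kappa>1_def using finA j by (intro Max_ge) (auto simp: A_def)
      then show "real N powr (1 - s j) \<le> real N powr \<kappa>1" using N by (intro powr_mono) auto
    qed (use C1 in auto)
    finally show ?thesis .
  qed
  show thesis
  proof (rule that[OF pos less C1])
    fix X :: "nat \<Rightarrow> nat" assume X: "\<And>i. 1 \<le> X i"
    have "(\<Sum>\<xi>\<in>ivec k (\<lambda>i. {- int (X i)..int (X i)}). cmod (fourier_coeff k (PiM {..<k} \<mu>s) \<xi>))
        = (\<Sum>\<xi>\<in>ivec k (\<lambda>i. {- int (X i)..int (X i)}). \<Prod>i<k. cmod (fourier_coeff1 (\<mu>s i) (\<xi> i)))"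
      by (simp add: fourier_coeff_PiM[OF ps] prod_norm)
    also have "\<dots> = (\<Prod>i<k. \<Sum>\<xi>\<in>{- int (X i)..int (X i)}. cmod (fourier_coeff1 (\<mu>s i) \<xi>))"
      by (rule prod_sum_PiE_dflt[symmetric]) auto
    also have "\<dots> \<le> (\<Prod>i<k. C1 * real (X i) powr \<kappa>1)"
      using X by (intro prod_mono conjI sum_nonneg one) auto
    finally show "(\<Sum>\<xi>\<in>ivec k (\<lambda>i. {- int (X i)..int (X i)}). cmod (fourier_coeff k (PiM {..<k} \<mu>s) \<xi>))
        \<le> (\<Prod>i<k. C1 * real (X i) powr \<kappa>1)" .
  qed
qed

lemma exponent_measure_of_dim:
  fixes k :: nat and \<mu> :: "(nat \<Rightarrow> real) measure"
  assumes k: "1 \<le> k" and prob: "prob_space \<mu>" and sets_mu: "sets \<mu> = sets (borel_k k)"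
    and supp: "measure \<mu> (PiE {..<k} (\<lambda>_. {0..1})) = 1"
    and dim: "fourier_l1_dim k \<mu> > real k - (real k - 1) / (real k + 1)"
  obtains \<kappa> \<eta> C0 where "exponent_measure k \<mu> \<kappa> \<eta> C0"
proof -
  interpret prob_space \<mu> by (rule prob)
  interpret cube_measure k \<mu> by unfold_locales (rule sets_mu)
  define t where "t = (real k - 1) / (real k + 1)"
  obtain s C where s: "s > real k - t" "s \<ge> 0" "s \<le> real k"
    "\<And>Q. Q \<ge> 1 \<Longrightarrow> (\<Sum>\<xi>\<in>freq_box k Q. cmod (fourier_coeff k \<mu> \<xi>)) \<le> C * Q powr (real k - s)"
    using dim_gtD[OF dim] unfolding t_def by metis
  \<comment> \<open>For \<open>k = 1\<close> the hypothesis would force a dimension above 1, so it is never satisfied.\<close>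
  have "k \<noteq> 1" using s(1,3) by (auto simp: t_def)
  then have k2: "k \<ge> 2" using k by simp
  then have t0: "t > 0" by (simp add: t_def)
  \<comment> \<open>The second argument secures \<open>\<kappa> > 0\<close> should \<open>s\<close>
    equal \<open>k\<close>.\<close>
  define \<kappa> where "\<kappa> = max (real k - s) (t / 2)"
  have \<kappa>: "0 < \<kappa>" "\<kappa> < t" using t0 s(1) by (auto simp: \<kappa>_def)
  obtain \<eta> where \<eta>: "\<eta> > 0" "(1 / real k + 2 * \<eta>) * (1 + \<kappa>) + \<kappa> < 1" "(1 / real k + 2 * \<eta>) * (real k - 1) < 1"
    using exists_small_eta[OF k2 \<kappa>(1)] \<kappa>(2) unfolding t_def by metis
  have "(\<Sum>\<xi>\<in>freq_box k Q. cmod (fourier_coeff k \<mu> \<xi>)) \<le> \<bar>C\<bar> * Q powr \<kappa>" if Q: "Q \<ge> 1" for Q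
  proof -
    have "C * Q powr (real k - s) \<le> \<bar>C\<bar> * Q powr \<kappa>"
      using Q by (intro mult_mono powr_mono) (auto simp: \<kappa>_def)
    then show ?thesis using s(4)[OF Q] by linarith
  qed
  then have "exponent_measure k \<mu> \<kappa> \<eta> \<bar>C\<bar>"
    using k2 supp \<kappa>(1) \<eta> by unfold_locales auto
  then show thesis by (rule that)
qed

theorem theorem1p5:
  fixes k :: nat and \<mu> :: "(nat \<Rightarrow> real) measure"
  assumes k: "1 \<le> k"
    and prob: "prob_space \<mu>"
    and sets_mu: "sets \<mu> = sets (borel_k k)"
    and supp: "measure \<mu> (PiE {..<k} (\<lambda>_. {0..1})) = 1"
  shows "(fourier_l1_dim k \<mu> > real k - (real k - 1) / (real k + 1) \<longrightarrow> khinchin k \<mu>)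
    \<and> (\<forall>\<mu>s :: nat \<Rightarrow> real measure.
          (\<forall>j<k. prob_space (\<mu>s j) \<and> sets (\<mu>s j) = sets borel \<and> measure (\<mu>s j) {0..1} = 1)
          \<longrightarrow> \<mu> = PiM {..<k} \<mu>s
          \<longrightarrow> fourier_l1_dim k \<mu> > real k - (real k - 1) / (real k + 1)
          \<longrightarrow> (\<forall>j<k. fourier_l1_dim1 (\<mu>s j) > 1 - 1 / (real k + 1))
          \<longrightarrow> gallagher k \<mu>)"
proof (intro conjI impI allI)
  assume "fourier_l1_dim k \<mu> > real k - (real k - 1) / (real k + 1)"
  then obtain \<kappa> \<eta> C0 where "exponent_measure k \<mu> \<kappa> \<eta> C0"
    using exponent_measure_of_dim[OF k prob sets_mu supp] by blast
  then show "khinchin k \<mu>" by (rule exponent_measure.khinchin)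
next
  fix \<mu>s :: "nat \<Rightarrow> real measure"
  assume \<mu>s: "\<forall>j<k. prob_space (\<mu>s j) \<and> sets (\<mu>s j) = sets borel \<and> measure (\<mu>s j) {0..1} = 1"
    and prod: "\<mu> = PiM {..<k} \<mu>s"
    and dim: "fourier_l1_dim k \<mu> > real k - (real k - 1) / (real k + 1)"
    and dim1: "\<forall>j<k. fourier_l1_dim1 (\<mu>s j) > 1 - 1 / (real k + 1)"
  obtain \<kappa> \<eta> C0 where em: "exponent_measure k \<mu> \<kappa> \<eta> C0"
    using exponent_measure_of_dim[OF k prob sets_mu supp dim] by blast
  interpret exponent_measure k \<mu> \<kappa> \<eta> C0 by (rule em)
  obtain \<kappa>1 C1 where \<kappa>1: "0 < \<kappa>1" "\<kappa>1 < 1 / (real k + 1)" "0 \<le> C1"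
    "\<And>X::nat \<Rightarrow> nat. (\<And>i. 1 \<le> X i) \<Longrightarrow>
      (\<Sum>\<xi>\<in>ivec k (\<lambda>i. {- int (X i)..int (X i)}). cmod (fourier_coeff k \<mu> \<xi>)) \<le> (\<Prod>i<k. C1 * real (X i) powr \<kappa>1)"
  proof (rule product_box_sum_le[of k \<mu>s "1 / (real k + 1)"])
    show "prob_space (\<mu>s j)" "sets (\<mu>s j) = sets borel" "1 - 1 / (real k + 1) < fourier_l1_dim1 (\<mu>s j)" if "j < k" for j
      using \<mu>s dim1 that by auto
  qed (use prod that in auto)
  show "gallagher k \<mu>"
    unfolding gallagher_def
  proof (intro allI impI conjI)
    fix \<psi> assume \<psi>: "admissible_psi \<psi>"
    show "W_mult_set k \<psi> \<in> null_sets \<mu>" if "summable (\<lambda>n. \<psi> (Suc n) * ln (real (Suc n)) ^ (k - 1))"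
      using \<psi> that \<kappa>1 by (rule gallagher_convergence)
    show "W_mult_set k \<psi> \<in> sets \<mu>" by (rule W_mult_set_measurable)
    show "measure \<mu> (W_mult_set k \<psi>) = 1" if "\<not> summable (\<lambda>n. \<psi> (Suc n) * ln (real (Suc n)) ^ (k - 1))"
      unfolding prob_eq_1[OF W_mult_set_measurable] using \<psi> that by (rule gallagher_divergence)
  qed
qed

end
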